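(* Let $C$ denote the Boolean product of two Boolean $n\times n$ matrices $A,B$ (accessed via oracles in the QRAM model), and let $i,j\in[n]$. (1) Without any preprocessing, a maximum witness query for $C[i,j]$ can be answered by a quantum algorithm in $\tilde{O}(\sqrt{n})$ time. Let $\ell\in[n]$ be a parameter. (2) After an $O((n/\ell)n^{\omega(1,\log_n\ell,1)})$-time preprocessing, a maximum witness query for $C[i,j]$ can be answered in $\tilde{O}(n/\ell+\sqrt{\ell})$ time. (3) After an $O((n/\ell)n^{\omega(1,\log_n\ell,1)}+n^3/\ell)$-time preprocessing, a maximum witness query for $C[i,j]$ can be answered in $\tilde{O}(\sqrt{\ell})$ time. (4) After a preprocessing running in $\tilde{O}((n/\ell)n^{\omega(1,\log_n\ell,1)}+n^3/\ell+n^2\sqrt{\ell})$ time, a maximum witness query for $C[i,j]$ can be answered in $O(1)$ time.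
   Context: A witness for a non-zero entry $C[i,j]$ of the Boolean product $C=A\times B$ is an index $k\in[n]$ with $A[i,k]=B[k,j]=1$; the maximum witness is the largest such index. A maximum witness query for $C[i,j]$ asks for the maximum witness of $C[i,j]$ if $C[i,j]=1$ and for ``No'' otherwise; answers are produced by quantum algorithms in the QRAM model (oracle $O_A$ maps $|i\rangle|j\rangle|0\rangle|z\rangle$ to $|i\rangle|j\rangle|A[i,j]\rangle|z\rangle$ with unit cost per call) and are correct with high probability. For reals $p,q,r$, $\omega(p,q,r)$ denotes the exponent of fast matrix multiplication of an $n^p\times n^q$ matrix by an $n^q\times n^r$ matrix. $\tilde{O}(\cdot)$ suppresses factors polylogarithmic in $n$. *)

theory Defs
  imports "HOL-Probability.Probability"
begin

section \<open>Boolean products and maximum witnesses\<close>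

definition bool_product ::
    "nat \<Rightarrow> (nat \<Rightarrow> nat \<Rightarrow> bool) \<Rightarrow> (nat \<Rightarrow> nat \<Rightarrow> bool) \<Rightarrow> nat \<Rightarrow> nat \<Rightarrow> bool" where
  "bool_product n A B i j \<longleftrightarrow> (\<exists>k\<in>{1..n}. A i k \<and> B k j)"

definition witnesses ::
    "nat \<Rightarrow> (nat \<Rightarrow> nat \<Rightarrow> bool) \<Rightarrow> (nat \<Rightarrow> nat \<Rightarrow> bool) \<Rightarrow> nat \<Rightarrow> nat \<Rightarrow> nat set" where
  "witnesses n A B i j = {k\<in>{1..n}. A i k \<and> B k j}"

text \<open>\<^const>\<open>None\<close> is the answer ``No''.\<close>

definition max_witness ::
    "nat \<Rightarrow> (nat \<Rightarrow> nat \<Rightarrow> bool) \<Rightarrow> (nat \<Rightarrow> nat \<Rightarrow> bool) \<Rightarrow> nat \<Rightarrow> nat \<Rightarrow> nat option" where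
  "max_witness n A B i j =
     (if bool_product n A B i j then Some (Max (witnesses n A B i j)) else None)"


section \<open>A word RAM with quantum registers and QRAM access\<close>

text \<open>
  The machine has classical registers and a classical random access memory, both holding words
  of \<open>w\<close> bits, and quantum registers of \<open>w\<close> qubits each. A basis state of the quantum part
  assigns a word to every quantum register (qubit \<open>p\<close> of register \<open>u\<close> being bit \<open>p\<close> of that
  word), and a quantum state is given by its amplitudes. A program mentions only finitely many
  registers, so it uses only \<open>O(w)\<close> qubits, and all amplitude functions that occur have finite
  support.
\<close>

type_synonym memory = "nat \<Rightarrow> nat"
type_synonym basis = "nat \<Rightarrow> nat"
type_synonym orac = "nat \<Rightarrow> nat \<Rightarrow> nat"

record mstate =
  reg :: "nat \<Rightarrow> nat"
  mem :: memory
  amp :: "basis \<Rightarrow> complex"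

datatype binop =
  Plus | Minus | Times | Quotient | Remainder | BitAnd | BitOr | BitXor | Less | Equal

text \<open>
  In the gates, a qubit operand \<open>(u, p)\<close> is a quantum register \<open>u\<close> together with a classical
  register \<open>p\<close> that holds the position of the qubit within \<open>u\<close>. All other operands of the
  quantum queries are quantum registers.
\<close>

datatype instr =
    Const nat nat
  | Arith binop nat nat nat
  | Load nat nat
  | Store nat nat
  | ReadA nat nat nat
  | ReadB nat nat nat
  | Hadamard "nat \<times> nat"
  | PhaseT "nat \<times> nat"
  | CNot "nat \<times> nat" "nat \<times> nat"
  | Toffoli "nat \<times> nat" "nat \<times> nat" "nat \<times> nat"
  | QueryA nat nat nat
  | QueryB nat nat nat
  | QueryMem nat nat
  | Measure nat "nat \<times> nat"

datatype prog =
    Skip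
  | Do instr
  | Seq prog prog
  | Cond nat prog prog
  | While nat prog

fun classical_instr :: "instr \<Rightarrow> bool" where
  "classical_instr (Const _ _) = True"
| "classical_instr (Arith _ _ _ _) = True"
| "classical_instr (Load _ _) = True"
| "classical_instr (Store _ _) = True"
| "classical_instr (ReadA _ _ _) = True"
| "classical_instr (ReadB _ _ _) = True"
| "classical_instr _ = False"

primrec classical :: "prog \<Rightarrow> bool" where
  "classical Skip = True"
| "classical (Do a) = classical_instr a"
| "classical (Seq c d) = (classical c \<and> classical d)"
| "classical (Cond r c d) = (classical c \<and> classical d)"
| "classical (While r c) = classical c"

fun arith :: "nat \<Rightarrow> binop \<Rightarrow> nat \<Rightarrow> nat \<Rightarrow> nat" where
  "arith w Plus x y = x + y"
| "arith w Minus x y = x + (2 ^ w - y)"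
| "arith w Times x y = x * y"
| "arith w Quotient x y = x div y"
| "arith w Remainder x y = x mod y"
| "arith w BitAnd x y = Bit_Operations.and x y"
| "arith w BitOr x y = Bit_Operations.or x y"
| "arith w BitXor x y = Bit_Operations.xor x y"
| "arith w Less x y = of_bool (x < y)"
| "arith w Equal x y = of_bool (x = y)"

definition put :: "nat \<Rightarrow> nat \<Rightarrow> nat \<Rightarrow> mstate \<Rightarrow> mstate" where
  "put w r v s = s\<lparr>reg := (reg s)(r := v mod 2 ^ w)\<rparr>"

definition resolve :: "mstate \<Rightarrow> nat \<times> nat \<Rightarrow> nat \<times> nat" where
  "resolve s q = (fst q, reg s (snd q))"

definition qbit :: "basis \<Rightarrow> nat \<times> nat \<Rightarrow> bool" where
  "qbit b q = bit (b (fst q)) (snd q)"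

definition qflip :: "nat \<times> nat \<Rightarrow> basis \<Rightarrow> basis" where
  "qflip q b = b(fst q := flip_bit (snd q) (b (fst q)))"

definition hadamard :: "nat \<times> nat \<Rightarrow> (basis \<Rightarrow> complex) \<Rightarrow> basis \<Rightarrow> complex" where
  "hadamard q \<psi> b = (\<psi> (b(fst q := unset_bit (snd q) (b (fst q))))
     + (if qbit b q then -1 else 1) * \<psi> (b(fst q := set_bit (snd q) (b (fst q)))))
     / complex_of_real (sqrt 2)"

definition phaseT :: "nat \<times> nat \<Rightarrow> (basis \<Rightarrow> complex) \<Rightarrow> basis \<Rightarrow> complex" where
  "phaseT q \<psi> b = (if qbit b q then cis (pi / 4) else 1) * \<psi> b"

text \<open>
  Each of the remaining unitaries permutes the basis states by an involution \<open>f\<close>, so it maps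
  \<open>\<psi>\<close> to \<open>\<psi> \<circ> f\<close>.
\<close>

definition cnot :: "nat \<times> nat \<Rightarrow> nat \<times> nat \<Rightarrow> (basis \<Rightarrow> complex) \<Rightarrow> basis \<Rightarrow> complex" where
  "cnot q t \<psi> b = \<psi> (if qbit b q then qflip t b else b)"

definition toffoli ::
    "nat \<times> nat \<Rightarrow> nat \<times> nat \<Rightarrow> nat \<times> nat \<Rightarrow> (basis \<Rightarrow> complex) \<Rightarrow> basis \<Rightarrow> complex" where
  "toffoli q q' t \<psi> b = \<psi> (if qbit b q \<and> qbit b q' then qflip t b else b)"

text \<open>\<open>|i\<rangle>|j\<rangle>|x\<rangle> \<mapsto> |i\<rangle>|j\<rangle>|x xor F i j\<rangle>\<close>, and similarly for the memory.\<close>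

definition query :: "orac \<Rightarrow> nat \<Rightarrow> nat \<Rightarrow> nat \<Rightarrow> (basis \<Rightarrow> complex) \<Rightarrow> basis \<Rightarrow> complex" where
  "query F u v t \<psi> b = \<psi> (b(t := Bit_Operations.xor (b t) (F (b u) (b v))))"

definition query_mem :: "memory \<Rightarrow> nat \<Rightarrow> nat \<Rightarrow> (basis \<Rightarrow> complex) \<Rightarrow> basis \<Rightarrow> complex" where
  "query_mem m u t \<psi> b = \<psi> (b(t := Bit_Operations.xor (b t) (m (b u))))"

definition outcome_prob :: "nat \<times> nat \<Rightarrow> bool \<Rightarrow> (basis \<Rightarrow> complex) \<Rightarrow> real" where
  "outcome_prob q v \<psi> = (\<Sum>b | \<psi> b \<noteq> 0 \<and> qbit b q = v. (cmod (\<psi> b))\<^sup>2)"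

definition collapse ::
    "nat \<times> nat \<Rightarrow> bool \<Rightarrow> (basis \<Rightarrow> complex) \<Rightarrow> basis \<Rightarrow> complex" where
  "collapse q v \<psi> b =
     (if qbit b q = v then \<psi> b / complex_of_real (sqrt (outcome_prob q v \<psi>)) else 0)"

text \<open>
  Quantum operations with coinciding operands or with a qubit position outside the word would
  not be unitary operations on the quantum registers; they have no effect.
\<close>

definition unitary_step ::
    "bool \<Rightarrow> ((basis \<Rightarrow> complex) \<Rightarrow> basis \<Rightarrow> complex) \<Rightarrow> mstate \<Rightarrow> mstate pmf" where
  "unitary_step valid U s = return_pmf (if valid then s\<lparr>amp := U (amp s)\<rparr> else s)"

fun step :: "nat \<Rightarrow> orac \<Rightarrow> orac \<Rightarrow> instr \<Rightarrow> mstate \<Rightarrow> mstate pmf" where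
  "step w A B (Const r k) s = return_pmf (put w r k s)"
| "step w A B (Arith f r x y) s = return_pmf (put w r (arith w f (reg s x) (reg s y)) s)"
| "step w A B (Load r x) s = return_pmf (put w r (mem s (reg s x)) s)"
| "step w A B (Store x r) s = return_pmf (s\<lparr>mem := (mem s)(reg s x := reg s r)\<rparr>)"
| "step w A B (ReadA r x y) s = return_pmf (put w r (A (reg s x) (reg s y)) s)"
| "step w A B (ReadB r x y) s = return_pmf (put w r (B (reg s x) (reg s y)) s)"
| "step w A B (Hadamard q) s =
     unitary_step (snd (resolve s q) < w) (hadamard (resolve s q)) s"
| "step w A B (PhaseT q) s =
     unitary_step (snd (resolve s q) < w) (phaseT (resolve s q)) s"
| "step w A B (CNot q t) s =
     unitary_step (snd (resolve s q) < w \<and> snd (resolve s t) < w \<and> resolve s q \<noteq> resolve s t)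
       (cnot (resolve s q) (resolve s t)) s"
| "step w A B (Toffoli q q' t) s =
     unitary_step (snd (resolve s q) < w \<and> snd (resolve s q') < w \<and> snd (resolve s t) < w
         \<and> distinct [resolve s q, resolve s q', resolve s t])
       (toffoli (resolve s q) (resolve s q') (resolve s t)) s"
| "step w A B (QueryA u v t) s = unitary_step (t \<noteq> u \<and> t \<noteq> v) (query A u v t) s"
| "step w A B (QueryB u v t) s = unitary_step (t \<noteq> u \<and> t \<noteq> v) (query B u v t) s"
| "step w A B (QueryMem u t) s = unitary_step (t \<noteq> u) (query_mem (mem s) u t) s"
| "step w A B (Measure r q) s =
     (if snd (resolve s q) < w then
        map_pmf (\<lambda>v. put w r (of_bool v) (s\<lparr>amp := collapse (resolve s q) v (amp s)\<rparr>))
          (bernoulli_pmf (outcome_prob (resolve s q) True (amp s)))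
      else return_pmf s)"

text \<open>
  \<open>exec w A B c t s D\<close>: started in \<open>s\<close>, on every branch of the measurement outcomes, the
  program \<open>c\<close> halts after at most \<open>t\<close> unit-cost steps; the final state has distribution \<open>D\<close>.
\<close>

inductive exec ::
    "nat \<Rightarrow> orac \<Rightarrow> orac \<Rightarrow> prog \<Rightarrow> nat \<Rightarrow> mstate \<Rightarrow> mstate pmf \<Rightarrow> bool"
  for w :: nat and A B :: orac where
  Skip: "exec w A B Skip 1 s (return_pmf s)"
| Do: "exec w A B (Do a) 1 s (step w A B a s)"
| Seq: "exec w A B c t s D
    \<Longrightarrow> (\<And>s'. s' \<in> set_pmf D \<Longrightarrow> exec w A B d (T s') s' (E s') \<and> T s' \<le> t')
    \<Longrightarrow> exec w A B (Seq c d) (t + t') s (bind_pmf D E)"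
| Cond_True: "reg s r \<noteq> 0 \<Longrightarrow> exec w A B c t s D \<Longrightarrow> exec w A B (Cond r c d) (1 + t) s D"
| Cond_False: "reg s r = 0 \<Longrightarrow> exec w A B d t s D \<Longrightarrow> exec w A B (Cond r c d) (1 + t) s D"
| While_False: "reg s r = 0 \<Longrightarrow> exec w A B (While r c) 1 s (return_pmf s)"
| While_True: "reg s r \<noteq> 0 \<Longrightarrow> exec w A B c t s D
    \<Longrightarrow> (\<And>s'. s' \<in> set_pmf D \<Longrightarrow> exec w A B (While r c) (T s') s' (E s') \<and> T s' \<le> t')
    \<Longrightarrow> exec w A B (While r c) (1 + t + t') s (bind_pmf D E)"

definition runs_within ::
    "nat \<Rightarrow> orac \<Rightarrow> orac \<Rightarrow> prog \<Rightarrow> real \<Rightarrow> mstate \<Rightarrow> mstate pmf \<Rightarrow> bool" where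
  "runs_within w A B c T s D \<longleftrightarrow> (\<exists>t. real t \<le> T \<and> exec w A B c t s D)"

definition init :: "nat list \<Rightarrow> memory \<Rightarrow> mstate" where
  "init ps m = \<lparr>reg = (\<lambda>r. if r < length ps then ps ! r else 0), mem = m,
                amp = (\<lambda>b. if b = (\<lambda>_. 0) then 1 else 0)\<rparr>"

abbreviation blank :: memory where
  "blank \<equiv> (\<lambda>_. 0)"

definition matrix_oracle :: "nat \<Rightarrow> nat \<Rightarrow> (nat \<Rightarrow> nat \<Rightarrow> nat) \<Rightarrow> orac" where
  "matrix_oracle a b X i j = (if i \<in> {1..a} \<and> j \<in> {1..b} then X i j else 0)"

definition bool_oracle :: "nat \<Rightarrow> (nat \<Rightarrow> nat \<Rightarrow> bool) \<Rightarrow> orac" where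
  "bool_oracle n A = matrix_oracle n n (\<lambda>i j. of_bool (A i j))"


section \<open>The exponent of rectangular matrix multiplication\<close>

text \<open>
  The arithmetic product of an \<open>a \<times> b\<close> and a \<open>b \<times> c\<close> matrix is to be written to the memory in
  row-major order. Entries are bounded by \<open>n\<close>, that is, they have \<open>O(log n)\<close> bits; by splitting
  the entries into blocks of bits, any other polynomial bound, or signed entries, would lead to
  the same exponent.
\<close>

definition multiplies :: "nat \<Rightarrow> nat \<Rightarrow> prog \<Rightarrow> real \<Rightarrow> nat \<Rightarrow> nat \<Rightarrow> nat \<Rightarrow> bool" where
  "multiplies w n P T a b c \<longleftrightarrow>
     (\<forall>X Y. (\<forall>i j. X i j \<le> n \<and> Y i j \<le> n) \<longrightarrow>
        (\<exists>D. runs_within w (matrix_oracle a b X) (matrix_oracle b c Y) P T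
               (init [n, a, b, c] blank) D
           \<and> (\<forall>s\<in>set_pmf D. \<forall>i\<in>{1..a}. \<forall>j\<in>{1..c}.
                mem s ((i - 1) * c + (j - 1)) = (\<Sum>k=1..b. X i k * Y k j))))"

text \<open>
  As \<open>n\<close> to a real power need not be an integer, an exponent for \<open>(p, q, r)\<close> has to be
  good for all dimensions up to \<open>n\<close> to the powers \<open>p\<close>, \<open>q\<close>, \<open>r\<close>.
  Here and below, algorithms have to work for every word length that is at least a suitable
  constant times \<open>log n\<close>.
\<close>

definition omega :: "real \<Rightarrow> real \<Rightarrow> real \<Rightarrow> real" where
  "omega p q r = Inf {\<tau>. \<exists>P K C. classical P \<and>
     (\<forall>n\<ge>2. \<forall>w. real w \<ge> K * log 2 (real n) \<longrightarrow>
        (\<forall>a b c. real a \<le> real n powr p \<and> real b \<le> real n powr q \<and> real c \<le> real n powr r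
           \<longrightarrow> multiplies w n P (C * real n powr \<tau>) a b c))}"

text \<open>
  As \<^const>\<open>omega\<close> is an infimum, multiplication in time \<open>O(n ^ omega)\<close> without an
  additional \<open>\<epsilon>\<close> in the exponent requires the infimum to be attained. The following says that
  it is, for products of \<open>n \<times> l\<close> and \<open>l \<times> n\<close> matrices, uniformly in \<open>l\<close>.
\<close>

definition omega_attained :: bool where
  "omega_attained \<longleftrightarrow> (\<exists>P K C. classical P \<and>
     (\<forall>n\<ge>2. \<forall>w. real w \<ge> K * log 2 (real n) \<longrightarrow> (\<forall>l\<in>{1..n}.
        multiplies w n P (C * real n powr omega 1 (log (real n) (real l)) 1) n l n)))"


section \<open>Answering maximum witness queries\<close>

text \<open>The answer is left in register 0; witnesses are positive, so 0 can stand for ``No''.\<close>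

definition answer :: "mstate \<Rightarrow> nat option" where
  "answer s = (if reg s 0 = 0 then None else Some (reg s 0))"

text \<open>
  \<open>M\<close> is the distribution of the memory that the query algorithm \<open>Q\<close> finds; \<open>ps\<close> are its
  parameters apart from the indices \<open>i\<close> and \<open>j\<close>. The error probability is taken over \<open>M\<close> and
  over the measurements of \<open>Q\<close>; the time bound is for the worst case.
\<close>

definition answers_queries ::
    "real \<Rightarrow> nat \<Rightarrow> nat \<Rightarrow> (nat \<Rightarrow> nat \<Rightarrow> bool) \<Rightarrow> (nat \<Rightarrow> nat \<Rightarrow> bool)
      \<Rightarrow> prog \<Rightarrow> real \<Rightarrow> nat list \<Rightarrow> memory pmf \<Rightarrow> bool" where
  "answers_queries \<alpha> w n A B Q T ps M \<longleftrightarrow>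
     (\<forall>i\<in>{1..n}. \<forall>j\<in>{1..n}. \<exists>R.
        (\<forall>m\<in>set_pmf M. runs_within w (bool_oracle n A) (bool_oracle n B) Q T
           (init (ps @ [i, j]) m) (R m))
      \<and> measure_pmf.prob (bind_pmf M R) {s. answer s = max_witness n A B i j}
          \<ge> 1 - real n powr (- \<alpha>))"

definition answers_without_preprocessing ::
    "real \<Rightarrow> (nat \<Rightarrow> real) \<Rightarrow> prog \<Rightarrow> bool" where
  "answers_without_preprocessing \<alpha> T Q \<longleftrightarrow>
     (\<exists>K. \<forall>n\<ge>2. \<forall>w. real w \<ge> K * log 2 (real n) \<longrightarrow>
        (\<forall>A B. answers_queries \<alpha> w n A B Q (T n) [n] (return_pmf blank)))"

text \<open>Only the classical memory is handed over from the preprocessing \<open>P\<close> to the queries.\<close>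

definition answers_after_preprocessing ::
    "real \<Rightarrow> (nat \<Rightarrow> nat \<Rightarrow> real) \<Rightarrow> (nat \<Rightarrow> nat \<Rightarrow> real) \<Rightarrow> prog \<Rightarrow> prog \<Rightarrow> bool" where
  "answers_after_preprocessing \<alpha> T T' P Q \<longleftrightarrow>
     (\<exists>K. \<forall>n\<ge>2. \<forall>w. real w \<ge> K * log 2 (real n) \<longrightarrow>
        (\<forall>l\<in>{1..n}. \<forall>A B. \<exists>D.
           runs_within w (bool_oracle n A) (bool_oracle n B) P (T n l) (init [n, l] blank) D
         \<and> answers_queries \<alpha> w n A B Q (T' n l) [n, l] (map_pmf mem D)))"

definition strips_time :: "real \<Rightarrow> nat \<Rightarrow> nat \<Rightarrow> real" where
  "strips_time \<epsilon> n l =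
     (real n / real l) * real n powr (omega 1 (log (real n) (real l)) 1 + \<epsilon>)"

end

theory Submission
  imports Defs
begin

text \<open>
  Bounded-error search by Grover iterations with an exponentially growing number of rounds decides
  whether an aligned interval of length \<open>2 ^ p\<close> contains a witness, in time about \<open>sqrt (2 ^ p)\<close>;
  repeating it \<open>O(log n)\<close> times makes the error polynomially small. Descending into the right half
  whenever it contains a witness, and into the left half otherwise, finds the maximum witness of the
  interval. On the interval of all indices this needs no preprocessing.

  The preprocessing cuts the index range into blocks of length at most \<open>l\<close>, multiplies the
  corresponding column blocks of \<open>A\<close> and row blocks of \<open>B\<close> one after the other, and records for every
  entry the last block in which the product is non-zero, as an aligned interval of length about
  \<open>l\<close>. A query searches only this interval. This single table serves both (2) and (3); it takes
  time at least \<open>n ^ 3 / l\<close> because an \<open>n \<times> n\<close> product has \<open>n ^ 2\<close> entries to be written. For (4) all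
  queries are answered in advance.

  The given multiplication programs read their input through oracles, expect empty memory and use
  an unknown word length, so each of them is simulated inside the preprocessing.
\<close>

section \<open>Reasoning about programs\<close>

text \<open>Three choices carry the construction. A measured flag can be 1 only if the interval
  contains a witness, so searches err on one side: repetitions combine by disjunction, and a descent
  can go wrong only at a half that does contain a witness. The reflection at the base point uses the
  QRAM instead of multiply controlled gates: a 1 is stored at that address of the classical memory,
  and the memory is queried in superposition; this is why the low cells stay zero and the table
  starts at address \<open>4 * n\<close>. Finally, \<open>omega\<close> provides a separate program
  for each exponent, whereas one preprocessing program has to serve all \<open>n\<close> and
  \<open>l\<close>, for which \<open>log (real n) (real l)\<close> takes infinitely many values. For
  \<epsilon> > 0 a finite grid of exponents is enough, because \<open>omega 1 q 1\<close> is
  monotone in \<open>q\<close> and somewhat narrower blocks cost only a small power of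
  \<open>n\<close>; for \<epsilon> = 0 \<open>omega_attained\<close> supplies a uniform program.
  Block widths are powers of two not above \<open>l\<close>, so that they divide the length of the
  aligned intervals.\<close>

lemma runs_within_mono:
  "runs_within w A B c T s D \<Longrightarrow> T \<le> T' \<Longrightarrow> runs_within w A B c T' s D"
  unfolding runs_within_def by force

lemma runs_within_nonneg: "runs_within w A B c T s D \<Longrightarrow> 0 \<le> T"
  unfolding runs_within_def by (meson of_nat_0_le_iff order_trans)

lemma runs_within_Skip: "1 \<le> T \<Longrightarrow> runs_within w A B Skip T s (return_pmf s)"
  unfolding runs_within_def by (intro exI[of _ "1::nat"] conjI exec.Skip) simp

lemma runs_within_Do: "1 \<le> T \<Longrightarrow> runs_within w A B (Do a) T s (step w A B a s)"
  unfolding runs_within_def by (intro exI[of _ "1::nat"] conjI exec.Do) simp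

text \<open>The rules for \<open>Seq\<close> and \<open>While\<close> ask for one natural number
  that bounds the time of all continuations. The floor of the common real bound serves; as some run
  exists, this bound is not negative.\<close>

lemma runs_within_uniform:
  assumes "\<And>s. s \<in> S \<Longrightarrow> runs_within w A B c T s (E s)" and "S \<noteq> {}"
  obtains \<tau> t where "\<And>s. s \<in> S \<Longrightarrow> exec w A B c (\<tau> s) s (E s) \<and> \<tau> s \<le> t" "real t \<le> T"
proof -
  have "\<exists>\<tau>. \<forall>s\<in>S. real (\<tau> s) \<le> T \<and> exec w A B c (\<tau> s) s (E s)"
    by (rule bchoice) (use assms(1) in \<open>auto simp: runs_within_def\<close>)
  then obtain \<tau> where \<tau>: "\<And>s. s \<in> S \<Longrightarrow> real (\<tau> s) \<le> T \<and> exec w A B c (\<tau> s) s (E s)"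
    by blast
  have "0 \<le> T"
    using assms runs_within_nonneg by blast
  show thesis
  proof (rule that)
    show "exec w A B c (\<tau> s) s (E s) \<and> \<tau> s \<le> nat \<lfloor>T\<rfloor>" if "s \<in> S" for s
      using \<tau>[OF that] by (simp add: le_nat_floor)
    show "real (nat \<lfloor>T\<rfloor>) \<le> T"
      using \<open>0 \<le> T\<close> by linarith
  qed
qed

lemma runs_within_Seq:
  assumes "runs_within w A B c T s D"
    and "\<And>s'. s' \<in> set_pmf D \<Longrightarrow> runs_within w A B d T' s' (E s')"
  shows "runs_within w A B (Seq c d) (T + T') s (bind_pmf D E)"
proof -
  obtain t where t: "real t \<le> T" "exec w A B c t s D"
    using assms(1) by (auto simp: runs_within_def)
  obtain \<tau> t' where "\<And>s'. s' \<in> set_pmf D \<Longrightarrow> exec w A B d (\<tau> s') s' (E s') \<and> \<tau> s' \<le> t'"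
      "real t' \<le> T'"
    using runs_within_uniform[OF assms(2) set_pmf_not_empty] by blast
  with t show ?thesis
    unfolding runs_within_def
    by (intro exI[of _ "t + t'"] conjI exec.Seq[where T = \<tau>]) auto
qed

lemma runs_within_Cond:
  assumes "runs_within w A B (if reg s r \<noteq> 0 then c else d) T s D"
  shows "runs_within w A B (Cond r c d) (1 + T) s D"
proof -
  obtain t where t: "real t \<le> T" "exec w A B (if reg s r \<noteq> 0 then c else d) t s D"
    using assms by (auto simp only: runs_within_def)
  have "exec w A B (Cond r c d) (1 + t) s D"
  proof (cases "reg s r = 0")
    case True
    with t(2) show ?thesis by (intro exec.Cond_False) simp_all
  next
    case False
    with t(2) show ?thesis by (intro exec.Cond_True) simp_all
  qed
  moreover have "real (1 + t) \<le> 1 + T"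
    using t(1) by simp
  ultimately show ?thesis
    unfolding runs_within_def by blast
qed

lemma runs_within_While_False:
  "reg s r = 0 \<Longrightarrow> 1 \<le> T \<Longrightarrow> runs_within w A B (While r c) T s (return_pmf s)"
  unfolding runs_within_def by (intro exI[of _ "1::nat"] conjI exec.While_False) auto

lemma runs_within_While_True:
  assumes "reg s r \<noteq> 0" "runs_within w A B c T s D"
    and "\<And>s'. s' \<in> set_pmf D \<Longrightarrow> runs_within w A B (While r c) T' s' (E s')"
  shows "runs_within w A B (While r c) (1 + T + T') s (bind_pmf D E)"
proof -
  obtain t where t: "real t \<le> T" "exec w A B c t s D"
    using assms(2) by (auto simp: runs_within_def)
  obtain \<tau> t' where "\<And>s'. s' \<in> set_pmf D \<Longrightarrow> exec w A B (While r c) (\<tau> s') s' (E s') \<and> \<tau> s' \<le> t'"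
      "real t' \<le> T'"
    using runs_within_uniform[OF assms(3) set_pmf_not_empty] by blast
  with t assms(1) show ?thesis
    unfolding runs_within_def
    by (intro exI[of _ "1 + t + t'"] conjI exec.While_True[where T = \<tau>]) auto
qed

section \<open>Quantitative Hoare triples for time, safety and error\<close>

text \<open>
  The last two arguments \<open>f\<close> and \<open>e\<close> bound an expected value, in most cases the probability of
  a wrong result. They compose along a program like weakest pre-expectations.
\<close>

definition tri ::
    "nat \<Rightarrow> orac \<Rightarrow> orac \<Rightarrow> prog \<Rightarrow> mstate \<Rightarrow> real \<Rightarrow> (mstate \<Rightarrow> bool) \<Rightarrow> (mstate \<Rightarrow> real) \<Rightarrow> real \<Rightarrow> bool"
  where "tri w A B c s T Q f e \<longleftrightarrow> (\<exists>D. runs_within w A B c T s D \<and> (\<forall>s'\<in>set_pmf D. Q s')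
     \<and> (\<integral>\<^sup>+s'. ennreal (f s') \<partial>measure_pmf D) \<le> ennreal e)"

lemma tri_conseq:
  assumes "tri w A B c s T Q g e" "T \<le> T'" "\<And>s. Q s \<Longrightarrow> Q' s \<and> f s \<le> g s" "e \<le> e'"
  shows "tri w A B c s T' Q' f e'"
proof -
  obtain D where D: "runs_within w A B c T s D" "\<forall>s'\<in>set_pmf D. Q s'"
      "(\<integral>\<^sup>+s'. ennreal (g s') \<partial>measure_pmf D) \<le> ennreal e"
    using assms(1) by (auto simp: tri_def)
  have "(\<integral>\<^sup>+s'. ennreal (f s') \<partial>measure_pmf D) \<le> (\<integral>\<^sup>+s'. ennreal (g s') \<partial>measure_pmf D)"
    using D(2) assms(3) by (intro nn_integral_mono_AE) (auto simp: AE_measure_pmf_iff intro!: ennreal_leI)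
  also have "\<dots> \<le> ennreal e'"
    using D(3) assms(4) by (meson ennreal_leI order_trans)
  finally show ?thesis
    unfolding tri_def using D assms(2,3) runs_within_mono by blast
qed

lemma tri_det:
  assumes "runs_within w A B c T s (return_pmf s')" "Q s'" "f s' \<le> e"
  shows "tri w A B c s T Q f e"
  unfolding tri_def using assms by (intro exI[of _ "return_pmf s'"]) (simp_all add: ennreal_leI)

text \<open>A postcondition that fixes the final state leaves only the point distribution.
  Deterministic fragments are thus verified with the rules for \<open>tri\<close> and then used as
  plain runs.\<close>

lemma tri_eqD:
  assumes "tri w A B c s T (\<lambda>s'. s' = s1) f e"
  shows "runs_within w A B c T s (return_pmf s1)"
proof -
  obtain D where D: "runs_within w A B c T s D" "\<forall>s'\<in>set_pmf D. s' = s1"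
    using assms unfolding tri_def by blast
  then have "set_pmf D \<subseteq> {s1}" by blast
  then have "D = return_pmf s1"
    by (simp only: set_pmf_subset_singleton)
  with D(1) show ?thesis by (simp only:)
qed

lemma tri_Seq:
  assumes "tri w A B c s T R g e" "\<And>s'. R s' \<Longrightarrow> tri w A B d s' T' Q f (g s')"
  shows "tri w A B (Seq c d) s (T + T') Q f e"
proof -
  obtain D where D: "runs_within w A B c T s D" "\<forall>s'\<in>set_pmf D. R s'"
      "(\<integral>\<^sup>+s'. ennreal (g s') \<partial>measure_pmf D) \<le> ennreal e"
    using assms(1) by (auto simp: tri_def)
  have "\<exists>E. \<forall>s'\<in>set_pmf D. runs_within w A B d T' s' (E s') \<and> (\<forall>s''\<in>set_pmf (E s'). Q s'')
     \<and> (\<integral>\<^sup>+s''. ennreal (f s'') \<partial>measure_pmf (E s')) \<le> ennreal (g s')"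
    by (rule bchoice) (use assms(2) D(2) in \<open>auto simp: tri_def\<close>)
  then obtain E where E: "\<And>s'. s' \<in> set_pmf D \<Longrightarrow> runs_within w A B d T' s' (E s') \<and> (\<forall>s''\<in>set_pmf (E s'). Q s'')
     \<and> (\<integral>\<^sup>+s''. ennreal (f s'') \<partial>measure_pmf (E s')) \<le> ennreal (g s')"
    by blast
  have "(\<integral>\<^sup>+s'. ennreal (f s') \<partial>measure_pmf (bind_pmf D E)) \<le> (\<integral>\<^sup>+s'. ennreal (g s') \<partial>measure_pmf D)"
    using E by (auto simp: AE_measure_pmf_iff intro!: nn_integral_mono_AE)
  also have "\<dots> \<le> ennreal e" by (rule D(3))
  finally show ?thesis
    unfolding tri_def using D E
    by (intro exI[of _ "bind_pmf D E"] conjI runs_within_Seq) auto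
qed

lemma tri_Cond:
  assumes "tri w A B (if reg s r \<noteq> 0 then c else d) s T Q f e"
  shows "tri w A B (Cond r c d) s (1 + T) Q f e"
  using assms unfolding tri_def by (elim exE conjE, intro exI conjI runs_within_Cond)

text \<open>The index \<open>k\<close> is the number of rounds still to come, so all branches make
  the same number of rounds. \<open>g k\<close> bounds the expected final error with
  \<open>k\<close> rounds left; like a supermartingale it must not grow on average in the
  body.\<close>

lemma tri_While:
  assumes zero: "\<And>s. I 0 s \<Longrightarrow> reg s r = 0"
    and nonzero: "\<And>k s. I (Suc k) s \<Longrightarrow> k < m \<Longrightarrow> reg s r \<noteq> 0"
    and body: "\<And>k s. I (Suc k) s \<Longrightarrow> k < m \<Longrightarrow> tri w A B c s (t k) (I k) (g k) (g (Suc k) s)"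
    and init: "I m s"
  shows "tri w A B (While r c) s (1 + (\<Sum>k<m. 1 + t k)) (I 0) (g 0) (g m s)"
  using init nonzero body
proof (induction m arbitrary: s)
  case 0
  then show ?case
    by (intro tri_det[where s' = s] runs_within_While_False zero) auto
next
  case (Suc m)
  have *: "tri w A B c s (t m) (I m) (g m) (g (Suc m) s)"
    using Suc.prems by blast
  have **: "tri w A B (While r c) s' (1 + (\<Sum>k<m. 1 + t k)) (I 0) (g 0) (g m s')" if "I m s'" for s'
    using that Suc.prems by (intro Suc.IH) auto
  obtain D where D: "runs_within w A B c (t m) s D" "\<forall>s'\<in>set_pmf D. I m s'"
      "(\<integral>\<^sup>+s'. ennreal (g m s') \<partial>measure_pmf D) \<le> ennreal (g (Suc m) s)"
    using * by (auto simp: tri_def)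
  have "\<exists>E. \<forall>s'\<in>set_pmf D. runs_within w A B (While r c) (1 + (\<Sum>k<m. 1 + t k)) s' (E s') \<and> (\<forall>s''\<in>set_pmf (E s'). I 0 s'')
     \<and> (\<integral>\<^sup>+s''. ennreal (g 0 s'') \<partial>measure_pmf (E s')) \<le> ennreal (g m s')"
    by (rule bchoice) (use ** D(2) in \<open>auto simp: tri_def\<close>)
  then obtain E where E: "\<And>s'. s' \<in> set_pmf D \<Longrightarrow> runs_within w A B (While r c) (1 + (\<Sum>k<m. 1 + t k)) s' (E s') \<and> (\<forall>s''\<in>set_pmf (E s'). I 0 s'')
     \<and> (\<integral>\<^sup>+s''. ennreal (g 0 s'') \<partial>measure_pmf (E s')) \<le> ennreal (g m s')"
    by blast
  have "(\<integral>\<^sup>+s'. ennreal (g 0 s') \<partial>measure_pmf (bind_pmf D E)) \<le> (\<integral>\<^sup>+s'. ennreal (g m s') \<partial>measure_pmf D)"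
    using E by (auto simp: AE_measure_pmf_iff intro!: nn_integral_mono_AE)
  also have "\<dots> \<le> ennreal (g (Suc m) s)" by (rule D(3))
  finally have int: "(\<integral>\<^sup>+s'. ennreal (g 0 s') \<partial>measure_pmf (bind_pmf D E)) \<le> ennreal (g (Suc m) s)" .
  have "runs_within w A B (While r c) (1 + t m + (1 + (\<Sum>k<m. 1 + t k))) s (bind_pmf D E)"
    using D(1) E Suc.prems by (intro runs_within_While_True) auto
  moreover have "1 + t m + (1 + (\<Sum>k<m. 1 + t k)) = 1 + (\<Sum>k<Suc m. 1 + t k)"
    by simp
  ultimately show ?case
    unfolding tri_def using D E int by (intro exI[of _ "bind_pmf D E"]) auto
qed

lemma det_While:
  assumes "\<And>k. k < m \<Longrightarrow> reg (st (Suc k)) r \<noteq> 0 \<and> runs_within w A B c t (st (Suc k)) (return_pmf (st k))"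
    and "reg (st 0) r = 0"
  shows "runs_within w A B (While r c) (1 + real m * (1 + t)) (st m) (return_pmf (st 0))"
proof -
  have "tri w A B (While r c) (st m) (1 + (\<Sum>k<m. 1 + t)) (\<lambda>s. s = st 0) (\<lambda>_. 0) 0"
    by (rule tri_While[where I = "\<lambda>k s. s = st k" and t = "\<lambda>_. t" and g = "\<lambda>_ _. 0"])
       (use assms in \<open>auto intro!: tri_det\<close>)
  then show ?thesis by (intro tri_eqD) simp
qed

section \<open>Straight-line blocks and their time budget\<close>

primrec blk :: "prog list \<Rightarrow> prog" where
  "blk [] = Skip"
| "blk (c # cs) = Seq c (blk cs)"

declare blk.simps [simp del]

text \<open>The budget \<open>T\<close> runs downwards: each statement deducts its cost, and the end
  of the block asks for the remaining 1 that the closing \<open>Skip\<close> takes. The total time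
  is therefore checked once, at the end of each block.\<close>

lemma tri_Nil: "1 \<le> T \<Longrightarrow> Q s \<Longrightarrow> f s \<le> e \<Longrightarrow> tri w A B (blk []) s T Q f e"
  by (auto simp: blk.simps intro!: tri_det runs_within_Skip)

lemma tri_Cons:
  assumes "tri w A B c s T\<^sub>0 R g e" "\<And>s'. R s' \<Longrightarrow> tri w A B (blk cs) s' (T - T\<^sub>0) Q f (g s')"
  shows "tri w A B (blk (c # cs)) s T Q f e"
  using tri_Seq[OF assms] by (simp add: blk.simps)

lemma tri_Cons_det:
  assumes "runs_within w A B c T\<^sub>0 s (return_pmf s')" "tri w A B (blk cs) s' (T - T\<^sub>0) Q f e"
  shows "tri w A B (blk (c # cs)) s T Q f e"
  using assms by (intro tri_Cons[where T\<^sub>0 = T\<^sub>0 and R = "\<lambda>s''. s'' = s'" and g = "\<lambda>_. e"]) (auto intro: tri_det)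

lemma tri_Do:
  assumes "step w A B a s = return_pmf s'" "tri w A B (blk cs) s' (T - 1) Q f e"
  shows "tri w A B (blk (Do a # cs)) s T Q f e"
  using assms by (intro tri_Cons_det[where s' = s' and T\<^sub>0 = 1]) (metis order_refl runs_within_Do)+

subsection \<open>Expressions\<close>

datatype ex = V nat | N nat | Op binop ex ex | MemAt ex | EntA ex ex | EntB ex ex

abbreviation ex_plus (infixl "\<oplus>" 65) where "a \<oplus> b \<equiv> Op Plus a b"
abbreviation ex_minus (infixl "\<ominus>" 65) where "a \<ominus> b \<equiv> Op Minus a b"
abbreviation ex_times (infixl "\<otimes>" 70) where "a \<otimes> b \<equiv> Op Times a b"
abbreviation ex_quotient (infixl "\<oslash>" 70) where "a \<oslash> b \<equiv> Op Quotient a b"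
abbreviation ex_less (infix "\<prec>" 50) where "a \<prec> b \<equiv> Op Less a b"

primrec ev :: "nat \<Rightarrow> orac \<Rightarrow> orac \<Rightarrow> mstate \<Rightarrow> ex \<Rightarrow> nat" where
  "ev w A B s (V r) = reg s r"
| "ev w A B s (N k) = k mod 2 ^ w"
| "ev w A B s (Op f a b) = arith w f (ev w A B s a) (ev w A B s b) mod 2 ^ w"
| "ev w A B s (MemAt a) = mem s (ev w A B s a) mod 2 ^ w"
| "ev w A B s (EntA a b) = A (ev w A B s a) (ev w A B s b) mod 2 ^ w"
| "ev w A B s (EntB a b) = B (ev w A B s a) (ev w A B s b) mod 2 ^ w"

text \<open>Registers 32 to 63 form the evaluation stack, which is zero between statements.\<close>

abbreviation scratch :: "nat set" where "scratch \<equiv> {32..<64}"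

definition valid :: "nat \<Rightarrow> (nat \<Rightarrow> nat) \<Rightarrow> bool" where
  "valid w R \<longleftrightarrow> (\<forall>r. R r < 2 ^ w) \<and> (\<forall>r\<in>scratch. R r = 0)"

text \<open>\<open>t\<close> is the stack position of the result. Leaves must stay inside the
  scratch area, which limits the nesting depth, and variables must stay outside it.\<close>

primrec wf_ex :: "ex \<Rightarrow> nat \<Rightarrow> bool" where
  "wf_ex (V r) t \<longleftrightarrow> (r < 32 \<or> 64 \<le> r) \<and> 32 \<le> t \<and> t < 64"
| "wf_ex (N k) t \<longleftrightarrow> 32 \<le> t \<and> t < 64"
| "wf_ex (Op f a b) t \<longleftrightarrow> wf_ex a t \<and> wf_ex b (Suc t)"
| "wf_ex (MemAt a) t \<longleftrightarrow> wf_ex a t"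
| "wf_ex (EntA a b) t \<longleftrightarrow> wf_ex a t \<and> wf_ex b (Suc t)"
| "wf_ex (EntB a b) t \<longleftrightarrow> wf_ex a t \<and> wf_ex b (Suc t)"

primrec cost :: "ex \<Rightarrow> real" where
  "cost (V r) = 1"
| "cost (N k) = 1"
| "cost (Op f a b) = cost a + cost b + 2"
| "cost (MemAt a) = cost a + 1"
| "cost (EntA a b) = cost a + cost b + 2"
| "cost (EntB a b) = cost a + cost b + 2"

text \<open>\<open>BitOr\<close> of a register with itself is the move instruction. The second
  operand is erased as soon as it is used, which keeps the stack zero above its live part.\<close>

primrec code :: "ex \<Rightarrow> nat \<Rightarrow> prog" where
  "code (V r) t = Do (Arith BitOr t r r)"
| "code (N k) t = Do (Const t k)"
| "code (Op f a b) t =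
    Seq (code a t) (Seq (code b (Suc t)) (Seq (Do (Arith f t t (Suc t))) (Do (Const (Suc t) 0))))"
| "code (MemAt a) t = Seq (code a t) (Do (Load t t))"
| "code (EntA a b) t =
    Seq (code a t) (Seq (code b (Suc t)) (Seq (Do (ReadA t t (Suc t))) (Do (Const (Suc t) 0))))"
| "code (EntB a b) t =
    Seq (code a t) (Seq (code b (Suc t)) (Seq (Do (ReadB t t (Suc t))) (Do (Const (Suc t) 0))))"

definition assign :: "nat \<Rightarrow> ex \<Rightarrow> prog" where
  "assign r e = Seq (code e 32) (Seq (Do (Arith BitOr r 32 32)) (Do (Const 32 0)))"

definition poke :: "ex \<Rightarrow> ex \<Rightarrow> prog" where
  "poke a e = Seq (code a 32) (Seq (code e 33)
     (Seq (Do (Store 32 33)) (Seq (Do (Const 32 0)) (Do (Const 33 0)))))"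

lemma valid_upd [simp]:
  "valid w R \<Longrightarrow> v < 2 ^ w \<Longrightarrow> r < 32 \<or> 64 \<le> r \<Longrightarrow> valid w (R(r := v))"
  by (auto simp: valid_def)

lemma validD: "valid w R \<Longrightarrow> R r < 2 ^ w" "valid w R \<Longrightarrow> 32 \<le> r \<Longrightarrow> r < 64 \<Longrightarrow> R r = 0"
  by (auto simp: valid_def)

lemma ev_less: "(\<And>r. reg s r < 2 ^ w) \<Longrightarrow> ev w A B s e < 2 ^ w"
  by (cases e) auto

text \<open>The code of a second operand runs while the first value already sits on the stack, so
  its value must not depend on scratch registers.\<close>

lemma ev_cong:
  assumes "\<And>r. r < 32 \<or> 64 \<le> r \<Longrightarrow> reg s r = reg s' r" "mem s = mem s'"
  shows "wf_ex e t \<Longrightarrow> ev w A B s e = ev w A B s' e"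
proof (induction e arbitrary: t)
  case (Op f a b)
  then show ?case by (metis ev.simps(3) wf_ex.simps(3))
qed (use assms in auto)

lemma runs_within_Seq_det:
  assumes "runs_within w A B c T s (return_pmf s')" "runs_within w A B d T' s' (return_pmf s'')"
  shows "runs_within w A B (Seq c d) (T + T') s (return_pmf s'')"
  using runs_within_Seq[OF assms(1), where E = "\<lambda>_. return_pmf s''"] assms(2)
  by (simp add: bind_return_pmf)

lemma runs_within_Do_det:
  "step w A B a s = return_pmf s' \<Longrightarrow> runs_within w A B (Do a) 1 s (return_pmf s')"
  by (metis order_refl runs_within_Do)

lemma wf_ex_bounds: "wf_ex e t \<Longrightarrow> 32 \<le> t \<and> t < 64"
  by (induction e arbitrary: t) auto

text \<open>The common part of \<open>Op\<close>, \<open>EntA\<close> and \<open>EntB\<close>, which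
  differ only in the instruction \<open>a\<close>.\<close>

lemma binary_code_correct:
  assumes "runs_within w A B c T s (return_pmf (s\<lparr>reg := (reg s)(t := x)\<rparr>))"
    and "runs_within w A B d T' (s\<lparr>reg := (reg s)(t := x)\<rparr>)
      (return_pmf (s\<lparr>reg := (reg s)(t := x, Suc t := y)\<rparr>))"
    and "step w A B a (s\<lparr>reg := (reg s)(t := x, Suc t := y)\<rparr>)
      = return_pmf (put w t v (s\<lparr>reg := (reg s)(t := x, Suc t := y)\<rparr>))"
    and "reg s (Suc t) = 0"
  shows "runs_within w A B (Seq c (Seq d (Seq (Do a) (Do (Const (Suc t) 0))))) (T + T' + 2) s
    (return_pmf (s\<lparr>reg := (reg s)(t := v mod 2 ^ w)\<rparr>))"
proof -
  have "s\<lparr>reg := (reg s)(t := v mod 2 ^ w)\<rparr> =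
      put w (Suc t) 0 (put w t v (s\<lparr>reg := (reg s)(t := x, Suc t := y)\<rparr>))"
    using assms(4) by (auto simp: put_def fun_eq_iff)
  then have "runs_within w A B (Seq c (Seq d (Seq (Do a) (Do (Const (Suc t) 0))))) (T + (T' + (1 + 1))) s
    (return_pmf (s\<lparr>reg := (reg s)(t := v mod 2 ^ w)\<rparr>))"
    by (intro runs_within_Seq_det[OF assms(1)] runs_within_Seq_det[OF assms(2)]
        runs_within_Seq_det[OF runs_within_Do_det[OF assms(3)]] runs_within_Do_det) simp
  then show ?thesis by (simp add: algebra_simps)
qed

lemma code_correct:
  assumes "wf_ex e t" "\<And>r. reg s r < 2 ^ w" "\<And>r. t \<le> r \<Longrightarrow> r < 64 \<Longrightarrow> reg s r = 0"
  shows "runs_within w A B (code e t) (cost e) s (return_pmf (s\<lparr>reg := (reg s)(t := ev w A B s e)\<rparr>))"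
  using assms
proof (induction e arbitrary: t s)
  case (V r)
  have "step w A B (Arith BitOr t r r) s = return_pmf (s\<lparr>reg := (reg s)(t := reg s r)\<rparr>)"
    using V.prems(2)[of r] by (simp add: put_def)
  from runs_within_Do_det[OF this] show ?case unfolding code.simps cost.simps ev.simps .
next
  case (N k)
  have "step w A B (Const t k) s = return_pmf (s\<lparr>reg := (reg s)(t := k mod 2 ^ w)\<rparr>)"
    by (simp add: put_def)
  from runs_within_Do_det[OF this] show ?case unfolding code.simps cost.simps ev.simps .
next
  case (MemAt a)
  let ?s = "s\<lparr>reg := (reg s)(t := ev w A B s a)\<rparr>"
  have "runs_within w A B (code a t) (cost a) s (return_pmf ?s)"
    using MemAt.prems by (intro MemAt.IH) simp_all
  moreover have "step w A B (Load t t) ?s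
      = return_pmf (s\<lparr>reg := (reg s)(t := mem s (ev w A B s a) mod 2 ^ w)\<rparr>)"
    by (simp add: put_def)
  ultimately show ?case
    unfolding code.simps cost.simps ev.simps by (intro runs_within_Seq_det runs_within_Do_det)
next
  case (Op f a b)
  let ?s = "s\<lparr>reg := (reg s)(t := ev w A B s a)\<rparr>"
  have t: "32 \<le> t" "Suc t < 64"
    using Op.prems(1) wf_ex_bounds[of a t] wf_ex_bounds[of b "Suc t"] by auto
  have b: "ev w A B ?s b = ev w A B s b"
    using Op.prems(1) t by (intro ev_cong[of _ _ b "Suc t"]) auto
  have "runs_within w A B (code a t) (cost a) s (return_pmf ?s)"
    using Op.prems by (intro Op.IH) auto
  moreover have "runs_within w A B (code b (Suc t)) (cost b) ?s
      (return_pmf (?s\<lparr>reg := (reg ?s)(Suc t := ev w A B ?s b)\<rparr>))"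
    using Op.prems ev_less[of s w A B a] by (intro Op.IH) auto
  ultimately show ?case
    unfolding code.simps cost.simps ev.simps b
    using Op.prems t by (intro binary_code_correct) simp_all
next
  case (EntA a b)
  let ?s = "s\<lparr>reg := (reg s)(t := ev w A B s a)\<rparr>"
  have t: "32 \<le> t" "Suc t < 64"
    using EntA.prems(1) wf_ex_bounds[of a t] wf_ex_bounds[of b "Suc t"] by auto
  have b: "ev w A B ?s b = ev w A B s b"
    using EntA.prems(1) t by (intro ev_cong[of _ _ b "Suc t"]) auto
  have "runs_within w A B (code a t) (cost a) s (return_pmf ?s)"
    using EntA.prems by (intro EntA.IH) auto
  moreover have "runs_within w A B (code b (Suc t)) (cost b) ?s
      (return_pmf (?s\<lparr>reg := (reg ?s)(Suc t := ev w A B ?s b)\<rparr>))"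
    using EntA.prems ev_less[of s w A B a] by (intro EntA.IH) auto
  ultimately show ?case
    unfolding code.simps cost.simps ev.simps b
    using EntA.prems t by (intro binary_code_correct) simp_all
next
  case (EntB a b)
  let ?s = "s\<lparr>reg := (reg s)(t := ev w A B s a)\<rparr>"
  have t: "32 \<le> t" "Suc t < 64"
    using EntB.prems(1) wf_ex_bounds[of a t] wf_ex_bounds[of b "Suc t"] by auto
  have b: "ev w A B ?s b = ev w A B s b"
    using EntB.prems(1) t by (intro ev_cong[of _ _ b "Suc t"]) auto
  have "runs_within w A B (code a t) (cost a) s (return_pmf ?s)"
    using EntB.prems by (intro EntB.IH) auto
  moreover have "runs_within w A B (code b (Suc t)) (cost b) ?s
      (return_pmf (?s\<lparr>reg := (reg ?s)(Suc t := ev w A B ?s b)\<rparr>))"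
    using EntB.prems ev_less[of s w A B a] by (intro EntB.IH) auto
  ultimately show ?case
    unfolding code.simps cost.simps ev.simps b
    using EntB.prems t by (intro binary_code_correct) simp_all
qed

lemma assign_correct:
  assumes "valid w (reg s)" "wf_ex e 32" "r < 32 \<or> 64 \<le> r"
  shows "runs_within w A B (assign r e) (cost e + 2) s
    (return_pmf (s\<lparr>reg := (reg s)(r := ev w A B s e)\<rparr>))"
proof -
  let ?v = "ev w A B s e"
  have v: "?v < 2 ^ w"
    using assms(1) by (intro ev_less) (simp add: valid_def)
  have "runs_within w A B (code e 32) (cost e) s (return_pmf (s\<lparr>reg := (reg s)(32 := ?v)\<rparr>))"
    using assms by (intro code_correct) (auto simp: valid_def)
  moreover have "s\<lparr>reg := (reg s)(r := ?v)\<rparr> =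
      put w 32 0 (put w r ?v (s\<lparr>reg := (reg s)(32 := ?v)\<rparr>))"
    using v assms(1,3) by (auto simp: put_def fun_eq_iff valid_def)
  ultimately have "runs_within w A B (assign r e) (cost e + (1 + 1)) s
      (return_pmf (s\<lparr>reg := (reg s)(r := ?v)\<rparr>))"
    unfolding assign_def
    by (elim runs_within_Seq_det) (intro runs_within_Seq_det[OF runs_within_Do_det runs_within_Do_det], simp_all)
  then show ?thesis by simp
qed

lemma poke_correct:
  assumes "valid w (reg s)" "wf_ex a 32" "wf_ex e 33"
  shows "runs_within w A B (poke a e) (cost a + cost e + 3) s
    (return_pmf (s\<lparr>mem := (mem s)(ev w A B s a := ev w A B s e)\<rparr>))"
proof -
  let ?a = "ev w A B s a" and ?v = "ev w A B s e"
  let ?s = "s\<lparr>reg := (reg s)(32 := ?a)\<rparr>"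
  have a: "?a < 2 ^ w"
    using assms(1) by (intro ev_less) (simp add: valid_def)
  have e: "ev w A B ?s e = ?v"
    using assms by (intro ev_cong[of _ _ e 33]) auto
  have "runs_within w A B (code a 32) (cost a) s (return_pmf ?s)"
    using assms by (intro code_correct) (auto simp: valid_def)
  moreover have "runs_within w A B (code e 33) (cost e) ?s (return_pmf (?s\<lparr>reg := (reg ?s)(33 := ?v)\<rparr>))"
    using code_correct[of e 33 ?s w A B] a assms unfolding e by (auto simp: valid_def)
  moreover have "s\<lparr>mem := (mem s)(?a := ?v)\<rparr> = put w 33 0 (put w 32 0
      (?s\<lparr>reg := (reg ?s)(33 := ?v), mem := (mem s)(?a := ?v)\<rparr>))"
    using assms(1) by (auto simp: put_def fun_eq_iff valid_def)
  ultimately have "runs_within w A B (poke a e) (cost a + (cost e + (1 + (1 + 1)))) s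
      (return_pmf (s\<lparr>mem := (mem s)(?a := ?v)\<rparr>))"
    unfolding poke_def
    by (elim runs_within_Seq_det) (intro runs_within_Seq_det[OF runs_within_Do_det
      runs_within_Seq_det[OF runs_within_Do_det runs_within_Do_det]], simp_all)
  then show ?thesis by (simp add: algebra_simps)
qed

lemma tri_assign:
  assumes "valid w (reg s)" "wf_ex e 32" "r < 32 \<or> 64 \<le> r"
    and "tri w A B (blk cs) (s\<lparr>reg := (reg s)(r := ev w A B s e)\<rparr>) (T - (cost e + 2)) Q f p"
  shows "tri w A B (blk (assign r e # cs)) s T Q f p"
  using assms by (intro tri_Cons_det[OF assign_correct])

lemma tri_poke:
  assumes "valid w (reg s)" "wf_ex a 32" "wf_ex e 33"
    and "tri w A B (blk cs) (s\<lparr>mem := (mem s)(ev w A B s a := ev w A B s e)\<rparr>)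
      (T - (cost a + cost e + 3)) Q f p"
  shows "tri w A B (blk (poke a e # cs)) s T Q f p"
  using assms by (intro tri_Cons_det[OF poke_correct])

text \<open>The machine subtracts by adding a complement, so the true difference appears after one
  full turn modulo the word size.\<close>

lemma sub_mod_word: "y \<le> x \<Longrightarrow> x < 2 ^ w \<Longrightarrow> (x + (2 ^ w - y)) mod 2 ^ w = x - (y::nat)"
proof -
  assume "y \<le> x" "x < 2 ^ w"
  then have "x + (2 ^ w - y) = (x - y) + 2 ^ w" "x - y < 2 ^ w" by auto
  then show ?thesis by (metis mod_add_self2 mod_less)
qed

section \<open>Amplitude amplification on aligned intervals\<close>

text \<open>The gate \<open>hadamard\<close> seen on the index register alone; \<open>qstate\<close>
  adds the other registers later.\<close>

definition had :: "nat \<Rightarrow> (nat \<Rightarrow> complex) \<Rightarrow> nat \<Rightarrow> complex" where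
  "had p \<phi> a = (\<phi> (unset_bit p a) + (if bit a p then -1 else 1) * \<phi> (set_bit p a))
     / complex_of_real (sqrt 2)"

primrec Hs :: "nat \<Rightarrow> (nat \<Rightarrow> complex) \<Rightarrow> nat \<Rightarrow> complex" where
  "Hs 0 \<phi> = \<phi>"
| "Hs (Suc q) \<phi> = Hs q (had q \<phi>)"

lemma csqrt2: "complex_of_real (sqrt 2) * complex_of_real (sqrt 2) = 2"
  by (simp flip: of_real_mult)

lemma had_had: "had p (had p \<phi>) = \<phi>"
proof
  fix a :: nat
  have bits: "unset_bit p (unset_bit p a) = unset_bit p a" "set_bit p (set_bit p a) = set_bit p a"
    "unset_bit p (set_bit p a) = unset_bit p a" "set_bit p (unset_bit p a) = set_bit p a"
    by (auto intro!: bit_eqI simp: bit_simps)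
  have ab: "(x / complex_of_real (sqrt 2) + y / complex_of_real (sqrt 2)) / complex_of_real (sqrt 2) = (x + y) / 2" for x y
    using csqrt2 by (simp add: field_simps)
  show "had p (had p \<phi>) a = \<phi> a"
  proof (cases "bit a p")
    case True
    then have "set_bit p a = a" by (auto intro!: bit_eqI simp: bit_simps)
    with True show ?thesis
      using ab[of "\<phi> (unset_bit p a) + \<phi> a" "- (\<phi> (unset_bit p a) - \<phi> a)"]
      by (simp add: had_def bits bit_simps)
  next
    case False
    then have "unset_bit p a = a" by (auto intro!: bit_eqI simp: bit_simps)
    with False show ?thesis
      using ab[of "\<phi> a + \<phi> (set_bit p a)" "(\<phi> a - \<phi> (set_bit p a))"]
      by (simp add: had_def bits bit_simps)
  qed
qed

lemma had_commute:
  assumes "p \<noteq> q"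
  shows "had p (had q \<phi>) = had q (had p \<phi>)"
proof
  fix a :: nat
  have bits: "unset_bit p (unset_bit q a) = unset_bit q (unset_bit p a)"
    "set_bit p (set_bit q a) = set_bit q (set_bit p a)"
    "unset_bit p (set_bit q a) = set_bit q (unset_bit p a)"
    "set_bit p (unset_bit q a) = unset_bit q (set_bit p a)"
    using assms by (auto intro!: bit_eqI simp: bit_simps)
  have b: "bit (unset_bit p a) q = bit a q" "bit (set_bit p a) q = bit a q"
    "bit (unset_bit q a) p = bit a p" "bit (set_bit q a) p = bit a p"
    using assms by (auto simp: bit_simps)
  show "had p (had q \<phi>) a = had q (had p \<phi>) a"
    using csqrt2 by (simp add: had_def bits b field_simps)
qed

lemma had_Hs_commute: "q \<le> p \<Longrightarrow> had p (Hs q \<phi>) = Hs q (had p \<phi>)"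
proof (induction q arbitrary: \<phi>)
  case (Suc q)
  then show ?case using had_commute[of p q \<phi>] by simp
qed simp

text \<open>Gates on distinct bits commute, so each gate of the second transform can be moved next
  to its partner, where the two cancel.\<close>

lemma Hs_Hs: "Hs q (Hs q \<phi>) = \<phi>"
proof (induction q arbitrary: \<phi>)
  case (Suc q)
  then show ?case by (simp add: had_Hs_commute had_had)
qed simp

lemma had_linear: "had p (\<lambda>a. \<phi> a + \<psi> a) = (\<lambda>a. had p \<phi> a + had p \<psi> a)"
  by (rule ext) (simp add: had_def field_simps)

lemma Hs_linear: "Hs q (\<lambda>a. \<phi> a + \<psi> a) = (\<lambda>a. Hs q \<phi> a + Hs q \<psi> a)"
  by (induction q arbitrary: \<phi> \<psi>) (simp_all add: had_linear)

text \<open>Adding less than \<open>2 ^ q\<close> to a multiple of \<open>2 ^ Suc q\<close> causes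
  no carry into bit \<open>q\<close>.\<close>

lemma aligned_bits:
  fixes x a :: nat
  assumes "2 ^ Suc q dvd x" "a < 2 ^ q"
  shows "\<not> bit (x + a) q" "unset_bit q (x + a) = x + a" "set_bit q (x + a) = x + 2 ^ q + a"
proof -
  obtain y where "x = 2 ^ q * (2 * y)" using assms(1) by (auto simp: dvd_def)
  then have "(x + a) div 2 ^ q = 2 * y" using assms(2) by simp
  then show b: "\<not> bit (x + a) q" by (simp add: bit_iff_odd)
  then show "unset_bit q (x + a) = x + a" by (auto intro!: bit_eqI simp: bit_simps)
  show "set_bit q (x + a) = x + 2 ^ q + a" using b by (simp add: set_bit_eq)
qed

lemma sum_double: "(\<Sum>a<2 * m. f a) = (\<Sum>a<m. f a) + (\<Sum>a<(m::nat). f (m + a))"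
  for f :: "nat \<Rightarrow> 'a::comm_monoid_add"
proof -
  have "(\<Sum>a<2 * m. f a) = (\<Sum>a\<in>{0..<m}. f a) + (\<Sum>a\<in>{m..<m + m}. f a)"
    by (subst sum.atLeastLessThan_concat) (auto simp: atLeast0LessThan mult_2)
  also have "(\<Sum>a\<in>{m..<m + m}. f a) = (\<Sum>a<m. f (m + a))"
    using sum.shift_bounds_nat_ivl[of f 0 m m] by (simp add: atLeast0LessThan add.commute)
  finally show ?thesis by (simp add: atLeast0LessThan)
qed

lemma csqrt_Suc: "complex_of_real (sqrt (2 ^ Suc q)) = complex_of_real (sqrt 2) * complex_of_real (sqrt (2 ^ q))"
  by (simp add: real_sqrt_mult)

text \<open>All bits of \<open>x\<close> below \<open>q\<close> are zero, so no minus sign enters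
  and the amplitude at the base point is the plain sum over the interval.\<close>

lemma Hs_base: "2 ^ q dvd x \<Longrightarrow> Hs q \<phi> x = (\<Sum>a<2 ^ q. \<phi> (x + a)) / complex_of_real (sqrt (2 ^ q))"
proof (induction q arbitrary: \<phi>)
  case (Suc q)
  have "2 ^ q dvd x" using Suc.prems by (metis dvd_mult_right power_Suc)
  then have "Hs (Suc q) \<phi> x = (\<Sum>a<2 ^ q. had q \<phi> (x + a)) / complex_of_real (sqrt (2 ^ q))"
    using Suc.IH by simp
  also have "(\<Sum>a<2 ^ q. had q \<phi> (x + a))
      = (\<Sum>a<2 ^ q. (\<phi> (x + a) + \<phi> (x + 2 ^ q + a)) / complex_of_real (sqrt 2))"
    by (intro sum.cong refl) (simp add: had_def aligned_bits[OF Suc.prems])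
  also have "\<dots> = (\<Sum>a<2 ^ Suc q. \<phi> (x + a)) / complex_of_real (sqrt 2)"
    by (simp add: sum_double add.assoc sum.distrib flip: sum_divide_distrib)
  finally show ?case by (simp only: csqrt_Suc divide_divide_eq_left)
qed simp

abbreviation spike :: "nat \<Rightarrow> complex \<Rightarrow> nat \<Rightarrow> complex" where
  "spike x c \<equiv> (\<lambda>a. if a = x then c else 0)"

lemma had_spike:
  assumes "2 ^ Suc q dvd x"
  shows "had q (spike x c) = (\<lambda>a. spike x (c / complex_of_real (sqrt 2)) a
    + spike (x + 2 ^ q) (c / complex_of_real (sqrt 2)) a)"
proof
  fix a :: nat
  have x: "\<not> bit x q" "set_bit q x = x + 2 ^ q" "unset_bit q x = x"
    using aligned_bits[OF assms, of 0] by simp_all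
  have s: "set_bit q a \<noteq> x"
  proof
    assume "set_bit q a = x"
    moreover have "bit (set_bit q a) q" by (simp add: bit_simps)
    ultimately show False using x(1) by blast
  qed
  have u: "unset_bit q a = x \<longleftrightarrow> a = x \<or> a = x + 2 ^ q"
  proof
    assume u: "unset_bit q a = x"
    have "a = x + of_bool (bit a q) * 2 ^ q"
    proof (cases "bit a q")
      case True
      then have "set_bit q x = a" unfolding u[symmetric] by (auto intro!: bit_eqI simp: bit_simps)
      with True x(2) show ?thesis by simp
    next
      case False
      then have "x = a" unfolding u[symmetric] by (auto intro!: bit_eqI simp: bit_simps)
      with False show ?thesis by simp
    qed
    then show "a = x \<or> a = x + 2 ^ q" by (cases "bit a q") auto
  next
    have "unset_bit q (set_bit q x) = unset_bit q x" by (auto intro!: bit_eqI simp: bit_simps)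
    then show "a = x \<or> a = x + 2 ^ q \<Longrightarrow> unset_bit q a = x" using x by auto
  qed
  show "had q (spike x c) a = spike x (c / complex_of_real (sqrt 2)) a
    + spike (x + 2 ^ q) (c / complex_of_real (sqrt 2)) a"
    using s u by (auto simp: had_def)
qed

text \<open>Each Hadamard gate splits a spike at an aligned point into two spikes half an interval
  apart, and both are aligned for the remaining bits.\<close>

lemma Hs_spike:
  "2 ^ q dvd x \<Longrightarrow> Hs q (spike x c) =
    (\<lambda>a. if a \<in> {x..<x + 2 ^ q} then c / complex_of_real (sqrt (2 ^ q)) else 0)"
proof (induction q arbitrary: x c)
  case 0
  then show ?case by (auto simp: fun_eq_iff)
next
  case (Suc q)
  have "2 ^ q dvd x" "2 ^ q dvd x + 2 ^ q"
    using Suc.prems by (auto intro: dvd_mult_right simp: dvd_add_left_iff) 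
  then show ?case
    by (simp only: Hs.simps had_spike[OF Suc.prems] Hs_linear Suc.IH csqrt_Suc)
       (auto simp: fun_eq_iff)
qed

definition supported :: "nat \<Rightarrow> nat \<Rightarrow> (nat \<Rightarrow> complex) \<Rightarrow> bool" where
  "supported x q \<phi> \<longleftrightarrow> (\<forall>a. \<phi> a \<noteq> 0 \<longrightarrow> a \<in> {x..<x + 2 ^ q})"

text \<open>Membership in an aligned interval is a matter of the high bits, which operations on bits
  below \<open>q\<close> leave alone.\<close>

lemma interval_iff_div:
  fixes x :: nat
  assumes "2 ^ q dvd x"
  shows "a \<in> {x..<x + 2 ^ q} \<longleftrightarrow> a div 2 ^ q = x div 2 ^ q"
proof
  assume "a \<in> {x..<x + 2 ^ q}"
  then obtain d where "a = x + d" "d < 2 ^ q" by (metis atLeastLessThan_iff le_iff_add nat_add_left_cancel_less)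
  then show "a div 2 ^ q = x div 2 ^ q" using assms by (simp add: div_plus_div_distrib_dvd_left)
next
  assume "a div 2 ^ q = x div 2 ^ q"
  then have "a = x + a mod 2 ^ q" using assms by (metis div_mult_mod_eq dvd_div_mult_self)
  then show "a \<in> {x..<x + 2 ^ q}" by (metis atLeastLessThan_iff le_add1 mod_less_divisor nat_add_left_cancel_less zero_less_numeral zero_less_power)
qed

lemma supported_had:
  assumes "2 ^ q dvd x" "p < q" "supported x q \<phi>"
  shows "supported x q (had p \<phi>)"
proof -
  have "set_bit p a div 2 ^ q = a div 2 ^ q" "unset_bit p a div 2 ^ q = a div 2 ^ q" for a :: nat
    using assms(2) by (auto simp flip: drop_bit_eq_div intro!: bit_eqI simp: bit_simps)
  then show ?thesis
    using assms(3) unfolding supported_def had_def interval_iff_div[OF assms(1)]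
    by (metis (no_types, lifting) add_0 div_0 mult_zero_right)
qed

lemma supported_Hs: "2 ^ q dvd x \<Longrightarrow> p \<le> q \<Longrightarrow> supported x q \<phi> \<Longrightarrow> supported x q (Hs p \<phi>)"
  by (induction p arbitrary: \<phi>) (auto simp: Suc_le_eq dest: less_imp_le intro: supported_had)

text \<open>
  Inversion about the mean: conjugating the reflection at the base point of the interval with
  the Hadamard transform.
\<close>

lemma diffusion:
  assumes "2 ^ q dvd x"
  shows "Hs q (\<lambda>a. if a = x then - Hs q \<phi> a else Hs q \<phi> a) =
    (\<lambda>a. \<phi> a - (if a \<in> {x..<x + 2 ^ q} then 2 * (\<Sum>a<2 ^ q. \<phi> (x + a)) / 2 ^ q else 0))"
proof -
  \<comment> \<open>The reflection at \<open>x\<close> only adds a spike to the transformed state.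
    By linearity the result is \<open>\<phi>\<close> plus the transform of that spike, whose height
    is given by the sum over the interval.\<close>
  have "(\<lambda>a. if a = x then - Hs q \<phi> a else Hs q \<phi> a) = (\<lambda>a. Hs q \<phi> a + spike x (- 2 * Hs q \<phi> x) a)"
    by (auto simp: fun_eq_iff)
  moreover have "complex_of_real (sqrt (2 ^ q)) * complex_of_real (sqrt (2 ^ q)) = 2 ^ q"
    by (simp flip: of_real_mult)
  ultimately show ?thesis
    by (simp only: Hs_linear Hs_Hs Hs_spike[OF assms] Hs_base[OF assms])
       (auto simp: fun_eq_iff)
qed

text \<open>The usual Grover angle: the square of its sine is the fraction of solutions in the
  interval.\<close>

definition angle :: "nat \<Rightarrow> nat \<Rightarrow> nat set \<Rightarrow> real" where
  "angle x q S = arcsin (sqrt (card ({x..<x + 2 ^ q} \<inter> S) / 2 ^ q))"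

text \<open>
  The state after \<open>j\<close> iterations from the global phase \<open>c\<close>. If there are no good or no bad
  elements, the corresponding quotient is a division by zero, but then it does not occur.
\<close>

definition grover_state :: "nat \<Rightarrow> nat \<Rightarrow> nat set \<Rightarrow> complex \<Rightarrow> nat \<Rightarrow> nat \<Rightarrow> complex" where
  "grover_state x q S c j a = (if a \<in> {x..<x + 2 ^ q} then c * (- 1) ^ j *
     (if a \<in> S then complex_of_real (sin ((2 * real j + 1) * angle x q S) / sqrt (card ({x..<x + 2 ^ q} \<inter> S)))
      else complex_of_real (cos ((2 * real j + 1) * angle x q S) / sqrt (card ({x..<x + 2 ^ q} - S))))
     else 0)"

context
  fixes x q :: nat and S :: "nat set"
begin

private abbreviation (input) "I \<equiv> {x..<x + 2 ^ q}"
private abbreviation (input) "t \<equiv> real (card (I \<inter> S))"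
private abbreviation (input) "u \<equiv> real (card (I - S))"
private abbreviation (input) "\<theta> \<equiv> angle x q S"

lemma tu: "t + u = 2 ^ q"
proof -
  have "card (I \<inter> S) + card (I - S) = card I"
    by (metis Diff_Int2 Int_commute card_Int_Diff finite_atLeastLessThan inf.idem)
  then show ?thesis by (metis card_atLeastLessThan diff_add_inverse of_nat_add of_nat_numeral of_nat_power)
qed

lemma ratio: "0 \<le> sqrt (t / 2 ^ q)" "sqrt (t / 2 ^ q) \<le> 1"
proof -
  have "t \<le> 2 ^ q" using tu by linarith
  then show "sqrt (t / 2 ^ q) \<le> 1" by (simp only: real_sqrt_le_1_iff divide_le_eq_1_pos zero_less_power zero_less_numeral)
qed simp

lemma sin_angle: "sin \<theta> = sqrt t / sqrt (2 ^ q)"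
proof -
  have "- 1 \<le> sqrt (t / 2 ^ q)" using ratio(1) by linarith
  then show ?thesis unfolding angle_def
    by (subst sin_arcsin) (simp_all only: ratio, simp only: real_sqrt_divide)
qed

lemma cos_angle: "cos \<theta> = sqrt u / sqrt (2 ^ q)"
proof -
  have "- 1 \<le> sqrt (t / 2 ^ q)" using ratio(1) by linarith
  then have "cos \<theta> = sqrt (1 - (sqrt (t / 2 ^ q))\<^sup>2)" unfolding angle_def
    by (subst cos_arcsin) (simp_all only: ratio)
  also have "(sqrt (t / 2 ^ q))\<^sup>2 = t / 2 ^ q"
    by simp
  also have "1 - t / 2 ^ q = u / 2 ^ q" using tu by (simp add: field_simps)
  finally show ?thesis by (simp add: real_sqrt_divide)
qed

lemma grover_state_0: "grover_state x q S c 0 = (\<lambda>a. if a \<in> I then c / complex_of_real (sqrt (2 ^ q)) else 0)"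
proof
  fix a :: nat
  consider "a \<notin> I" | "a \<in> I" "a \<in> S" | "a \<in> I" "a \<notin> S" by blast
  then show "grover_state x q S c 0 a = (if a \<in> I then c / complex_of_real (sqrt (2 ^ q)) else 0)"
  proof cases
    case 2
    then have "card (I \<inter> S) \<noteq> 0" by auto
    then have "sin \<theta> / sqrt t = 1 / sqrt (2 ^ q)" by (simp add: sin_angle)
    moreover have "grover_state x q S c 0 a = c * complex_of_real (sin \<theta> / sqrt t)"
      using 2 by (simp add: grover_state_def)
    ultimately have "grover_state x q S c 0 a = c * complex_of_real (1 / sqrt (2 ^ q))" by (simp only:)
    with 2 show ?thesis by simp
  next
    case 3
    then have "card (I - S) \<noteq> 0" by auto
    then have "cos \<theta> / sqrt u = 1 / sqrt (2 ^ q)" by (simp add: cos_angle)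
    moreover have "grover_state x q S c 0 a = c * complex_of_real (cos \<theta> / sqrt u)"
      using 3 by (simp add: grover_state_def)
    ultimately have "grover_state x q S c 0 a = c * complex_of_real (1 / sqrt (2 ^ q))" by (simp only:)
    with 3 show ?thesis by simp
  next
    case 1
    then show ?thesis by (simp only: grover_state_def if_False)
  qed
qed

lemma mult_div_sqrt: "0 \<le> y \<Longrightarrow> y * (z / sqrt y) = sqrt y * z"
  using real_div_sqrt[of y] by (metis times_divide_eq_left times_divide_eq_right)

text \<open>The \<open>t\<close> solutions contribute with flipped sign and the \<open>u\<close>
  other elements with their own. Since sin \<theta> and cos \<theta> are the square roots of
  \<open>t\<close> and \<open>u\<close> divided by sqrt (2 ^ q), the total is an instance of the
  addition theorem for the cosine.\<close>

lemma grover_mean: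
  "(\<Sum>a<2 ^ q. (if x + a \<in> S then - grover_state x q S c j (x + a) else grover_state x q S c j (x + a))) =
    c * (- 1) ^ j * complex_of_real (sqrt (2 ^ q) * cos ((2 * real j + 2) * \<theta>))"
proof -
  let ?g = "grover_state x q S c j"
  let ?s = "sin ((2 * real j + 1) * \<theta>)" and ?c = "cos ((2 * real j + 1) * \<theta>)"
  have "(\<Sum>a<2 ^ q. (if x + a \<in> S then - ?g (x + a) else ?g (x + a))) = (\<Sum>a\<in>I. (if a \<in> S then - ?g a else ?g a))"
    by (rule sum.reindex_bij_witness[of _ "\<lambda>a. a - x" "\<lambda>a. x + a"]) auto
  also have "\<dots> = (\<Sum>a\<in>I \<inter> S. - ?g a) + (\<Sum>a\<in>I - S. ?g a)"
    by (subst sum.If_cases) (auto simp: Diff_eq)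
  also have "(\<Sum>a\<in>I \<inter> S. - ?g a) = (\<Sum>a\<in>I \<inter> S. - (c * (- 1) ^ j * complex_of_real (?s / sqrt t)))"
    by (intro sum.cong) (auto simp: grover_state_def)
  also have "\<dots> = - (c * (- 1) ^ j * complex_of_real (t * (?s / sqrt t)))"
    by simp
  also have "(\<Sum>a\<in>I - S. ?g a) = (\<Sum>a\<in>I - S. c * (- 1) ^ j * complex_of_real (?c / sqrt u))"
    by (intro sum.cong) (auto simp: grover_state_def)
  also have "\<dots> = c * (- 1) ^ j * complex_of_real (u * (?c / sqrt u))"
    by simp
  finally have "(\<Sum>a<2 ^ q. (if x + a \<in> S then - ?g (x + a) else ?g (x + a))) =
      - (c * (- 1) ^ j * complex_of_real (t * (?s / sqrt t))) + c * (- 1) ^ j * complex_of_real (u * (?c / sqrt u))" .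
  also have "t * (?s / sqrt t) = sqrt (2 ^ q) * sin \<theta> * ?s"
    by (subst mult_div_sqrt) (simp_all add: sin_angle)
  also have "u * (?c / sqrt u) = sqrt (2 ^ q) * cos \<theta> * ?c"
    by (subst mult_div_sqrt) (simp_all add: cos_angle)
  also have "- (c * (- 1) ^ j * complex_of_real (sqrt (2 ^ q) * sin \<theta> * ?s))
      + c * (- 1) ^ j * complex_of_real (sqrt (2 ^ q) * cos \<theta> * ?c)
      = c * (- 1) ^ j * complex_of_real (sqrt (2 ^ q) * (?c * cos \<theta> - ?s * sin \<theta>))"
    by (simp add: algebra_simps)
  also have "?c * cos \<theta> - ?s * sin \<theta> = cos ((2 * real j + 2) * \<theta>)"
    by (simp flip: cos_add add: algebra_simps)
  finally show ?thesis .
qed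

lemma minus_mult_diff: "- k * (a - b) = k * b - k * (a :: complex)"
  by (simp add: algebra_simps)

text \<open>The reflection at the base point subtracts twice the mean from the amplitude instead of
  the amplitude from twice the mean. So each iteration contributes a global sign, which is the
  factor \<open>(- 1) ^ j\<close> of \<open>grover_state\<close>; up to this sign the state rotates
  by 2 \<theta>.\<close>

lemma grover_iteration:
  assumes "2 ^ q dvd x"
    and "\<phi> = (\<lambda>a. if a \<in> S then - grover_state x q S c j a else grover_state x q S c j a)"
  shows "Hs q (\<lambda>a. if a = x then - Hs q \<phi> a else Hs q \<phi> a) = grover_state x q S c (Suc j)"
proof
  fix a :: nat
  let ?s = "sin ((2 * real j + 1) * \<theta>)" and ?c = "cos ((2 * real j + 1) * \<theta>)"
  let ?m = "c * (- 1) ^ j * complex_of_real (2 * cos ((2 * real j + 2) * \<theta>) / sqrt (2 ^ q))"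
  have "Hs q (\<lambda>a. if a = x then - Hs q \<phi> a else Hs q \<phi> a) a
      = \<phi> a - (if a \<in> I then 2 * (c * (- 1) ^ j * complex_of_real (sqrt (2 ^ q) * cos ((2 * real j + 2) * \<theta>))) / 2 ^ q else 0)"
    unfolding diffusion[OF assms(1)] unfolding assms(2) grover_mean by simp
  also have "2 * (c * (- 1) ^ j * complex_of_real (sqrt (2 ^ q) * cos ((2 * real j + 2) * \<theta>))) / 2 ^ q
      = c * (- 1) ^ j * complex_of_real (2 * cos ((2 * real j + 2) * \<theta>) * (sqrt (2 ^ q) / 2 ^ q))"
    by simp
  also have "sqrt (2 ^ q) / 2 ^ q = 1 / sqrt (2 ^ q :: real)"
    by (metis divide_divide_eq_right div_self mult.commute real_div_sqrt sqrt_divide_self_eq inverse_eq_divide zero_le_numeral zero_le_power)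
  finally have *: "Hs q (\<lambda>a. if a = x then - Hs q \<phi> a else Hs q \<phi> a) a = \<phi> a - (if a \<in> I then ?m else 0)"
    by simp
  consider "a \<notin> I" | "a \<in> I" "a \<in> S" | "a \<in> I" "a \<notin> S" by blast
  then show "Hs q (\<lambda>a. if a = x then - Hs q \<phi> a else Hs q \<phi> a) a = grover_state x q S c (Suc j) a"
  proof cases
    case 1
    then show ?thesis unfolding * by (simp only: grover_state_def assms(2) if_False if_cancel) simp
  next
    case 2
    then have "card (I \<inter> S) \<noteq> 0" by auto
    then have t: "1 / sqrt (2 ^ q) = sin \<theta> / sqrt t" by (simp add: sin_angle)
    \<comment> \<open>The old and the new multiple of \<theta> lie symmetrically around (2 j + 2)
      \<theta>, the angle that occurs in the mean of the flipped state.\<close>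
    have "sin ((2 * real j + 2) * \<theta> + \<theta>) = sin ((2 * real j + 2) * \<theta> - \<theta>) + 2 * cos ((2 * real j + 2) * \<theta>) * sin \<theta>"
      by (simp add: sin_add sin_diff)
    moreover have "(2 * real j + 2) * \<theta> - \<theta> = (2 * real j + 1) * \<theta>"
      "(2 * real j + 2) * \<theta> + \<theta> = (2 * real (Suc j) + 1) * \<theta>" by (simp_all add: algebra_simps)
    ultimately have "sin ((2 * real (Suc j) + 1) * \<theta>) = ?s + 2 * cos ((2 * real j + 2) * \<theta>) * sin \<theta>"
      by metis
    then have "sin ((2 * real (Suc j) + 1) * \<theta>) / sqrt t = ?s / sqrt t + 2 * cos ((2 * real j + 2) * \<theta>) * (sin \<theta> / sqrt t)"
      by (simp only: add_divide_distrib times_divide_eq_right)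
    then have step: "sin ((2 * real (Suc j) + 1) * \<theta>) / sqrt t = ?s / sqrt t + 2 * cos ((2 * real j + 2) * \<theta>) / sqrt (2 ^ q)"
      by (simp only: t[symmetric] times_divide_eq_right mult_1_right)
    have "grover_state x q S c (Suc j) a = - (c * (- 1) ^ j) * complex_of_real (sin ((2 * real (Suc j) + 1) * \<theta>) / sqrt t)"
      using 2 by (simp add: grover_state_def)
    also have "\<dots> = - (c * (- 1) ^ j * complex_of_real (?s / sqrt t)) - ?m"
      unfolding step of_real_add by (simp only: ring_distribs mult_minus_left diff_conv_add_uminus)
    also have "c * (- 1) ^ j * complex_of_real (?s / sqrt t) = grover_state x q S c j a"
      using 2 by (simp add: grover_state_def)
    finally show ?thesis unfolding * using 2 by (simp add: assms(2))
  next
    case 3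
    then have "card (I - S) \<noteq> 0" by auto
    then have t: "1 / sqrt (2 ^ q) = cos \<theta> / sqrt u" by (simp add: cos_angle)
    have "cos ((2 * real j + 2) * \<theta> + \<theta>) = 2 * cos ((2 * real j + 2) * \<theta>) * cos \<theta> - cos ((2 * real j + 2) * \<theta> - \<theta>)"
      by (simp add: cos_add cos_diff)
    moreover have "(2 * real j + 2) * \<theta> - \<theta> = (2 * real j + 1) * \<theta>"
      "(2 * real j + 2) * \<theta> + \<theta> = (2 * real (Suc j) + 1) * \<theta>" by (simp_all add: algebra_simps)
    ultimately have "cos ((2 * real (Suc j) + 1) * \<theta>) = 2 * cos ((2 * real j + 2) * \<theta>) * cos \<theta> - ?c"
      by metis
    then have "cos ((2 * real (Suc j) + 1) * \<theta>) / sqrt u = 2 * cos ((2 * real j + 2) * \<theta>) * (cos \<theta> / sqrt u) - ?c / sqrt u"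
      by (simp only: diff_divide_distrib times_divide_eq_right)
    then have step: "cos ((2 * real (Suc j) + 1) * \<theta>) / sqrt u = 2 * cos ((2 * real j + 2) * \<theta>) / sqrt (2 ^ q) - ?c / sqrt u"
      by (simp only: t[symmetric] times_divide_eq_right mult_1_right)
    have "grover_state x q S c (Suc j) a = - (c * (- 1) ^ j) * complex_of_real (cos ((2 * real (Suc j) + 1) * \<theta>) / sqrt u)"
      using 3 by (simp add: grover_state_def)
    also have "\<dots> = c * (- 1) ^ j * complex_of_real (?c / sqrt u) - ?m"
      unfolding step of_real_diff by (rule minus_mult_diff)
    also have "c * (- 1) ^ j * complex_of_real (?c / sqrt u) = grover_state x q S c j a"
      using 3 by (simp add: grover_state_def)
    finally show ?thesis unfolding * using 3 by (simp add: assms(2))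
  qed
qed

lemma supported_grover_state: "supported x q (grover_state x q S c j)"
  by (auto simp: supported_def grover_state_def)

lemma grover_prob:
  assumes "cmod c = 1"
  shows "(\<Sum>a | grover_state x q S c j a \<noteq> 0 \<and> a \<in> S. (cmod (grover_state x q S c j a))\<^sup>2)
      = (sin ((2 * real j + 1) * \<theta>))\<^sup>2" (is "?p = _")
    and "(\<Sum>a | grover_state x q S c j a \<noteq> 0 \<and> a \<notin> S. (cmod (grover_state x q S c j a))\<^sup>2)
      = (cos ((2 * real j + 1) * \<theta>))\<^sup>2" (is "?q = _")
proof -
  let ?s = "sin ((2 * real j + 1) * \<theta>)" and ?c = "cos ((2 * real j + 1) * \<theta>)"
  have "?p = (\<Sum>a\<in>I \<inter> S. (cmod (grover_state x q S c j a))\<^sup>2)"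
    by (rule sum.mono_neutral_left) (auto simp: grover_state_def)
  also have "\<dots> = (\<Sum>a\<in>I \<inter> S. (?s / sqrt t)\<^sup>2)"
    by (intro sum.cong) (auto simp: grover_state_def norm_mult norm_power assms power_divide simp flip: of_real_divide)
  also have "\<dots> = t * (?s\<^sup>2 / t)" by (simp add: power_divide)
  also have "\<dots> = ?s\<^sup>2"
  proof (cases "t = 0")
    case True
    \<comment> \<open>Without solutions the quotient by \<open>t\<close> is 0 by convention, and the
      angle is 0 as well.\<close>
    then have "\<theta> = 0" by (simp add: angle_def)
    then show ?thesis using True by simp
  qed simp
  finally show "?p = ?s\<^sup>2" .
  have "?q = (\<Sum>a\<in>I - S. (cmod (grover_state x q S c j a))\<^sup>2)"
    by (rule sum.mono_neutral_left) (auto simp: grover_state_def)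
  also have "\<dots> = (\<Sum>a\<in>I - S. (?c / sqrt u)\<^sup>2)"
    by (intro sum.cong) (auto simp: grover_state_def norm_mult norm_power assms power_divide simp flip: of_real_divide)
  also have "\<dots> = u * (?c\<^sup>2 / u)" by (simp add: power_divide)
  also have "\<dots> = ?c\<^sup>2"
  proof (cases "u = 0")
    case True
    then have "t = 2 ^ q" using tu by linarith
    \<comment> \<open>If every element is a solution, the angle is pi / 2, and the cosine vanishes
      at its odd multiples.\<close>
    then have \<theta>: "\<theta> = pi / 2" by (simp add: angle_def)
    have "(2 * real j + 1) * (pi / 2) = real j * pi + pi / 2"
      by (simp add: algebra_simps)
    then have "?c = 0"
      unfolding \<theta> by (simp only:) (simp add: cos_add)
    then show ?thesis using True by simp
  qed simp
  finally show "?q = ?c\<^sup>2" .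
qed

lemma sin_sq_ge_half:
  assumes "pi / 4 \<le> y" "y \<le> 3 * pi / 4"
  shows "1 / 2 \<le> (sin y)\<^sup>2"
proof -
  have "cos (2 * y) = - cos (2 * y - pi)" by (simp add: cos_diff)
  moreover have "0 \<le> cos (2 * y - pi)" using assms by (intro cos_ge_zero) auto
  ultimately show ?thesis using cos_double_sin[of y] by linarith
qed

text \<open>
  As consecutive numbers \<open>3 ^ i * \<theta>\<close> differ by a factor of 3, one of them falls into the
  interval from \<open>pi / 4\<close> to \<open>3 * pi / 4\<close>.
\<close>

lemma good_round:
  assumes "I \<inter> S \<noteq> {}"
  obtains i :: nat where "9 ^ i \<le> (9 :: nat) * 2 ^ q" "1 / 2 \<le> (sin (3 ^ i * \<theta>))\<^sup>2"
proof -
  have t: "1 \<le> t" using assms by (simp add: Suc_le_eq card_gt_0_iff)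
  have le: "0 \<le> \<theta>" "\<theta> \<le> pi / 2"
    unfolding angle_def using arcsin_le_arcsin[of 0 "sqrt (t / 2 ^ q)"] arcsin_bounded[of "sqrt (t / 2 ^ q)"] ratio
    by auto
  \<comment> \<open>One solution suffices to keep the angle at least 1 / sqrt (2 ^ q).\<close>
  have "1 / sqrt (2 ^ q) \<le> sin \<theta>" using t by (simp add: sin_angle divide_right_mono)
  also have "\<dots> \<le> \<theta>" using le by (intro sin_x_le_x)
  finally have lb: "1 / sqrt (2 ^ q) \<le> \<theta>" .
  have pos: "0 < \<theta>" using lb by (rule less_le_trans[rotated]) simp
  obtain i0 where "pi / 4 / \<theta> < 3 ^ i0" using real_arch_pow[of 3 "pi / 4 / \<theta>"] by auto
  then have ex: "pi / 4 \<le> 3 ^ i0 * \<theta>" using pos by (simp add: field_simps)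
  define i where "i = (LEAST i. pi / 4 \<le> 3 ^ i * \<theta>)"
  have i: "pi / 4 \<le> 3 ^ i * \<theta>" unfolding i_def by (rule LeastI[of "\<lambda>i. pi / 4 \<le> 3 ^ i * \<theta>", OF ex])
  show thesis
  proof (cases i)
    case 0
    have "1 / 2 \<le> (sin \<theta>)\<^sup>2" using i le 0 by (intro sin_sq_ge_half) auto
    then show thesis by (intro that[of 0]) simp_all
  next
    case (Suc k)
    have k: "3 ^ k * \<theta> < pi / 4"
      using not_less_Least[of k "\<lambda>i. pi / 4 \<le> 3 ^ i * \<theta>"] Suc by (auto simp: i_def)
    \<comment> \<open>The preceding power of 3 leaves the angle below pi / 4 < 1, which bounds this
      power by sqrt (2 ^ q). Squaring gives a condition on natural numbers that a program can
      test.\<close>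
    have "3 ^ k * (1 / sqrt (2 ^ q)) \<le> 3 ^ k * \<theta>" using lb by (intro mult_left_mono) auto
    also have "\<dots> < 1" using k pi_less_4 by linarith
    finally have "3 ^ k < sqrt (2 ^ q)" by (simp add: field_simps)
    then have "(3 ^ k)\<^sup>2 < (sqrt (2 ^ q))\<^sup>2" by (intro power_strict_mono) auto
    then have "(9 :: real) ^ k < 2 ^ q" by (simp add: power2_eq_square flip: power_mult_distrib)
    then have "real (9 ^ k) < real (2 ^ q)" by simp
    then have "(9 :: nat) ^ k < 2 ^ q" by (simp only: of_nat_less_iff)
    have "3 ^ i * \<theta> = 3 * (3 ^ k * \<theta>)" by (simp add: Suc)
    then have "1 / 2 \<le> (sin (3 ^ i * \<theta>))\<^sup>2" using i k by (intro sin_sq_ge_half) linarith+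
    then show thesis using \<open>(9 :: nat) ^ k < 2 ^ q\<close> Suc by (intro that[of i]) auto
  qed
qed

end

section \<open>Quantum routines\<close>

text \<open>
  Quantum register 0 holds the index that is searched for, registers 1 and 2 hold \<open>i\<close> and \<open>j\<close>,
  and all the others are zero.
\<close>

definition conf :: "nat \<Rightarrow> nat \<Rightarrow> basis \<Rightarrow> bool" where
  "conf i j b \<longleftrightarrow> b 1 = i \<and> b 2 = j \<and> (\<forall>r\<ge>3. b r = 0)"

definition basis_of :: "nat \<Rightarrow> nat \<Rightarrow> nat \<Rightarrow> basis" where
  "basis_of i j a = (\<lambda>_. 0)(0 := a, 1 := i, 2 := j)"

definition qstate :: "nat \<Rightarrow> nat \<Rightarrow> (nat \<Rightarrow> complex) \<Rightarrow> basis \<Rightarrow> complex" where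
  "qstate i j \<phi> b = (if conf i j b then \<phi> (b 0) else 0)"

lemma conf_iff: "conf i j b \<longleftrightarrow> b = basis_of i j (b 0)"
proof
  assume "conf i j b"
  then have "b r = basis_of i j (b 0) r" for r
    by (cases "r \<ge> 3") (auto simp: conf_def basis_of_def not_le numeral_eq_Suc less_Suc_eq)
  then show "b = basis_of i j (b 0)" by (rule ext)
next
  assume "b = basis_of i j (b 0)"
  then have "conf i j b \<longleftrightarrow> conf i j (basis_of i j (b 0))" by (rule arg_cong)
  then show "conf i j b" by (simp add: conf_def basis_of_def)
qed

lemma basis_of_simps [simp]: "basis_of i j a 0 = a" "conf i j (basis_of i j a)"
  "qstate i j \<phi> (basis_of i j a) = \<phi> a"
  by (auto simp: basis_of_def conf_def qstate_def)

lemma init_qstate: "(\<lambda>b. if b = (\<lambda>_. 0) then 1 else 0) = qstate 0 0 (spike 0 1)"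
proof
  fix b :: basis
  have "conf 0 0 b \<and> b 0 = 0 \<longleftrightarrow> b = (\<lambda>_. 0)"
  proof
    assume *: "conf 0 0 b \<and> b 0 = 0"
    then have "b = basis_of 0 0 0" unfolding conf_iff by metis
    also have "\<dots> = (\<lambda>_. 0)" by (auto simp: basis_of_def)
    finally show "b = (\<lambda>_. 0)" .
  qed (simp add: conf_def)
  then show "(if b = (\<lambda>_. 0) then 1 else 0) = qstate 0 0 (spike 0 1) b"
    by (auto simp: qstate_def)
qed

lemma hadamard_qstate: "hadamard (0, p) (qstate i j \<phi>) = qstate i j (had p \<phi>)"
proof
  fix b :: basis
  have "conf i j (b(0 := a)) = conf i j b" for a by (simp add: conf_def)
  then show "hadamard (0, p) (qstate i j \<phi>) b = qstate i j (had p \<phi>) b"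
    by (simp add: hadamard_def had_def qstate_def qbit_def)
qed

subsection \<open>Marking the witnesses\<close>

text \<open>Registers 3 and 4 receive the two matrix entries, and bit 0 of register 5 their
  conjunction. As a map of basis states this is the forward direction of the circuit.\<close>

definition mark :: "orac \<Rightarrow> orac \<Rightarrow> basis \<Rightarrow> basis" where
  "mark A B b = (let b = b(3 := Bit_Operations.xor (b 3) (A (b 1) (b 0)));
       b = b(4 := Bit_Operations.xor (b 4) (B (b 0) (b 2)))
     in if qbit b (3, 0) \<and> qbit b (4, 0) then qflip (5, 0) b else b)"

definition unmark :: "orac \<Rightarrow> orac \<Rightarrow> basis \<Rightarrow> basis" where
  "unmark A B b = (let b = (if qbit b (3, 0) \<and> qbit b (4, 0) then qflip (5, 0) b else b);
       b = b(4 := Bit_Operations.xor (b 4) (B (b 0) (b 2)))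
     in b(3 := Bit_Operations.xor (b 3) (A (b 1) (b 0))))"

definition sol :: "orac \<Rightarrow> orac \<Rightarrow> nat \<Rightarrow> nat \<Rightarrow> nat set" where
  "sol A B i j = {a. bit (A i a) 0 \<and> bit (B a j) 0}"

lemma xor_cancel: "Bit_Operations.xor (Bit_Operations.xor x y) y = (x :: nat)"
  by (simp add: xor.assoc)

lemma flip_flip: "flip_bit p (flip_bit p x) = (x :: nat)"
  by (auto intro!: bit_eqI simp: bit_simps)

lemma mark_unmark: "mark A B (unmark A B b) = b" and unmark_mark: "unmark A B (mark A B b) = b"
  by (auto simp: mark_def unmark_def Let_def qbit_def qflip_def xor_cancel flip_flip fun_eq_iff)

text \<open>A permutation of the basis states acts on amplitudes through its inverse: running the
  marking circuit composes the amplitudes with \<open>unmark\<close>, and running it backwards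
  composes them with \<open>mark\<close>.\<close>

lemma amp_marked:
  "toffoli (3, 0) (4, 0) (5, 0) (query B 0 2 4 (query A 1 0 3 \<psi>)) = (\<lambda>b. \<psi> (unmark A B b))"
  by (rule ext) (simp add: toffoli_def query_def unmark_def Let_def)

lemma amp_unmarked:
  "query A 1 0 3 (query B 0 2 4 (toffoli (3, 0) (4, 0) (5, 0) \<psi>)) = (\<lambda>b. \<psi> (mark A B b))"
  by (rule ext) (simp add: toffoli_def query_def mark_def Let_def)

lemma qbit_mark: "conf i j b \<Longrightarrow> qbit (mark A B b) (5, 0) \<longleftrightarrow> b 0 \<in> sol A B i j"
  by (auto simp: mark_def Let_def qbit_def qflip_def conf_def sol_def bit_simps)

definition zphase :: "nat \<times> nat \<Rightarrow> (basis \<Rightarrow> complex) \<Rightarrow> basis \<Rightarrow> complex" where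
  "zphase q \<psi> b = (if qbit b q then - \<psi> b else \<psi> b)"

text \<open>Four rotations of the phase by pi / 4 make the sign change of the Z gate.\<close>

lemma phaseT_4: "phaseT q (phaseT q (phaseT q (phaseT q \<psi>))) = zphase q \<psi>"
proof -
  have "cis (pi / 4) * (cis (pi / 4) * (cis (pi / 4) * (cis (pi / 4) * x))) = - x" for x
    by (simp add: cis_mult mult.assoc[symmetric])
  then show ?thesis
    by (auto simp: phaseT_def zphase_def fun_eq_iff)
qed

text \<open>Compute the flag, change its phase, uncompute: the work registers return to zero and
  only a sign on the solutions remains.\<close>

lemma oracle_qstate:
  "(\<lambda>b. zphase (5, 0) (\<lambda>b. qstate i j \<phi> (unmark A B b)) (mark A B b))
    = qstate i j (\<lambda>a. if a \<in> sol A B i j then - \<phi> a else \<phi> a)"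
  by (auto simp: zphase_def unmark_mark qstate_def qbit_mark fun_eq_iff)

text \<open>Unmarking maps the marked configurations bijectively to index values, so the probability
  can be counted on the index alone.\<close>

lemma outcome_prob_marked:
  "outcome_prob (5, 0) v (\<lambda>b. qstate i j \<phi> (unmark A B b))
    = (\<Sum>a | \<phi> a \<noteq> 0 \<and> (a \<in> sol A B i j) = v. (cmod (\<phi> a))\<^sup>2)"
  unfolding outcome_prob_def
proof (rule sum.reindex_bij_witness[where j = "\<lambda>b. unmark A B b 0" and i = "\<lambda>a. mark A B (basis_of i j a)"])
  fix b assume "b \<in> {b. qstate i j \<phi> (unmark A B b) \<noteq> 0 \<and> qbit b (5, 0) = v}"
  then have b: "conf i j (unmark A B b)" "\<phi> (unmark A B b 0) \<noteq> 0" "qbit b (5, 0) = v"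
    by (auto simp: qstate_def split: if_splits)
  show "mark A B (basis_of i j (unmark A B b 0)) = b"
    using b(1) unfolding conf_iff by (metis mark_unmark)
  show "unmark A B b 0 \<in> {a. \<phi> a \<noteq> 0 \<and> (a \<in> sol A B i j) = v}"
    using b qbit_mark[OF b(1), of A B] by (simp add: mark_unmark)
  show "(cmod (\<phi> (unmark A B b 0)))\<^sup>2 = (cmod (qstate i j \<phi> (unmark A B b)))\<^sup>2"
    using b(1) by (simp add: qstate_def)
next
  fix a assume "a \<in> {a. \<phi> a \<noteq> 0 \<and> (a \<in> sol A B i j) = v}"
  then show "mark A B (basis_of i j a) \<in> {b. qstate i j \<phi> (unmark A B b) \<noteq> 0 \<and> qbit b (5, 0) = v}"
    by (simp add: unmark_mark qbit_mark[of i j])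
  show "unmark A B (mark A B (basis_of i j a)) 0 = a"
    by (simp add: unmark_mark)
qed

lemma collapse_marked:
  "(\<lambda>b. collapse (5, 0) v (\<lambda>b. qstate i j \<phi> (unmark A B b)) (mark A B b)) =
    qstate i j (\<lambda>a. if (a \<in> sol A B i j) = v then \<phi> a / complex_of_real
      (sqrt (\<Sum>a | \<phi> a \<noteq> 0 \<and> (a \<in> sol A B i j) = v. (cmod (\<phi> a))\<^sup>2)) else 0)"
  by (rule ext, unfold collapse_def outcome_prob_marked) (auto simp: unmark_mark qstate_def qbit_mark)

subsection \<open>Access to the classical memory\<close>

text \<open>If the memory holds a 1 at the base point and zeros in the rest of the interval, it is
  itself the indicator of the base point. Querying it into the zero register 5 on both sides of a Z
  gate yields the reflection.\<close>

lemma reflect_qstate: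
  "query_mem m 0 5 (zphase (5, 0) (query_mem m 0 5 (qstate i j \<phi>)))
    = qstate i j (\<lambda>a. if bit (m a) 0 then - \<phi> a else \<phi> a)"
proof
  fix b :: basis
  have "conf i j b \<Longrightarrow> b 5 = 0" by (simp add: conf_def)
  then show "query_mem m 0 5 (zphase (5, 0) (query_mem m 0 5 (qstate i j \<phi>))) b
    = qstate i j (\<lambda>a. if bit (m a) 0 then - \<phi> a else \<phi> a) b"
    by (auto simp: query_mem_def zphase_def xor_cancel qbit_def qstate_def) (metis fun_upd_triv)
qed

text \<open>A classical word enters a quantum register by way of cell 0: register 6 is always zero
  and serves as the address. A second query with the same word takes it out again.\<close>

lemma load_qstate:
  "query_mem m 6 0 (qstate i j \<phi>) = qstate i j (\<lambda>a. \<phi> (Bit_Operations.xor a (m 0)))"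
  "query_mem m 6 1 (qstate i j \<phi>) = qstate (Bit_Operations.xor i (m 0)) j \<phi>"
  "query_mem m 6 2 (qstate i j \<phi>) = qstate i (Bit_Operations.xor j (m 0)) \<phi>"
proof -
  have b: "conf i j b \<Longrightarrow> b 6 = 0" for b i j by (simp add: conf_def)
  have x: "Bit_Operations.xor x y = z \<longleftrightarrow> x = Bit_Operations.xor z y" for x y z :: nat
    by (metis xor_cancel)
  show "query_mem m 6 0 (qstate i j \<phi>) = qstate i j (\<lambda>a. \<phi> (Bit_Operations.xor a (m 0)))"
    using b by (auto simp: query_mem_def qstate_def conf_def fun_eq_iff)
  show "query_mem m 6 1 (qstate i j \<phi>) = qstate (Bit_Operations.xor i (m 0)) j \<phi>"
    by (auto simp: query_mem_def qstate_def conf_def fun_eq_iff x)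
  show "query_mem m 6 2 (qstate i j \<phi>) = qstate i (Bit_Operations.xor j (m 0)) \<phi>"
    by (auto simp: query_mem_def qstate_def conf_def fun_eq_iff x)
qed

lemma xor_eq_0_iff: "Bit_Operations.xor x y = 0 \<longleftrightarrow> x = (y :: nat)"
  by (metis xor.left_neutral xor_cancel xor_self_eq)

subsection \<open>Measuring the index\<close>

lemma outcome_prob_qstate:
  "outcome_prob (0, p) v (qstate i j \<phi>) = (\<Sum>a | \<phi> a \<noteq> 0 \<and> bit a p = v. (cmod (\<phi> a))\<^sup>2)"
  unfolding outcome_prob_def
  by (rule sum.reindex_bij_witness[where j = "\<lambda>b. b 0" and i = "basis_of i j"])
     (auto simp: qbit_def qstate_def conf_iff split: if_splits)

lemma collapse_qstate:
  "collapse (0, p) v (qstate i j \<phi>) = qstate i j (\<lambda>a. if bit a p = v then \<phi> a / complex_of_real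
      (sqrt (\<Sum>a | \<phi> a \<noteq> 0 \<and> bit a p = v. (cmod (\<phi> a))\<^sup>2)) else 0)"
  by (rule ext) (auto simp: collapse_def outcome_prob_qstate qstate_def qbit_def)

definition weight :: "(nat \<Rightarrow> complex) \<Rightarrow> real" where
  "weight \<phi> = (\<Sum>a | \<phi> a \<noteq> 0. (cmod (\<phi> a))\<^sup>2)"

lemma finite_support: "supported x q \<phi> \<Longrightarrow> finite {a. \<phi> a \<noteq> 0}"
  by (rule finite_subset[of _ "{x..<x + 2 ^ q}"]) (auto simp: supported_def)

lemma weight_split:
  assumes "supported x q \<phi>"
  shows "weight \<phi> = (\<Sum>a | \<phi> a \<noteq> 0 \<and> P a. (cmod (\<phi> a))\<^sup>2) + (\<Sum>a | \<phi> a \<noteq> 0 \<and> \<not> P a. (cmod (\<phi> a))\<^sup>2)"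
proof -
  have "{a. \<phi> a \<noteq> 0} = {a. \<phi> a \<noteq> 0 \<and> P a} \<union> {a. \<phi> a \<noteq> 0 \<and> \<not> P a}" by auto
  then show ?thesis
    unfolding weight_def using finite_support[OF assms]
    by (metis (mono_tags, lifting) finite_Un sum.union_disjoint disjoint_iff mem_Collect_eq)
qed

text \<open>\<open>P\<close> holds of the support after a measurement with outcome \<open>v\<close>.\<close>

lemma weight_collapse:
  assumes "weight \<phi> = 1" "supported x q \<phi>"
    and "p = (\<Sum>a | \<phi> a \<noteq> 0 \<and> P a. (cmod (\<phi> a))\<^sup>2)"
    and "v \<in> set_pmf (bernoulli_pmf p)"
  shows "weight (\<lambda>a. if P a = v then \<phi> a / complex_of_real
      (sqrt (\<Sum>a | \<phi> a \<noteq> 0 \<and> P a = v. (cmod (\<phi> a))\<^sup>2)) else 0) = 1"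
proof -
  let ?p = "\<lambda>v. \<Sum>a | \<phi> a \<noteq> 0 \<and> P a = v. (cmod (\<phi> a))\<^sup>2"
  have sum1: "?p True + ?p False = 1"
    using weight_split[OF assms(2), of P] assms(1) by simp
  have nonneg: "0 \<le> ?p u" for u by (intro sum_nonneg) simp
  \<comment> \<open>An outcome of probability 0 is not in the support of the Bernoulli distribution,
    so the normalization divides by a positive number.\<close>
  have pos: "?p v > 0"
  proof (rule ccontr)
    assume "\<not> ?p v > 0"
    then have 0: "?p v = 0" using nonneg[of v] by linarith
    have "p = ?p True" using assms(3) by simp
    then have "pmf (bernoulli_pmf p) v = 0"
      using 0 sum1 by (cases v) simp_all
    then show False using assms(4) by (simp add: set_pmf_iff)
  qed
  then have "weight (\<lambda>a. if P a = v then \<phi> a / complex_of_real (sqrt (?p v)) else 0)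
      = (\<Sum>a | \<phi> a \<noteq> 0 \<and> P a = v. (cmod (\<phi> a / complex_of_real (sqrt (?p v))))\<^sup>2)"
    unfolding weight_def by (intro sum.cong) auto
  also have "\<dots> = (\<Sum>a | \<phi> a \<noteq> 0 \<and> P a = v. (cmod (\<phi> a))\<^sup>2 / ?p v)"
    using pos by (intro sum.cong refl) (simp add: norm_divide power_divide)
  also have "\<dots> = 1" using pos by (simp flip: sum_divide_distrib)
  finally show ?thesis .
qed

text \<open>Once all bits of the index are measured, only a phase is left undetermined.\<close>

lemma supported_singleton:
  assumes "weight \<phi> = 1" "supported x 0 \<phi>"
  shows "\<phi> = spike x (\<phi> x)" "cmod (\<phi> x) = 1"
proof -
  have 0: "a \<noteq> x \<Longrightarrow> \<phi> a = 0" for a using assms(2) by (auto simp: supported_def)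
  then show "\<phi> = spike x (\<phi> x)" by (auto simp: fun_eq_iff)
  have "weight \<phi> = (\<Sum>a\<in>{x}. (cmod (\<phi> a))\<^sup>2)"
    unfolding weight_def using 0 by (intro sum.mono_neutral_left) auto
  then show "cmod (\<phi> x) = 1" using assms(1) by (simp add: power2_eq_1_iff) (metis norm_ge_zero not_one_le_zero neg_0_le_iff_le one_le_numeral le_minus_one_simps(3))
qed

lemma grover_state_weight:
  assumes "cmod c = 1"
  shows "weight (grover_state x q S c j) = 1"
  using weight_split[OF supported_grover_state, of x q S c j "\<lambda>a. a \<in> S"] grover_prob[OF assms, of x q S j]
  by simp

text \<open>Bit \<open>k\<close> tells the halves of the interval apart because \<open>y\<close> is
  a multiple of its length.\<close>

lemma aligned_halves:
  fixes y :: nat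
  assumes "2 ^ Suc k dvd y" "a \<in> {y..<y + 2 ^ Suc k}"
  shows "a \<in> {y + 2 ^ k * of_bool (bit a k)..<y + 2 ^ k * of_bool (bit a k) + 2 ^ k}"
proof (cases "a < y + 2 ^ k")
  case True
  then have "a - y < 2 ^ k" using assms(2) by auto
  then have "\<not> bit a k" using aligned_bits(1)[OF assms(1), of "a - y"] assms(2) by simp
  then show ?thesis using True assms(2) by simp
next
  case False
  then obtain d where d: "a = y + 2 ^ k + d" "d < 2 ^ k"
    using assms(2) by (auto simp: not_less le_iff_add)
  have "set_bit k (y + d) = a" using aligned_bits(3)[OF assms(1) d(2)] d(1) by simp
  then have "bit a k" by (auto simp: bit_simps)
  then show ?thesis using d by simp
qed

lemma supported_half:
  assumes "2 ^ Suc k dvd y" "supported y (Suc k) \<phi>"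
  shows "supported (y + 2 ^ k * of_bool v) k (\<lambda>a. if bit a k = v then \<phi> a / z else 0)"
  unfolding supported_def
proof (intro allI impI)
  fix a assume "(if bit a k = v then \<phi> a / z else 0) \<noteq> 0"
  then have "bit a k = v" "\<phi> a \<noteq> 0" by (auto split: if_splits)
  then show "a \<in> {y + 2 ^ k * of_bool v..<y + 2 ^ k * of_bool v + 2 ^ k}"
    using aligned_halves[OF assms(1), of a] assms(2) unfolding supported_def by blast
qed

text \<open>Brings record updates into one order, so that states can be compared by
  rewriting.\<close>

lemma mstate_update_order [simp]:
  "s\<lparr>amp := a, reg := r\<rparr> = s\<lparr>reg := r, amp := a\<rparr>"
  "s\<lparr>mem := m, reg := r\<rparr> = s\<lparr>reg := r, mem := m\<rparr>"
  "s\<lparr>amp := a, mem := m\<rparr> = s\<lparr>mem := m, amp := a\<rparr>" for s :: mstate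
  by simp_all

section \<open>Register names and the quantum subroutines\<close>

abbreviation (input) vN :: nat where "vN \<equiv> 4"
abbreviation (input) vI :: nat where "vI \<equiv> 5"
abbreviation (input) vJ :: nat where "vJ \<equiv> 6"
abbreviation (input) vL :: nat where "vL \<equiv> 7"
abbreviation (input) vX :: nat where "vX \<equiv> 8"
abbreviation (input) vQ :: nat where "vQ \<equiv> 9"
abbreviation (input) vH :: nat where "vH \<equiv> 10"
abbreviation (input) vY :: nat where "vY \<equiv> 11"
abbreviation (input) vFound :: nat where "vFound \<equiv> 12"
abbreviation (input) vR :: nat where "vR \<equiv> 13"
abbreviation (input) vG :: nat where "vG \<equiv> 14"
abbreviation (input) vCont :: nat where "vCont \<equiv> 15"
abbreviation (input) vIt :: nat where "vIt \<equiv> 16"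
abbreviation (input) vFlag :: nat where "vFlag \<equiv> 17"
abbreviation (input) vPos :: nat where "vPos \<equiv> 18"
abbreviation (input) vM :: nat where "vM \<equiv> 19"
abbreviation (input) vE :: nat where "vE \<equiv> 20"
abbreviation (input) vBit :: nat where "vBit \<equiv> 21"
abbreviation (input) vReps :: nat where "vReps \<equiv> 22"
abbreviation (input) vP :: nat where "vP \<equiv> 23"
text \<open>The last scratch register is zero between statements and thus designates qubit position
  0.\<close>

abbreviation (input) vZ :: nat where "vZ \<equiv> 63"

definition decr :: "nat \<Rightarrow> prog" where
  "decr r = assign r (V r \<ominus> N 1)"

lemma tri_decr:
  assumes "valid w (reg s)" "0 < w" "reg s r = Suc k" "r < 32 \<or> 64 \<le> r"
    and "tri w A B (blk cs) (s\<lparr>reg := (reg s)(r := k)\<rparr>) (T - 6) Q f p"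
  shows "tri w A B (blk (decr r # cs)) s T Q f p"
proof -
  have "Suc k < 2 ^ w" using assms(1,3) validD(1)[of w "reg s" r] by simp
  then have "(Suc k + (2 ^ w - 1)) mod 2 ^ w = k"
    by (subst sub_mod_word) auto
  moreover have "1 mod 2 ^ w = (1 :: nat)"
    using assms(2) by (simp add: one_less_power)
  ultimately have "ev w A B s (V r \<ominus> N 1) = k"
    by (simp only: ev.simps arith.simps assms(3))
  moreover have "cost (V r \<ominus> N 1) + 2 = 6"
    by simp
  ultimately show ?thesis
    unfolding decr_def using assms by (intro tri_assign) (simp_all del: ev.simps cost.simps)
qed

definition load :: "nat \<Rightarrow> ex \<Rightarrow> prog" where
  "load q e = blk [poke (N 0) e, Do (QueryMem 6 q)]"

definition load_all :: "ex \<Rightarrow> prog" where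
  "load_all e = blk [load 0 e, load 1 (V vI), load 2 (V vJ), poke (N 0) (N 0)]"

definition hloop :: prog where
  "hloop = blk [assign vPos (V vQ),
     While vPos (blk [decr vPos, Do (Hadamard (0, vPos))])]"

definition zph :: prog where
  "zph = blk [Do (PhaseT (5, vZ)), Do (PhaseT (5, vZ)), Do (PhaseT (5, vZ)), Do (PhaseT (5, vZ))]"

definition do_mark :: prog where
  "do_mark = blk [Do (QueryA 1 0 3), Do (QueryB 0 2 4), Do (Toffoli (3, vZ) (4, vZ) (5, vZ))]"

definition do_unmark :: prog where
  "do_unmark = blk [Do (Toffoli (3, vZ) (4, vZ) (5, vZ)), Do (QueryB 0 2 4), Do (QueryA 1 0 3)]"

definition iter :: prog where
  "iter = blk [do_mark, zph, do_unmark, hloop, Do (QueryMem 0 5), zph, Do (QueryMem 0 5), hloop]"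

text \<open>The result is not meant as a candidate witness. Measuring makes the index classically
  known, so that one more exclusive or can reset the quantum register for the next search.
  \<open>vM\<close> collects the index and \<open>vE\<close> is the current power of two.\<close>

definition measure_index :: prog where
  "measure_index = blk [assign vM (V vY), assign vE (V vH), assign vPos (V vQ),
     While vPos (blk [decr vPos, assign vE (V vE \<oslash> N 2),
       Do (Measure vBit (0, vPos)), assign vM (V vM \<oplus> V vE \<otimes> V vBit)])]"

text \<open>The second \<open>load_all\<close> undoes the first: \<open>i\<close> and
  \<open>j\<close> cancel, and for the index the measured value \<open>vM\<close> takes the place of
  \<open>vY\<close>.\<close>

definition grover :: prog where
  "grover = blk [load_all (V vY), poke (V vY) (N 1), hloop, assign vIt (V vG),
     While vIt (blk [iter, decr vIt]),
     do_mark, Do (Measure vFlag (5, vZ)), do_unmark, poke (V vY) (N 0),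
     measure_index, load_all (V vM)]"

section \<open>Correctness of the quantum subroutines\<close>

lemma load_correct:
  assumes "valid w (reg s)" "wf_ex e 33" "q \<noteq> 6"
  shows "runs_within w A B (load q e) (cost e + 6) s (return_pmf
    (s\<lparr>mem := (mem s)(0 := ev w A B s e), amp := query_mem ((mem s)(0 := ev w A B s e)) 6 q (amp s)\<rparr>))"
  unfolding load_def
  apply (rule tri_eqD[where f = "\<lambda>_. 0" and e = 0])
  apply (rule tri_poke)
     apply (use assms in simp_all)
  apply (rule tri_Do)
   apply (simp add: unitary_step_def)
  apply (rule tri_Nil)
    apply simp_all
  done

lemma load_all_correct:
  assumes "valid w (reg s)" "wf_ex e 33" "mem s 0 = 0" "amp s = qstate i j \<phi>"
  shows "runs_within w A B (load_all e) (cost e + 30) s (return_pmf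
    (s\<lparr>amp := qstate (Bit_Operations.xor i (reg s vI)) (Bit_Operations.xor j (reg s vJ))
      (\<lambda>a. \<phi> (Bit_Operations.xor a (ev w A B s e)))\<rparr>))"
proof -
  let ?I = "Bit_Operations.xor i (reg s vI)" and ?J = "Bit_Operations.xor j (reg s vJ)"
  let ?\<psi> = "\<lambda>a. \<phi> (Bit_Operations.xor a (ev w A B s e))"
  define s1 where "s1 = s\<lparr>mem := (mem s)(0 := ev w A B s e), amp := qstate i j ?\<psi>\<rparr>"
  define s2 where "s2 = s\<lparr>mem := (mem s)(0 := reg s vI), amp := qstate ?I j ?\<psi>\<rparr>"
  define s3 where "s3 = s\<lparr>mem := (mem s)(0 := reg s vJ), amp := qstate ?I ?J ?\<psi>\<rparr>"
  have "runs_within w A B (load 0 e) (cost e + 6) s (return_pmf s1)"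
    using load_correct[OF assms(1,2), of 0 A B] by (simp add: s1_def assms(4) load_qstate)
  moreover have "runs_within w A B (load 1 (V vI)) 7 s1 (return_pmf s2)"
    using load_correct[of w s1 "V vI" 1 A B] load_qstate(2)[of "(mem s)(0 := reg s vI)"] assms(1)
    by (simp add: s1_def s2_def)
  moreover have "runs_within w A B (load 2 (V vJ)) 7 s2 (return_pmf s3)"
    using load_correct[of w s2 "V vJ" 2 A B] load_qstate(3)[of "(mem s)(0 := reg s vJ)"] assms(1)
    by (simp add: s2_def s3_def)
  moreover have "runs_within w A B (poke (N 0) (N 0)) 5 s3
      (return_pmf (s\<lparr>amp := qstate ?I ?J ?\<psi>\<rparr>))"
  proof -
    have "s3\<lparr>mem := (mem s3)(0 := 0)\<rparr> = s\<lparr>amp := qstate ?I ?J ?\<psi>\<rparr>"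
      using assms(3) by (intro mstate.equality) (auto simp: s3_def)
    then show ?thesis
      using poke_correct[of w s3 "N 0" "N 0" A B] assms(1) by (simp add: s3_def)
  qed
  ultimately show ?thesis
    unfolding load_all_def
    apply (intro tri_eqD[where f = "\<lambda>_. 0" and e = 0])
    apply (elim tri_Cons_det)
    apply (rule tri_Nil, simp_all)
    done
qed

lemma hloop_correct:
  assumes "valid w (reg s)" "reg s vQ \<le> w" "0 < w" "amp s = qstate i j \<phi>"
  shows "runs_within w A B hloop (5 + 9 * reg s vQ) s (return_pmf
    (s\<lparr>reg := (reg s)(vPos := 0), amp := qstate i j (Hs (reg s vQ) \<phi>)\<rparr>))"
proof -
  let ?q = "reg s vQ"
  define J where "J = (\<lambda>k s'. \<exists>\<phi>'. Hs k \<phi>' = Hs ?q \<phi> \<and>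
    s' = s\<lparr>reg := (reg s)(vPos := k), amp := qstate i j \<phi>'\<rparr>)"
  let ?body = "blk [decr vPos, Do (Hadamard (0, vPos))]"
  have loop: "tri w A B (While vPos ?body) s' (1 + (\<Sum>k<?q. 1 + 8)) (J 0) (\<lambda>_. 0) 0" if "J ?q s'" for s'
  proof (rule tri_While[where I = J and g = "\<lambda>_ _. 0" and t = "\<lambda>_. 8"])
    fix k s' assume k: "J (Suc k) s'" "k < ?q"
    then obtain \<phi>' where \<phi>': "Hs (Suc k) \<phi>' = Hs ?q \<phi>"
        "s' = s\<lparr>reg := (reg s)(vPos := Suc k), amp := qstate i j \<phi>'\<rparr>"
      by (auto simp: J_def)
    have "Suc k \<le> w" using k(2) assms(2) by simp
    then have lt: "Suc k < 2 ^ w" "k < w"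
      using le_less_trans[OF _ less_exp] by auto
    show "tri w A B ?body s' 8 (J k) (\<lambda>_. 0) 0"
      unfolding \<phi>'
      apply (rule tri_decr[where k = k])
          apply (use assms lt in simp_all)[4]
      apply (rule tri_Do)
       apply (use lt in \<open>simp add: unitary_step_def resolve_def hadamard_qstate\<close>)
      apply (rule tri_Nil)
        apply (use \<phi>'(1) in \<open>auto simp: J_def\<close>)
      done
  qed (use that in \<open>auto simp: J_def\<close>)
  show ?thesis
    unfolding hloop_def
    apply (rule tri_eqD[where f = "\<lambda>_. 0" and e = 0])
    apply (rule tri_assign)
       apply (use assms in simp, simp, simp)
    apply (rule tri_Cons)
     apply (rule loop)
     apply (use assms in \<open>simp add: J_def, intro exI[of _ \<phi>]\<close>, simp)
    apply (rule tri_Nil)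
      apply (use assms in \<open>auto simp: J_def algebra_simps\<close>)
    done
qed

lemma zph_correct:
  assumes "valid w (reg s)" "0 < w"
  shows "runs_within w A B zph 5 s (return_pmf (s\<lparr>amp := zphase (5, 0) (amp s)\<rparr>))"
proof -
  have "reg s vZ = 0" using assms(1) by (simp add: valid_def)
  then show ?thesis
    unfolding zph_def phaseT_4[symmetric]
    apply (intro tri_eqD[where f = "\<lambda>_. 0" and e = 0])
    apply (rule tri_Do, use assms in \<open>simp add: unitary_step_def resolve_def\<close>)+
    apply (rule tri_Nil, simp_all)
    done
qed

lemma do_mark_correct:
  assumes "valid w (reg s)" "0 < w"
  shows "runs_within w A B do_mark 4 s (return_pmf (s\<lparr>amp := \<lambda>b. amp s (unmark A B b)\<rparr>))"
proof -
  have "reg s vZ = 0" using assms(1) by (simp add: valid_def)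
  then show ?thesis
    unfolding do_mark_def amp_marked[symmetric]
    apply (intro tri_eqD[where f = "\<lambda>_. 0" and e = 0])
    apply (rule tri_Do, use assms in \<open>simp add: unitary_step_def resolve_def\<close>)+
    apply (rule tri_Nil, simp_all)
    done
qed

lemma do_unmark_correct:
  assumes "valid w (reg s)" "0 < w"
  shows "runs_within w A B do_unmark 4 s (return_pmf (s\<lparr>amp := \<lambda>b. amp s (mark A B b)\<rparr>))"
proof -
  have "reg s vZ = 0" using assms(1) by (simp add: valid_def)
  then show ?thesis
    unfolding do_unmark_def amp_unmarked[symmetric]
    apply (intro tri_eqD[where f = "\<lambda>_. 0" and e = 0])
    apply (rule tri_Do, use assms in \<open>simp add: unitary_step_def resolve_def\<close>)+
    apply (rule tri_Nil, simp_all)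
    done
qed

lemma iter_correct:
  assumes "valid w (reg s)" "0 < w" "reg s vQ = q" "q \<le> w" "2 ^ q dvd y"
    and "mem s y = 1" "\<And>a. y < a \<Longrightarrow> a < y + 2 ^ q \<Longrightarrow> mem s a = 0"
    and amp: "amp s = qstate i j (grover_state y q (sol A B i j) c k)"
  shows "runs_within w A B iter (31 + 18 * q) s (return_pmf
    (s\<lparr>reg := (reg s)(vPos := 0), amp := qstate i j (grover_state y q (sol A B i j) c (Suc k))\<rparr>))"
proof -
  let ?S = "sol A B i j"
  define \<phi> where "\<phi> = (\<lambda>a. if a \<in> ?S then - grover_state y q ?S c k a else grover_state y q ?S c k a)"
  define \<psi> where "\<psi> = (\<lambda>a. if bit (mem s a) 0 then - Hs q \<phi> a else Hs q \<phi> a)"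
  have "supported y q \<phi>"
    using supported_grover_state[of y q ?S c k] by (auto simp: supported_def \<phi>_def)
  then have "supported y q (Hs q \<phi>)"
    using assms(5) by (intro supported_Hs) auto
  \<comment> \<open>The memory is known to be zero only at the other points of the interval; outside
    the interval the amplitude vanishes.\<close>
  then have "a \<noteq> y \<Longrightarrow> Hs q \<phi> a \<noteq> 0 \<Longrightarrow> mem s a = 0" for a
    using assms(7)[of a] by (auto simp: supported_def)
  then have "\<psi> a = (if a = y then - Hs q \<phi> a else Hs q \<phi> a)" for a
    unfolding \<psi>_def using assms(6) by (cases "a = y"; cases "Hs q \<phi> a = 0") (simp_all add: bit_0)
  then have "\<psi> = (\<lambda>a. if a = y then - Hs q \<phi> a else Hs q \<phi> a)"
    by (rule ext)
  then have \<psi>: "Hs q \<psi> = grover_state y q ?S c (Suc k)"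
    using grover_iteration[OF assms(5) \<phi>_def] by simp
  have marked: "(\<lambda>b. zphase (5, 0) (\<lambda>b. amp s (unmark A B b)) (mark A B b)) = qstate i j \<phi>"
    unfolding amp oracle_qstate \<phi>_def ..
  have reflect: "query_mem (mem s) 0 5 (zphase (5, 0) (query_mem (mem s) 0 5 (qstate i j (Hs q \<phi>)))) = qstate i j \<psi>"
    unfolding reflect_qstate \<psi>_def ..
  show ?thesis
    unfolding iter_def
    apply (rule tri_eqD[where f = "\<lambda>_. 0" and e = 0])
    apply (rule tri_Cons_det[OF do_mark_correct[OF assms(1,2)]])
    apply (rule tri_Cons_det[OF zph_correct], use assms in simp, use assms in simp)
    apply (rule tri_Cons_det[OF do_unmark_correct], use assms in simp, use assms in simp)
    apply (rule tri_Cons_det[OF hloop_correct[where \<phi> = \<phi> and i = i and j = j]], use assms in simp, use assms in simp, use assms in simp, use marked in simp)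
    apply (rule tri_Do, simp add: unitary_step_def)
    apply (rule tri_Cons_det[OF zph_correct], use assms in simp, use assms in simp)
    apply (rule tri_Do, simp add: unitary_step_def)
    apply (rule tri_Cons_det[OF hloop_correct[where \<phi> = \<psi> and i = i and j = j]], use assms in simp, use assms in simp, use assms in simp, use reflect assms(3) in simp)
    apply (rule tri_Nil)
      apply (use assms \<psi> in simp_all)
    done
qed

text \<open>The error bound before a measurement is the mean of the bounds after its two outcomes.
  The proof recovers the outcome from the register \<open>r\<close>.\<close>

lemma tri_Measure:
  assumes "snd (resolve s q) < w" "p = outcome_prob (resolve s q) True (amp s)" "0 \<le> p" "p \<le> 1"
    and "\<And>v. v \<in> set_pmf (bernoulli_pmf p) \<Longrightarrow> tri w A B (blk cs)
        (s\<lparr>reg := (reg s)(r := of_bool v), amp := collapse (resolve s q) v (amp s)\<rparr>) (T - 1) Q f (h v)"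
    and "\<And>v. 0 \<le> h v" "p * h True + (1 - p) * h False \<le> e"
  shows "tri w A B (blk (Do (Measure r q) # cs)) s T Q f e"
proof -
  let ?st = "\<lambda>v. s\<lparr>reg := (reg s)(r := of_bool v), amp := collapse (resolve s q) v (amp s)\<rparr>"
  let ?D = "map_pmf ?st (bernoulli_pmf p)"
  let ?g = "\<lambda>s'. h (reg s' r = 1)"
  have "1 < (2 :: nat) ^ w"
    using assms(1) by (intro one_less_power) auto
  then have "of_bool v < (2 :: nat) ^ w" for v
    by (cases v) auto
  then have "step w A B (Measure r q) s = ?D"
    using assms(1,2) by (auto simp: put_def intro!: map_pmf_cong)
  then have "runs_within w A B (Do (Measure r q)) 1 s ?D"
    by (metis order_refl runs_within_Do)
  moreover have "(\<integral>\<^sup>+s'. ennreal (?g s') \<partial>measure_pmf ?D) \<le> ennreal e"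
  proof -
    have "(\<integral>\<^sup>+s'. ennreal (?g s') \<partial>measure_pmf ?D) = ennreal (p * h True + (1 - p) * h False)"
      using assms(3,4,6) by (simp add: ennreal_mult'' ennreal_plus mult.commute)
    also have "\<dots> \<le> ennreal e" using assms(7) by (intro ennreal_leI)
    finally show ?thesis .
  qed
  ultimately have "tri w A B (Do (Measure r q)) s 1 (\<lambda>s'. \<exists>v\<in>set_pmf (bernoulli_pmf p). s' = ?st v) ?g e"
    unfolding tri_def by (intro exI[of _ ?D]) auto
  then show ?thesis
  proof (rule tri_Cons)
    fix s' assume "\<exists>v\<in>set_pmf (bernoulli_pmf p). s' = ?st v"
    then obtain v where v: "v \<in> set_pmf (bernoulli_pmf p)" "s' = ?st v" by blast
    have "?g (?st v) = h v" by simp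
    then show "tri w A B (blk cs) s' (T - 1) Q f (?g s')"
      using assms(5)[OF v(1)] by (simp only: v(2))
  qed
qed


lemma measure_index_correct:
  assumes "valid w (reg s)" "5 \<le> w" "reg s vQ = q" "reg s vH = 2 ^ q" "q < w" "2 ^ q dvd reg s vY"
    and "reg s vY + 2 ^ q \<le> 2 ^ w" "amp s = qstate i j \<phi>" "weight \<phi> = 1" "supported (reg s vY) q \<phi>" "0 \<le> e"
  shows "tri w A B measure_index s (12 + 24 * q)
    (\<lambda>s'. \<exists>R c. s' = s\<lparr>reg := R, amp := qstate i j (spike (R vM) c)\<rparr> \<and> valid w R \<and> cmod c = 1
      \<and> (\<forall>r. r \<notin> {vM, vE, vPos, vBit} \<longrightarrow> R r = reg s r)) (\<lambda>_. e) e"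
proof -
  define J where "J = (\<lambda>k s'. \<exists>R \<phi>'. s' = s\<lparr>reg := R, amp := qstate i j \<phi>'\<rparr> \<and> valid w R \<and> R vPos = k
    \<and> R vE = 2 ^ k \<and> weight \<phi>' = 1 \<and> supported (R vM) k \<phi>' \<and> 2 ^ k dvd R vM \<and> R vM + 2 ^ k \<le> 2 ^ w
    \<and> (\<forall>r. r \<notin> {vM, vE, vPos, vBit} \<longrightarrow> R r = reg s r))"
  let ?body = "blk [decr vPos, assign vE (V vE \<oslash> N 2),
       Do (Measure vBit (0, vPos)), assign vM (V vM \<oplus> V vE \<otimes> V vBit)]"
  have loop: "tri w A B (While vPos ?body) s' (1 + (\<Sum>k<q. 1 + 23)) (J 0) (\<lambda>_. e) e" if "J q s'" for s'
  proof (rule tri_While[where I = J and g = "\<lambda>_ _. e" and t = "\<lambda>_. 23"])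
    fix k s' assume k: "J (Suc k) s'" "k < q"
    then obtain R \<phi>' where R: "s' = s\<lparr>reg := R, amp := qstate i j \<phi>'\<rparr>" "valid w R" "R vPos = Suc k"
      "R vE = 2 ^ Suc k" "weight \<phi>' = 1" "supported (R vM) (Suc k) \<phi>'" "2 ^ Suc k dvd R vM"
      "R vM + 2 ^ Suc k \<le> 2 ^ w" "\<And>r. r \<notin> {vM, vE, vPos, vBit} \<Longrightarrow> R r = reg s r"
      by (auto simp: J_def)
    define p where "p = (\<Sum>a | \<phi>' a \<noteq> 0 \<and> bit a k. (cmod (\<phi>' a))\<^sup>2)"
    have p: "0 \<le> p" "p \<le> 1"
      using weight_split[OF R(6), of "\<lambda>a. bit a k"] R(5)
        sum_nonneg[of "{a. \<phi>' a \<noteq> 0 \<and> \<not> bit a k}" "\<lambda>a. (cmod (\<phi>' a))\<^sup>2"]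
      by (auto simp: p_def intro: sum_nonneg)
    have k2: "(2 :: nat) ^ k < 2 ^ w" using k(2) assms(5) by (intro power_strict_increasing) auto
    have "k < w" using k(2) assms(5) by simp
    then have kw: "k < 2 ^ w" using less_trans[OF _ less_exp] by blast
    have big: "(32 :: nat) \<le> 2 ^ w" using power_increasing[of 5 w "2 :: nat"] assms(2) by simp
    then have two: "2 mod 2 ^ w = (2 :: nat)" by (intro mod_less) linarith
    have E: "ev w A B (s\<lparr>reg := R(vPos := k), amp := qstate i j \<phi>'\<rparr>) (V vE \<oslash> N 2) = 2 ^ k"
      using k2 by (simp add: R(4) two)
    show "tri w A B ?body s' 23 (J k) (\<lambda>_. e) e"
      unfolding R(1)
      apply (rule tri_decr[where k = k])
          apply (use R assms(2) in simp_all)[4]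
      apply (rule tri_assign)
         apply (use R k2 kw in \<open>simp_all del: ev.simps\<close>)[3]
      apply (simp del: ev.simps add: E)
      apply (rule tri_Measure[where p = p and h = "\<lambda>_. e"])
            apply (use k(2) assms(5) in \<open>simp add: resolve_def\<close>)
           apply (simp add: resolve_def outcome_prob_qstate p_def)
          apply (rule p(1))
         apply (rule p(2))
        defer
        apply (rule assms(11))
       apply (simp add: algebra_simps)
      subgoal for v
      proof -
        assume v: "v \<in> set_pmf (bernoulli_pmf p)"
        define R' where "R' = R(vPos := k, vE := 2 ^ k, vBit := of_bool v)"
        have "1 < (2 :: nat) ^ w" using big by linarith
        then have one: "of_bool v < (2 :: nat) ^ w" by (cases v) simp_all
        define \<psi> where "\<psi> = (\<lambda>a. if bit a k = v then \<phi>' a / complex_of_real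
          (sqrt (\<Sum>a | \<phi>' a \<noteq> 0 \<and> bit a k = v. (cmod (\<phi>' a))\<^sup>2)) else 0)"
        define M where "M = R vM + 2 ^ k * of_bool v"
        have R': "valid w R'"
          unfolding R'_def by (intro valid_upd R(2) kw k2 one) simp_all
        have "2 ^ k * of_bool v \<le> (2 :: nat) ^ k" by (cases v) simp_all
        moreover have "0 < (2 :: nat) ^ k" by simp
        ultimately have M: "R vM + 2 ^ k * of_bool v < 2 ^ w" "2 ^ k * of_bool v < (2 :: nat) ^ w"
            "R vM + 2 ^ k * of_bool v + 2 ^ k \<le> 2 ^ w"
          using R(8) k2 unfolding power_Suc by linarith+
        have e: "ev w A B (s\<lparr>reg := R', amp := qstate i j \<psi>\<rparr>) (V vM \<oplus> V vE \<otimes> V vBit) = M"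
          unfolding ev.simps arith.simps using M by (simp add: R'_def M_def)
        have J: "J k (s\<lparr>reg := R'(vM := M), amp := qstate i j \<psi>\<rparr>)"
          unfolding J_def
        proof (intro exI conjI)
          show "valid w (R'(vM := M))"
            using R' M by (intro valid_upd) (auto simp: M_def)
          show "weight \<psi> = 1"
            unfolding \<psi>_def using v by (intro weight_collapse[OF R(5,6)]) (auto simp: p_def)
          show "supported ((R'(vM := M)) vM) k \<psi>"
            using supported_half[OF R(7,6), of v] by (simp add: \<psi>_def M_def)
          have "2 ^ k dvd R vM" using R(7) by (metis dvd_mult_right power_Suc)
          then show "2 ^ k dvd (R'(vM := M)) vM" by (simp add: M_def)
          show "(R'(vM := M)) vM + 2 ^ k \<le> 2 ^ w"
            using M(3) by (simp add: M_def)
        qed (use R(9) in \<open>auto simp: R'_def\<close>)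
        have "tri w A B (blk [assign vM (V vM \<oplus> V vE \<otimes> V vBit)]) (s\<lparr>reg := R', amp := qstate i j \<psi>\<rparr>) 10 (J k) (\<lambda>_. e) e"
          apply (rule tri_assign)
             apply (use R' in simp, simp, simp)
          apply (rule tri_Nil)
            apply simp
           apply (use J e in \<open>simp del: ev.simps\<close>)
          apply simp
          done
        then show ?thesis
          by (simp add: R'_def resolve_def collapse_qstate \<psi>_def)
      qed
      done
  qed (use that in \<open>auto simp: J_def\<close>)
  have "J q (s\<lparr>reg := (reg s)(vM := reg s vY, vE := 2 ^ q, vPos := q)\<rparr>)"
    unfolding J_def
    apply (intro exI[of _ "(reg s)(vM := reg s vY, vE := 2 ^ q, vPos := q)"] exI[of _ \<phi>])
    using assms validD(1)[OF assms(1), of vQ] validD(1)[OF assms(1), of vY] validD(1)[OF assms(1), of vH]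
    by (auto intro!: valid_upd)
  note * = loop[OF this]
  have fin: "\<exists>R c. s' = s\<lparr>reg := R, amp := qstate i j (spike (R vM) c)\<rparr> \<and> valid w R \<and> cmod c = 1
      \<and> (\<forall>r. r \<notin> {vM, vE, vPos, vBit} \<longrightarrow> R r = reg s r)" if J0: "J 0 s'" for s'
  proof -
    obtain R \<phi>' where R: "s' = s\<lparr>reg := R, amp := qstate i j \<phi>'\<rparr>" "valid w R" "weight \<phi>' = 1"
      "supported (R vM) 0 \<phi>'" "\<forall>r. r \<notin> {vM, vE, vPos, vBit} \<longrightarrow> R r = reg s r"
      using J0 unfolding J_def by blast
    show ?thesis
      by (intro exI[of _ R] exI[of _ "\<phi>' (R vM)"] conjI R(2,5) supported_singleton(2)[OF R(3,4)])
        (simp only: R(1) supported_singleton(1)[OF R(3,4), symmetric])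
  qed
  show ?thesis
    unfolding measure_index_def
    apply (rule tri_assign)
       apply (use assms(1) in simp, simp, simp)
    apply (rule tri_assign)
       apply (use assms(1) validD(1)[OF assms(1)] in simp, simp, simp)
    apply (rule tri_assign)
       apply (use assms(1) validD(1)[OF assms(1)] in simp, simp, simp)
    apply (simp add: assms(3,4))
    apply (rule tri_Cons[OF *])
    apply (rule tri_Nil)
      apply simp
     apply (drule fin, simp)
    apply simp
    done
qed

lemma xor_cancel_spike: "(\<lambda>a. spike m c (Bit_Operations.xor a m)) = spike 0 c"
proof
  fix a :: nat
  have "Bit_Operations.xor a m = m \<longleftrightarrow> a = 0"
  proof
    assume "Bit_Operations.xor a m = m"
    then have "Bit_Operations.xor (Bit_Operations.xor a m) m = 0" by simp
    then show "a = 0" by (simp only: xor_cancel)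
  qed simp
  then show "spike m c (Bit_Operations.xor a m) = spike 0 c a" by simp
qed

text \<open>Only the modulus is fixed: measurements leave a global phase behind, which the next
  search carries along as the \<open>c\<close> of \<open>grover_state\<close>.\<close>

definition clean :: "mstate \<Rightarrow> bool" where
  "clean s \<longleftrightarrow> (\<exists>c. cmod c = 1 \<and> amp s = qstate 0 0 (spike 0 c))"

definition frame :: "nat \<Rightarrow> nat set \<Rightarrow> mstate \<Rightarrow> mstate \<Rightarrow> bool" where
  "frame w X s s' \<longleftrightarrow> valid w (reg s') \<and> clean s' \<and> mem s' = mem s
     \<and> (\<forall>r. r \<notin> X \<longrightarrow> reg s' r = reg s r)"

text \<open>By \<open>grover_prob\<close> the flag is missed with the probability given by the
  Grover rotation. It is never raised wrongly, since marked amplitude can only come from a solution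
  in the interval.\<close>

lemma grover_correct:
  assumes valid: "valid w (reg s)" and w: "5 \<le> w" "q < w" and q: "reg s vQ = q" "reg s vH = 2 ^ q"
    and y: "reg s vY = y" "2 ^ q dvd y" "y + 2 ^ q \<le> 2 ^ w"
    and clean: "clean s" and mem: "\<And>a. a < y + 2 ^ q \<Longrightarrow> mem s a = 0"
    and g: "reg s vG = g" and S: "S = sol A B (reg s vI) (reg s vJ)"
  shows "tri w A B grover s (150 + 60 * q + (40 + 20 * q) * g)
    (\<lambda>s'. frame w {vPos, vIt, vFlag, vM, vE, vBit} s s'
      \<and> (reg s' vFlag = 0 \<or> reg s' vFlag = 1 \<and> {y..<y + 2 ^ q} \<inter> S \<noteq> {}))
    (\<lambda>s'. of_bool (reg s' vFlag = 0)) (1 - (sin ((2 * real g + 1) * angle y q S))\<^sup>2)"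
proof -
  obtain c where c: "cmod c = 1" "amp s = qstate 0 0 (spike 0 c)"
    using clean by (auto simp: clean_def)
  let ?I = "reg s vI" and ?J = "reg s vJ"
  define gs where "gs = grover_state y q S c"
  define m1 where "m1 = (mem s)(y := 1)"
  define s1 where "s1 = s\<lparr>amp := qstate ?I ?J (spike y c)\<rparr>"
  define s2 where "s2 = s\<lparr>mem := m1, amp := qstate ?I ?J (spike y c)\<rparr>"
  define s3 where "s3 = s\<lparr>reg := (reg s)(vPos := 0), mem := m1, amp := qstate ?I ?J (gs 0)\<rparr>"
  define st where "st = (\<lambda>k. s\<lparr>reg := (reg s)(vPos := 0, vIt := k), mem := m1, amp := qstate ?I ?J (gs (g - k))\<rparr>)"
  have big: "(32 :: nat) \<le> 2 ^ w" using power_increasing[of 5 w "2 :: nat"] w(1) by simp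
  have lt: "1 mod 2 ^ w = (1 :: nat)" using big by (intro mod_less) linarith
  have gw: "g < 2 ^ w" using validD(1)[OF valid, of vG] g by simp
  have mem0: "mem s 0 = 0" "mem s y = 0" by (rule mem, simp)+
  have r1: "runs_within w A B (load_all (V vY)) 31 s (return_pmf s1)"
    using load_all_correct[OF valid, of "V vY" 0 0 "spike 0 c" A B] mem0 c(2)
    by (simp add: xor_eq_0_iff y(1) s1_def)
  have r2: "runs_within w A B (poke (V vY) (N 1)) 5 s1 (return_pmf s2)"
    using poke_correct[of w s1 "V vY" "N 1" A B] valid lt by (simp add: s1_def s2_def m1_def y(1))
  have r3: "runs_within w A B hloop (5 + 9 * q) s2 (return_pmf s3)"
    using hloop_correct[of w s2 ?I ?J "spike y c" A B] valid w q
    by (simp add: s2_def s3_def gs_def grover_state_0 Hs_spike[OF y(2)])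
  have r4: "runs_within w A B (assign vIt (V vG)) 3 s3 (return_pmf (st g))"
    using assign_correct[of w s3 "V vG" vIt A B] valid g by (simp add: s3_def st_def)
  have iter: "runs_within w A B (blk [iter, decr vIt]) (39 + 18 * q) (st (Suc k)) (return_pmf (st k))" if "k < g" for k
  proof -
    have k: "Suc (g - Suc k) = g - k" using that by simp
    have v: "valid w ((reg s)(vPos := 0, vIt := Suc k))"
      using valid that gw by (intro valid_upd) auto
    have "runs_within w A B iter (31 + 18 * q) (st (Suc k)) (return_pmf
        (s\<lparr>reg := (reg s)(vPos := 0, vIt := Suc k), mem := m1, amp := qstate ?I ?J (gs (g - k))\<rparr>))"
      using iter_correct[of w "st (Suc k)" q y ?I ?J A B c "g - Suc k"] v w q y mem
      by (simp add: st_def gs_def S k m1_def fun_upd_twist)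
    then show ?thesis
      apply (intro tri_eqD[where f = "\<lambda>_. 0" and e = 0])
      apply (rule tri_Cons_det, assumption)
      apply (rule tri_decr[where k = k])
          apply (use v w in simp_all)[4]
      apply (rule tri_Nil)
        apply (simp_all add: st_def)
      done
  qed
  have r5: "runs_within w A B (While vIt (blk [iter, decr vIt])) (1 + real g * (1 + real (39 + 18 * q))) (st g) (return_pmf (st 0))"
    using iter by (intro det_While) (auto simp: st_def)
  define s5 where "s5 = s\<lparr>reg := (reg s)(vPos := 0, vIt := 0), mem := m1, amp := \<lambda>b. qstate ?I ?J (gs g) (unmark A B b)\<rparr>"
  have v5: "valid w ((reg s)(vPos := 0, vIt := 0))"
    using valid by (intro valid_upd) auto
  have r6: "runs_within w A B do_mark 4 (st 0) (return_pmf s5)"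
    using do_mark_correct[of w "st 0" A B] v5 w by (simp add: st_def s5_def)
  define p where "p = (sin ((2 * real g + 1) * angle y q S))\<^sup>2"
  have supp: "supported y q (gs g)" unfolding gs_def by (rule supported_grover_state)
  have weight: "weight (gs g) = 1" unfolding gs_def by (rule grover_state_weight[OF c(1)])
  have p: "p = (\<Sum>a | gs g a \<noteq> 0 \<and> a \<in> S. (cmod (gs g a))\<^sup>2)" "0 \<le> p" "p \<le> 1"
    unfolding p_def gs_def grover_prob(1)[OF c(1)] by (auto simp: abs_square_le_1)
  define post where "post = (\<lambda>s'. frame w {vPos, vIt, vFlag, vM, vE, vBit} s s'
      \<and> (reg s' vFlag = 0 \<or> reg s' vFlag = 1 \<and> {y..<y + 2 ^ q} \<inter> S \<noteq> {}))"
  have rest: "tri w A B (blk [do_unmark, poke (V vY) (N 0), measure_index, load_all (V vM)])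
      (s5\<lparr>reg := (reg s5)(vFlag := of_bool v), amp := collapse (5, 0) v (amp s5)\<rparr>)
      (65 + 24 * q) post (\<lambda>s'. of_bool (reg s' vFlag = 0)) (of_bool (\<not> v))"
    if v: "v \<in> set_pmf (bernoulli_pmf p)" for v
  proof -
    define \<phi> where "\<phi> = (\<lambda>a. if (a \<in> S) = v then gs g a / complex_of_real
      (sqrt (\<Sum>a | gs g a \<noteq> 0 \<and> (a \<in> S) = v. (cmod (gs g a))\<^sup>2)) else 0)"
    define R where "R = (reg s)(vPos := 0, vIt := 0, vFlag := of_bool v)"
    have "of_bool v < (2 :: nat) ^ w" using big by (cases v) auto
    then have R: "valid w R" using valid unfolding R_def by (intro valid_upd) auto
    have \<phi>: "weight \<phi> = 1" "supported y q \<phi>"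
      unfolding \<phi>_def using weight_collapse[OF weight supp p(1) v] supp by (auto simp: supported_def)
    \<comment> \<open>The state after the measurement has weight 1 and therefore a point of non-zero
      amplitude; for the outcome \<open>True\<close> this point is a solution in the
      interval.\<close>
    have "\<exists>a. \<phi> a \<noteq> 0"
      using \<phi>(1) by (auto simp: weight_def intro: ccontr)
    then obtain a where a: "\<phi> a \<noteq> 0" by blast
    then have "a \<in> {y..<y + 2 ^ q}" "v \<Longrightarrow> a \<in> S"
      using \<phi>(2) by (auto simp: \<phi>_def supported_def split: if_splits)
    then have found: "v \<Longrightarrow> {y..<y + 2 ^ q} \<inter> S \<noteq> {}" by blast
    define s6 where "s6 = s\<lparr>reg := R, mem := m1, amp := qstate ?I ?J \<phi>\<rparr>"
    define s7 where "s7 = s\<lparr>reg := R, amp := qstate ?I ?J \<phi>\<rparr>"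
    have t1: "runs_within w A B do_unmark 4 (s5\<lparr>reg := (reg s5)(vFlag := of_bool v), amp := collapse (5, 0) v (amp s5)\<rparr>) (return_pmf s6)"
    proof -
      define s' where "s' = s5\<lparr>reg := (reg s5)(vFlag := of_bool v), amp := collapse (5, 0) v (amp s5)\<rparr>"
      have "valid w (reg s')" using R by (simp only: s'_def s5_def R_def mstate.simps mstate.update_convs) simp
      moreover have "(\<lambda>b. amp s' (mark A B b)) = qstate ?I ?J \<phi>"
        using collapse_marked[of v ?I ?J "gs g" A B] unfolding \<phi>_def S by (simp add: s'_def s5_def)
      moreover have "s'\<lparr>amp := qstate ?I ?J \<phi>\<rparr> = s6"
        by (simp add: s'_def s5_def s6_def R_def)
      ultimately show ?thesis
        using do_unmark_correct[of w s' A B] w unfolding s'_def[symmetric] by simp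
    qed
    have "m1(y := 0) = mem s" using mem0 by (auto simp: m1_def)
    then have t2: "runs_within w A B (poke (V vY) (N 0)) 5 s6 (return_pmf s7)"
      using poke_correct[of w s6 "V vY" "N 0" A B] R by (simp add: s6_def s7_def R_def y(1))
    have t3: "tri w A B measure_index s7 (12 + 24 * q)
      (\<lambda>s'. \<exists>R' c. s' = s7\<lparr>reg := R', amp := qstate ?I ?J (spike (R' vM) c)\<rparr> \<and> valid w R' \<and> cmod c = 1
        \<and> (\<forall>r. r \<notin> {vM, vE, vPos, vBit} \<longrightarrow> R' r = reg s7 r)) (\<lambda>_. of_bool (\<not> v)) (of_bool (\<not> v))"
      by (rule measure_index_correct[where \<phi> = \<phi>]) (use R w q y \<phi> in \<open>auto simp: s7_def R_def\<close>)
    show ?thesis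
      apply (rule tri_Cons_det[OF t1])
      apply (rule tri_Cons_det[OF t2])
      apply (rule tri_Cons[OF t3])
      apply (elim exE conjE)
      subgoal for s' R' c'
      proof -
        assume s': "s' = s7\<lparr>reg := R', amp := qstate ?I ?J (spike (R' vM) c')\<rparr>" and R': "valid w R'" and c': "cmod c' = 1"
          and eq: "\<forall>r. r \<notin> {vM, vE, vPos, vBit} \<longrightarrow> R' r = reg s7 r"
        have IJ: "R' vI = ?I" "R' vJ = ?J" "R' vFlag = of_bool v" using eq by (simp_all add: s7_def R_def)
        have t4: "runs_within w A B (load_all (V vM)) 31 s' (return_pmf (s\<lparr>reg := R', amp := qstate 0 0 (spike 0 c')\<rparr>))"
          using load_all_correct[of w s' "V vM" ?I ?J "spike (R' vM) c'" A B] R' mem0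
          by (simp add: s' s7_def IJ xor_cancel_spike)
        have "post (s\<lparr>reg := R', amp := qstate 0 0 (spike 0 c')\<rparr>)"
          unfolding post_def frame_def clean_def
          using R' c' eq IJ found by (cases v) (auto simp: s7_def R_def)
        then show ?thesis
          apply (intro tri_Cons_det[OF t4] tri_Nil)
            apply (simp_all add: IJ)
          done
      qed
      done
  qed
  have "tri w A B grover s (150 + 60 * q + (40 + 20 * q) * g) post (\<lambda>s'. of_bool (reg s' vFlag = 0)) (1 - p)"
    unfolding grover_def
    apply (rule tri_Cons_det[OF r1])
    apply (rule tri_Cons_det[OF r2])
    apply (rule tri_Cons_det[OF r3])
    apply (rule tri_Cons_det[OF r4])
    apply (rule tri_Cons_det[OF r5])
    apply (rule tri_Cons_det[OF r6])
    apply (rule tri_Measure[where p = p and h = "\<lambda>v. of_bool (\<not> v)"])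
          apply (use v5 w in \<open>simp add: resolve_def s5_def valid_def\<close>)
         apply (use v5 in \<open>simp add: resolve_def s5_def valid_def outcome_prob_marked p(1) S\<close>)
        apply (rule p)
       apply (rule p)
      subgoal premises v for v
      proof -
        have z: "resolve s5 (5, vZ) = (5, 0)" using v5 by (simp add: resolve_def s5_def valid_def)
        show ?thesis
          unfolding z by (rule tri_conseq[OF rest[OF v]]) (auto simp: algebra_simps)
      qed
     apply simp
    apply simp
    done
  then show ?thesis unfolding p_def post_def .
qed

section \<open>Finding the maximum witness in an aligned interval\<close>

text \<open>For steps that have no influence on the error: a bound that holds for every outcome
  replaces the expectation.\<close>

lemma tri_bound:
  assumes "tri w A B c s T Q f e" "\<And>s'. Q s' \<Longrightarrow> g s' \<le> b"
  shows "tri w A B c s T Q g b"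
proof -
  obtain D where D: "runs_within w A B c T s D" "\<forall>s'\<in>set_pmf D. Q s'"
    using assms(1) by (auto simp: tri_def)
  have "(\<integral>\<^sup>+s'. ennreal (g s') \<partial>measure_pmf D) \<le> (\<integral>\<^sup>+s'. ennreal b \<partial>measure_pmf D)"
    using D(2) assms(2) by (intro nn_integral_mono_AE) (auto simp: AE_measure_pmf_iff intro!: ennreal_leI)
  also have "\<dots> = ennreal b" by simp
  finally show ?thesis unfolding tri_def using D by blast
qed

text \<open>Linearity of the expectation. The factor \<open>b\<close> brings in the failure of later
  repetitions, the summand \<open>a\<close> the error of other levels of the descent.\<close>

lemma tri_affine:
  assumes "tri w A B c s T Q f e" "0 \<le> a" "0 \<le> b" "0 \<le> e" "\<And>s'. 0 \<le> f s'"
  shows "tri w A B c s T Q (\<lambda>s'. a + b * f s') (a + b * e)"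
proof -
  obtain D where D: "runs_within w A B c T s D" "\<forall>s'\<in>set_pmf D. Q s'"
      "(\<integral>\<^sup>+s'. ennreal (f s') \<partial>measure_pmf D) \<le> ennreal e"
    using assms(1) by (auto simp: tri_def)
  have "(\<integral>\<^sup>+s'. ennreal (a + b * f s') \<partial>measure_pmf D)
      = ennreal a + ennreal b * (\<integral>\<^sup>+s'. ennreal (f s') \<partial>measure_pmf D)"
    using assms(2,3,5) by (simp add: ennreal_plus ennreal_mult nn_integral_add nn_integral_cmult)
  also have "\<dots> \<le> ennreal a + ennreal b * ennreal e"
    using D(3) by (intro add_left_mono mult_left_mono) auto
  also have "\<dots> = ennreal (a + b * e)"
    using assms by (simp add: ennreal_plus ennreal_mult)
  finally show ?thesis unfolding tri_def using D by blast
qed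

lemma frame_trans: "frame w X s s' \<Longrightarrow> frame w Y s' s'' \<Longrightarrow> X \<union> Y \<subseteq> Z \<Longrightarrow> frame w Z s s''"
  unfolding frame_def by (metis UnI1 UnI2 subsetD)

lemma frame_upd:
  "frame w X s s' \<Longrightarrow> v < 2 ^ w \<Longrightarrow> r < 32 \<or> 64 \<le> r \<Longrightarrow> r \<in> X \<Longrightarrow>
    frame w X s (s'\<lparr>reg := (reg s')(r := v)\<rparr>)"
  by (auto simp: frame_def clean_def)

text \<open>Passing from \<open>g\<close> iterations to \<open>3 * g + 1\<close> makes 2 g + 1 run
  through the powers of 3 that \<open>good_round\<close> asks for. The loop continues while the
  square of 2 g + 1 is at most \<open>9 * 2 ^ q\<close>; the 1 added on the right turns
  \<open>Less\<close> into \<le>.\<close>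

definition pass :: prog where
  "pass = blk [assign vG (N 0), assign vCont (N 1),
     While vCont (blk [grover, assign vFound (N 0 \<prec> V vFound \<oplus> V vFlag),
       assign vG (N 3 \<otimes> V vG \<oplus> N 1),
       assign vCont ((N 2 \<otimes> V vG \<oplus> N 1) \<otimes> (N 2 \<otimes> V vG \<oplus> N 1) \<prec> N 9 \<otimes> V vH \<oplus> N 1)])]"

definition test :: prog where
  "test = blk [assign vFound (N 0), assign vR (V vReps), While vR (blk [pass, decr vR])]"

definition find_max :: prog where
  "find_max = blk [assign vQ (V vP),
     While vQ (blk [decr vQ, assign vH (V vH \<oslash> N 2), assign vY (V vX \<oplus> V vH), test,
       assign vX (V vX \<oplus> V vFound \<otimes> V vH)]),
     assign vX (V vX \<otimes> (EntA (V vI) (V vX) \<otimes> EntB (V vX) (V vJ)))]"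

fun rounds :: "nat \<Rightarrow> nat" where
  "rounds 0 = 0"
| "rounds (Suc i) = 3 * rounds i + 1"

lemma rounds: "2 * rounds i + 1 = 3 ^ i"
  by (induction i) auto

abbreviation pass_regs :: "nat set" where
  "pass_regs \<equiv> {vPos, vIt, vFlag, vM, vE, vBit, vG, vCont, vFound}"

lemma numeral_mod_word: "100 \<le> (2 :: nat) ^ w \<Longrightarrow>
    1 mod 2 ^ w = (1 :: nat) \<and> 2 mod 2 ^ w = (2 :: nat) \<and> 3 mod 2 ^ w = (3 :: nat) \<and> 9 mod 2 ^ w = (9 :: nat)"
  by (intro conjI mod_less) linarith+

lemma pass_correct:
  assumes valid: "valid w (reg s)" and room: "100 * 2 ^ q \<le> (2 :: nat) ^ w" and w: "5 \<le> w" "q < w"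
    and q: "reg s vQ = q" "reg s vH = 2 ^ q"
    and y: "reg s vY = y" "2 ^ q dvd y" "y + 2 ^ q \<le> 2 ^ w"
    and clean: "clean s" and mem: "\<And>a. a < y + 2 ^ q \<Longrightarrow> mem s a = 0"
    and sol: "found \<longleftrightarrow> {y..<y + 2 ^ q} \<inter> sol A B (reg s vI) (reg s vJ) \<noteq> {}"
    and f: "reg s vFound = 0 \<or> reg s vFound = 1 \<and> found"
  shows "tri w A B pass s (1200 * (1 + real q) * sqrt (2 ^ q))
    (\<lambda>s'. frame w pass_regs s s' \<and> (reg s' vFound = 0 \<or> reg s' vFound = 1 \<and> found))
    (\<lambda>s'. of_bool (reg s' vFound = 0))
    (if reg s vFound = 1 then 0 else if found then 1 / 2 else 1)"
proof -
  let ?S = "sol A B (reg s vI) (reg s vJ)"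
  define \<theta> where "\<theta> = angle y q ?S"
  define L where "L = (LEAST i. \<not> 9 ^ i \<le> (9 :: nat) * 2 ^ q)"
  have one: "(1 :: nat) \<le> 2 ^ q" by simp
  have big: "100 \<le> (2 :: nat) ^ w" using room one by linarith
  note num = numeral_mod_word[OF big]
  have "\<exists>i. \<not> 9 ^ i \<le> (9 :: nat) * 2 ^ q"
  proof
    show "\<not> 9 ^ (9 * 2 ^ q) \<le> (9 :: nat) * 2 ^ q"
      using less_exp[of "9 * 2 ^ q"] power_mono[of 2 "9 :: nat" "9 * 2 ^ q"] by linarith
  qed
  then have L: "\<not> 9 ^ L \<le> (9 :: nat) * 2 ^ q" unfolding L_def by (rule LeastI_ex)
  have below: "9 ^ i \<le> (9 :: nat) * 2 ^ q" if "i < L" for i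
    using that not_less_Least unfolding L_def by blast
  have above: "\<not> 9 ^ i \<le> (9 :: nat) * 2 ^ q" if "L \<le> i" for i
    using L power_increasing[OF that, of "9 :: nat"] by linarith
  have iff: "9 ^ i \<le> (9 :: nat) * 2 ^ q \<longleftrightarrow> i < L" for i
    using below above by (meson not_le)
  have L0: "0 < L" using iff[of 0] by simp
  obtain i0 where i0: "found \<Longrightarrow> i0 < L \<and> 1 / 2 \<le> (sin (3 ^ i0 * \<theta>))\<^sup>2"
    using good_round[of y q ?S] sol iff unfolding \<theta>_def by (metis (full_types))
  \<comment> \<open>As long as the good round \<open>i0\<close> is still to come, failure has
    probability at most 1 / 2; after it no bound better than 1 is claimed. A success already
    recorded makes the error 0.\<close>
  define g where "g = (\<lambda>k (s' :: mstate). if reg s' vFound = 1 then 0 else if found \<and> L - k \<le> i0 then 1 / 2 else (1 :: real))"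
  define J where "J = (\<lambda>k s'. frame w pass_regs s s' \<and> (reg s' vFound = 0 \<or> reg s' vFound = 1 \<and> found)
     \<and> reg s' vG = rounds (L - k) \<and> reg s' vCont = of_bool (k \<noteq> 0))"
  define t where "t = (\<lambda>k. real (150 + 60 * q + (40 + 20 * q) * rounds (L - Suc k)) + 50)"
  let ?body = "blk [grover, assign vFound (N 0 \<prec> V vFound \<oplus> V vFlag),
       assign vG (N 3 \<otimes> V vG \<oplus> N 1),
       assign vCont ((N 2 \<otimes> V vG \<oplus> N 1) \<otimes> (N 2 \<otimes> V vG \<oplus> N 1) \<prec> N 9 \<otimes> V vH \<oplus> N 1)]"
  have loop: "tri w A B (While vCont ?body) s' (1 + (\<Sum>k<L. 1 + t k)) (J 0) (g 0) (g L s')" if "J L s'" for s'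
  proof (rule tri_While[where I = J and g = g and t = t])
    fix k s' assume k: "J (Suc k) s'" "k < L"
    \<comment> \<open>With \<open>Suc k\<close> rounds left, \<open>i\<close> is the number of the
      current round, counted from 0.\<close>
    define i where "i = L - Suc k"
    have i: "i < L" "L - k = Suc i" using k(2) by (auto simp: i_def)
    have fr: "frame w pass_regs s s'" and fnd: "reg s' vFound = 0 \<or> reg s' vFound = 1 \<and> found" and G: "reg s' vG = rounds i"
      using k(1) by (auto simp: J_def i_def)
    have same: "reg s' vQ = q" "reg s' vH = 2 ^ q" "reg s' vY = y" "reg s' vI = reg s vI" "reg s' vJ = reg s vJ" "mem s' = mem s"
      "valid w (reg s')" "clean s'"
      using fr q y(1) by (auto simp: frame_def)
    have ang: "(2 * real (rounds i) + 1) = 3 ^ i"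
      using arg_cong[OF rounds[of i], of real] by simp
    define R where "R = (\<lambda>s''. frame w {vPos, vIt, vFlag, vM, vE, vBit} s' s''
      \<and> (reg s'' vFlag = 0 \<or> reg s'' vFlag = 1 \<and> found))"
    have grover: "tri w A B grover s' (real (150 + 60 * q + (40 + 20 * q) * rounds i)) R
       (\<lambda>s''. of_bool (reg s'' vFlag = 0)) (1 - (sin (3 ^ i * \<theta>))\<^sup>2)"
      using grover_correct[OF same(7) w same(1,2,3) y(2,3) same(8) _ G, of ?S A B] mem
      by (simp add: same ang sol \<theta>_def R_def)
    define h where "h = (\<lambda>s'' :: mstate. if reg s'' vFound = 1 \<or> reg s'' vFlag = 1 then 0 else if found \<and> Suc i \<le> i0 then 1 / 2 else (1 :: real))"
    \<comment> \<open>The random outcome matters only in the good round with nothing found so far.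
      In all other cases the bound holds for each outcome separately.\<close>
    have h: "tri w A B grover s' (real (150 + 60 * q + (40 + 20 * q) * rounds i)) R h (g (Suc k) s')"
    proof (cases "reg s' vFound = 1 \<or> \<not> found \<or> i \<noteq> i0")
      case True
      show ?thesis
        by (rule tri_bound[OF grover]) (use True i in \<open>auto simp: h_def g_def R_def frame_def i_def[symmetric]\<close>)
    next
      case False
      show ?thesis
        by (rule tri_conseq[OF grover order_refl]) (use False i0 in \<open>auto simp: h_def g_def i_def[symmetric] R_def frame_def\<close>)
    qed
    have "9 ^ i \<le> (9 :: nat) * 2 ^ q" using below[OF i(1)] .
    moreover have sq: "(3 ^ n * 3 ^ n :: nat) = 9 ^ n" for n by (simp flip: power_mult_distrib)
    \<comment> \<open>The tested square is at most 81 * 2 ^ q; this is what the factor 100 in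
      \<open>room\<close> is for.\<close>
    ultimately have lt9: "9 ^ Suc i < (2 :: nat) ^ w" using room one unfolding power_Suc by linarith
    have r: "2 * rounds (Suc i) + 1 = 3 ^ Suc i" by (rule rounds)
    have "3 ^ Suc i \<le> (3 ^ Suc i * 3 ^ Suc i :: nat)" by simp
    then have lt3: "3 ^ Suc i < (2 :: nat) ^ w" using lt9 unfolding sq by linarith
    have lts: "rounds (Suc i) < 2 ^ w" "2 * rounds (Suc i) < 2 ^ w" "3 * rounds i < 2 ^ w" "9 * 2 ^ q < (2 :: nat) ^ w" "9 * 2 ^ q + 1 < (2 :: nat) ^ w"
      using lt3 r room one by simp_all
    show "tri w A B ?body s' (t k) (J k) (g k) (g (Suc k) s')"
      apply (rule tri_Cons[OF h])
      subgoal premises R0 for s''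
      proof -
        have fr'': "frame w {vPos, vIt, vFlag, vM, vE, vBit} s' s''" and flag: "reg s'' vFlag = 0 \<or> reg s'' vFlag = 1 \<and> found"
          using R0 by (auto simp: R_def)
        have v: "valid w (reg s'')" using fr'' by (simp add: frame_def)
        have regs: "reg s'' vFound = reg s' vFound" "reg s'' vG = rounds i" "reg s'' vH = 2 ^ q"
          using fr'' G same by (auto simp: frame_def)
        define b where "b = (if 0 < reg s'' vFound + reg s'' vFlag then 1 else (0 :: nat))"
        define ct where "ct = (if Suc i < L then 1 else (0 :: nat))"
        have e1: "ev w A B s'' (N 0 \<prec> V vFound \<oplus> V vFlag) = b"
        proof -
          have "reg s'' vFound + reg s'' vFlag \<le> 2" using fnd flag regs by auto
          then have "(reg s'' vFound + reg s'' vFlag) mod 2 ^ w = reg s'' vFound + reg s'' vFlag"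
            using big by (intro mod_less) linarith
          then have "ev w A B s'' (N 0 \<prec> V vFound \<oplus> V vFlag) = of_bool (0 < reg s'' vFound + reg s'' vFlag) mod 2 ^ w"
            by (simp only: ev.simps arith.simps mod_0)
          then show ?thesis using num by (simp add: b_def)
        qed
        have bc: "b < 2 ^ w" "ct < 2 ^ w" using big by (auto simp: b_def ct_def)
        define s1 where "s1 = s''\<lparr>reg := (reg s'')(vFound := b)\<rparr>"
        have e2: "ev w A B s1 (N 3 \<otimes> V vG \<oplus> N 1) = rounds (Suc i)"
          using lts num by (simp add: s1_def regs)
        define s2 where "s2 = s1\<lparr>reg := (reg s1)(vG := rounds (Suc i))\<rparr>"
        have odd: "ev w A B s2 (N 2 \<otimes> V vG \<oplus> N 1) = 3 ^ Suc i"
        proof -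
          have "ev w A B s2 (N 2 \<otimes> V vG \<oplus> N 1) = ((2 * rounds (Suc i)) mod 2 ^ w + 1) mod 2 ^ w"
            using num by (simp add: s2_def del: rounds.simps)
          then show ?thesis using lts lt3 r by (metis mod_less)
        qed
        have nine: "ev w A B s2 (N 9 \<otimes> V vH \<oplus> N 1) = 9 * 2 ^ q + 1"
          using num lts by (simp add: s2_def s1_def regs)
        have "ev w A B s2 ((N 2 \<otimes> V vG \<oplus> N 1) \<otimes> (N 2 \<otimes> V vG \<oplus> N 1)) = 9 ^ Suc i"
          by (subst ev.simps, subst arith.simps, subst odd, subst odd, subst sq, rule mod_less, rule lt9)
        then have "ev w A B s2 ((N 2 \<otimes> V vG \<oplus> N 1) \<otimes> (N 2 \<otimes> V vG \<oplus> N 1) \<prec> N 9 \<otimes> V vH \<oplus> N 1)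
            = of_bool (9 ^ Suc i < 9 * 2 ^ q + (1 :: nat)) mod 2 ^ w"
          by (subst ev.simps, subst arith.simps, subst nine) simp
        also have "9 ^ Suc i < 9 * 2 ^ q + (1 :: nat) \<longleftrightarrow> Suc i < L"
          using iff[of "Suc i"] by (simp only: Suc_eq_plus1[symmetric] less_Suc_eq_le)
        also have "of_bool (Suc i < L) mod 2 ^ w = ct"
          using num by (simp add: ct_def)
        finally have e3: "ev w A B s2 ((N 2 \<otimes> V vG \<oplus> N 1) \<otimes> (N 2 \<otimes> V vG \<oplus> N 1) \<prec> N 9 \<otimes> V vH \<oplus> N 1) = ct" .
        define s3 where "s3 = s2\<lparr>reg := (reg s2)(vCont := ct)\<rparr>"
        have "frame w pass_regs s s''" by (rule frame_trans[OF fr fr'']) auto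
        then have fr3: "frame w pass_regs s s3"
          unfolding s3_def s2_def s1_def using bc lts(1) by (intro frame_upd) simp_all
        have J3: "J k s3"
          unfolding J_def using fr3 i fnd flag
          by (auto simp: s3_def s2_def s1_def ct_def b_def regs)
        have g3: "g k s3 \<le> h s''"
          using fnd flag by (auto simp: g_def h_def s3_def s2_def s1_def b_def i regs)
        have v1: "valid w (reg s1)" "valid w (reg s2)"
          using v bc lts(1) by (auto simp: s1_def s2_def intro!: valid_upd)
        show ?thesis
          apply (rule tri_assign[OF v], simp, simp)
          apply (simp only: e1 s1_def[symmetric])
          apply (rule tri_assign[OF v1(1)], simp, simp)
          apply (simp only: e2 s2_def[symmetric])
          apply (rule tri_assign[OF v1(2)], simp, simp)
          apply (simp only: e3 s3_def[symmetric])
          apply (rule tri_Nil)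
            apply (simp add: t_def i_def)
           apply (rule J3)
          apply (rule g3)
          done
      qed
      done
  qed (use that in \<open>auto simp: J_def\<close>)
  define s0 where "s0 = s\<lparr>reg := (reg s)(vG := 0, vCont := 1)\<rparr>"
  have "frame w pass_regs s s" using valid clean by (simp add: frame_def)
  then have "frame w pass_regs s s0"
    using big frame_upd[OF frame_upd[of w pass_regs s s 0 vG], of 1 vCont] by (simp add: s0_def)
  then have J0: "J L s0"
    using L0 f by (simp add: J_def s0_def)
  \<comment> \<open>A round is charged in proportion to its power of 3, so the rounds form a
    geometric series governed by the last one.\<close>
  have "(\<Sum>k<L. 1 + t k) \<le> (\<Sum>k<L. (221 + 70 * real q) * 3 ^ (L - Suc k))"
  proof (rule sum_mono)
    fix k
    have "real (2 * rounds (L - Suc k) + 1) = 3 ^ (L - Suc k)" unfolding rounds by simp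
    then have r: "2 * real (rounds (L - Suc k)) = 3 ^ (L - Suc k) - 1" by simp
    have "(1 :: real) \<le> 3 ^ (L - Suc k)" by simp
    then have "(201 + 60 * real q) * 1 \<le> (201 + 60 * real q) * 3 ^ (L - Suc k)"
      by (intro mult_left_mono) auto
    moreover have "(40 + 20 * real q) * real (rounds (L - Suc k)) = (20 + 10 * real q) * (3 ^ (L - Suc k) - 1)"
      unfolding r[symmetric] by (simp add: algebra_simps)
    ultimately show "1 + t k \<le> (221 + 70 * real q) * 3 ^ (L - Suc k)"
      unfolding t_def by (simp add: algebra_simps)
  qed
  also have "\<dots> = (221 + 70 * real q) * (\<Sum>k<L. 3 ^ (L - Suc k))"
    by (simp add: sum_distrib_left)
  also have "(\<Sum>k<L. 3 ^ (L - Suc k)) = (\<Sum>k<L. (3 :: real) ^ k)"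
    by (rule sum.nat_diff_reindex)
  also have "\<dots> = (3 ^ L - 1) / 2"
    by (simp add: geometric_sum)
  \<comment> \<open>Round \<open>L - 1\<close> still passed the test, hence 3 ^ (L - 1) \<le> 3 *
    sqrt (2 ^ q).\<close>
  also have "3 ^ L \<le> 9 * sqrt (2 ^ q)"
  proof -
    have "9 ^ (L - 1) \<le> (9 :: nat) * 2 ^ q" using L0 by (intro below) simp
    then have "real (9 ^ (L - 1)) \<le> real (9 * 2 ^ q)" by (simp only: of_nat_le_iff)
    moreover have "(9 :: real) ^ (L - 1) = (3 ^ (L - 1))\<^sup>2" by (simp add: power2_eq_square flip: power_mult_distrib)
    ultimately have "(3 ^ (L - 1) :: real)\<^sup>2 \<le> 9 * 2 ^ q" by simp
    then have "3 ^ (L - 1) \<le> sqrt (9 * 2 ^ q)" by (rule real_le_rsqrt)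
    also have "\<dots> = 3 * sqrt (2 ^ q)" by (simp add: real_sqrt_mult)
    finally have "3 * 3 ^ (L - 1) \<le> 9 * sqrt (2 ^ q)" by simp
    then show ?thesis using L0 by (simp flip: power_Suc)
  qed
  finally have time: "(\<Sum>k<L. 1 + t k) \<le> (221 + 70 * real q) * ((9 * sqrt (2 ^ q) - 1) / 2)"
    by (simp add: mult_left_mono divide_right_mono)
  have sq1: "1 \<le> sqrt (2 ^ q)" by simp
  have "(221 + 70 * real q) * ((9 * sqrt (2 ^ q) - 1) / 2) \<le> 1100 * (1 + real q) * sqrt (2 ^ q)"
    using sq1 mult_nonneg_nonneg[of "real q" "sqrt (2 ^ q)"] by (simp add: field_simps)
  moreover have "1 * 1 \<le> (1 + real q) * sqrt (2 ^ q)" using sq1 by (intro mult_mono) auto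
  ultimately have T: "10 + (\<Sum>k<L. 1 + t k) \<le> 1200 * (1 + real q) * sqrt (2 ^ q)"
    using time by linarith
  have g0: "g L s0 = (if reg s vFound = 1 then 0 else if found then 1 / 2 else 1)"
    by (simp add: g_def s0_def)
  have fin: "g 0 s' = of_bool (reg s' vFound = 0)" if "J 0 s'" for s'
    using that i0 by (auto simp: g_def J_def)
  show ?thesis
    unfolding pass_def g0[symmetric]
    apply (rule tri_assign[OF valid], simp, simp)
    apply (rule tri_assign, use valid in simp, simp, simp)
    apply (rule tri_Cons)
     apply (use loop[OF J0] num in \<open>simp add: s0_def\<close>)
    apply (rule tri_Nil)
      apply (use T in simp)
     apply (simp add: J_def)
    apply (simp add: fin)
    done
qed

abbreviation test_regs :: "nat set" where
  "test_regs \<equiv> insert vR pass_regs"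

text \<open>A pass never reports a witness that is not there. So one success among the passes
  settles the test, and the failure probabilities of the passes multiply.\<close>

lemma test_correct:
  assumes valid: "valid w (reg s)" and room: "100 * 2 ^ q \<le> (2 :: nat) ^ w" and w: "5 \<le> w" "q < w"
    and q: "reg s vQ = q" "reg s vH = 2 ^ q"
    and y: "reg s vY = y" "2 ^ q dvd y" "y + 2 ^ q \<le> 2 ^ w"
    and clean: "clean s" and mem: "\<And>a. a < y + 2 ^ q \<Longrightarrow> mem s a = 0"
    and sol: "found \<longleftrightarrow> {y..<y + 2 ^ q} \<inter> sol A B (reg s vI) (reg s vJ) \<noteq> {}"
  shows "tri w A B test s (10 + 1210 * real (reg s vReps) * (1 + real q) * sqrt (2 ^ q))
    (\<lambda>s'. frame w test_regs s s' \<and> (reg s' vFound = 0 \<or> reg s' vFound = 1 \<and> found))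
    (\<lambda>s'. of_bool (reg s' vFound = 0))
    (if found then (1 / 2) ^ reg s vReps else 1)"
proof -
  let ?R = "reg s vReps" and ?C = "1200 * (1 + real q) * sqrt (2 ^ q)"
  define g where "g = (\<lambda>k (s' :: mstate). if reg s' vFound = 1 then 0 else if found then (1 / 2) ^ k else (1 :: real))"
  define J where "J = (\<lambda>k s'. frame w test_regs s s' \<and> (reg s' vFound = 0 \<or> reg s' vFound = 1 \<and> found)
     \<and> reg s' vR = k)"
  have loop: "tri w A B (While vR (blk [pass, decr vR])) s' (1 + (\<Sum>k<?R. 1 + (?C + 7))) (J 0) (g 0) (g ?R s')"
    if "J ?R s'" for s'
  proof (rule tri_While[where I = J and g = g and t = "\<lambda>_. ?C + 7"])
    fix k s' assume k: "J (Suc k) s'"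
    then have fr: "frame w test_regs s s'" and fnd: "reg s' vFound = 0 \<or> reg s' vFound = 1 \<and> found" and r: "reg s' vR = Suc k"
      by (auto simp: J_def)
    have same: "reg s' vQ = q" "reg s' vH = 2 ^ q" "reg s' vY = y" "reg s' vI = reg s vI" "reg s' vJ = reg s vJ" "mem s' = mem s"
      "valid w (reg s')" "clean s'"
      using fr q y(1) by (auto simp: frame_def)
    have "tri w A B pass s' ?C
      (\<lambda>s''. frame w pass_regs s' s'' \<and> (reg s'' vFound = 0 \<or> reg s'' vFound = 1 \<and> found))
      (\<lambda>s''. of_bool (reg s'' vFound = 0)) (if reg s' vFound = 1 then 0 else if found then 1 / 2 else 1)"
      using mem by (intro pass_correct[OF same(7) room w same(1,2,3) y(2,3) same(8) _ _ fnd]) (simp_all add: same sol)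
    then have "tri w A B pass s' ?C
      (\<lambda>s''. frame w pass_regs s' s'' \<and> (reg s'' vFound = 0 \<or> reg s'' vFound = 1 \<and> found))
      (\<lambda>s''. 0 + (if found then (1 / 2) ^ k else 1) * of_bool (reg s'' vFound = 0))
      (0 + (if found then (1 / 2) ^ k else 1) * (if reg s' vFound = 1 then 0 else if found then 1 / 2 else 1))"
      by (rule tri_affine) auto
    moreover have "0 + (if found then (1 / 2) ^ k else 1) * (if reg s' vFound = 1 then 0 else if found then 1 / 2 else 1) = g (Suc k) s'"
      by (auto simp: g_def)
    ultimately have *: "tri w A B pass s' ?C
      (\<lambda>s''. frame w pass_regs s' s'' \<and> (reg s'' vFound = 0 \<or> reg s'' vFound = 1 \<and> found))
      (\<lambda>s''. 0 + (if found then (1 / 2) ^ k else 1) * of_bool (reg s'' vFound = 0)) (g (Suc k) s')"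
      by simp
    show "tri w A B (blk [pass, decr vR]) s' (?C + 7) (J k) (g k) (g (Suc k) s')"
      apply (rule tri_Cons[OF *])
      subgoal premises p for s''
      proof -
        have fr'': "frame w pass_regs s' s''" and fnd'': "reg s'' vFound = 0 \<or> reg s'' vFound = 1 \<and> found"
          using p by auto
        have v: "valid w (reg s'')" "reg s'' vR = Suc k" using fr'' r by (auto simp: frame_def)
        have "Suc k < 2 ^ w" using validD(1)[OF v(1), of vR] v(2) by simp
        moreover have "frame w test_regs s s''" by (rule frame_trans[OF fr fr'']) auto
        ultimately have "frame w test_regs s (s''\<lparr>reg := (reg s'')(vR := k)\<rparr>)" by (intro frame_upd) auto
        then show ?thesis
          apply (intro tri_decr[OF v(1) _ v(2)])
            apply (use w in simp)
           apply simp
          apply (rule tri_Nil)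
            apply simp
           apply (use fnd'' in \<open>auto simp: J_def\<close>)[1]
          apply (use fnd'' in \<open>auto simp: g_def\<close>)
          done
      qed
      done
  qed (use that in \<open>auto simp: J_def\<close>)
  define s0 where "s0 = s\<lparr>reg := (reg s)(vFound := 0, vR := ?R)\<rparr>"
  have "frame w test_regs s s" using valid clean by (simp add: frame_def)
  then have "frame w test_regs s s0"
    using frame_upd[OF frame_upd[of w test_regs s s 0 vFound], of ?R vR] validD(1)[OF valid] by (simp add: s0_def)
  then have J0: "J ?R s0" by (simp add: J_def s0_def)
  have g0: "g ?R s0 = (if found then (1 / 2) ^ ?R else 1)"
    by (simp add: g_def s0_def)
  have "1 * 1 \<le> (1 + real q) * sqrt (2 ^ q)" by (intro mult_mono) auto
  then have "real ?R * (1 + (?C + 7)) \<le> real ?R * (1210 * ((1 + real q) * sqrt (2 ^ q)))"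
    by (intro mult_left_mono) linarith+
  then have T: "8 + (\<Sum>k<?R. 1 + (?C + 7)) \<le> 10 + 1210 * real ?R * (1 + real q) * sqrt (2 ^ q)"
    by (simp add: algebra_simps)
  show ?thesis
    unfolding test_def g0[symmetric]
    apply (rule tri_assign[OF valid], simp, simp)
    apply (rule tri_assign, use valid in simp, simp, simp)
    apply (rule tri_Cons)
     apply (use loop[OF J0] in \<open>simp add: s0_def\<close>)
    apply (rule tri_Nil)
      apply (use T in simp)
     apply (simp add: J_def)
    apply (auto simp: J_def g_def)
    done
qed

abbreviation find_regs :: "nat set" where
  "find_regs \<equiv> {vQ, vH, vY, vX} \<union> test_regs"

lemma find_max_correct:
  assumes valid: "valid w (reg s)" and room: "100 * 2 ^ p \<le> (2 :: nat) ^ w" and w: "5 \<le> w" "p < w"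
    and p: "reg s vP = p" "reg s vH = 2 ^ p"
    and x: "reg s vX = x" "2 ^ p dvd x" "x + 2 ^ p \<le> 2 ^ w"
    and clean: "clean s" and mem: "\<And>a. a < x + 2 ^ p \<Longrightarrow> mem s a = 0"
    and bool: "\<And>a b. A a b \<le> 1" "\<And>a b. B a b \<le> 1"
    and W: "W = {x..<x + 2 ^ p} \<inter> sol A B (reg s vI) (reg s vJ)"
  shows "tri w A B find_max s (1300 * (1 + real (reg s vReps)) * (1 + real p) ^ 2 * sqrt (2 ^ p))
    (\<lambda>s'. frame w find_regs s s')
    (\<lambda>s'. of_bool (reg s' vX \<noteq> (if W = {} then 0 else Max W)))
    (real p * (1 / 2) ^ reg s vReps)"
proof -
  let ?R = "reg s vReps" and ?S = "sol A B (reg s vI) (reg s vJ)"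
  define \<delta> :: real where "\<delta> = (1 / 2) ^ ?R"
  have \<delta>: "0 \<le> \<delta>" by (simp add: \<delta>_def)
  have big: "100 \<le> (2 :: nat) ^ w" 
  proof -
    have "(1 :: nat) \<le> 2 ^ p" by simp
    then show ?thesis using room by linarith
  qed
  note num = numeral_mod_word[OF big]
  \<comment> \<open>The descent is on track while the maximum witness lies in the current interval.
    Without witnesses no turn is wrong.\<close>
  define good where "good = (\<lambda>k x'. W = {} \<or> Max W \<in> {x'..<x' + 2 ^ k})"
  \<comment> \<open>A union bound: each of the \<open>k\<close> tests still to come fails with
    probability at most \<delta>. The cap at 1 makes a descent that has gone astray, with value 1,
    the worst case.\<close>
  define g where "g = (\<lambda>k (s' :: mstate). if good k (reg s' vX) then min 1 (real k * \<delta>) else 1)"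
  define J where "J = (\<lambda>k s'. frame w find_regs s s' \<and> reg s' vQ = k \<and> reg s' vH = 2 ^ k
     \<and> 2 ^ k dvd reg s' vX \<and> x \<le> reg s' vX \<and> reg s' vX + 2 ^ k \<le> x + 2 ^ p)"
  define t where "t = (\<lambda>k. 45 + 1210 * real ?R * (1 + real k) * sqrt (2 ^ k))"
  have finW: "finite W" unfolding W by simp
  let ?body = "blk [decr vQ, assign vH (V vH \<oslash> N 2), assign vY (V vX \<oplus> V vH), test,
       assign vX (V vX \<oplus> V vFound \<otimes> V vH)]"
  have loop: "tri w A B (While vQ ?body) s' (1 + (\<Sum>k<p. 1 + t k)) (J 0) (g 0) (g p s')" if "J p s'" for s'
  proof (rule tri_While[where I = J and g = g and t = t])
    fix k s' assume k: "J (Suc k) s'" "k < p"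
    define x' where "x' = reg s' vX"
    define y where "y = x' + 2 ^ k"
    have fr: "frame w find_regs s s'" and r: "reg s' vQ = Suc k" "reg s' vH = 2 ^ Suc k"
      and x': "2 ^ Suc k dvd x'" "x \<le> x'" "x' + 2 ^ Suc k \<le> x + 2 ^ p"
      using k(1) by (auto simp: J_def x'_def)
    have same: "reg s' vI = reg s vI" "reg s' vJ = reg s vJ" "mem s' = mem s" "reg s' vReps = ?R"
      "valid w (reg s')" "clean s'"
      using fr by (auto simp: frame_def)
    have xw: "x' + 2 * 2 ^ k \<le> 2 ^ w" using x' x(3) by simp
    have kpos: "0 < (2 :: nat) ^ k" by simp
    have lt: "y < 2 ^ w" "2 ^ k < (2 :: nat) ^ w" "k < 2 ^ w"
    proof -
      show "y < 2 ^ w" "2 ^ k < (2 :: nat) ^ w" using xw kpos unfolding y_def by linarith+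
      then show "k < 2 ^ w" using less_exp[of k] by linarith
    qed
    define s1 where "s1 = s'\<lparr>reg := (reg s')(vQ := k, vH := 2 ^ k, vY := y)\<rparr>"
    have fr1: "frame w find_regs s s1"
      using frame_upd[OF frame_upd[OF frame_upd[OF fr lt(3), of vQ] lt(2), of vH] lt(1), of vY] by (simp add: s1_def)
    then have v1: "valid w (reg s1)" "clean s1" by (simp_all add: frame_def)
    have s1: "reg s1 vQ = k" "reg s1 vH = 2 ^ k" "reg s1 vY = y" "reg s1 vI = reg s vI" "reg s1 vJ = reg s vJ"
      "mem s1 = mem s" "reg s1 vReps = ?R" "reg s1 vX = x'"
      by (simp_all add: s1_def same x'_def)
    define found where "found \<longleftrightarrow> {y..<y + 2 ^ k} \<inter> ?S \<noteq> {}"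
    have "2 ^ p \<ge> (2 :: nat) ^ k" using k(2) by (intro power_increasing) auto
    then have room': "100 * 2 ^ k \<le> (2 :: nat) ^ w" using room by linarith
    have yd: "2 ^ k dvd y" "y + 2 ^ k \<le> 2 ^ w" "y + 2 ^ k \<le> x + 2 ^ p" "x \<le> y" "2 ^ k dvd x'"
      using x' xw by (auto simp: y_def dvd_mult_right)
    have sub: "{y..<y + 2 ^ k} \<subseteq> {x..<x + 2 ^ p}" using yd by (intro ivl_subset[THEN iffD2]) simp
    have kw: "k < w" using k(2) w by simp
    have "tri w A B test s1 (10 + 1210 * real (reg s1 vReps) * (1 + real k) * sqrt (2 ^ k))
      (\<lambda>s'. frame w test_regs s1 s' \<and> (reg s' vFound = 0 \<or> reg s' vFound = 1 \<and> found))
      (\<lambda>s'. of_bool (reg s' vFound = 0)) (if found then (1 / 2) ^ reg s1 vReps else 1)"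
      using mem yd by (intro test_correct[OF v1(1) room' w(1) kw s1(1,2,3) yd(1,2) v1(2)]) (simp_all add: s1 found_def)
    then have test: "tri w A B test s1 (10 + 1210 * real ?R * (1 + real k) * sqrt (2 ^ k))
      (\<lambda>s'. frame w test_regs s1 s' \<and> (reg s' vFound = 0 \<or> reg s' vFound = 1 \<and> found))
      (\<lambda>s'. of_bool (reg s' vFound = 0)) (if found then \<delta> else 1)"
      by (simp only: s1(7) \<delta>_def)
    define h where "h = (\<lambda>s'' :: mstate. if good k (x' + reg s'' vFound * 2 ^ k) then min 1 (real k * \<delta>) else 1)"
    have min_le: "min 1 (real k * \<delta>) \<le> min 1 (real (Suc k) * \<delta>)"
      using \<delta> by (simp add: algebra_simps min_def)
    have test': "tri w A B test s1 (10 + 1210 * real ?R * (1 + real k) * sqrt (2 ^ k))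
      (\<lambda>s'. frame w test_regs s1 s' \<and> (reg s' vFound = 0 \<or> reg s' vFound = 1 \<and> found)) h (g (Suc k) s')"
    proof -
      \<comment> \<open>Only in the last case can the test do harm: the maximum witness is in the
        right half and may be missed. In the third case the right half is empty of witnesses and the
        test certainly turns left.\<close>
      consider "\<not> good (Suc k) x'" | "1 \<le> real (Suc k) * \<delta>" | "good k x'" "\<not> found"
        | "good (Suc k) x'" "real (Suc k) * \<delta> < 1" "good k y" "found"
      proof (cases "good (Suc k) x'")
        case True
        show ?thesis
        proof (cases "W = {}")
          case True
          then have "\<not> found" using sub unfolding found_def W by blast
          with True that(3) show ?thesis by (auto simp: good_def)
        next
          case False
          then have M: "Max W \<in> W" "\<And>a. a \<in> W \<Longrightarrow> a \<le> Max W" using finW by auto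
          show ?thesis
          proof (cases "Max W < y")
            case 1: True
            have "\<not> found"
            proof
              assume found
              then obtain a where "a \<in> {y..<y + 2 ^ k}" "a \<in> ?S" unfolding found_def by blast
              moreover from this have "a \<in> W" unfolding W using sub by blast
              ultimately show False using M(2)[of a] 1 by simp
            qed
            moreover have "good k x'" using True False 1 by (auto simp: good_def y_def)
            ultimately show ?thesis using that(3) by blast
          next
            case 2: False
            have "Max W \<in> {y..<y + 2 ^ k}" using True False 2 by (auto simp: good_def y_def)
            then have "good k y" "found" using M(1) W unfolding found_def good_def by blast+
            then show ?thesis using that(2,4) True by fastforce
          qed
        qed
      qed (use that in auto)
      then show ?thesis
      proof cases
        case 1
        then show ?thesis
          using \<delta> by (intro tri_bound[OF test]) (auto simp: h_def g_def x'_def)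
      next
        case 2
        then show ?thesis
          using \<delta> by (intro tri_bound[OF test]) (auto simp: h_def g_def x'_def)
      next
        case 3
        then have "good (Suc k) x'" by (auto simp: good_def)
        then show ?thesis
          using 3 min_le by (intro tri_bound[OF test]) (auto simp: h_def g_def x'_def[symmetric])
      next
        case 4
        \<comment> \<open>The error allowed for the levels below is added to the indicator of a
          miss, whose expectation is at most \<delta>.\<close>
        have "tri w A B test s1 (10 + 1210 * real ?R * (1 + real k) * sqrt (2 ^ k))
          (\<lambda>s'. frame w test_regs s1 s' \<and> (reg s' vFound = 0 \<or> reg s' vFound = 1 \<and> found))
          (\<lambda>s'. real k * \<delta> + 1 * of_bool (reg s' vFound = 0)) (real k * \<delta> + 1 * (if found then \<delta> else 1))"
          using \<delta> by (intro tri_affine[OF test]) auto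
        then show ?thesis
          apply (rule tri_conseq[OF _ order_refl])
          using 4 \<delta> by (auto simp: h_def g_def x'_def[symmetric] y_def algebra_simps)
      qed
    qed
    have E: "ev w A B (s'\<lparr>reg := (reg s')(vQ := k)\<rparr>) (V vH \<oslash> N 2) = 2 ^ k"
      using r num lt by simp
    have E': "ev w A B (s'\<lparr>reg := (reg s')(vQ := k, vH := 2 ^ k)\<rparr>) (V vX \<oplus> V vH) = y"
      using lt by (simp add: y_def x'_def)
    show "tri w A B ?body s' (t k) (J k) (g k) (g (Suc k) s')"
      apply (rule tri_decr[OF same(5) _ r(1)])
        apply (use w in simp)
       apply simp
      apply (rule tri_assign, use same(5) lt in simp, simp, simp)
      apply (simp del: ev.simps add: E)
      apply (rule tri_assign, use same(5) lt in simp, simp, simp)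
      apply (simp del: ev.simps add: E')
      apply (simp only: s1_def[symmetric])
      apply (rule tri_Cons[OF test'])
      subgoal premises pr for s''
      proof -
        have fr2: "frame w test_regs s1 s''" and fnd: "reg s'' vFound = 0 \<or> reg s'' vFound = 1 \<and> found"
          using pr by auto
        have v: "valid w (reg s'')" and s'': "reg s'' vX = x'" "reg s'' vH = 2 ^ k" "reg s'' vQ = k"
          using fr2 s1 by (auto simp: frame_def)
        define z where "z = x' + reg s'' vFound * 2 ^ k"
        have z: "z < 2 ^ w" "2 ^ k dvd z" "x \<le> z" "z + 2 ^ k \<le> x + 2 ^ p"
        proof -
          have "x' < 2 ^ w" "x' + 2 ^ k \<le> x + 2 ^ p" using xw kpos x'(3) unfolding power_Suc by linarith+
          moreover have "z = x' \<or> z = y" using fnd unfolding z_def y_def by auto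
          ultimately show "z < 2 ^ w" "2 ^ k dvd z" "x \<le> z" "z + 2 ^ k \<le> x + 2 ^ p"
            using lt(1) yd x'(2) by blast+
        qed
        have ez: "ev w A B s'' (V vX \<oplus> V vFound \<otimes> V vH) = z"
          using fnd z lt by (auto simp: z_def s'')
        have "frame w find_regs s s''" by (rule frame_trans[OF fr1 fr2]) auto
        then have frz: "frame w find_regs s (s''\<lparr>reg := (reg s'')(vX := z)\<rparr>)"
          using z by (intro frame_upd) auto
        show ?thesis
          apply (rule tri_assign[OF v], simp, simp)
          apply (simp only: ez)
          apply (rule tri_Nil)
            apply (simp add: t_def)
           apply (use frz z s'' in \<open>simp add: J_def\<close>)
          apply (simp add: g_def h_def z_def)
          done
      qed
      done
  qed (use that in \<open>auto simp: J_def\<close>)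
  define s0 where "s0 = s\<lparr>reg := (reg s)(vQ := p)\<rparr>"
  have "frame w find_regs s s" using valid clean by (simp add: frame_def)
  then have "frame w find_regs s s0"
    using frame_upd[of w find_regs s s p vQ] validD(1)[OF valid, of vP] p by (simp add: s0_def)
  then have J0: "J p s0" using x p by (simp add: J_def s0_def)
  have "good p x"
    using Max_in[OF finW] W unfolding good_def by blast
  then have g0: "g p s0 \<le> real p * (1 / 2) ^ ?R"
    by (simp add: g_def s0_def x \<delta>_def)
  have S1: "1 \<le> sqrt (2 ^ p)" by simp
  \<comment> \<open>Every level is charged like the largest. This gives one of the two factors
    \<open>1 + real p\<close>; the other comes from the Hadamard gates within an iteration.\<close>
  have "(\<Sum>k<p. 1 + t k) \<le> (\<Sum>k<p. 46 + 1210 * real ?R * (1 + real p) * sqrt (2 ^ p))"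
    unfolding t_def by (intro sum_mono) (auto intro!: add_mono mult_mono real_sqrt_le_mono power_increasing)
  then have T1: "(\<Sum>k<p. 1 + t k) \<le> real p * (46 + 1210 * real ?R * (1 + real p) * sqrt (2 ^ p))"
    by simp
  have T: "30 + (\<Sum>k<p. 1 + t k) \<le> 1300 * (1 + real ?R) * (1 + real p) ^ 2 * sqrt (2 ^ p)"
  proof -
    define P where "P = (1 + real p) ^ 2 * sqrt (2 ^ p)"
    have "1 * 1 \<le> P" unfolding P_def using S1 by (intro mult_mono) auto
    moreover have "real p * 1 \<le> P" unfolding P_def using S1
      by (intro mult_mono) (auto simp: power2_eq_square algebra_simps)
    moreover have "real p * ((1 + real p) * sqrt (2 ^ p)) \<le> P"
      unfolding P_def power2_eq_square mult.assoc by (intro mult_right_mono) auto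
    then have "real ?R * (real p * ((1 + real p) * sqrt (2 ^ p))) \<le> real ?R * P"
      by (intro mult_left_mono) auto
    moreover have "real p * (46 + 1210 * real ?R * (1 + real p) * sqrt (2 ^ p))
        = 46 * (real p * 1) + 1210 * (real ?R * (real p * ((1 + real p) * sqrt (2 ^ p))))"
      by (simp add: algebra_simps)
    moreover have "1300 * (1 + real ?R) * (1 + real p) ^ 2 * sqrt (2 ^ p) = 1300 * P + 1300 * (real ?R * P)"
      unfolding P_def by (simp add: algebra_simps)
    moreover have "0 \<le> real ?R * P" unfolding P_def by simp
    ultimately show ?thesis using T1 by linarith
  qed
  have final: "tri w A B (blk [assign vX (V vX \<otimes> (EntA (V vI) (V vX) \<otimes> EntB (V vX) (V vJ)))]) s' 20
      (frame w find_regs s) (\<lambda>s'. of_bool (reg s' vX \<noteq> (if W = {} then 0 else Max W))) (g 0 s')" if "J 0 s'" for s'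
  proof -
    have fr: "frame w find_regs s s'" and xs: "x \<le> reg s' vX" "reg s' vX < x + 2 ^ p"
      using that by (auto simp: J_def)
    have v: "valid w (reg s')" and same: "reg s' vI = reg s vI" "reg s' vJ = reg s vJ" using fr by (auto simp: frame_def)
    define b where "b = (reg s' vX \<in> ?S)"
    have "A (reg s vI) (reg s' vX) = 0 \<or> A (reg s vI) (reg s' vX) = 1" "B (reg s' vX) (reg s vJ) = 0 \<or> B (reg s' vX) (reg s vJ) = 1"
      using bool(1)[of "reg s vI" "reg s' vX"] bool(2)[of "reg s' vX" "reg s vJ"] by linarith+
    then have "A (reg s vI) (reg s' vX) * B (reg s' vX) (reg s vJ) = of_bool b"
      "A (reg s vI) (reg s' vX) mod 2 ^ w = A (reg s vI) (reg s' vX)" "B (reg s' vX) (reg s vJ) mod 2 ^ w = B (reg s' vX) (reg s vJ)"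
      unfolding b_def sol_def using num by (auto simp: bit_0)
    then have e: "ev w A B s' (V vX \<otimes> (EntA (V vI) (V vX) \<otimes> EntB (V vX) (V vJ))) = reg s' vX * of_bool b"
      using num validD(1)[OF v, of vX] by (cases b) (auto simp: same)
    have "frame w find_regs s (s'\<lparr>reg := (reg s')(vX := reg s' vX * of_bool b)\<rparr>)"
      using fr validD(1)[OF v, of vX] by (intro frame_upd) auto
    moreover have "reg s' vX * of_bool b = (if W = {} then 0 else Max W)" if "good 0 (reg s' vX)"
    proof (cases "W = {}")
      case True
      moreover have "reg s' vX \<in> {x..<x + 2 ^ p}" using xs by simp
      ultimately have "\<not> b" unfolding b_def W by blast
      with True show ?thesis by simp
    next
      case False
      then have "reg s' vX = Max W" using that by (auto simp: good_def)
      moreover have "Max W \<in> W" using False finW by simp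
      ultimately have b using W unfolding b_def by auto
      with False \<open>reg s' vX = Max W\<close> show ?thesis by simp
    qed
    ultimately show ?thesis
      apply (intro tri_assign[OF v], simp, simp)
      apply (simp only: e)
      apply (rule tri_Nil)
        apply simp
       apply simp
      apply (auto simp: g_def)
      done
  qed
  have "tri w A B find_max s (3 + (1 + (\<Sum>k<p. 1 + t k)) + 20) (frame w find_regs s)
    (\<lambda>s'. of_bool (reg s' vX \<noteq> (if W = {} then 0 else Max W))) (g p s0)"
    unfolding find_max_def
    apply (rule tri_assign[OF valid], simp, simp)
    apply (rule tri_Cons)
     apply (use loop[OF J0] p in \<open>simp add: s0_def\<close>)
    apply (rule tri_conseq[OF final])
       apply simp_all
    done
  then show ?thesis
    by (rule tri_conseq) (use T g0 in auto)
qed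

section \<open>Simulating a classical program inside a larger one\<close>

text \<open>
  A program for words of \<open>w - 2\<close> bits runs on registers from 64 upwards. Cell \<open>a\<close> of its memory
  is represented by a value at \<open>2 ^ (w - 1) + 2 * a\<close> and, next to it, a tag; cells whose tag
  is not the current one count as zero, so that a fresh tag clears the memory in one step.
\<close>

abbreviation (input) vMask :: nat where "vMask \<equiv> 24"
abbreviation (input) vHB :: nat where "vHB \<equiv> 25"
abbreviation (input) vTag :: nat where "vTag \<equiv> 26"
abbreviation (input) vLB :: nat where "vLB \<equiv> 27"
abbreviation (input) vVL :: nat where "vVL \<equiv> 28"

fun instr_below :: "nat \<Rightarrow> instr \<Rightarrow> bool" where
  "instr_below m (Const r k) \<longleftrightarrow> r < m"
| "instr_below m (Arith f r x y) \<longleftrightarrow> r < m \<and> x < m \<and> y < m"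
| "instr_below m (Load r x) \<longleftrightarrow> r < m \<and> x < m"
| "instr_below m (Store x r) \<longleftrightarrow> r < m \<and> x < m"
| "instr_below m (ReadA r x y) \<longleftrightarrow> r < m \<and> x < m \<and> y < m"
| "instr_below m (ReadB r x y) \<longleftrightarrow> r < m \<and> x < m \<and> y < m"
| "instr_below m _ \<longleftrightarrow> True"

primrec prog_below :: "nat \<Rightarrow> prog \<Rightarrow> bool" where
  "prog_below m Skip \<longleftrightarrow> True"
| "prog_below m (Do a) \<longleftrightarrow> instr_below m a"
| "prog_below m (Seq c d) \<longleftrightarrow> prog_below m c \<and> prog_below m d"
| "prog_below m (Cond r c d) \<longleftrightarrow> r < m \<and> prog_below m c \<and> prog_below m d"
| "prog_below m (While r c) \<longleftrightarrow> r < m \<and> prog_below m c"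

lemma instr_below_mono: "instr_below m a \<Longrightarrow> m \<le> m' \<Longrightarrow> instr_below m' a"
  by (cases a) auto

lemma prog_below_mono: "prog_below m c \<Longrightarrow> m \<le> m' \<Longrightarrow> prog_below m' c"
  by (induction c) (auto intro: instr_below_mono)

lemma ex_prog_below: "\<exists>m. prog_below m c"
proof (induction c)
  case (Do a)
  have "\<exists>m. instr_below m a"
  proof (cases a)
    case (Const r k)
    then show ?thesis by (intro exI[of _ "Suc (r)"]) simp
  next
    case (Arith f r x y)
    then show ?thesis by (intro exI[of _ "Suc (r + x + y)"]) simp
  next
    case (Load r x)
    then show ?thesis by (intro exI[of _ "Suc (r + x)"]) simp
  next
    case (Store x r)
    then show ?thesis by (intro exI[of _ "Suc (r + x)"]) simp
  next
    case (ReadA r x y)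
    then show ?thesis by (intro exI[of _ "Suc (r + x + y)"]) simp
  next
    case (ReadB r x y)
    then show ?thesis by (intro exI[of _ "Suc (r + x + y)"]) simp
  qed auto
  then show ?case by simp
next
  case (Seq c d)
  then obtain m m' where "prog_below m c" "prog_below m' d" by blast
  then have "prog_below (max m m') c" "prog_below (max m m') d" by (auto elim: prog_below_mono)
  then show ?case by auto
next
  case (Cond r c d)
  then obtain m m' where "prog_below m c" "prog_below m' d" by blast
  then have "prog_below (Suc r + max m m') c" "prog_below (Suc r + max m m') d" by (auto elim: prog_below_mono)
  then show ?case by (auto intro!: exI[of _ "Suc r + max m m'"])
next
  case (While r c)
  then obtain m where "prog_below m c" by blast
  then have "prog_below (Suc r + m) c" by (auto elim: prog_below_mono)
  then show ?case by (auto intro!: exI[of _ "Suc r + m"])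
qed simp

abbreviation val_cell :: "nat \<Rightarrow> ex" where
  "val_cell x \<equiv> V vHB \<oplus> N 2 \<otimes> V x"

abbreviation tag_cell :: "nat \<Rightarrow> ex" where
  "tag_cell x \<equiv> V vHB \<oplus> N 2 \<otimes> V x \<oplus> N 1"

abbreviation cell_value :: "nat \<Rightarrow> ex" where
  "cell_value x \<equiv> Op Equal (MemAt (tag_cell x)) (V vTag) \<otimes> MemAt (val_cell x)"

text \<open>Masking with \<open>h - 1\<close> reduces results to the shorter word. The block of
  width \<open>vLB\<close> that starts at \<open>vVL\<close> appears as a matrix of its own: its
  index y is read at \<open>vVL\<close> + (y - 1). The comparison with \<open>vLB\<close> suppresses
  positions outside the block, including y = 0, whose predecessor wraps around. The range of the
  other index is guarded by the given oracle.\<close>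

fun sim_instr :: "instr \<Rightarrow> prog" where
  "sim_instr (Const r k) = assign (64 + r) (Op BitAnd (N k) (V vMask))"
| "sim_instr (Arith f r x y) = assign (64 + r) (Op BitAnd (Op f (V (64 + x)) (V (64 + y))) (V vMask))"
| "sim_instr (Load r x) = assign (64 + r) (Op BitAnd (cell_value (64 + x)) (V vMask))"
| "sim_instr (Store x r) = blk [poke (val_cell (64 + x)) (V (64 + r)), poke (tag_cell (64 + x)) (V vTag)]"
| "sim_instr (ReadA r x y) = assign (64 + r)
     (EntA (V (64 + x)) (V vVL \<oplus> (V (64 + y) \<ominus> N 1)) \<otimes> (V (64 + y) \<ominus> N 1 \<prec> V vLB))"
| "sim_instr (ReadB r x y) = assign (64 + r)
     (EntB (V vVL \<oplus> (V (64 + x) \<ominus> N 1)) (V (64 + y)) \<otimes> (V (64 + x) \<ominus> N 1 \<prec> V vLB))"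
| "sim_instr _ = Skip"

primrec sim :: "prog \<Rightarrow> prog" where
  "sim Skip = Skip"
| "sim (Do a) = sim_instr a"
| "sim (Seq c d) = Seq (sim c) (sim d)"
| "sim (Cond r c d) = Cond (64 + r) (sim c) (sim d)"
| "sim (While r c) = While (64 + r) (sim c)"

definition cell :: "nat \<Rightarrow> nat \<Rightarrow> memory \<Rightarrow> nat \<Rightarrow> nat" where
  "cell h tag m a = (if m (2 * h + 2 * a + 1) = tag then m (2 * h + 2 * a) else 0)"

text \<open>The simulated program may address all \<open>h\<close> cells of its memory. With two
  host cells for each they fill the upper half of the address space, and the lower half stays with
  the host. Since no tag exceeds the current one, the next larger tag is fresh.\<close>

definition sim_rel :: "nat \<Rightarrow> nat \<Rightarrow> nat \<Rightarrow> mstate \<Rightarrow> mstate \<Rightarrow> mstate \<Rightarrow> bool" where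
  "sim_rel w h m \<sigma>\<^sub>0 s \<sigma> \<longleftrightarrow> valid w (reg \<sigma>) \<and> (\<forall>r<m. reg \<sigma> (64 + r) = reg s r \<and> reg s r < h)
    \<and> (\<forall>a<h. mem s a = cell h (reg \<sigma>\<^sub>0 vTag) (mem \<sigma>) a \<and> mem s a < h \<and> mem \<sigma> (2 * h + 2 * a + 1) \<le> reg \<sigma>\<^sub>0 vTag)
    \<and> (\<forall>a<2 * h. mem \<sigma> a = mem \<sigma>\<^sub>0 a) \<and> (\<forall>r<64. reg \<sigma> r = reg \<sigma>\<^sub>0 r) \<and> amp \<sigma> = amp \<sigma>\<^sub>0"

lemma and_mask: "h = 2 ^ k \<Longrightarrow> Bit_Operations.and x (h - 1) = x mod (h :: nat)"
  by (metis mask_eq_exp_minus_1 take_bit_eq_mask take_bit_eq_mod)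

locale simulation =
  fixes w h m n b L :: nat and A B :: orac and \<sigma>\<^sub>0 :: mstate
  assumes w: "5 \<le> w" and h: "h = 2 ^ (w - 2)"
    and own: "reg \<sigma>\<^sub>0 vMask = h - 1" "reg \<sigma>\<^sub>0 vHB = 2 * h" "reg \<sigma>\<^sub>0 vLB = b" "reg \<sigma>\<^sub>0 vVL = L"
    and room: "b < h" "L + b < h" and tag: "0 < reg \<sigma>\<^sub>0 vTag"
    and bool: "\<And>i j. A i j \<le> 1" "\<And>i j. B i j \<le> 1"
    and guard: "\<And>i j. i \<notin> {1..n} \<Longrightarrow> A i j = 0" "\<And>i j. j \<notin> {1..n} \<Longrightarrow> B i j = 0"
begin

definition A' :: orac where "A' = matrix_oracle n b (\<lambda>i y. A i (L + (y - 1)))"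
definition B' :: orac where "B' = matrix_oracle b n (\<lambda>y j. B (L + (y - 1)) j)"

lemma word: "2 ^ w = 4 * h" "8 \<le> h"
proof -
  obtain k where k: "w = k + 5" using w by (metis le_iff_add add.commute)
  show "2 ^ w = 4 * h" "8 \<le> h" unfolding h k by (simp_all add: power_add)
qed

lemma mod_h: "x mod (4 * h) mod h = x mod h"
  by (simp add: mod_mod_cancel)

lemma num: "1 mod 2 ^ w = (1 :: nat)" "2 mod 2 ^ w = (2 :: nat)"
  unfolding word(1) using word(2) by simp_all

lemma ev_mask:
  assumes "reg \<sigma> vMask = h - 1"
  shows "ev w A B \<sigma> (Op BitAnd e (V vMask)) = ev w A B \<sigma> e mod h"
proof -
  have "ev w A B \<sigma> e mod h < 4 * h" using word(2) mod_less_divisor[of h "ev w A B \<sigma> e"] by linarith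
  then show ?thesis
    unfolding ev.simps arith.simps assms and_mask[OF h] word(1) by simp
qed

lemma step_oracles: "A' i y = (if y - 1 < b \<and> y \<noteq> 0 then A i (L + (y - 1)) else 0)"
  "B' y j = (if y - 1 < b \<and> y \<noteq> 0 then B (L + (y - 1)) j else 0)"
  using guard by (auto simp: A'_def B'_def matrix_oracle_def)

lemma step_oracles_le: "A' i j \<le> 1" "B' i j \<le> 1"
  unfolding step_oracles using bool by simp_all

text \<open>Apart from \<open>Minus\<close>, the operations agree even before reduction. For
  \<open>Minus\<close> the complements belong to different word lengths, but they differ by a
  multiple of \<open>h\<close>.\<close>

lemma arith_mod: 
  assumes "x < h" "y < h"
  shows "arith w f x y mod 2 ^ w mod h = arith (w - 2) f x y mod h"
proof (cases "f = Minus")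
  case True
  have "x + (4 * h - y) = x + (h - y) + 3 * h" using assms by linarith
  then have "(x + (4 * h - y)) mod h = (x + (h - y)) mod h" by (simp only: mod_mult_self1)
  then show ?thesis unfolding True arith.simps word(1) mod_h h[symmetric] .
next
  case False
  then show ?thesis unfolding word(1) mod_h by (cases f) auto
qed

lemma ev_pred:
  assumes "reg \<sigma> r < h"
  shows "ev w A B \<sigma> (V r \<ominus> N 1) = (if reg \<sigma> r = 0 then 4 * h - 1 else reg \<sigma> r - 1)"
proof (cases "reg \<sigma> r = 0")
  case True
  have "(4 * h - 1) mod (4 * h) = 4 * h - 1" using word(2) by simp
  then show ?thesis using True num by (simp add: word(1))
next
  case False
  then show ?thesis
    using sub_mod_word[of 1 "reg \<sigma> r" w] assms num by (simp add: word(1))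
qed

lemma sim_instr_correct:
  assumes "classical_instr a" "instr_below m a" and rel: "sim_rel w h m \<sigma>\<^sub>0 s \<sigma>"
  shows "\<exists>s' \<sigma>'. step (w - 2) A' B' a s = return_pmf s'
    \<and> runs_within w A B (sim_instr a) 40 \<sigma> (return_pmf \<sigma>') \<and> sim_rel w h m \<sigma>\<^sub>0 s' \<sigma>'"
proof -
  have v: "valid w (reg \<sigma>)" and R: "\<And>r. r < m \<Longrightarrow> reg \<sigma> (64 + r) = reg s r \<and> reg s r < h"
    and M: "\<And>a. a < h \<Longrightarrow> mem s a = cell h (reg \<sigma>\<^sub>0 vTag) (mem \<sigma>) a \<and> mem s a < h \<and> mem \<sigma> (2 * h + 2 * a + 1) \<le> reg \<sigma>\<^sub>0 vTag"
    and fr: "\<And>r. r < 64 \<Longrightarrow> reg \<sigma> r = reg \<sigma>\<^sub>0 r"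
    using rel by (auto simp: sim_rel_def)
  have own': "reg \<sigma> vMask = h - 1" "reg \<sigma> vHB = 2 * h" "reg \<sigma> vLB = b" "reg \<sigma> vVL = L" "reg \<sigma> vTag = reg \<sigma>\<^sub>0 vTag"
    using fr own by simp_all
  have tw: "reg \<sigma>\<^sub>0 vTag < 4 * h" using validD(1)[OF v, of vTag] own' word by simp
  have assign: "\<exists>s' \<sigma>'. return_pmf (put (w - 2) r x s) = return_pmf s'
    \<and> runs_within w A B (assign (64 + r) e) 40 \<sigma> (return_pmf \<sigma>') \<and> sim_rel w h m \<sigma>\<^sub>0 s' \<sigma>'"
    if "ev w A B \<sigma> e = x mod h" "wf_ex e 32" "cost e \<le> 38" for r x e
  proof (intro exI conjI)
    show "runs_within w A B (assign (64 + r) e) 40 \<sigma> (return_pmf (\<sigma>\<lparr>reg := (reg \<sigma>)(64 + r := x mod h)\<rparr>))"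
      using assign_correct[OF v that(2), of "64 + r" A B] that runs_within_mono by force
    have "x mod h < h" "x mod h < 2 ^ w" using word mod_less_divisor[of h x] by linarith+
    then show "sim_rel w h m \<sigma>\<^sub>0 (put (w - 2) r x s) (\<sigma>\<lparr>reg := (reg \<sigma>)(64 + r := x mod h)\<rparr>)"
      using rel word by (auto simp: sim_rel_def put_def h[symmetric] intro!: valid_upd)
  qed simp
  have cells: "ev w A B \<sigma> (val_cell (64 + x)) = 2 * h + 2 * reg s x"
    "ev w A B \<sigma> (tag_cell (64 + x)) = 2 * h + 2 * reg s x + 1" if "x < m" for x
    using R[OF that] num word by (simp_all add: own')
  show ?thesis
  proof (cases a)
    case (Const r k)
    have "ev w A B \<sigma> (Op BitAnd (N k) (V vMask)) = k mod h"
      unfolding ev_mask[OF own'(1)] by (simp add: word(1) mod_h)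
    from assign[OF this, of r] show ?thesis using Const by (simp del: ev.simps arith.simps)
  next
    case (Arith f r x y)
    have "ev w A B \<sigma> (Op BitAnd (Op f (V (64 + x)) (V (64 + y))) (V vMask)) = arith (w - 2) f (reg s x) (reg s y) mod h"
      unfolding ev_mask[OF own'(1)] using R assms(2) Arith by (simp add: arith_mod)
    from assign[OF this, of r] show ?thesis using Arith by (simp del: ev.simps arith.simps)
  next
    case (Load r x)
    then have x: "x < m" using assms(2) by simp
    have c: "mem s (reg s x) = cell h (reg \<sigma>\<^sub>0 vTag) (mem \<sigma>) (reg s x)" "mem s (reg s x) < h"
      "mem \<sigma> (2 * h + 2 * reg s x + 1) \<le> reg \<sigma>\<^sub>0 vTag"
      using M[of "reg s x"] R[OF x] by auto
    have "mem \<sigma> (2 * h + 2 * reg s x + 1) mod (4 * h) = mem \<sigma> (2 * h + 2 * reg s x + 1)"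
      using c(3) tw by simp
    then have t: "ev w A B \<sigma> (MemAt (tag_cell (64 + x))) = mem \<sigma> (2 * h + 2 * reg s x + 1)"
      by (subst ev.simps(4)) (simp only: cells[OF x] word(1))
    have u: "ev w A B \<sigma> (MemAt (val_cell (64 + x))) = mem \<sigma> (2 * h + 2 * reg s x) mod (4 * h)"
      by (subst ev.simps(4)) (simp only: cells[OF x] word(1))
    have "ev w A B \<sigma> (Op Equal (MemAt (tag_cell (64 + x))) (V vTag)) = of_bool (mem \<sigma> (2 * h + 2 * reg s x + 1) = reg \<sigma>\<^sub>0 vTag)"
      using num by (subst ev.simps(3), subst t) (simp add: own')
    then have "ev w A B \<sigma> (cell_value (64 + x)) = mem s (reg s x)"
      using c(1,2) by (subst ev.simps(3), subst u) (auto simp: cell_def word(1))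
    then have "ev w A B \<sigma> (Op BitAnd (cell_value (64 + x)) (V vMask)) = mem s (reg s x) mod h"
      by (simp only: ev_mask[OF own'(1)])
    from assign[OF this, of r] show ?thesis using Load by (simp del: ev.simps arith.simps)
  next
    case (Store x r)
    then have x: "x < m" and r: "r < m" using assms(2) by simp_all
    define \<sigma>1 where "\<sigma>1 = \<sigma>\<lparr>mem := (mem \<sigma>)(2 * h + 2 * reg s x := reg s r)\<rparr>"
    define \<sigma>2 where "\<sigma>2 = \<sigma>\<lparr>mem := (mem \<sigma>)(2 * h + 2 * reg s x := reg s r, 2 * h + 2 * reg s x + 1 := reg \<sigma>\<^sub>0 vTag)\<rparr>"
    have p1: "runs_within w A B (poke (val_cell (64 + x)) (V (64 + r))) 11 \<sigma> (return_pmf \<sigma>1)"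
      using poke_correct[OF v, of "val_cell (64 + x)" "V (64 + r)" A B] unfolding cells[OF x] using R[OF r] by (simp add: \<sigma>1_def)
    have "ev w A B \<sigma>1 (tag_cell (64 + x)) = 2 * h + 2 * reg s x + 1"
      using R[OF x] num word by (simp add: \<sigma>1_def own')
    then have p2: "runs_within w A B (poke (tag_cell (64 + x)) (V vTag)) 14 \<sigma>1 (return_pmf \<sigma>2)"
      using poke_correct[of w \<sigma>1 "tag_cell (64 + x)" "V vTag" A B] v by (simp add: \<sigma>1_def \<sigma>2_def own' del: ev.simps(3))
    have "runs_within w A B (sim_instr a) 40 \<sigma> (return_pmf \<sigma>2)"
      unfolding Store sim_instr.simps
      apply (rule tri_eqD[where f = "\<lambda>_. 0" and e = 0])
      apply (rule tri_Cons_det[OF p1])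
      apply (rule tri_Cons_det[OF p2])
      apply (rule tri_Nil, simp_all)
      done
    moreover have "sim_rel w h m \<sigma>\<^sub>0 (s\<lparr>mem := (mem s)(reg s x := reg s r)\<rparr>) \<sigma>2"
    proof -
      \<comment> \<open>Value cells have even addresses and tag cells odd ones, so a write to the
        one kind never hits the other.\<close>
      have "2 * h + 2 * a + 1 \<noteq> 2 * h + 2 * a'" "2 * h + 2 * a' \<noteq> Suc (2 * h + 2 * a)" for a a' :: nat by presburger+
      then show ?thesis
        using rel R[OF r] R[OF x] unfolding sim_rel_def \<sigma>2_def cell_def by auto
    qed
    ultimately show ?thesis using Store by (intro exI[of _ "s\<lparr>mem := (mem s)(reg s x := reg s r)\<rparr>"] exI[of _ \<sigma>2]) simp
  next
    case (ReadA r x y)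
    then have xy: "x < m" "y < m" using assms(2) by simp_all
    define z where "z = (if reg s y = 0 then 4 * h - 1 else reg s y - 1)"
    have p: "ev w A B \<sigma> (V (64 + y) \<ominus> N 1) = z"
      using ev_pred[of \<sigma> "64 + y"] R[OF xy(2)] by (simp add: z_def)
    have b1: "A i j mod (4 * h) = A i j" for i j using bool(1)[of i j] word by simp
    have i: "ev w A B \<sigma> (V vVL \<oplus> (V (64 + y) \<ominus> N 1)) = (L + z) mod (4 * h)"
      by (subst ev.simps(3), subst p) (simp add: own' word(1))
    have e: "ev w A B \<sigma> (EntA (V (64 + x)) (V vVL \<oplus> (V (64 + y) \<ominus> N 1))) = A (reg s x) ((L + z) mod (4 * h))"
      using R[OF xy(1)] by (subst ev.simps(5), subst i) (simp add: b1 word(1))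
    have l: "ev w A B \<sigma> (V (64 + y) \<ominus> N 1 \<prec> V vLB) = of_bool (z < b)"
      using num by (subst ev.simps(3), subst p) (simp add: own')
    have "ev w A B \<sigma> (EntA (V (64 + x)) (V vVL \<oplus> (V (64 + y) \<ominus> N 1)) \<otimes> (V (64 + y) \<ominus> N 1 \<prec> V vLB))
        = A (reg s x) ((L + z) mod (4 * h)) * of_bool (z < b) mod (4 * h)"
      by (subst ev.simps(3), subst e, subst l) (simp add: word(1))
    also have "\<dots> = A' (reg s x) (reg s y)"
    proof (cases "reg s y - 1 < b \<and> reg s y \<noteq> 0")
      case True
      then have "(L + (reg s y - 1)) mod (4 * h) = L + (reg s y - 1)" using room by (intro mod_less) linarith
      with True show ?thesis unfolding step_oracles by (simp add: z_def b1)
    next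
      case False
      \<comment> \<open>For index 0 the predecessor is \<open>4 * h - 1\<close>, which lies beyond
        the block width.\<close>
      then have "\<not> z < b" using room word by (auto simp: z_def split: if_splits)
      with False show ?thesis unfolding step_oracles by auto
    qed
    also have "\<dots> = A' (reg s x) (reg s y) mod h"
      using step_oracles_le[of "reg s x" "reg s y"] word(2) by (intro mod_less[symmetric]) linarith
    finally show ?thesis using assign[of _ _ r] ReadA by (simp del: ev.simps arith.simps)
  next
    case (ReadB r x y)
    then have xy: "x < m" "y < m" using assms(2) by simp_all
    define z where "z = (if reg s x = 0 then 4 * h - 1 else reg s x - 1)"
    have p: "ev w A B \<sigma> (V (64 + x) \<ominus> N 1) = z"
      using ev_pred[of \<sigma> "64 + x"] R[OF xy(1)] by (simp add: z_def)
    have b1: "B i j mod (4 * h) = B i j" for i j using bool(2)[of i j] word by simp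
    have i: "ev w A B \<sigma> (V vVL \<oplus> (V (64 + x) \<ominus> N 1)) = (L + z) mod (4 * h)"
      by (subst ev.simps(3), subst p) (simp add: own' word(1))
    have e: "ev w A B \<sigma> (EntB (V vVL \<oplus> (V (64 + x) \<ominus> N 1)) (V (64 + y))) = B ((L + z) mod (4 * h)) (reg s y)"
      using R[OF xy(2)] by (subst ev.simps(6), subst i) (simp add: b1 word(1))
    have l: "ev w A B \<sigma> (V (64 + x) \<ominus> N 1 \<prec> V vLB) = of_bool (z < b)"
      using num by (subst ev.simps(3), subst p) (simp add: own')
    have "ev w A B \<sigma> (EntB (V vVL \<oplus> (V (64 + x) \<ominus> N 1)) (V (64 + y)) \<otimes> (V (64 + x) \<ominus> N 1 \<prec> V vLB))
        = B ((L + z) mod (4 * h)) (reg s y) * of_bool (z < b) mod (4 * h)"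
      by (subst ev.simps(3), subst e, subst l) (simp add: word(1))
    also have "\<dots> = B' (reg s x) (reg s y)"
    proof (cases "reg s x - 1 < b \<and> reg s x \<noteq> 0")
      case True
      then have "(L + (reg s x - 1)) mod (4 * h) = L + (reg s x - 1)" using room by (intro mod_less) linarith
      with True show ?thesis unfolding step_oracles by (simp add: z_def b1)
    next
      case False
      then have "\<not> z < b" using room word by (auto simp: z_def split: if_splits)
      with False show ?thesis unfolding step_oracles by auto
    qed
    also have "\<dots> = B' (reg s x) (reg s y) mod h"
      using step_oracles_le[of "reg s x" "reg s y"] word(2) by (intro mod_less[symmetric]) linarith
    finally show ?thesis using assign[of _ _ r] ReadB by (simp del: ev.simps arith.simps)
  qed (use assms(1) in simp_all)
qed

text \<open>A classical program has a single run, so \<open>D\<close> is a point distribution, and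
  the simulation follows this run with at most 40 host steps for each of its steps.\<close>

lemma sim_correct:
  assumes "exec (w - 2) A' B' c t s D" "classical c" "prog_below m c" "sim_rel w h m \<sigma>\<^sub>0 s \<sigma>"
  shows "\<exists>s' \<sigma>'. D = return_pmf s' \<and> runs_within w A B (sim c) (40 * real t) \<sigma> (return_pmf \<sigma>')
    \<and> sim_rel w h m \<sigma>\<^sub>0 s' \<sigma>'"
  using assms
proof (induction arbitrary: \<sigma> rule: exec.induct)
  case (Skip s)
  then show ?case by (intro exI[of _ s] exI[of _ \<sigma>]) (simp add: runs_within_Skip)
next
  case (Do a s)
  then show ?case using sim_instr_correct[of a s \<sigma>] by simp
next
  case (Seq c t s D d T E t')
  have "classical c" "prog_below m c" using Seq.prems by simp_all
  from Seq.IH(1)[OF this Seq.prems(3)] obtain s1 \<sigma>1 where 1: "D = return_pmf s1" "runs_within w A B (sim c) (40 * real t) \<sigma> (return_pmf \<sigma>1)" "sim_rel w h m \<sigma>\<^sub>0 s1 \<sigma>1"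
    by blast
  with Seq obtain s2 \<sigma>2 where 2: "E s1 = return_pmf s2" "runs_within w A B (sim d) (40 * real (T s1)) \<sigma>1 (return_pmf \<sigma>2)" "sim_rel w h m \<sigma>\<^sub>0 s2 \<sigma>2" "T s1 \<le> t'"
    by (metis classical.simps(3) prog_below.simps(3) set_return_pmf singletonI)
  have "runs_within w A B (sim (Seq c d)) (40 * real t + 40 * real (T s1)) \<sigma> (return_pmf \<sigma>2)"
    using 1(2) 2(2) by (simp add: runs_within_Seq_det)
  then have "runs_within w A B (sim (Seq c d)) (40 * real (t + t')) \<sigma> (return_pmf \<sigma>2)"
    using 2(4) by (elim runs_within_mono) (simp add: algebra_simps)
  then show ?case using 1 2 by (auto simp: bind_return_pmf)
next
  case (Cond_True s r c t D d)
  have "classical c" "prog_below m c" using Cond_True.prems by simp_all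
  from Cond_True.IH(1)[OF this Cond_True.prems(3)] obtain s1 \<sigma>1 where 1: "D = return_pmf s1" "runs_within w A B (sim c) (40 * real t) \<sigma> (return_pmf \<sigma>1)" "sim_rel w h m \<sigma>\<^sub>0 s1 \<sigma>1"
    by blast
  have "reg \<sigma> (64 + r) \<noteq> 0" using Cond_True by (auto simp: sim_rel_def)
  then have "runs_within w A B (sim (Cond r c d)) (1 + 40 * real t) \<sigma> (return_pmf \<sigma>1)"
    using 1(2) by (auto intro!: runs_within_Cond)
  then have "runs_within w A B (sim (Cond r c d)) (40 * real (1 + t)) \<sigma> (return_pmf \<sigma>1)"
    by (elim runs_within_mono) simp
  with 1 show ?case by blast
next
  case (Cond_False s r d t D c)
  have "classical d" "prog_below m d" using Cond_False.prems by simp_all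
  from Cond_False.IH(1)[OF this Cond_False.prems(3)] obtain s1 \<sigma>1 where 1: "D = return_pmf s1" "runs_within w A B (sim d) (40 * real t) \<sigma> (return_pmf \<sigma>1)" "sim_rel w h m \<sigma>\<^sub>0 s1 \<sigma>1"
    by blast
  have "reg \<sigma> (64 + r) = 0" using Cond_False by (auto simp: sim_rel_def)
  then have "runs_within w A B (sim (Cond r c d)) (1 + 40 * real t) \<sigma> (return_pmf \<sigma>1)"
    using 1(2) by (auto intro!: runs_within_Cond)
  then have "runs_within w A B (sim (Cond r c d)) (40 * real (1 + t)) \<sigma> (return_pmf \<sigma>1)"
    by (elim runs_within_mono) simp
  with 1 show ?case by blast
next
  case (While_False s r c)
  then have "reg \<sigma> (64 + r) = 0" by (auto simp: sim_rel_def)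
  with While_False show ?case
    by (intro exI[of _ s] exI[of _ \<sigma>]) (simp add: runs_within_While_False)
next
  case (While_True s r c t D T E t')
  have "classical c" "prog_below m c" using While_True.prems by simp_all
  from While_True.IH(1)[OF this While_True.prems(3)] obtain s1 \<sigma>1 where 1: "D = return_pmf s1" "runs_within w A B (sim c) (40 * real t) \<sigma> (return_pmf \<sigma>1)" "sim_rel w h m \<sigma>\<^sub>0 s1 \<sigma>1"
    by blast
  with While_True obtain s2 \<sigma>2 where 2: "E s1 = return_pmf s2" "runs_within w A B (sim (While r c)) (40 * real (T s1)) \<sigma>1 (return_pmf \<sigma>2)" "sim_rel w h m \<sigma>\<^sub>0 s2 \<sigma>2" "T s1 \<le> t'"
    by (metis set_return_pmf singletonI)
  have "reg \<sigma> (64 + r) \<noteq> 0" using While_True by (auto simp: sim_rel_def)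
  then have "runs_within w A B (While (64 + r) (sim c)) (1 + 40 * real t + 40 * real (T s1)) \<sigma> (bind_pmf (return_pmf \<sigma>1) (\<lambda>_. return_pmf \<sigma>2))"
    using 1(2) 2(2) by (intro runs_within_While_True) simp_all
  then have "runs_within w A B (sim (While r c)) (40 * real (1 + t + t')) \<sigma> (return_pmf \<sigma>2)"
    using 2(4) by (simp add: bind_return_pmf) (elim runs_within_mono, simp add: algebra_simps)
  then show ?case using 1 2 by (auto simp: bind_return_pmf)
qed

end

section \<open>The exponent of matrix multiplication\<close>

lemma step_mem:
  assumes "s' \<in> set_pmf (step w A B a s)"
  shows "\<exists>x v. mem s' = (mem s)(x := v)"
proof (cases "\<exists>x r. a = Store x r")
  case False
  then have "mem s' = mem s"
    using assms by (cases a) (auto simp: put_def unitary_step_def split: if_splits)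
  then have "mem s' = (mem s)(0 := mem s 0)" by simp
  then show ?thesis by blast
next
  case True
  then obtain x r where "a = Store x r" by blast
  then have "mem s' = (mem s)(reg s x := reg s r)" using assms by simp
  then show ?thesis by blast
qed

text \<open>A step writes at most one memory cell. This turns the size of an output into a lower
  bound on the running time.\<close>

lemma changed_cells:
  "exec w A B c t s D \<Longrightarrow> s' \<in> set_pmf D \<Longrightarrow>
    finite {a. mem s' a \<noteq> mem s a} \<and> card {a. mem s' a \<noteq> mem s a} \<le> t \<and> 1 \<le> t"
proof (induction arbitrary: s' rule: exec.induct)
  case (Do a s)
  then obtain x v where "mem s' = (mem s)(x := v)" using step_mem by blast
  then have "{a. mem s' a \<noteq> mem s a} \<subseteq> {x}" by auto
  then show ?case using finite_subset card_mono[of "{x}"] by fastforce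
next
  case (Seq c t s D d T E t')
  then obtain s1 where s1: "s1 \<in> set_pmf D" "s' \<in> set_pmf (E s1)" by auto
  let ?X = "{a. mem s1 a \<noteq> mem s a}" and ?Y = "{a. mem s' a \<noteq> mem s1 a}"
  have *: "finite ?X" "card ?X \<le> t" "1 \<le> t" "finite ?Y" "card ?Y \<le> T s1" "T s1 \<le> t'"
    using Seq.IH s1 by blast+
  have "{a. mem s' a \<noteq> mem s a} \<subseteq> ?X \<union> ?Y" by auto
  moreover have "card (?X \<union> ?Y) \<le> t + t'" using card_Un_le[of ?X ?Y] * by linarith
  ultimately show ?case using * by (meson card_mono finite_UnI finite_subset le_trans trans_le_add1)
next
  case (While_True s r c t D T E t')
  then obtain s1 where s1: "s1 \<in> set_pmf D" "s' \<in> set_pmf (E s1)" by auto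
  let ?X = "{a. mem s1 a \<noteq> mem s a}" and ?Y = "{a. mem s' a \<noteq> mem s1 a}"
  have *: "finite ?X" "card ?X \<le> t" "1 \<le> t" "finite ?Y" "card ?Y \<le> T s1" "T s1 \<le> t'"
    using While_True.IH s1 by blast+
  have "{a. mem s' a \<noteq> mem s a} \<subseteq> ?X \<union> ?Y" by auto
  moreover have "card (?X \<union> ?Y) \<le> 1 + t + t'" using card_Un_le[of ?X ?Y] * by linarith
  ultimately show ?case using * by (meson card_mono finite_UnI finite_subset le_trans le_add1 trans_le_add1)
qed (auto simp: le_Suc_eq)

text \<open>For all-ones matrices each of the \<open>n * n\<close> result entries is
  \<open>b\<close>, hence non-zero, while the memory starts blank. The bound lets \<open>T\<close>
  absorb all costs of order \<open>n ^ 2\<close> later on.\<close>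

lemma multiplies_time:
  assumes "multiplies w n P T n b n" "1 \<le> n" "1 \<le> b"
  shows "real n ^ 2 \<le> T"
proof -
  define X :: "nat \<Rightarrow> nat \<Rightarrow> nat" where "X = (\<lambda>_ _. 1)"
  have "\<forall>i j. X i j \<le> n \<and> X i j \<le> n" using assms(2) by (simp add: X_def)
  then obtain D where D: "runs_within w (matrix_oracle n b X) (matrix_oracle b n X) P T (init [n, n, b, n] blank) D"
      "\<forall>s\<in>set_pmf D. \<forall>i\<in>{1..n}. \<forall>j\<in>{1..n}. mem s ((i - 1) * n + (j - 1)) = (\<Sum>k=1..b. X i k * X k j)"
    using assms(1) unfolding multiplies_def by blast
  obtain s where s: "s \<in> set_pmf D" using set_pmf_not_empty[of D] by blast
  obtain t where t: "real t \<le> T" "exec w (matrix_oracle n b X) (matrix_oracle b n X) P t (init [n, n, b, n] blank) D"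
    using D(1) by (auto simp: runs_within_def)
  let ?C = "{a. mem s a \<noteq> mem (init [n, n, b, n] blank) a}"
  have "{..<n * n} \<subseteq> ?C"
  proof
    fix a assume "a \<in> {..<n * n}"
    then have idx: "a div n < n" "a mod n < n" using assms(2) by (auto simp: less_mult_imp_div_less)
    have "mem s ((Suc (a div n) - 1) * n + (Suc (a mod n) - 1)) = (\<Sum>k=1..b. X (Suc (a div n)) k * X k (Suc (a mod n)))"
      by (intro D(2)[rule_format, OF s]) (auto simp: Suc_le_eq intro: idx)
    then have "mem s a = b" by (simp add: X_def)
    then show "a \<in> ?C" using assms(3) by (simp add: init_def)
  qed
  then have "n * n \<le> card ?C" using changed_cells[OF t(2) s] card_mono[of ?C "{..<n * n}"] by simp
  then have "n * n \<le> t" using changed_cells[OF t(2) s] by linarith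
  then have "real (n * n) \<le> real t" by (simp only: of_nat_le_iff)
  then show ?thesis using t(1) by (simp add: power2_eq_square)
qed

section \<open>Cubic matrix multiplication\<close>

lemma classical_code: "classical (code e t)"
  by (induction e arbitrary: t) auto

lemma classical_blk: "classical (blk cs) \<longleftrightarrow> (\<forall>c\<in>set cs. classical c)"
  by (induction cs) (auto simp: blk.simps)

lemma classical_statements: "classical (assign r e)" "classical (poke e e')" "classical (decr r)"
  by (auto simp: assign_def poke_def decr_def classical_code)

lemma word_bound:
  assumes "real K * log 2 (real n) \<le> real w" "1 \<le> n"
  shows "n ^ K \<le> 2 ^ w"
proof -
  have "real (n ^ K) = 2 powr (real K * log 2 (real n))"
    using assms(2) by (simp add: powr_realpow[symmetric] powr_powr[symmetric] mult.commute powr_def[of "real n"] log_def) (simp add: powr_def)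
  also have "\<dots> \<le> 2 powr (real w)" using assms(1) by (intro powr_mono) auto
  also have "\<dots> = real (2 ^ w)" by (simp add: powr_realpow)
  finally show ?thesis by (simp only: of_nat_le_iff)
qed

lemma row_major:
  fixes a c :: nat
  assumes "i \<in> {1..a}" "j \<in> {1..c}"
  shows "((i - 1) * c + (j - 1)) div c = i - 1" "((i - 1) * c + (j - 1)) mod c = j - 1"
    "(i - 1) * c + (j - 1) < a * c"
proof -
  have j: "j - 1 < c" using assms(2) by auto
  have "(x * c + y) div c = x \<and> (x * c + y) mod c = y" if "y < c" for x y using that by simp
  from this[OF j] show "((i - 1) * c + (j - 1)) div c = i - 1" "((i - 1) * c + (j - 1)) mod c = j - 1"
    by blast+
  have "(i - 1) * c + (j - 1) < (i - 1) * c + c" using j by simp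
  also have "\<dots> = i * c" using assms(1) by (cases i) auto
  also have "\<dots> \<le> a * c" using assms(1) by simp
  finally show "(i - 1) * c + (j - 1) < a * c" .
qed

text \<open>A witness that the set of exponents is not empty, without which its infimum would carry
  no information.\<close>

definition naive :: prog where
  "naive = blk [assign vR (V 1 \<otimes> V 3), While vR (blk [decr vR,
     assign vX (V vR \<oslash> V 3 \<oplus> N 1), assign vY (Op Remainder (V vR) (V 3) \<oplus> N 1),
     assign vM (N 0), assign vQ (V 2),
     While vQ (blk [assign vM (V vM \<oplus> EntA (V vX) (V vQ) \<otimes> EntB (V vQ) (V vY)), decr vQ]),
     poke (V vR) (V vM)])]"

lemma classical_naive: "classical naive"
  by (simp add: naive_def classical_blk classical_statements)

lemma naive_multiplies:
  assumes n: "2 \<le> n" and w: "n ^ 8 \<le> 2 ^ w" and abc: "a \<le> n" "b \<le> n" "c \<le> n"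
  shows "multiplies w n naive (100 * real n ^ 3) a b c"
  unfolding multiplies_def
proof (intro allI impI)
  fix X Y :: "nat \<Rightarrow> nat \<Rightarrow> nat"
  assume XY: "\<forall>i j. X i j \<le> n \<and> Y i j \<le> n"
  let ?A = "matrix_oracle a b X" and ?B = "matrix_oracle b c Y"
  have n8: "256 \<le> n ^ 8" using power_mono[OF n, of 8] by simp
  then have big: "256 \<le> (2 :: nat) ^ w" using w by linarith
  have "w > 0" using big by (cases w) auto
  have n3: "n ^ 3 * 16 < 2 ^ w"
  proof -
    have "n ^ 3 * 2 ^ 4 < n ^ 3 * n ^ 5"
      using n power_mono[OF n, of 5] by (intro mult_strict_left_mono) auto
    then show ?thesis using w by (simp flip: power_add)
  qed
  have n1: "n \<le> n ^ 3" "n * n \<le> n ^ 3" using n by (auto simp: power3_eq_cube)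
  have nw: "n < 2 ^ w" "n * n < 2 ^ w" "n + 1 < 2 ^ w" using n1 n3 n by linarith+
  have num: "1 mod 2 ^ w = (1 :: nat)" using big by (intro mod_less) linarith
  define s0 where "s0 = init [n, a, b, c] blank"
  have v0: "valid w (reg s0)" using nw abc by (auto simp: valid_def s0_def init_def nth_Cons')
  have r0: "reg s0 1 = a" "reg s0 2 = b" "reg s0 3 = c" "mem s0 = blank" by (simp_all add: s0_def init_def)
  define P where "P = (\<lambda>e. \<Sum>k=1..b. X (e div c + 1) k * Y k (e mod c + 1))"
  define J where "J = (\<lambda>k (s :: mstate). valid w (reg s) \<and> reg s vR = k \<and> reg s 1 = a \<and> reg s 2 = b \<and> reg s 3 = c
      \<and> (\<forall>e. k \<le> e \<longrightarrow> e < a * c \<longrightarrow> mem s e = P e))"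
  let ?inner = "blk [assign vM (V vM \<oplus> EntA (V vX) (V vQ) \<otimes> EntB (V vQ) (V vY)), decr vQ]"
  let ?body = "blk [decr vR,
     assign vX (V vR \<oslash> V 3 \<oplus> N 1), assign vY (Op Remainder (V vR) (V 3) \<oplus> N 1),
     assign vM (N 0), assign vQ (V 2), While vQ ?inner, poke (V vR) (V vM)]"
  have loop: "tri w ?A ?B (While vR ?body) s (1 + (\<Sum>k<a * c. 1 + real (50 + 25 * b))) (J 0) (\<lambda>_. 0) 0" if "J (a * c) s" for s
  proof (rule tri_While[where I = J and g = "\<lambda>_ _. 0" and t = "\<lambda>_. real (50 + 25 * b)"])
    fix e s assume e: "J (Suc e) s" "e < a * c"
    define x where "x = e div c + 1"
    define y where "y = e mod c + 1"
    have c0: "0 < c" using e(2) by (cases c) auto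
    have xy: "x \<in> {1..a}" "y \<in> {1..c}"
      using e(2) c0 by (auto simp: x_def y_def Suc_le_eq less_mult_imp_div_less)
    have v: "valid w (reg s)" and r: "reg s vR = Suc e" "reg s 1 = a" "reg s 2 = b" "reg s 3 = c"
      and m: "\<And>e'. Suc e \<le> e' \<Longrightarrow> e' < a * c \<Longrightarrow> mem s e' = P e'" using e(1) by (auto simp: J_def)
    have lt: "e < 2 ^ w" "x < 2 ^ w" "y < 2 ^ w" "e div c < 2 ^ w" "e mod c < 2 ^ w" "b < 2 ^ w"
      using validD(1)[OF v, of vR] r xy abc nw by (auto simp: x_def y_def)
    \<comment> \<open>The inner loop counts down, so the sum accumulated so far consists of the
      terms above \<open>k\<close>.\<close>
    define Q where "Q = (\<lambda>k. \<Sum>i=Suc k..b. X x i * Y i y)"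
    have Qn: "Q k \<le> n ^ 3" for k
    proof -
      have "Q k \<le> (\<Sum>i=Suc k..b. n * n)" unfolding Q_def using XY by (intro sum_mono mult_mono) auto
      also have "\<dots> = (b - k) * (n * n)" by simp
      also have "\<dots> \<le> n * (n * n)" using abc(2) by (intro mult_right_mono) auto
      finally show ?thesis by (simp add: power3_eq_cube)
    qed
    have QS: "k < b \<Longrightarrow> Q k = Q (Suc k) + X x (Suc k) * Y (Suc k) y" for k
      unfolding Q_def by (subst sum.atLeast_Suc_atMost) auto
    define st where "st = (\<lambda>k. s\<lparr>reg := (reg s)(vR := e, vX := x, vY := y, vM := Q k, vQ := k)\<rparr>)"
    have vst: "valid w (reg (st k))" if "k \<le> b" for k
      using v lt Qn[of k] n3 that unfolding st_def by (auto intro!: valid_upd)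
    have inner: "runs_within w ?A ?B (While vQ ?inner) (1 + real b * (1 + 22)) (st b) (return_pmf (st 0))"
    proof (rule det_While)
      fix k assume k: "k < b"
      have "X x (Suc k) * Y (Suc k) y \<le> n * n" using XY by (intro mult_mono) auto
      then have q: "X x (Suc k) * Y (Suc k) y < 2 ^ w" "X x (Suc k) < 2 ^ w" "Y (Suc k) y < 2 ^ w" "Q k < 2 ^ w"
        using nw Qn[of k] n3 XY le_less_trans by (blast, blast, blast, linarith)
      have o: "?A x (Suc k) = X x (Suc k)" "?B (Suc k) y = Y (Suc k) y"
        using xy k by (auto simp: matrix_oracle_def)
      have ev: "ev w ?A ?B (st (Suc k)) (V vM \<oplus> EntA (V vX) (V vQ) \<otimes> EntB (V vQ) (V vY)) = Q k"
        using q o QS[OF k] by (simp add: st_def)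
      have stq: "st (Suc k)\<lparr>reg := (reg (st (Suc k)))(vM := Q k)\<rparr> = s\<lparr>reg := (reg s)(vR := e, vX := x, vY := y, vM := Q k, vQ := Suc k)\<rparr>"
        by (simp add: st_def fun_upd_twist)
      have vq: "valid w ((reg s)(vR := e, vX := x, vY := y, vM := Q k, vQ := Suc k))"
        using v lt q k by (intro valid_upd) auto
      have "runs_within w ?A ?B ?inner 22 (st (Suc k)) (return_pmf (st k))"
        apply (intro tri_eqD[where f = "\<lambda>_. 0" and e = 0])
        apply (rule tri_assign)
           apply (use vst[of "Suc k"] k in simp, simp, simp)
        apply (simp only: ev stq)
        apply (rule tri_decr[where k = k])
            apply (use vq \<open>w > 0\<close> in simp_all)[4]
        apply (rule tri_Nil)
          apply (simp_all add: st_def)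
        done
      then show "reg (st (Suc k)) vQ \<noteq> 0 \<and> runs_within w ?A ?B ?inner 22 (st (Suc k)) (return_pmf (st k))"
        by (simp add: st_def)
    qed (simp add: st_def)
    have Q0: "Q 0 = P e" by (simp add: Q_def P_def x_def y_def)
    have Jn: "J e (s\<lparr>reg := (reg s)(vR := e, vX := x, vY := y, vM := Q 0, vQ := 0), mem := (mem s)(e := Q 0)\<rparr>)"
      unfolding J_def using vst[of 0] r m by (auto simp: st_def Q0)
    show "tri w ?A ?B ?body s (real (50 + 25 * b)) (J e) (\<lambda>_. 0) 0"
      apply (rule tri_decr[OF v \<open>w > 0\<close> r(1)], simp)
      apply (rule tri_assign, use v lt in simp, simp, simp)
      apply (rule tri_assign, use v lt r num in \<open>simp add: x_def\<close>, simp, simp)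
      apply (rule tri_assign, use v lt r num in \<open>simp add: x_def y_def\<close>, simp, simp)
      apply (rule tri_assign, use v lt r num in \<open>simp add: x_def y_def\<close>, simp, simp)
      apply (rule tri_Cons_det[where s' = "st 0"])
       apply (use inner r lt num in \<open>simp add: st_def x_def y_def Q_def\<close>)
      apply (rule tri_poke)
         apply (use vst[of 0] in simp, simp, simp)
      apply (rule tri_Nil)
        apply simp
       apply (use Jn in \<open>simp add: st_def\<close>)
      apply simp
      done
  qed (use that in \<open>auto simp: J_def\<close>)
  have ac: "a * c \<le> n * n" using abc by (intro mult_mono) auto
  then have acw: "a * c < 2 ^ w" using nw by linarith
  then have J0: "J (a * c) (s0\<lparr>reg := (reg s0)(vR := a * c)\<rparr>)"
    unfolding J_def using v0 r0 by (auto intro!: valid_upd)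
  have "1 + (50 + 25 * b) \<le> 76 * n" using abc n by linarith
  then have "a * c * (1 + (50 + 25 * b)) \<le> n * n * (76 * n)" by (intro mult_mono ac) auto
  then have "real (a * c * (1 + (50 + 25 * b))) \<le> real (n * n * (76 * n))" by (simp only: of_nat_le_iff)
  also have "\<dots> = 76 * real n ^ 3" by (simp add: power3_eq_cube)
  finally have "(\<Sum>k<a * c. 1 + real (50 + 25 * b)) \<le> 76 * real n ^ 3" by (simp add: algebra_simps)
  moreover have "2 ^ 3 \<le> real n ^ 3" using n by (intro power_mono) auto
  ultimately have T: "10 + (\<Sum>k<a * c. 1 + real (50 + 25 * b)) \<le> 100 * real n ^ 3" by simp
  have "tri w ?A ?B naive s0 (100 * real n ^ 3) (J 0) (\<lambda>_. 0) 0"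
    unfolding naive_def
    apply (rule tri_assign[OF v0], simp, simp)
    apply (rule tri_Cons)
     apply (use loop[OF J0] acw r0 in simp)
    apply (rule tri_Nil)
      apply (use T in simp)
     apply simp
    apply simp
    done
  then obtain D where D: "runs_within w ?A ?B naive (100 * real n ^ 3) s0 D" "\<forall>s\<in>set_pmf D. J 0 s"
    by (auto simp: tri_def)
  show "\<exists>D. runs_within w ?A ?B naive (100 * real n ^ 3) (init [n, a, b, c] blank) D
      \<and> (\<forall>s\<in>set_pmf D. \<forall>i\<in>{1..a}. \<forall>j\<in>{1..c}. mem s ((i - 1) * c + (j - 1)) = (\<Sum>k=1..b. X i k * Y k j))"
  proof (intro exI[of _ D] conjI ballI)
    show "runs_within w ?A ?B naive (100 * real n ^ 3) (init [n, a, b, c] blank) D"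
      using D(1) by (simp add: s0_def)
    fix s i j assume s: "s \<in> set_pmf D" and ij: "i \<in> {1..a}" "j \<in> {1..c}"
    let ?e = "(i - 1) * c + (j - 1)"
    show "mem s ?e = (\<Sum>k=1..b. X i k * Y k j)"
      using D(2) s ij row_major[OF ij] by (simp add: J_def P_def)
  qed
qed

section \<open>The set of admissible exponents\<close>

definition exponents :: "real \<Rightarrow> real set" where
  "exponents q = {\<tau>. \<exists>P K C. classical P \<and>
     (\<forall>n\<ge>2. \<forall>w. real w \<ge> K * log 2 (real n) \<longrightarrow>
        (\<forall>a b c. real a \<le> real n powr 1 \<and> real b \<le> real n powr q \<and> real c \<le> real n powr 1
           \<longrightarrow> multiplies w n P (C * real n powr \<tau>) a b c))}"

lemma omega_eq: "omega 1 q 1 = Inf (exponents q)"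
  by (simp add: omega_def exponents_def)

lemma exponents_3:
  assumes "q \<le> 1"
  shows "3 \<in> exponents q"
  unfolding exponents_def
proof (rule CollectI, rule exI[of _ naive], rule exI[of _ "real 8"], rule exI[of _ 100], intro conjI classical_naive allI impI)
  fix n w a b c :: nat
  assume n: "2 \<le> n" and w: "real 8 * log 2 (real n) \<le> real w"
    and abc: "real a \<le> real n powr 1 \<and> real b \<le> real n powr q \<and> real c \<le> real n powr 1"
  have "real n powr q \<le> real n powr 1" using assms n by (intro powr_mono) auto
  then have "a \<le> n" "b \<le> n" "c \<le> n" using abc n by auto
  moreover have "n ^ 8 \<le> 2 ^ w" using n w by (intro word_bound) auto
  ultimately show "multiplies w n naive (100 * real n powr 3) a b c"
    using naive_multiplies[OF n] n by (simp add: powr_realpow[of _ 3, simplified])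
qed

text \<open>Even an empty product takes one step, whereas \<open>C * real n powr \<tau>\<close>
  tends to 0 for negative \<tau>. So the infimum is taken over a set that is bounded below.\<close>

lemma exponents_nonneg:
  assumes "\<tau> \<in> exponents q"
  shows "0 \<le> \<tau>"
proof (rule ccontr)
  assume "\<not> 0 \<le> \<tau>"
  obtain P K C where P: "\<And>n w a b c. 2 \<le> n \<Longrightarrow> real w \<ge> K * log 2 (real n) \<Longrightarrow>
      real a \<le> real n powr 1 \<and> real b \<le> real n powr q \<and> real c \<le> real n powr 1
           \<Longrightarrow> multiplies w n P (C * real n powr \<tau>) a b c"
    using assms unfolding exponents_def by blast
  have 1: "1 \<le> C * real n powr \<tau>" if n: "2 \<le> n" for n
  proof -
    obtain w where "real w \<ge> K * log 2 (real n)" using real_arch_simple by blast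
    then have "multiplies w n P (C * real n powr \<tau>) 0 0 0" using n by (intro P) auto
    then obtain D A B s where "runs_within w A B P (C * real n powr \<tau>) s D"
      unfolding multiplies_def by (metis (full_types) bot_nat_0.extremum)
    then obtain t where "real t \<le> C * real n powr \<tau>" "exec w A B P t s D"
      by (auto simp: runs_within_def)
    moreover obtain s' where "s' \<in> set_pmf D" using set_pmf_not_empty[of D] by blast
    ultimately show ?thesis using changed_cells by fastforce
  qed
  have "(\<lambda>n. real n powr \<tau>) \<longlonglongrightarrow> 0"
    using \<open>\<not> 0 \<le> \<tau>\<close> by (intro tendsto_neg_powr filterlim_real_sequentially) auto
  then have "(\<lambda>n. C * real n powr \<tau>) \<longlonglongrightarrow> 0"
    using tendsto_mult_right_zero by blast
  then have "\<forall>\<^sub>F n in sequentially. C * real n powr \<tau> < 1"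
    by (rule order_tendstoD) simp
  then obtain n where "2 \<le> n" "C * real n powr \<tau> < 1"
    using eventually_at_top_linorder by (metis (no_types, lifting) nle_le order.refl)
  then show False using 1[of n] by linarith
qed

lemma exponents_bdd: "bdd_below (exponents q)"
  using exponents_nonneg by (intro bdd_belowI[of _ 0])

text \<open>A program that copes with inner dimensions up to n powr q' copes with those up to n powr
  q.\<close>

lemma exponents_antimono: "q \<le> q' \<Longrightarrow> exponents q' \<subseteq> exponents q"
proof
  fix \<tau> assume q: "q \<le> q'" and "\<tau> \<in> exponents q'"
  then obtain P K C where P: "classical P" "\<forall>n\<ge>2. \<forall>w. real w \<ge> K * log 2 (real n) \<longrightarrow>
        (\<forall>a b c. real a \<le> real n powr 1 \<and> real b \<le> real n powr q' \<and> real c \<le> real n powr 1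
           \<longrightarrow> multiplies w n P (C * real n powr \<tau>) a b c)"
    unfolding exponents_def by blast
  have "real n powr q \<le> real n powr q'" if "2 \<le> n" for n :: nat using q that by (intro powr_mono) auto
  then show "\<tau> \<in> exponents q"
    using P unfolding exponents_def by (intro CollectI exI[of _ P] exI[of _ K] exI[of _ C]) (meson order_trans)
qed

lemma omega_mono: "q \<le> q' \<Longrightarrow> q' \<le> 1 \<Longrightarrow> omega 1 q 1 \<le> omega 1 q' 1"
  unfolding omega_eq using exponents_3[of q']
  by (intro cInf_superset_mono exponents_bdd exponents_antimono) auto

lemma exponent_near:
  assumes "q \<le> 1" "0 < \<delta>"
  obtains \<tau> where "\<tau> \<in> exponents q" "\<tau> < omega 1 q 1 + \<delta>"
  using cInf_lessD[of "exponents q" "omega 1 q 1 + \<delta>"] exponents_3[OF assms(1)] assms(2)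
  unfolding omega_eq by (metis empty_iff less_add_same_cancel1)

subsection \<open>Choosing the width of the blocks\<close>

abbreviation (input) vBits :: nat where "vBits \<equiv> 1"
abbreviation (input) vIdx :: nat where "vIdx \<equiv> 30"

fun lg :: "nat \<Rightarrow> nat" where
  "lg n = (if n < 2 then 0 else Suc (lg (n div 2)))"

declare lg.simps [simp del]

lemma lg_bounds: "1 \<le> n \<Longrightarrow> 2 ^ lg n \<le> n \<and> n < 2 ^ Suc (lg n)"
proof (induction n rule: lg.induct)
  case (1 n)
  show ?case
  proof (cases "n < 2")
    case True
    then show ?thesis using 1(2) by (subst (1 2) lg.simps) simp
  next
    case False
    then have "2 ^ lg (n div 2) \<le> n div 2 \<and> n div 2 < 2 ^ Suc (lg (n div 2))" using 1 by simp
    then show ?thesis using False by (subst (1 2) lg.simps) auto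
  qed
qed

lemma lg_mono: "1 \<le> l \<Longrightarrow> l \<le> n \<Longrightarrow> lg l \<le> lg n"
proof -
  assume l: "1 \<le> l" "l \<le> n"
  then have "2 ^ lg l < (2 :: nat) ^ Suc (lg n)" using lg_bounds[of l] lg_bounds[of n] by linarith
  then have "lg l < Suc (lg n)" by (rule power_less_imp_less_exp[rotated]) simp
  then show ?thesis by simp
qed

lemma lg_log: "1 \<le> n \<Longrightarrow> real (lg n) \<le> log 2 (real n)" "1 \<le> n \<Longrightarrow> log 2 (real n) < real (lg n) + 1"
proof -
  assume n: "1 \<le> n"
  have "real (2 ^ lg n) \<le> real n" "real n < real (2 ^ Suc (lg n))"
    using lg_bounds[OF n] by (simp_all only: of_nat_le_iff of_nat_less_iff)
  then have "2 powr real (lg n) \<le> real n" "real n < 2 powr (real (lg n) + 1)"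
    by (simp_all add: powr_realpow powr_add)
  then show "real (lg n) \<le> log 2 (real n)" "log 2 (real n) < real (lg n) + 1"
    using n by (simp_all add: le_log_iff log_less_iff)
qed

text \<open>The interface between \<open>omega\<close> and the preprocessing. From N = lg n and p =
  lg l the expressions \<open>ei\<close> and \<open>ep\<close> compute, on the machine, which
  program of the list to use and the binary logarithm of the block width. Because of
  \<open>fp N p \<le> p\<close> the width divides \<open>2 ^ p\<close>. \<open>T\<close> bounds a
  single product, and all blocks together stay within a constant factor of
  \<open>strips_time\<close>.\<close>

definition suits :: "real \<Rightarrow> prog list \<Rightarrow> ex \<Rightarrow> ex \<Rightarrow> (nat \<Rightarrow> nat \<Rightarrow> nat) \<Rightarrow> (nat \<Rightarrow> nat \<Rightarrow> nat) \<Rightarrow> nat \<Rightarrow> real \<Rightarrow> bool" where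
  "suits \<epsilon> Ps ei ep fi fp K c \<longleftrightarrow> (\<forall>P\<in>set Ps. classical P) \<and> wf_ex ei 32 \<and> wf_ex ep 32
    \<and> (\<forall>w A B s N p. valid w (reg s) \<longrightarrow> reg s vBits = N \<longrightarrow> reg s vP = p \<longrightarrow> p \<le> N \<longrightarrow> K * (N + 1) < 2 ^ w
        \<longrightarrow> ev w A B s ei = fi N p \<and> (reg s vIdx = fi N p \<longrightarrow> ev w A B s ep = fp N p))
    \<and> (\<forall>N p. p \<le> N \<longrightarrow> fp N p \<le> p \<and> fi N p < length Ps)
    \<and> (\<forall>n w l. 2 \<le> n \<longrightarrow> real K * log 2 (real n) \<le> real w \<longrightarrow> l \<in> {1..n} \<longrightarrow>
        (\<exists>T. real n ^ 2 \<le> T \<and> real n / 2 ^ fp (lg n) (lg l) * T \<le> c * strips_time \<epsilon> n l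
          \<and> multiplies (w - 2) n (Ps ! fi (lg n) (lg l)) T n (2 ^ fp (lg n) (lg l)) n))"

text \<open>Simulated programs have two bits less. As log 2 n is at least 1, raising the constant by
  2 makes up for them.\<close>

lemma word_length_minus_2:
  assumes "2 \<le> n" "K\<^sub>0 + 2 \<le> real K" "real K * log 2 (real n) \<le> real w"
  shows "K\<^sub>0 * log 2 (real n) \<le> real (w - 2)"
proof -
  have "log 2 (real 2) \<le> log 2 (real n)" using assms(1) by (intro log_mono) auto
  then have 1: "1 \<le> log 2 (real n)" by simp
  then have "(K\<^sub>0 + 2) * log 2 (real n) \<le> real w"
    using assms(2,3) mult_right_mono[of "K\<^sub>0 + 2" "real K" "log 2 (real n)"] by linarith
  then have "K\<^sub>0 * log 2 (real n) \<le> real w - 2" using 1 by (simp add: algebra_simps)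
  then show ?thesis by linarith
qed

text \<open>Here one program serves all \<open>l\<close>. Rounding \<open>l\<close> down to a power
  of two at most doubles n divided by the width, and monotonicity of \<open>omega\<close> covers the
  smaller inner dimension.\<close>

lemma suits_attained:
  assumes omega_attained
  shows "\<exists>Ps ei ep fi fp K c. suits 0 Ps ei ep fi fp K c"
proof -
  obtain P K\<^sub>0 C where P: "classical P" "\<And>n w l. 2 \<le> n \<Longrightarrow> K\<^sub>0 * log 2 (real n) \<le> real w \<Longrightarrow> l \<in> {1..n} \<Longrightarrow>
      multiplies w n P (C * real n powr omega 1 (log (real n) (real l)) 1) n l n"
    using assms unfolding omega_attained_def by blast
  obtain K :: nat where K: "K\<^sub>0 + 2 \<le> real K" using real_arch_simple by blast
  have "\<exists>T. real n ^ 2 \<le> T \<and> real n / 2 ^ lg l * T \<le> 2 * C * strips_time 0 n l \<and> multiplies (w - 2) n P T n (2 ^ lg l) n"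
    if n: "2 \<le> n" and w: "real K * log 2 (real n) \<le> real w" and l: "l \<in> {1..n}" for n w l
  proof -
    let ?b = "2 ^ lg l :: nat"
    let ?T = "C * real n powr omega 1 (log (real n) (real ?b)) 1"
    have lb: "?b \<le> l" "l < 2 * ?b" using lg_bounds[of l] l by auto
    then have "?b \<in> {1..n}" using l by auto
    then have m: "multiplies (w - 2) n P ?T n ?b n"
      using P(2) n word_length_minus_2[OF n K w] by blast
    then have T: "real n ^ 2 \<le> ?T" using n by (intro multiplies_time) auto
    moreover have "0 < real n ^ 2" using n by simp
    ultimately have "0 < ?T" by linarith
    then have C: "0 \<le> C" using n by (simp add: zero_less_mult_iff)
    have "log (real n) (real ?b) \<le> log (real n) (real l)" "log (real n) (real l) \<le> 1"
      using lb(1) l n by (auto simp: log_le_one_cancel_iff simp del: of_nat_power)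
    then have "?T \<le> C * real n powr omega 1 (log (real n) (real l)) 1"
      using n C by (intro mult_left_mono powr_mono omega_mono) auto
    moreover have "real n / 2 ^ lg l \<le> 2 * (real n / real l)"
    proof -
      have "real l \<le> real (2 * 2 ^ lg l)" using lb(2) by (simp only: of_nat_le_iff)
      then have "2 * real n / (2 * 2 ^ lg l) \<le> 2 * real n / real l" using l by (intro divide_left_mono) auto
      then show ?thesis by simp
    qed
    ultimately have "real n / 2 ^ lg l * ?T \<le> 2 * (real n / real l) * (C * real n powr omega 1 (log (real n) (real l)) 1)"
      using \<open>0 < ?T\<close> by - (rule mult_mono, auto)
    then show ?thesis using T m by (auto simp: strips_time_def algebra_simps intro!: exI[of _ ?T])
  qed
  then have "suits 0 [P] (N 0) (V vP) (\<lambda>_ _. 0) (\<lambda>_ p. p) K (2 * C)"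
    unfolding suits_def using P(1) by auto
  then show ?thesis by blast
qed

text \<open>
  For \<open>\<epsilon> > 0\<close> finitely many multiplication programs, for the exponents \<open>i / m\<close>, are enough:
  a block of width \<open>2 ^ fp N p\<close>, which is about \<open>n powr (i / m)\<close>, is narrower than \<open>l\<close> by a
  factor of at most \<open>8 * n powr (1 / m)\<close>.
\<close>

lemma suits_grid:
  assumes "0 < \<epsilon>"
  shows "\<exists>Ps ei ep fi fp K c. suits \<epsilon> Ps ei ep fi fp K c"
proof -
  \<comment> \<open>One half of \<epsilon> pays for exponents that only approach the infimum, the
    other half for the spacing 1 / m of the grid.\<close>
  obtain m :: nat where m: "2 / \<epsilon> \<le> real m" using real_arch_simple by blast
  have "0 < 2 / \<epsilon>" using assms by simp
  then have m0: "0 < real m" "0 < m" using m by linarith+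
  have m\<epsilon>: "1 / real m \<le> \<epsilon> / 2" using m m0 assms by (simp add: field_simps)
  have "\<exists>P K C \<tau>. i < m \<longrightarrow> classical P \<and> \<tau> < omega 1 (real i / real m) 1 + \<epsilon> / 2
     \<and> (\<forall>n\<ge>2. \<forall>w. real w \<ge> K * log 2 (real n) \<longrightarrow>
        (\<forall>a b c. real a \<le> real n powr 1 \<and> real b \<le> real n powr (real i / real m) \<and> real c \<le> real n powr 1
           \<longrightarrow> multiplies w n P (C * real n powr \<tau>) a b c))" for i
  proof (cases "i < m")
    case True
    then have "real i / real m \<le> 1" using m0 by simp
    then obtain \<tau> where "\<tau> \<in> exponents (real i / real m)" "\<tau> < omega 1 (real i / real m) 1 + \<epsilon> / 2"
      using exponent_near assms by (metis half_gt_zero)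
    then show ?thesis unfolding exponents_def by blast
  qed simp
  then obtain P K\<^sub>0 C \<tau> where P: "\<And>i. i < m \<Longrightarrow> classical (P i)" "\<And>i. i < m \<Longrightarrow> \<tau> i < omega 1 (real i / real m) 1 + \<epsilon> / 2"
    "\<And>i n w a b c. i < m \<Longrightarrow> 2 \<le> n \<Longrightarrow> K\<^sub>0 i * log 2 (real n) \<le> real w \<Longrightarrow> real a \<le> real n powr 1 \<Longrightarrow>
      real b \<le> real n powr (real i / real m) \<Longrightarrow> real c \<le> real n powr 1 \<Longrightarrow> multiplies w n (P i) (C i * real n powr \<tau> i) a b c"
    by metis
  obtain K1 :: nat where K1: "(\<Sum>i<m. \<bar>K\<^sub>0 i\<bar>) + 2 \<le> real K1" using real_arch_simple by blast
  \<comment> \<open>\<open>K\<close> covers the constants of all programs of the grid and, through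
    \<open>m\<close>, lets the numerators of the two quotients fit into a word.\<close>
  define K where "K = K1 + m"
  have K: "K\<^sub>0 i + 2 \<le> real K" if "i < m" for i
  proof -
    have "\<bar>K\<^sub>0 i\<bar> \<le> (\<Sum>i<m. \<bar>K\<^sub>0 i\<bar>)" using that by (intro member_le_sum) auto
    then show ?thesis using K1 unfolding K_def by simp
  qed
  define C1 where "C1 = (\<Sum>i<m. \<bar>C i\<bar>)"
  have C1: "C i \<le> C1" if "i < m" for i
  proof -
    have "\<bar>C i\<bar> \<le> C1" unfolding C1_def using that by (intro member_le_sum) auto
    then show ?thesis by linarith
  qed
  have C10: "0 \<le> C1" unfolding C1_def by (intro sum_nonneg) auto
  \<comment> \<open>Both quotients are rounded down. As N + 1 exceeds the logarithm of n, the grid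
    point i / m is at most \<open>log (real n) (real l)\<close>; and as N does not exceed it, the
    width is at most n powr (i / m).\<close>
  define fi where "fi = (\<lambda>N p. (m * p) div (N + 1))"
  define fp where "fp = (\<lambda>N p. (N * fi N p) div m)"
  have fi: "fi N p < m" if "p \<le> N" for N p
  proof -
    have "m * p < m * (N + 1)" using that m0 by (intro mult_strict_left_mono) auto
    then show ?thesis unfolding fi_def by (intro less_mult_imp_div_less) (simp add: mult.commute)
  qed
  have fi_le: "fi N p * (N + 1) \<le> m * p" for N p unfolding fi_def by (rule div_times_less_eq_dividend)
  have fp_le: "fp N p * m \<le> N * fi N p" for N p unfolding fp_def by (rule div_times_less_eq_dividend)
  have fp: "fp N p \<le> p" for N p
  proof -
    have "m * (fp N p * (N + 1)) = fp N p * m * (N + 1)" by (simp only: mult_ac)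
    also have "\<dots> \<le> N * fi N p * (N + 1)" by (intro mult_right_mono fp_le) simp
    also have "\<dots> = N * (fi N p * (N + 1))" by (simp only: mult_ac)
    also have "\<dots> \<le> N * (m * p)" by (intro mult_left_mono fi_le) simp
    also have "\<dots> = m * (p * N)" by (simp only: mult_ac)
    finally have "fp N p * (N + 1) \<le> p * N" using m0 by simp
    also have "\<dots> \<le> p * (N + 1)" by simp
    finally show ?thesis by (simp only: mult_le_cancel2)
  qed
  \<comment> \<open>The rounding in \<open>fi\<close> costs N / m and the rounding in
    \<open>fp\<close> costs 1; the other 1 comes from the denominator N + 1 in place of N.\<close>
  have width: "real p \<le> real (fp N p) + 2 + real N / real m" if pN: "p \<le> N" for N p
  proof -
    have "m * p < (N + 1) + (N + 1) * fi N p" unfolding fi_def by (rule dividend_less_times_div) simp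
    also have "\<dots> = (fi N p + 1) * (N + 1)" by (simp add: algebra_simps)
    finally have "m * p < (fi N p + 1) * (N + 1)" .
    then have "real m * real p < (real (fi N p) + 1) * (real N + 1)"
      by (metis (mono_tags, lifting) of_nat_1 of_nat_add of_nat_less_iff of_nat_mult)
    then have 1: "real p * real m / (real N + 1) < real (fi N p) + 1" by (simp add: field_simps)
    have "N * fi N p < m + m * fp N p" using m0(2) unfolding fp_def by (rule dividend_less_times_div)
    also have "\<dots> = (fp N p + 1) * m" by (simp add: algebra_simps)
    finally have "N * fi N p < (fp N p + 1) * m" .
    then have "real N * real (fi N p) < (real (fp N p) + 1) * real m"
      by (metis (mono_tags, lifting) of_nat_1 of_nat_add of_nat_less_iff of_nat_mult)
    then have 2: "real N * real (fi N p) / real m < real (fp N p) + 1" using m0 by (simp add: field_simps)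
    have "real N * (real p * real m / (real N + 1)) \<le> real N * (real (fi N p) + 1)"
      using 1 by (intro mult_left_mono) auto
    then have "real N * (real p * real m / (real N + 1)) / real m \<le> real N * (real (fi N p) + 1) / real m"
      using m0 by (intro divide_right_mono) auto
    moreover have "real N * (real p * real m / (real N + 1)) / real m = real N * real p / (real N + 1)"
    proof -
      have "x * (y * z / v) / z = x * y / v" if "z \<noteq> 0" for x y z v :: real using that by simp
      from this[of "real m"] show ?thesis using m0 by simp
    qed
    moreover have "real N * (real (fi N p) + 1) / real m = real N * real (fi N p) / real m + real N / real m"
      by (simp add: distrib_left add_divide_distrib)
    ultimately have "real N * real p / (real N + 1) \<le> real N * real (fi N p) / real m + real N / real m"
      by linarith
    moreover have "real N * real p / (real N + 1) = real p - real p / (real N + 1)" by (simp add: field_simps)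
    moreover have "real p / (real N + 1) \<le> 1" using pN by simp
    ultimately show ?thesis using 2 by linarith
  qed
  have "\<exists>T. real n ^ 2 \<le> T \<and> real n / 2 ^ fp (lg n) (lg l) * T \<le> 8 * C1 * strips_time \<epsilon> n l
      \<and> multiplies (w - 2) n (map P [0..<m] ! fi (lg n) (lg l)) T n (2 ^ fp (lg n) (lg l)) n"
    if n: "2 \<le> n" and w: "real K * log 2 (real n) \<le> real w" and l: "l \<in> {1..n}" for n w l
  proof -
    define N where "N = lg n"
    define p where "p = lg l"
    define i where "i = fi N p"
    define k where "k = fp N p"
    have pN: "p \<le> N" unfolding p_def N_def using l by (intro lg_mono) auto
    have im: "i < m" unfolding i_def by (rule fi[OF pN])
    have log2: "0 < log 2 (real n)" "log 2 (real n) \<le> real N + 1" "real p \<le> log 2 (real l)" "real N \<le> log 2 (real n)"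
      unfolding N_def p_def using lg_log[of n] lg_log[of l] n l by auto
    have "real i / real m \<le> real p / (real N + 1)"
    proof -
      have "real (i * (N + 1)) \<le> real (m * p)" unfolding i_def by (simp only: of_nat_le_iff fi_le)
      then show ?thesis using m0 by (simp add: field_simps)
    qed
    also have "\<dots> \<le> log 2 (real l) / log 2 (real n)"
      using log2 by (intro frac_le) auto
    also have "\<dots> = log (real n) (real l)" by (simp add: log_def)
    finally have q: "real i / real m \<le> log (real n) (real l)" .
    have q1: "log (real n) (real l) \<le> 1" using l n by (auto simp: log_le_one_cancel_iff)
    have N2: "2 powr real N \<le> real n"
      using log2(4) n by (simp add: le_log_iff)
    have "real (2 ^ k) \<le> real n powr (real i / real m)"
    proof -
      have "real (k * m) \<le> real (N * i)" unfolding k_def i_def by (simp only: of_nat_le_iff fp_le)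
      then have "real k \<le> real N * (real i / real m)" using m0 by (simp add: field_simps)
      then have "2 powr real k \<le> 2 powr (real N * (real i / real m))" by (intro powr_mono) auto
      also have "\<dots> = (2 powr real N) powr (real i / real m)" by (simp add: powr_powr)
      also have "\<dots> \<le> real n powr (real i / real m)" using N2 by (intro powr_mono2) auto
      finally show ?thesis by (simp add: powr_realpow)
    qed
    then have mul: "multiplies (w - 2) n (P i) (C i * real n powr \<tau> i) n (2 ^ k) n"
      using n word_length_minus_2[OF n K[OF im] w] by (intro P(3)[OF im n]) auto
    then have T: "real n ^ 2 \<le> C i * real n powr \<tau> i" using n by (intro multiplies_time) auto
    have "\<tau> i \<le> omega 1 (log (real n) (real l)) 1 + \<epsilon> / 2"
      using P(2)[OF im] omega_mono[OF q q1] by linarith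
    then have "C i * real n powr \<tau> i \<le> C1 * real n powr (omega 1 (log (real n) (real l)) 1 + \<epsilon> / 2)"
      using C1[OF im] C10 n by (intro mult_mono powr_mono) auto
    \<comment> \<open>The factor 8 is a 2 from l < 2 * 2 ^ p times the 4 that stems from the summand
      2 in \<open>width\<close>.\<close>
    moreover have "real n / 2 ^ k \<le> 8 * (real n / real l) * real n powr (\<epsilon> / 2)"
    proof -
      have "l < 2 * 2 ^ p" using lg_bounds[of l] l by (simp add: p_def)
      then have "real l \<le> real (2 * 2 ^ p)" by (simp only: of_nat_le_iff)
      also have "\<dots> = 2 * 2 ^ p" by simp
      also have "2 ^ p = 2 powr real p" by (simp add: powr_realpow)
      also have "2 powr real p \<le> 2 powr (real k + 2 + real N * (1 / real m))"
        using width[OF pN] unfolding k_def by (intro powr_mono) auto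
      also have "\<dots> = 4 * 2 ^ k * (2 powr real N) powr (1 / real m)"
        by (simp only: powr_add powr_powr[symmetric]) (simp add: powr_realpow)
      also have "(2 powr real N) powr (1 / real m) \<le> real n powr (1 / real m)"
        using N2 by (intro powr_mono2) auto
      also have "real n powr (1 / real m) \<le> real n powr (\<epsilon> / 2)"
        using m\<epsilon> n by (intro powr_mono) auto
      finally have "real l \<le> 2 ^ k * (8 * real n powr (\<epsilon> / 2))" by (simp add: mult_left_mono)
      then have "real n * real l \<le> real n * (2 ^ k * (8 * real n powr (\<epsilon> / 2)))" by (intro mult_left_mono) auto
      then show ?thesis using l by (simp add: field_simps)
    qed
    moreover have "0 \<le> C i * real n powr \<tau> i" using T by (rule order_trans[rotated]) simp
    ultimately have "real n / 2 ^ k * (C i * real n powr \<tau> i) \<le>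
        8 * (real n / real l) * real n powr (\<epsilon> / 2) * (C1 * real n powr (omega 1 (log (real n) (real l)) 1 + \<epsilon> / 2))"
      by - (rule mult_mono, auto)
    also have "\<dots> = 8 * C1 * ((real n / real l) * (real n powr (\<epsilon> / 2) * real n powr (omega 1 (log (real n) (real l)) 1 + \<epsilon> / 2)))"
      by simp
    also have "\<dots> = 8 * C1 * strips_time \<epsilon> n l"
      unfolding strips_time_def powr_add[symmetric] by (simp add: algebra_simps)
    finally have "real n / 2 ^ k * (C i * real n powr \<tau> i) \<le> 8 * C1 * strips_time \<epsilon> n l" .
    then show ?thesis
      using T mul im unfolding N_def[symmetric] p_def[symmetric] i_def[symmetric] k_def[symmetric]
      by (intro exI[of _ "C i * real n powr \<tau> i"]) simp
  qed
  moreover have "ev w A B s (N m \<otimes> V vP \<oslash> (V vBits \<oplus> N 1)) = fi M p"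
      "reg s vIdx = fi M p \<longrightarrow> ev w A B s (V vBits \<otimes> V vIdx \<oslash> N m) = fp M p"
    if "reg s vBits = M" "reg s vP = p" "p \<le> M" "K * (M + 1) < 2 ^ w" for w A B s M p
  proof -
    have "m * (M + 1) \<le> K * (M + 1)" unfolding K_def by (intro mult_right_mono) auto
    then have mN: "m * (M + 1) < 2 ^ w" using that(4) by linarith
    have le: "m \<le> m * (M + 1)" "M + 1 \<le> m * (M + 1)" "m * p \<le> m * (M + 1)"
    proof -
      show "m \<le> m * (M + 1)" by simp
      show "M + 1 \<le> m * (M + 1)" using mult_le_mono1[of 1 m "M + 1"] m0 by simp
      show "m * p \<le> m * (M + 1)" by (rule mult_le_mono2) (use that(3) in simp)
    qed
    have lt: "m < 2 ^ w" "M + 1 < 2 ^ w" "m * p < 2 ^ w"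
      by (rule le_less_trans[OF le(1) mN], rule le_less_trans[OF le(2) mN], rule le_less_trans[OF le(3) mN])
    have "0 \<le> (\<Sum>i<m. \<bar>K\<^sub>0 i\<bar>)" by (intro sum_nonneg) simp
    then have "2 \<le> real K1" using K1 by linarith
    then have K2: "2 \<le> K1" by simp
    have "2 * 1 \<le> K * (M + 1)" using K2 unfolding K_def by (intro mult_mono) auto
    then have one: "1 mod 2 ^ w = (1 :: nat)" using that(4) by (intro mod_less) linarith
    have "M * fi M p \<le> (M + 1) * m" using fi[OF that(3)] by (intro mult_le_mono) auto
    then have fil: "M * fi M p < 2 ^ w" using mN by (simp add: mult.commute)
    have fiw: "fi M p < 2 ^ w" using less_trans[OF fi[OF that(3)] lt(1)] .
    show "ev w A B s (N m \<otimes> V vP \<oslash> (V vBits \<oplus> N 1)) = fi M p"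
      using lt fiw one that(1,2) by (simp add: fi_def)
    have "fp M p \<le> M * fi M p" unfolding fp_def by simp
    then have "fp M p < 2 ^ w" using fil by (rule le_less_trans)
    then show "reg s vIdx = fi M p \<longrightarrow> ev w A B s (V vBits \<otimes> V vIdx \<oslash> N m) = fp M p"
      using lt fil that(1) by (simp add: fp_def)
  qed
  ultimately have "suits \<epsilon> (map P [0..<m]) (N m \<otimes> V vP \<oslash> (V vBits \<oplus> N 1)) (V vBits \<otimes> V vIdx \<oslash> N m) fi fp K (8 * C1)"
    unfolding suits_def using P(1) fi fp by (auto simp del: ev.simps)
  then show ?thesis by blast
qed

section \<open>Preprocessing\<close>

abbreviation (input) vPP :: nat where "vPP \<equiv> 2"
abbreviation (input) vS :: nat where "vS \<equiv> 3"
abbreviation (input) vC :: nat where "vC \<equiv> 29"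
abbreviation (input) vT :: nat where "vT \<equiv> 31"

definition log_prog :: "nat \<Rightarrow> nat \<Rightarrow> nat \<Rightarrow> prog" where
  "log_prog r k h = blk [assign k (N 0), assign h (N 1), assign vCont (N 1 \<prec> V r),
     While vCont (blk [assign k (V k \<oplus> N 1), assign h (V h \<otimes> N 2), assign vCont (V h \<otimes> N 2 \<prec> V r \<oplus> N 1)])]"

definition pow_prog :: prog where
  "pow_prog = blk [assign vLB (N 1), assign vCont (V vPP),
     While vCont (blk [assign vLB (V vLB \<otimes> N 2), decr vCont])]"

text \<open>The word length is not among the inputs. It is recovered from 0 - 1, the word of all
  ones: divided by 4 it gives \<open>h - 1\<close>, and then 2 * (h - 1) + 2 is
  \<open>2 * h\<close>.\<close>

definition prep :: "ex \<Rightarrow> ex \<Rightarrow> prog" where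
  "prep ei ep = blk [assign vN (V 0), assign vL (V 1), log_prog vN vBits vH, log_prog vL vP vS,
     assign vIdx ei, assign vPP ep, pow_prog, assign vMask ((N 0 \<ominus> N 1) \<oslash> N 4),
     assign vHB (N 2 \<otimes> V vMask \<oplus> N 2), assign vTag (N 0), assign vVL (N 0)]"

text \<open>The initial registers [n, a, b, c] that \<open>multiplies\<close> prescribes, with a = c
  = n and the block width for b.\<close>

fun start_value :: "nat \<Rightarrow> ex" where
  "start_value r = (if r = 2 then V vLB else if r < 4 then V vN else N 0)"

primrec setup_regs :: "nat \<Rightarrow> prog" where
  "setup_regs 0 = Skip"
| "setup_regs (Suc m) = Seq (setup_regs m) (assign (64 + m) (start_value m))"

primrec select :: "prog list \<Rightarrow> prog" where
  "select [] = Skip"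
| "select (c # cs) = Cond vT (blk [decr vT, select cs]) c"

text \<open>Blocks are scanned in increasing order and overwrite each other, so the last one with a
  non-zero product remains. What is stored is the number of the aligned interval of length
  \<open>vS\<close> around it, plus 1, so that 0 means no witness.\<close>

definition scan :: prog where
  "scan = blk [assign vR (V vN \<otimes> V vN), While vR (blk [decr vR, assign vFlag (N 0 \<prec> cell_value vR),
     Cond vFlag (poke (N 4 \<otimes> V vN \<oplus> V vR) (V vVL \<oslash> V vS \<oplus> N 1)) Skip])]"

definition multiply :: "nat \<Rightarrow> prog list \<Rightarrow> prog" where
  "multiply m Ps = blk [setup_regs m, assign vT (V vIdx), select (map sim Ps)]"

text \<open>One block more than the quotient is taken, because the blocks start at index 0 and must
  include the index n.\<close>

definition blocks :: "nat \<Rightarrow> prog list \<Rightarrow> prog" where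
  "blocks m Ps = blk [assign vC (V vN \<oslash> V vLB \<oplus> N 1), While vC (blk [assign vTag (V vTag \<oplus> N 1),
     multiply m Ps, scan, assign vVL (V vVL \<oplus> V vLB), decr vC])]"

section \<open>Correctness of the auxiliary programs\<close>

lemma log_prog_correct:
  assumes valid: "valid w (reg s)" and big: "100 \<le> (2 :: nat) ^ w" and R: "reg s r = R" "1 \<le> R" "4 * R < 2 ^ w"
    and regs: "r < 32" "k < 32" "h < 32" "distinct [r, k, h, vCont]"
  shows "runs_within w A B (log_prog r k h) (20 + 30 * real (lg R)) s
    (return_pmf (s\<lparr>reg := (reg s)(k := lg R, h := 2 ^ lg R, vCont := 0)\<rparr>))"
proof -
  define p where "p = lg R"
  note num = numeral_mod_word[OF big]
  have p: "2 ^ p \<le> R" "R < 2 ^ Suc p" using lg_bounds[OF R(2)] by (auto simp: p_def)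
  have ne: "k \<noteq> r" "h \<noteq> r" "k \<noteq> h" "h \<noteq> k" "r \<noteq> k" "r \<noteq> h" "k \<noteq> vCont" "h \<noteq> vCont" "r \<noteq> vCont" "vCont \<noteq> k" "vCont \<noteq> h"
    using regs(4) by auto
  have pw: "p < 2 ^ w" using p(1) R(3) less_exp[of p] by linarith
  define cf where "cf = (\<lambda>i :: nat. if i = 0 then 0 else (1 :: nat))"
  have cf: "cf i < 2 ^ w" for i using big by (simp add: cf_def)
  define st where "st = (\<lambda>i. s\<lparr>reg := (reg s)(k := p - i, h := 2 ^ (p - i), vCont := cf i)\<rparr>)"
  have iff: "2 * 2 ^ j \<le> R \<longleftrightarrow> j < p" for j
  proof
    assume "2 * 2 ^ j \<le> R"
    then have "(2 :: nat) ^ Suc j < 2 ^ Suc p" using p(2) unfolding power_Suc by linarith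
    then have "Suc j < Suc p" by (rule power_less_imp_less_exp[rotated]) simp
    then show "j < p" by simp
  next
    assume "j < p"
    then have "(2 :: nat) ^ Suc j \<le> 2 ^ p" by (intro power_increasing) auto
    then show "2 * 2 ^ j \<le> R" using p(1) by simp
  qed
  have loop: "runs_within w A B (While vCont (blk [assign k (V k \<oplus> N 1), assign h (V h \<otimes> N 2), assign vCont (V h \<otimes> N 2 \<prec> V r \<oplus> N 1)]))
     (1 + real p * (1 + 25)) (st p) (return_pmf (st 0))"
  proof (rule det_While)
    fix i assume i: "i < p"
    define j where "j = p - Suc i"
    have j: "p - i = Suc j" "j < p" using i by (auto simp: j_def)
    have jR: "2 * 2 ^ j \<le> R" using iff j(2) by blast
    have lt: "Suc j < 2 ^ w" "2 * 2 ^ j < (2 :: nat) ^ w" "2 * (2 * 2 ^ j) < (2 :: nat) ^ w" "R + 1 < 2 ^ w" "j < 2 ^ w" "2 ^ j < (2 :: nat) ^ w"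
      using j(2) pw jR R(3) R(2) by linarith+
    define H where "H = (2 :: nat) ^ Suc j"
    have H: "H < 2 ^ w" "2 * H < 2 ^ w" using lt by (simp_all add: H_def)
    have cond: "of_bool (H * 2 < R + 1) = cf i"
      using iff[of "Suc j"] j by (auto simp: cf_def H_def)
    have v: "valid w ((reg s)(k := j, h := 2 ^ j, vCont := cf (Suc i)))"
      using valid regs lt cf by (intro valid_upd) auto
    define s1 where "s1 = s\<lparr>reg := (reg s)(k := Suc j, h := 2 ^ j, vCont := cf (Suc i))\<rparr>"
    define s2 where "s2 = s\<lparr>reg := (reg s)(k := Suc j, h := H, vCont := cf (Suc i))\<rparr>"
    have v1: "valid w (reg s1)" using valid regs lt cf by (simp add: s1_def)
    have v2: "valid w (reg s2)" using valid regs lt cf H by (simp add: s2_def)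
    have st1: "st (Suc i) = s\<lparr>reg := (reg s)(k := j, h := 2 ^ j, vCont := cf (Suc i))\<rparr>" by (simp add: st_def j_def)
    have r1: "runs_within w A B (assign k (V k \<oplus> N 1)) 6 (st (Suc i)) (return_pmf s1)"
    proof -
      have "ev w A B (st (Suc i)) (V k \<oplus> N 1) = Suc j" using num lt ne by (simp add: st1)
      moreover have "st (Suc i)\<lparr>reg := (reg (st (Suc i)))(k := Suc j)\<rparr> = s1"
        using ne by (auto simp: st1 s1_def fun_eq_iff)
      moreover have "valid w (reg (st (Suc i)))" using v by (simp add: st1)
      ultimately show ?thesis using assign_correct[of w "st (Suc i)" "V k \<oplus> N 1" k A B] regs by (simp del: ev.simps)
    qed
    have r2: "runs_within w A B (assign h (V h \<otimes> N 2)) 6 s1 (return_pmf s2)"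
    proof -
      have "ev w A B s1 (V h \<otimes> N 2) = H" using num lt ne by (simp add: s1_def H_def mult.commute)
      moreover have "s1\<lparr>reg := (reg s1)(h := H)\<rparr> = s2"
        using ne by (auto simp: s1_def s2_def fun_eq_iff)
      ultimately show ?thesis using assign_correct[of w s1 "V h \<otimes> N 2" h A B] v1 regs by (simp del: ev.simps)
    qed
    have r3: "runs_within w A B (assign vCont (V h \<otimes> N 2 \<prec> V r \<oplus> N 1)) 12 s2 (return_pmf (st i))"
    proof -
      have "ev w A B s2 (V h \<otimes> N 2) = H * 2" using num H ne by (simp add: s2_def mult.commute)
      moreover have "ev w A B s2 (V r \<oplus> N 1) = R + 1" using num lt ne R(1) by (simp add: s2_def)
      ultimately have "ev w A B s2 (V h \<otimes> N 2 \<prec> V r \<oplus> N 1) = cf i mod 2 ^ w"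
        unfolding cond[symmetric] by (subst ev.simps) (simp only: arith.simps)
      moreover have "s2\<lparr>reg := (reg s2)(vCont := cf i)\<rparr> = st i"
        using ne j by (auto simp: s2_def st_def H_def fun_eq_iff)
      ultimately show ?thesis using assign_correct[of w s2 "V h \<otimes> N 2 \<prec> V r \<oplus> N 1" vCont A B] v2 regs cf[of i] by (simp del: ev.simps)
    qed
    have "runs_within w A B (blk [assign k (V k \<oplus> N 1), assign h (V h \<otimes> N 2), assign vCont (V h \<otimes> N 2 \<prec> V r \<oplus> N 1)]) 25
        (st (Suc i)) (return_pmf (st i))"
      apply (rule tri_eqD[where f = "\<lambda>_. 0" and e = 0])
      apply (rule tri_Cons_det[OF r1])
      apply (rule tri_Cons_det[OF r2])
      apply (rule tri_Cons_det[OF r3])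
      apply (rule tri_Nil, simp_all)
      done
    then show "reg (st (Suc i)) vCont \<noteq> 0 \<and> runs_within w A B (blk [assign k (V k \<oplus> N 1), assign h (V h \<otimes> N 2), assign vCont (V h \<otimes> N 2 \<prec> V r \<oplus> N 1)]) 25
        (st (Suc i)) (return_pmf (st i))"
      by (simp add: st_def cf_def)
  qed (simp add: st_def cf_def)
  have c0: "of_bool (1 < R) = cf p" using iff[of 0] by (auto simp: cf_def)
  define t1 where "t1 = s\<lparr>reg := (reg s)(k := 0, h := 1)\<rparr>"
  have one: "1 < (2 :: nat) ^ w" using big by linarith
  have vt: "valid w (reg t1)" using valid regs one by (simp add: t1_def)
  have r0: "runs_within w A B (assign vCont (N 1 \<prec> V r)) 6 t1 (return_pmf (st p))"
  proof -
    have "ev w A B t1 (N 1 \<prec> V r) = of_bool (1 < R) mod 2 ^ w"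
      using num ne R(1) by (simp add: t1_def)
    moreover have "t1\<lparr>reg := (reg t1)(vCont := cf p)\<rparr> = st p"
      using ne by (auto simp: t1_def st_def fun_eq_iff)
    ultimately show ?thesis using assign_correct[of w t1 "N 1 \<prec> V r" vCont A B] vt regs cf[of p] c0 by (simp del: ev.simps)
  qed
  have fin: "st 0 = s\<lparr>reg := (reg s)(k := lg R, h := 2 ^ lg R, vCont := 0)\<rparr>" by (simp add: st_def cf_def p_def)
  show ?thesis
    unfolding log_prog_def fin[symmetric]
    apply (rule tri_eqD[where f = "\<lambda>_. 0" and e = 0])
    apply (rule tri_assign[OF valid], simp, use regs in simp)
    apply (rule tri_assign, use valid regs in simp, simp, use regs in simp)
    apply (rule tri_Cons_det[where s' = "st p"])
     apply (use r0 num in \<open>simp add: t1_def\<close>)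
    apply (rule tri_Cons_det[OF loop])
    apply (rule tri_Nil)
      apply (simp_all add: p_def)
    done
qed

lemma pow_prog_correct:
  assumes valid: "valid w (reg s)" and big: "100 \<le> (2 :: nat) ^ w" and pp: "reg s vPP = pp" "2 * 2 ^ pp < (2 :: nat) ^ w"
  shows "runs_within w A B pow_prog (20 + 20 * real pp) s (return_pmf (s\<lparr>reg := (reg s)(vLB := 2 ^ pp, vCont := 0)\<rparr>))"
proof -
  note num = numeral_mod_word[OF big]
  have "0 < w" using big by (cases w) auto
  have one: "1 < (2 :: nat) ^ w" using big by linarith
  define st where "st = (\<lambda>i. s\<lparr>reg := (reg s)(vLB := 2 ^ (pp - i), vCont := i)\<rparr>)"
  have loop: "runs_within w A B (While vCont (blk [assign vLB (V vLB \<otimes> N 2), decr vCont])) (1 + real pp * (1 + 14)) (st pp) (return_pmf (st 0))"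
  proof (rule det_While)
    fix i assume i: "i < pp"
    define j where "j = pp - Suc i"
    have j: "pp - i = Suc j" using i by (auto simp: j_def)
    have "(2 :: nat) ^ Suc j \<le> 2 ^ pp" using i by (intro power_increasing) (auto simp: j_def)
    then have lt: "2 * 2 ^ j < (2 :: nat) ^ w" "2 ^ j < (2 :: nat) ^ w" using pp(2) unfolding power_Suc by linarith+
    have iw: "Suc i < 2 ^ w" using i validD(1)[OF valid, of vPP] pp(1) by simp
    have "runs_within w A B (blk [assign vLB (V vLB \<otimes> N 2), decr vCont]) 14 (st (Suc i)) (return_pmf (st i))"
      unfolding st_def j j_def[symmetric]
      apply (rule tri_eqD[where f = "\<lambda>_. 0" and e = 0])
      apply (rule tri_assign)
         apply (use valid lt iw in simp, simp, simp)
      apply (rule tri_decr[where k = i])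
          apply (use valid lt iw num \<open>0 < w\<close> in \<open>simp_all add: mult.commute\<close>)[4]
      apply (rule tri_Nil)
        apply (use num lt in \<open>simp_all add: mult.commute fun_upd_twist\<close>)
      done
    then show "reg (st (Suc i)) vCont \<noteq> 0 \<and> runs_within w A B (blk [assign vLB (V vLB \<otimes> N 2), decr vCont]) 14 (st (Suc i)) (return_pmf (st i))"
      by (simp add: st_def)
  qed (simp add: st_def)
  show ?thesis
    unfolding pow_prog_def
    apply (rule tri_eqD[where f = "\<lambda>_. 0" and e = 0])
    apply (rule tri_assign[OF valid], simp, simp)
    apply (rule tri_assign, use valid one \<open>0 < w\<close> in simp, simp, simp)
    apply (rule tri_Cons_det[where s' = "st 0"])
     apply (use loop num pp in \<open>simp add: st_def\<close>)
    apply (rule tri_Nil)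
      apply (simp_all add: st_def)
    done
qed

lemma setup_regs_correct:
  assumes valid: "valid w (reg s)"
  shows "runs_within w A B (setup_regs m) (1 + 3 * real m) s
    (return_pmf (s\<lparr>reg := (\<lambda>r. if 64 \<le> r \<and> r < 64 + m then ev w A B s (start_value (r - 64)) else reg s r)\<rparr>))"
proof (induction m)
  case 0
  have "(\<lambda>r. if 64 \<le> r \<and> r < 64 + 0 then ev w A B s (start_value (r - 64)) else reg s r) = reg s"
    by (rule ext) (simp del: start_value.simps)
  then have "s\<lparr>reg := (\<lambda>r. if 64 \<le> r \<and> r < 64 + 0 then ev w A B s (start_value (r - 64)) else reg s r)\<rparr> = s"
    by (simp only:) simp
  then show ?case by (simp only: setup_regs.simps) (simp add: runs_within_Skip)
next
  case (Suc m)
  define s1 where "s1 = s\<lparr>reg := (\<lambda>r. if 64 \<le> r \<and> r < 64 + m then ev w A B s (start_value (r - 64)) else reg s r)\<rparr>"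
  have v1: "valid w (reg s1)"
    using valid ev_less[of s w A B] by (auto simp: valid_def s1_def)
  have wf: "wf_ex (start_value m) 32" "cost (start_value m) + 2 = 3" by auto
  \<comment> \<open>Start values are computed from host registers, which the earlier assignments
    have not touched.\<close>
  have e: "ev w A B s1 (start_value m) = ev w A B s (start_value m)" by (simp add: s1_def)
  have "runs_within w A B (assign (64 + m) (start_value m)) 3 s1 (return_pmf (s1\<lparr>reg := (reg s1)(64 + m := ev w A B s (start_value m))\<rparr>))"
    using assign_correct[OF v1 wf(1), of "64 + m" A B] unfolding wf(2) e by simp
  moreover have "s1\<lparr>reg := (reg s1)(64 + m := ev w A B s (start_value m))\<rparr> =
     s\<lparr>reg := (\<lambda>r. if 64 \<le> r \<and> r < 64 + Suc m then ev w A B s (start_value (r - 64)) else reg s r)\<rparr>"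
    by (auto simp: s1_def fun_eq_iff simp del: start_value.simps)
  ultimately show ?case
    using runs_within_Seq_det[OF Suc[folded s1_def]] by (force simp: algebra_simps)
qed

lemma select_correct:
  assumes "idx < length cs" "reg s vT = idx" "valid w (reg s)" "0 < w"
    and "runs_within w A B (cs ! idx) T (s\<lparr>reg := (reg s)(vT := 0)\<rparr>) (return_pmf s')"
  shows "runs_within w A B (select cs) (T + 10 * (1 + real idx)) s (return_pmf s')"
  using assms
proof (induction cs arbitrary: idx s)
  case (Cons c cs)
  show ?case
  proof (cases idx)
    case 0
    have "(reg s)(vT := 0) = reg s" using Cons.prems(2) 0 by (intro fun_upd_idem) simp
    then have "s\<lparr>reg := (reg s)(vT := 0)\<rparr> = s" by simp
    then have "runs_within w A B c T s (return_pmf s')" using Cons.prems(5) 0 by (simp only: nth_Cons_0)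
    then have "runs_within w A B (select (c # cs)) (1 + T) s (return_pmf s')"
      using Cons.prems(2) 0 unfolding select.simps by (intro runs_within_Cond) simp
    then show ?thesis by (rule runs_within_mono) simp
  next
    case (Suc i)
    define s1 where "s1 = s\<lparr>reg := (reg s)(vT := i)\<rparr>"
    have "Suc i < 2 ^ w" using Cons.prems(2,3) Suc validD(1)[of w "reg s" vT] by simp
    then have v1: "valid w (reg s1)" using Cons.prems(3) by (simp add: s1_def)
    have "s1\<lparr>reg := (reg s1)(vT := 0)\<rparr> = s\<lparr>reg := (reg s)(vT := 0)\<rparr>" by (simp add: s1_def)
    then have run: "runs_within w A B (cs ! i) T (s1\<lparr>reg := (reg s1)(vT := 0)\<rparr>) (return_pmf s')"
      using Cons.prems(5) Suc by (simp only: nth_Cons_Suc)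
    have "runs_within w A B (select cs) (T + 10 * (1 + real i)) s1 (return_pmf s')"
      by (rule Cons.IH[OF _ _ v1 Cons.prems(4) run]) (use Cons.prems(1) Suc in \<open>simp_all add: s1_def\<close>)
    then have "runs_within w A B (blk [decr vT, select cs]) (6 + (T + 10 * (1 + real i)) + 1) s (return_pmf s')"
      apply (intro tri_eqD[where f = "\<lambda>_. 0" and e = 0])
      apply (rule tri_decr[where k = i])
          apply (use Cons.prems Suc in simp_all)[4]
      apply (rule tri_Cons_det)
       apply (simp add: s1_def)
      apply (rule tri_Nil, simp_all)
      done
    then have "runs_within w A B (select (c # cs)) (1 + (6 + (T + 10 * (1 + real i)) + 1)) s (return_pmf s')"
      using Cons.prems(2) Suc unfolding select.simps by (intro runs_within_Cond) simp
    then show ?thesis by (rule runs_within_mono) (simp add: Suc)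
  qed
qed simp

lemma ev_cell_value:
  assumes "2 ^ w = 4 * h" "8 \<le> h" "reg s vHB = 2 * h" "reg s vTag = \<tau>" "\<tau> < 4 * h" "reg s r = e" "e < h"
    and "mem s (2 * h + 2 * e + 1) \<le> \<tau>" "cell h \<tau> (mem s) e < 4 * h"
  shows "ev w A B s (cell_value r) = cell h \<tau> (mem s) e"
proof -
  have num: "1 mod 2 ^ w = (1 :: nat)" "2 mod 2 ^ w = (2 :: nat)" using assms(1,2) by simp_all
  have c: "ev w A B s (val_cell r) = 2 * h + 2 * e" "ev w A B s (tag_cell r) = 2 * h + 2 * e + 1"
    using num assms(1,3,6,7) by simp_all
  have "mem s (2 * h + 2 * e + 1) mod (4 * h) = mem s (2 * h + 2 * e + 1)" using assms(5,8) by simp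
  then have t: "ev w A B s (MemAt (tag_cell r)) = mem s (2 * h + 2 * e + 1)"
    by (subst ev.simps(4)) (simp only: c assms(1))
  have u: "ev w A B s (MemAt (val_cell r)) = mem s (2 * h + 2 * e) mod (4 * h)"
    by (subst ev.simps(4)) (simp only: c assms(1))
  have "ev w A B s (Op Equal (MemAt (tag_cell r)) (V vTag)) = of_bool (mem s (2 * h + 2 * e + 1) = \<tau>)"
    using num assms(4) by (subst ev.simps(3), subst t) simp
  then show ?thesis
    using assms(1,9) by (subst ev.simps(3), subst u) (auto simp: cell_def)
qed

lemma scan_correct:
  assumes valid: "valid w (reg s)" and w: "2 ^ w = 4 * h" "8 \<le> h" "0 < w"
    and regs: "reg s vHB = 2 * h" "reg s vTag = \<tau>" "reg s vN = n" "reg s vVL = L" "reg s vS = S" "0 < S"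
    and room: "4 * n + n * n < h" "L + 1 < h" "\<tau> < 4 * h"
    and cells: "\<And>e. e < n * n \<Longrightarrow> mem s (2 * h + 2 * e + 1) \<le> \<tau> \<and> cell h \<tau> (mem s) e < h"
  shows "tri w A B scan s (10 + 80 * real (n * n)) (\<lambda>s'. valid w (reg s') \<and> amp s' = amp s
    \<and> (\<forall>r. r \<notin> {vR, vFlag} \<longrightarrow> reg s' r = reg s r)
    \<and> mem s' = (\<lambda>a. if 4 * n \<le> a \<and> a < 4 * n + n * n \<and> cell h \<tau> (mem s) (a - 4 * n) \<noteq> 0 then L div S + 1 else mem s a)) (\<lambda>_. 0) 0"
proof -
  define M where "M = (\<lambda>k a. if 4 * n + k \<le> a \<and> a < 4 * n + n * n \<and> cell h \<tau> (mem s) (a - 4 * n) \<noteq> 0 then L div S + 1 else mem s a)"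
  define J where "J = (\<lambda>k (s' :: mstate). valid w (reg s') \<and> amp s' = amp s \<and> (\<forall>r. r \<notin> {vR, vFlag} \<longrightarrow> reg s' r = reg s r)
    \<and> reg s' vR = k \<and> mem s' = M k)"
  have num: "1 mod 2 ^ w = (1 :: nat)" "4 mod 2 ^ w = (4 :: nat)" using w by simp_all
  \<comment> \<open>The table lies below \<open>h\<close> and the simulated memory starts at
    \<open>2 * h\<close>, so writing to the one leaves the other unchanged.\<close>
  have M_high: "M k a = mem s a" if "h \<le> a" for k a using that room by (auto simp: M_def)
  have cell_M: "cell h \<tau> (M k) e = cell h \<tau> (mem s) e" for k e
    unfolding cell_def by (subst (1 2) M_high) auto
  let ?body = "blk [decr vR, assign vFlag (N 0 \<prec> cell_value vR), Cond vFlag (poke (N 4 \<otimes> V vN \<oplus> V vR) (V vVL \<oslash> V vS \<oplus> N 1)) Skip]"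
  have loop: "tri w A B (While vR ?body) s' (1 + (\<Sum>k<n * n. 1 + 70)) (J 0) (\<lambda>_. 0) 0" if "J (n * n) s'" for s'
  proof (rule tri_While[where I = J and g = "\<lambda>_ _. 0" and t = "\<lambda>_. 70"])
    fix e s' assume e: "J (Suc e) s'" "e < n * n"
    have v: "valid w (reg s')" and r: "reg s' vR = Suc e" "\<And>r. r \<notin> {vR, vFlag} \<Longrightarrow> reg s' r = reg s r" and m: "mem s' = M (Suc e)" "amp s' = amp s"
      using e(1) by (auto simp: J_def)
    define s1 where "s1 = s'\<lparr>reg := (reg s')(vR := e)\<rparr>"
    have eh: "e < h" using e(2) room by linarith
    have ew: "e < 2 ^ w" using eh w by linarith
    have v1: "valid w (reg s1)" using v ew by (auto simp: s1_def intro!: valid_upd)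
    have ec: "ev w A B s1 (cell_value vR) = cell h \<tau> (mem s) e"
    proof -
      have "ev w A B s1 (cell_value vR) = cell h \<tau> (mem s1) e"
        using cells[OF e(2)] w(2) by (intro ev_cell_value[OF w(1,2)]) (auto simp: s1_def r regs room eh m cell_M M_high)
      moreover have "mem s1 = M (Suc e)" by (simp add: s1_def m)
      ultimately show ?thesis by (simp only: cell_M)
    qed
    define f where "f = (if cell h \<tau> (mem s) e \<noteq> 0 then 1 else (0 :: nat))"
    have ef: "ev w A B s1 (N 0 \<prec> cell_value vR) = f"
      using num by (subst ev.simps(3), subst ec) (simp add: f_def)
    define s2 where "s2 = s1\<lparr>reg := (reg s1)(vFlag := f)\<rparr>"
    have fw: "f < 2 ^ w" using w by (simp add: f_def)
    have v2: "valid w (reg s2)" using v1 fw by (auto simp: s2_def intro!: valid_upd)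
    define s3 where "s3 = (if f = 0 then s2 else s2\<lparr>mem := (mem s2)(4 * n + e := L div S + 1)\<rparr>)"
    have s2r: "reg s2 vN = n" "reg s2 vR = e" "reg s2 vVL = L" "reg s2 vS = S" "reg s2 vFlag = f"
      by (simp_all add: s2_def s1_def r regs)
    have lt: "4 * n < 4 * h" "4 * n + e < 4 * h" "L div S + 1 < 4 * h"
      using room e(2) div_le_dividend[of L S] by linarith+
    have ea: "ev w A B s2 (N 4 \<otimes> V vN \<oplus> V vR) = 4 * n + e" "ev w A B s2 (V vVL \<oslash> V vS \<oplus> N 1) = L div S + 1"
      using num lt by (simp_all add: s2r w(1))
    have rc: "runs_within w A B (Cond vFlag (poke (N 4 \<otimes> V vN \<oplus> V vR) (V vVL \<oslash> V vS \<oplus> N 1)) Skip) 20 s2 (return_pmf s3)"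
    proof -
      have "runs_within w A B (if reg s2 vFlag \<noteq> 0 then poke (N 4 \<otimes> V vN \<oplus> V vR) (V vVL \<oslash> V vS \<oplus> N 1) else Skip) 19 s2 (return_pmf s3)"
      proof (cases "f = 0")
        case True
        then show ?thesis by (simp add: s2r s3_def runs_within_Skip)
      next
        case False
        then have "s3 = s2\<lparr>mem := (mem s2)(4 * n + e := L div S + 1)\<rparr>" by (simp add: s3_def)
        then have "runs_within w A B (poke (N 4 \<otimes> V vN \<oplus> V vR) (V vVL \<oslash> V vS \<oplus> N 1)) 17 s2 (return_pmf s3)"
          using poke_correct[OF v2, of "N 4 \<otimes> V vN \<oplus> V vR" "V vVL \<oslash> V vS \<oplus> N 1" A B]
          unfolding ea by simp
        then have "runs_within w A B (poke (N 4 \<otimes> V vN \<oplus> V vR) (V vVL \<oslash> V vS \<oplus> N 1)) 19 s2 (return_pmf s3)"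
          by (rule runs_within_mono) simp
        then show ?thesis using False by (simp add: s2r)
      qed
      from runs_within_Cond[OF this] show ?thesis by simp
    qed
    have "mem s3 = M e"
    proof
      fix a
      show "mem s3 a = M e a"
      proof (cases "a = 4 * n + e")
        case True
        then show ?thesis using e(2) by (auto simp: s3_def s2_def s1_def m M_def f_def)
      next
        case False
        then have "4 * n + Suc e \<le> a \<longleftrightarrow> 4 * n + e \<le> a" by linarith
        then show ?thesis using False by (auto simp: s3_def s2_def s1_def m M_def)
      qed
    qed
    then have J3: "J e s3"
      using v2 m r(2) by (auto simp: J_def s3_def s2_def s1_def)
    show "tri w A B ?body s' 70 (J e) (\<lambda>_. 0) 0"
      apply (rule tri_decr[OF v w(3) r(1)], simp)
      apply (simp only: s1_def[symmetric])
      apply (rule tri_assign[OF v1], simp, simp)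
      apply (simp only: ef s2_def[symmetric])
      apply (rule tri_Cons_det[OF rc])
      apply (rule tri_Nil)
        apply simp
       apply (rule J3)
      apply simp
      done
  qed (use that in \<open>auto simp: J_def\<close>)
  have nn: "n * n < 2 ^ w" using room w by linarith
  then have J0: "J (n * n) (s\<lparr>reg := (reg s)(vR := n * n)\<rparr>)"
    using valid by (auto simp: J_def M_def fun_eq_iff intro!: valid_upd)
  have "M 0 = (\<lambda>a. if 4 * n \<le> a \<and> a < 4 * n + n * n \<and> cell h \<tau> (mem s) (a - 4 * n) \<noteq> 0 then L div S + 1 else mem s a)"
    by (simp add: M_def)
  then have fin: "J 0 s' \<Longrightarrow> valid w (reg s') \<and> amp s' = amp s
    \<and> (\<forall>r. r \<notin> {vR, vFlag} \<longrightarrow> reg s' r = reg s r)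
    \<and> mem s' = (\<lambda>a. if 4 * n \<le> a \<and> a < 4 * n + n * n \<and> cell h \<tau> (mem s) (a - 4 * n) \<noteq> 0 then L div S + 1 else mem s a)" for s'
    by (simp add: J_def)
  show ?thesis
    unfolding scan_def
    apply (rule tri_assign[OF valid], simp, simp)
    apply (rule tri_Cons)
     apply (use loop[OF J0] nn in \<open>simp add: regs\<close>)
    apply (rule tri_Nil)
      apply simp
     apply (erule fin)
    apply simp
    done
qed

lemma bool_oracle_le: "bool_oracle n a i j \<le> 1"
  by (simp add: bool_oracle_def matrix_oracle_def)

lemma bool_oracle_guard: "i \<notin> {1..n} \<Longrightarrow> bool_oracle n a i j = 0" "j \<notin> {1..n} \<Longrightarrow> bool_oracle n a i j = 0"
  by (auto simp: bool_oracle_def matrix_oracle_def)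

section \<open>The preprocessing of one pair of matrices\<close>

locale strips =
  fixes w n l m K :: nat and a b :: "nat \<Rightarrow> nat \<Rightarrow> bool" and Ps :: "prog list" and ei ep :: ex
    and fi fp :: "nat \<Rightarrow> nat \<Rightarrow> nat" and T :: real
  assumes n: "2 \<le> n" and l: "l \<in> {1..n}" and w5: "5 \<le> w" and room: "2000 * n ^ 2 \<le> 2 ^ (w - 2)"
    and KN: "K * (lg n + 1) < 2 ^ w" and wf: "wf_ex ei 32" "wf_ex ep 32"
    and exprs: "\<And>s. valid w (reg s) \<Longrightarrow> reg s vBits = lg n \<Longrightarrow> reg s vP = lg l \<Longrightarrow>
        ev w (bool_oracle n a) (bool_oracle n b) s ei = fi (lg n) (lg l)
        \<and> (reg s vIdx = fi (lg n) (lg l) \<longrightarrow> ev w (bool_oracle n a) (bool_oracle n b) s ep = fp (lg n) (lg l))"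
    and choice: "fp (lg n) (lg l) \<le> lg l" "fi (lg n) (lg l) < length Ps"
    and Ps: "\<And>P. P \<in> set Ps \<Longrightarrow> classical P \<and> prog_below m P" and m: "4 \<le> m"
    and T: "multiplies (w - 2) n (Ps ! fi (lg n) (lg l)) T n (2 ^ fp (lg n) (lg l)) n" "real n ^ 2 \<le> T"
begin

abbreviation "A \<equiv> bool_oracle n a"
abbreviation "B \<equiv> bool_oracle n b"
abbreviation "q \<equiv> lg l"
abbreviation "idx \<equiv> fi (lg n) (lg l)"
abbreviation "d \<equiv> fp (lg n) (lg l)"

definition h :: nat where "h = 2 ^ (w - 2)"
definition bw :: nat where "bw = 2 ^ d"

definition W :: "nat \<Rightarrow> nat set" where
  "W e = {k\<in>{1..n}. a (e div n + 1) k \<and> b k (e mod n + 1)}"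

text \<open>The number of the aligned interval that contains the maximum, shifted by 1 as in the
  table.\<close>

definition top :: "nat set \<Rightarrow> nat" where
  "top X = (if X = {} then 0 else Max X div 2 ^ q + 1)"

definition prepared :: "mstate \<Rightarrow> bool" where
  "prepared s \<longleftrightarrow> valid w (reg s) \<and> clean s \<and> reg s vN = n \<and> reg s vBits = lg n \<and> reg s vP = q \<and> reg s vS = 2 ^ q
    \<and> reg s vIdx = idx \<and> reg s vLB = bw \<and> reg s vMask = h - 1 \<and> reg s vHB = 2 * h"

lemma word: "2 ^ w = 4 * h" "8 \<le> h" "0 < w" "100 \<le> (2 :: nat) ^ w"
proof -
  have "w = (w - 2) + 2" using w5 by simp
  then have "(2 :: nat) ^ w = 2 ^ (w - 2) * 2 ^ 2" by (metis power_add)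
  then show w: "2 ^ w = 4 * h" by (simp add: h_def)
  have "(2 :: nat) ^ 3 \<le> 2 ^ (w - 2)" using w5 by (intro power_increasing) auto
  then show "8 \<le> h" by (simp add: h_def)
  show "0 < w" using w5 by simp
  have "2 ^ 2 \<le> n ^ 2" using n by (intro power_mono) auto
  then have "4 \<le> n ^ 2" by simp
  then show "100 \<le> (2 :: nat) ^ w" using room w unfolding h_def[symmetric] by linarith
qed

lemma sizes: "4 * n + n * n < h" "n < h" "2 * n < h" "2 ^ q \<le> l" "2 ^ q \<le> n" "l < 2 * 2 ^ q" "bw \<le> 2 ^ q" "bw \<le> n" "0 < bw"
  "2 * 2 ^ d < (2 :: nat) ^ w" "n * n + 10 * n + 100 < h"
proof -
  have hn: "2000 * (n * n) \<le> h" using room by (simp add: h_def power2_eq_square)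
  have nn: "2 * n \<le> n * n" using n by simp
  show "4 * n + n * n < h" "n < h" "2 * n < h" "n * n + 10 * n + 100 < h" using hn nn n by linarith+
  show q: "2 ^ q \<le> l" "l < 2 * 2 ^ q" using lg_bounds[of l] l by auto
  then show qn: "2 ^ q \<le> n" using l by simp
  show bq: "bw \<le> 2 ^ q" unfolding bw_def using choice(1) by (intro power_increasing) auto
  then show "bw \<le> n" using qn by linarith
  show "0 < bw" by (simp add: bw_def)
  show "2 * 2 ^ d < (2 :: nat) ^ w" using bq qn \<open>2 * n < h\<close> word unfolding bw_def by linarith
qed

lemma prep_correct:
  "tri w A B (prep ei ep) (init [n, l] blank) (300 + cost ei + cost ep + 80 * real (lg n))
    (\<lambda>s. prepared s \<and> reg s vTag = 0 \<and> reg s vVL = 0 \<and> mem s = blank) (\<lambda>_. 0) 0"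
proof -
  define s0 where "s0 = init [n, l] blank"
  have ln: "l < 4 * h" "n < 4 * h" "4 * n < 4 * h" "4 * l < 4 * h" using sizes l by auto
  have R0: "reg s0 0 = n" "reg s0 1 = l" by (simp_all add: s0_def init_def)
  have v0: "valid w (reg s0)" using ln word by (auto simp: valid_def s0_def init_def nth_Cons')
  have lgn: "lg n < 2 ^ w" "2 ^ lg n < (2 :: nat) ^ w" "q < 2 ^ w" "2 ^ q < (2 :: nat) ^ w"
    using lg_bounds[of n] n less_exp[of "lg n"] less_exp[of q] ln sizes(4,5) unfolding word(1) by linarith+
  define R1 where "R1 = (reg s0)(vN := n, vL := l)"
  define R2 where "R2 = R1(vBits := lg n, vH := 2 ^ lg n, vCont := 0)"
  define R3 where "R3 = R2(vP := q, vS := 2 ^ q, vCont := 0)"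
  define R4 where "R4 = R3(vIdx := idx)"
  define R5 where "R5 = R4(vPP := d)"
  define R6 where "R6 = R5(vLB := bw, vCont := 0)"
  define R7 where "R7 = R6(vMask := h - 1)"
  define R8 where "R8 = R7(vHB := 2 * h)"
  define R9 where "R9 = R8(vTag := 0, vVL := 0)"
  have v1: "valid w R1" using v0 ln word by (simp add: R1_def)
  have v2: "valid w R2" using v1 lgn by (simp add: R2_def)
  have v3: "valid w R3" using v2 lgn by (simp add: R3_def)
  have e4: "ev w A B (s0\<lparr>reg := R3\<rparr>) ei = idx"
    using exprs[of "s0\<lparr>reg := R3\<rparr>"] v3 by (simp add: R3_def R2_def)
  have v4: "valid w R4" using v3 ev_less[of "s0\<lparr>reg := R3\<rparr>" w A B ei] validD(1)[OF v3] unfolding e4 by (simp add: R4_def)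
  have e5: "ev w A B (s0\<lparr>reg := R4\<rparr>) ep = d"
    using exprs[of "s0\<lparr>reg := R4\<rparr>"] v4 by (simp add: R4_def R3_def R2_def)
  have v5: "valid w R5" using v4 ev_less[of "s0\<lparr>reg := R4\<rparr>" w A B ep] validD(1)[OF v4] unfolding e5 by (simp add: R5_def)
  have v6: "valid w R6" using v5 sizes ln word by (simp add: R6_def)
  have v7: "valid w R7" using v6 word by (simp add: R7_def)
  have v8: "valid w R8" using v7 word by (simp add: R8_def)
  have v9: "valid w R9" using v8 word by (simp add: R9_def)
  have r2: "runs_within w A B (log_prog vN vBits vH) (20 + 30 * real (lg n)) (s0\<lparr>reg := R1\<rparr>) (return_pmf (s0\<lparr>reg := R2\<rparr>))"
    using log_prog_correct[of w "s0\<lparr>reg := R1\<rparr>" vN n vBits vH A B] v1 word ln n by (simp add: R2_def R1_def)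
  have r3: "runs_within w A B (log_prog vL vP vS) (20 + 30 * real q) (s0\<lparr>reg := R2\<rparr>) (return_pmf (s0\<lparr>reg := R3\<rparr>))"
    using log_prog_correct[of w "s0\<lparr>reg := R2\<rparr>" vL l vP vS A B] v2 word ln l by (simp add: R3_def R2_def R1_def)
  have r6: "runs_within w A B pow_prog (20 + 20 * real d) (s0\<lparr>reg := R5\<rparr>) (return_pmf (s0\<lparr>reg := R6\<rparr>))"
    using pow_prog_correct[of w "s0\<lparr>reg := R5\<rparr>" d A B] v5 word sizes(10) by (simp add: R6_def R5_def bw_def)
  have num: "1 mod 2 ^ w = (1 :: nat)" "2 mod 2 ^ w = (2 :: nat)" "4 mod 2 ^ w = (4 :: nat)" using word by simp_all
  have "(4 * h - 1) mod (4 * h) = 4 * h - 1" "(4 * h - 1) div 4 = h - 1" "(h - 1) mod (4 * h) = h - 1" using word(2) by auto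
  then have e7: "ev w A B (s0\<lparr>reg := R6\<rparr>) ((N 0 \<ominus> N 1) \<oslash> N 4) = h - 1"
    using num by (simp add: word(1))
  have "2 * (h - 1) + 2 = 2 * h" "2 * (h - 1) < 4 * h" "2 * h < 4 * h" using word(2) by auto
  then have e8: "ev w A B (s0\<lparr>reg := R7\<rparr>) (N 2 \<otimes> V vMask \<oplus> N 2) = 2 * h"
    using num by (simp add: R7_def word(1))
  have fin: "prepared (s0\<lparr>reg := R9\<rparr>)"
    unfolding prepared_def clean_def using v9
    by (auto simp: R9_def R8_def R7_def R6_def R5_def R4_def R3_def R2_def R1_def s0_def init_def init_qstate intro!: exI[of _ 1])
  have lqd: "real q \<le> real (lg n)" "real d \<le> real (lg n)" using lg_mono[of l n] l choice(1) by auto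
  show ?thesis
    unfolding prep_def s0_def[symmetric]
    apply (rule tri_assign[OF v0], simp, simp)
    apply (rule tri_assign, use v0 ln word R0 in simp, simp, simp)
    apply (rule tri_Cons_det[where s' = "s0\<lparr>reg := R2\<rparr>"])
     apply (use r2 R0 in \<open>simp add: R1_def\<close>)
    apply (rule tri_Cons_det[OF r3])
    apply (rule tri_assign, use v3 in simp, rule wf, simp)
    apply (simp only: e4 mstate.select_convs mstate.surjective mstate.update_convs)
    apply (rule tri_assign, use v4 in \<open>simp add: R4_def\<close>, rule wf, simp)
    apply (rule tri_Cons_det[where s' = "s0\<lparr>reg := R6\<rparr>"])
     apply (use r6 e5 in \<open>simp add: R5_def R4_def\<close>)
    apply (rule tri_assign, use v6 in simp, simp, simp)
    apply (rule tri_assign, use v7 e7 in \<open>simp del: ev.simps add: R7_def\<close>, simp, simp)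
    apply (rule tri_assign, use v8 e7 e8 in \<open>simp del: ev.simps add: R8_def R7_def\<close>, simp, simp)
    apply (rule tri_assign, use v8 e7 e8 word in \<open>simp del: ev.simps(3) add: R8_def R7_def\<close>, simp, simp)
    apply (rule tri_Nil)
      apply (use lqd in simp)
     apply (use fin e7 e8 in \<open>simp del: ev.simps(3) add: R9_def R8_def R7_def s0_def init_def\<close>)
    apply simp
    done
qed

text \<open>A tag larger than all those in memory makes the simulated memory blank, as the
  multiplication program expects. The product entries are sums of naturals, so an entry is non-zero
  exactly if the block contains a witness.\<close>

lemma multiply_correct:
  assumes s: "prepared s" "reg s vTag = \<tau>" "0 < \<tau>" "reg s vVL = L" and L: "L + bw < h"
    and tags: "\<And>e. e < h \<Longrightarrow> mem s (2 * h + 2 * e + 1) < \<tau>"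
  obtains s' where "runs_within w A B (multiply m Ps) (20 + 3 * real m + 10 * (1 + real (length Ps)) + 40 * T) s (return_pmf s')"
    "valid w (reg s')" "amp s' = amp s" "\<And>r. r < 64 \<Longrightarrow> r \<noteq> vT \<Longrightarrow> reg s' r = reg s r" "\<And>x. x < 2 * h \<Longrightarrow> mem s' x = mem s x"
    "\<And>e. e < h \<Longrightarrow> mem s' (2 * h + 2 * e + 1) \<le> \<tau> \<and> cell h \<tau> (mem s') e < h"
    "\<And>e. e < n * n \<Longrightarrow> cell h \<tau> (mem s') e \<noteq> 0 \<longleftrightarrow> W e \<inter> {L..<L + bw} \<noteq> {}"
proof -
  have v: "valid w (reg s)" and regs: "reg s vN = n" "reg s vLB = bw" "reg s vIdx = idx" "reg s vMask = h - 1" "reg s vHB = 2 * h"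
    using s(1) by (auto simp: prepared_def)
  define R1 where "R1 = (\<lambda>r. if 64 \<le> r \<and> r < 64 + m then ev w A B s (start_value (r - 64)) else reg s r)"
  have v1: "valid w R1" using v ev_less[of s w A B] by (auto simp: valid_def R1_def)
  define \<sigma>\<^sub>0 where "\<sigma>\<^sub>0 = s\<lparr>reg := R1(vT := 0)\<rparr>"
  have v0: "valid w (reg \<sigma>\<^sub>0)" using v1 word by (simp add: \<sigma>\<^sub>0_def)
  have low: "R1 r = reg s r" if "r < 64" for r using that by (simp add: R1_def)
  interpret sim: simulation w h m n bw L A B \<sigma>\<^sub>0
  proof unfold_locales
    show "reg \<sigma>\<^sub>0 vMask = h - 1" "reg \<sigma>\<^sub>0 vHB = 2 * h" "reg \<sigma>\<^sub>0 vLB = bw" "reg \<sigma>\<^sub>0 vVL = L" "0 < reg \<sigma>\<^sub>0 vTag"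
      using regs s by (simp_all add: \<sigma>\<^sub>0_def low)
    show "bw < h" using L by linarith
    show "i \<notin> {1..n} \<Longrightarrow> A i j = 0" "j \<notin> {1..n} \<Longrightarrow> B i j = 0" for i j
      by (rule bool_oracle_guard, assumption)+
  qed (rule w5 h_def L bool_oracle_le)+
  define t0 where "t0 = init [n, n, bw, n] blank"
  have rel: "sim_rel w h m \<sigma>\<^sub>0 t0 \<sigma>\<^sub>0"
    unfolding sim_rel_def
  proof (intro conjI allI impI)
    fix r assume r: "r < m"
    have t: "reg t0 r = (if r = 2 then bw else if r < 4 then n else 0)"
    proof -
      consider "r = 0" | "r = 1" | "r = 2" | "r = 3" | "4 \<le> r" by linarith
      then show ?thesis by cases (simp_all add: t0_def init_def)
    qed
    have "reg \<sigma>\<^sub>0 (64 + r) = ev w A B s (start_value r)"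
      using r by (simp add: \<sigma>\<^sub>0_def R1_def del: start_value.simps)
    then show "reg \<sigma>\<^sub>0 (64 + r) = reg t0 r"
      unfolding t by (simp add: regs)
    show "reg t0 r < h" using sizes(2) L unfolding t by simp
  next
    fix e assume e: "e < h"
    show "mem t0 e = cell h (reg \<sigma>\<^sub>0 vTag) (mem \<sigma>\<^sub>0) e" "mem t0 e < h" "mem \<sigma>\<^sub>0 (2 * h + 2 * e + 1) \<le> reg \<sigma>\<^sub>0 vTag"
      using tags[OF e] s word by (auto simp: t0_def init_def cell_def \<sigma>\<^sub>0_def low)
  qed (use v0 in auto)
  define X where "X = (\<lambda>i y. A i (L + (y - 1)))"
  define Y where "Y = (\<lambda>y j. B (L + (y - 1)) j)"
  have XY: "\<forall>i j. X i j \<le> n \<and> Y i j \<le> n"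
    using bool_oracle_le[of n a] bool_oracle_le[of n b] n unfolding X_def Y_def by (meson dual_order.trans one_le_numeral)
  have AB: "sim.A' = matrix_oracle n bw X" "sim.B' = matrix_oracle bw n Y"
    by (simp_all add: sim.A'_def sim.B'_def X_def Y_def)
  have T1: "multiplies (w - 2) n (Ps ! idx) T n bw n" using T(1) by (simp add: bw_def)
  obtain D where D: "runs_within (w - 2) sim.A' sim.B' (Ps ! idx) T t0 D"
      "\<forall>s\<in>set_pmf D. \<forall>i\<in>{1..n}. \<forall>j\<in>{1..n}. mem s ((i - 1) * n + (j - 1)) = (\<Sum>k=1..bw. X i k * Y k j)"
    using T1[unfolded multiplies_def, THEN spec, of X, THEN spec, of Y, THEN mp, OF XY]
    unfolding AB t0_def by blast
  obtain t where t: "real t \<le> T" "exec (w - 2) sim.A' sim.B' (Ps ! idx) t t0 D"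
    using D(1) by (auto simp: runs_within_def)
  have P: "classical (Ps ! idx)" "prog_below m (Ps ! idx)" using Ps[of "Ps ! idx"] choice(2) by auto
  obtain t' s' where s': "D = return_pmf t'" "runs_within w A B (sim (Ps ! idx)) (40 * real t) \<sigma>\<^sub>0 (return_pmf s')"
      "sim_rel w h m \<sigma>\<^sub>0 t' s'"
    using sim.sim_correct[OF t(2) P rel] by blast
  have r3: "runs_within w A B (select (map sim Ps)) (40 * T + 10 * (1 + real idx)) (s\<lparr>reg := R1(vT := idx)\<rparr>) (return_pmf s')"
  proof (rule select_correct)
    have "idx < 2 ^ w" using validD(1)[OF v, of vIdx] regs by simp
    then show "valid w (reg (s\<lparr>reg := R1(vT := idx)\<rparr>))" using v1 by simp
    have "runs_within w A B (sim (Ps ! idx)) (40 * T) \<sigma>\<^sub>0 (return_pmf s')"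
      using s'(2) t(1) by (elim runs_within_mono) simp
    then show "runs_within w A B (map sim Ps ! idx) (40 * T) ((s\<lparr>reg := R1(vT := idx)\<rparr>)\<lparr>reg := (reg (s\<lparr>reg := R1(vT := idx)\<rparr>))(vT := 0)\<rparr>) (return_pmf s')"
      using choice(2) by (simp add: \<sigma>\<^sub>0_def)
  qed (use choice(2) word in auto)
  have r2: "runs_within w A B (assign vT (V vIdx)) 3 (s\<lparr>reg := R1\<rparr>) (return_pmf (s\<lparr>reg := R1(vT := idx)\<rparr>))"
    using assign_correct[of w "s\<lparr>reg := R1\<rparr>" "V vIdx" vT A B] v1 regs by (simp add: low)
  have "real idx \<le> real (length Ps)" using choice(2) by simp
  then have "runs_within w A B (multiply m Ps) (20 + 3 * real m + 10 * (1 + real (length Ps)) + 40 * T) s (return_pmf s')"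
    unfolding multiply_def
    apply (intro tri_eqD[where f = "\<lambda>_. 0" and e = 0])
    apply (rule tri_Cons_det[OF setup_regs_correct[OF v]])
    apply (rule tri_Cons_det)
     apply (fold R1_def)
     apply (rule r2)
    apply (rule tri_Cons_det[OF r3])
    apply (rule tri_Nil, simp_all)
    done
  moreover have "cell h \<tau> (mem s') e \<noteq> 0 \<longleftrightarrow> W e \<inter> {L..<L + bw} \<noteq> {}" if e: "e < n * n" for e
  proof -
    define i where "i = e div n + 1"
    define j where "j = e mod n + 1"
    have dm: "e div n < n" "e mod n < n" using e n by (auto simp: less_mult_imp_div_less)
    have ij: "i \<in> {1..n}" "j \<in> {1..n}" unfolding i_def j_def using dm by (simp_all add: Suc_le_eq)
    have eij: "(i - 1) * n + (j - 1) = e" by (simp add: i_def j_def)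
    have "e < h" using e sizes(1) by linarith
    then have "cell h \<tau> (mem s') e = mem t' e"
      using s'(3) s by (simp add: sim_rel_def \<sigma>\<^sub>0_def low)
    also have "\<dots> = (\<Sum>k=1..bw. X i k * Y k j)"
      using D(2)[rule_format, of t' i j] s'(1) ij unfolding eij by simp
    finally have "cell h \<tau> (mem s') e \<noteq> 0 \<longleftrightarrow> (\<exists>k\<in>{1..bw}. X i k \<noteq> 0 \<and> Y k j \<noteq> 0)"
      by (auto simp: sum_eq_0_iff)
    also have "\<dots> \<longleftrightarrow> (\<exists>x\<in>{L..<L + bw}. A i x \<noteq> 0 \<and> B x j \<noteq> 0)"
    proof
      assume "\<exists>k\<in>{1..bw}. X i k \<noteq> 0 \<and> Y k j \<noteq> 0"
      then obtain k where "k \<in> {1..bw}" "A i (L + (k - 1)) \<noteq> 0 \<and> B (L + (k - 1)) j \<noteq> 0" by (auto simp: X_def Y_def)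
      then show "\<exists>x\<in>{L..<L + bw}. A i x \<noteq> 0 \<and> B x j \<noteq> 0" by (intro bexI[of _ "L + (k - 1)"]) auto
    next
      assume "\<exists>x\<in>{L..<L + bw}. A i x \<noteq> 0 \<and> B x j \<noteq> 0"
      then obtain x where "x \<in> {L..<L + bw}" "A i x \<noteq> 0 \<and> B x j \<noteq> 0" by blast
      then show "\<exists>k\<in>{1..bw}. X i k \<noteq> 0 \<and> Y k j \<noteq> 0" by (intro bexI[of _ "x - L + 1"]) (auto simp: X_def Y_def)
    qed
    also have "\<dots> \<longleftrightarrow> W e \<inter> {L..<L + bw} \<noteq> {}"
      using ij unfolding W_def i_def[symmetric] j_def[symmetric]
      by (auto simp: bool_oracle_def matrix_oracle_def split: if_splits)
    finally show ?thesis .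
  qed
  ultimately show thesis
    using s'(3) s by (intro that[of s']) (auto simp: sim_rel_def \<sigma>\<^sub>0_def low)
qed

text \<open>The cells in front of the table stay zero for the reflections and loads of later
  searches, whose intervals end at \<open>2 * n\<close> at the latest.\<close>

definition table :: "memory \<Rightarrow> bool" where
  "table M \<longleftrightarrow> (\<forall>x<4 * n. M x = 0) \<and> (\<forall>e<n * n. M (4 * n + e) = top (W e))"

text \<open>The width divides \<open>2 ^ q\<close> and blocks start at multiples of it, so a block
  lies within one aligned interval. Whichever of its elements is the maximum, the interval is that
  of \<open>L\<close>.\<close>

lemma top_block:
  assumes "L = v * bw"
  shows "top (X \<inter> {..<L + bw}) = (if X \<inter> {L..<L + bw} = {} then top (X \<inter> {..<L}) else L div 2 ^ q + 1)"
proof (cases "X \<inter> {L..<L + bw} = {}")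
  case True
  then have "X \<inter> {..<L + bw} = X \<inter> {..<L}" by (auto simp: not_less)
  with True show ?thesis by simp
next
  case False
  let ?M = "Max (X \<inter> {..<L + bw})"
  have fin: "finite (X \<inter> {..<L + bw})" by simp
  obtain x where x: "x \<in> X" "L \<le> x" "x < L + bw" using False by auto
  then have xM: "x \<le> ?M" by (intro Max_ge) auto
  have "?M \<in> X \<inter> {..<L + bw}" using x by (intro Max_in) auto
  then have M: "L \<le> ?M" "?M < L + bw" using order_trans[OF x(2) xM] by blast+
  have "?M div bw = v" "L div bw = v"
    using M sizes(9) unfolding assms by (auto simp: div_nat_eqI mult.commute)
  moreover have "2 ^ q = bw * 2 ^ (q - d)"
    unfolding bw_def using choice(1) by (simp flip: power_add)
  ultimately have "?M div 2 ^ q = L div 2 ^ q" by (simp add: div_mult2_eq)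
  then show ?thesis using x False by (auto simp: top_def)
qed

lemma blocks_correct:
  assumes "prepared s" "reg s vTag = 0" "reg s vVL = 0" "mem s = blank"
  shows "tri w A B (blocks m Ps) s (20 + real (n div bw + 1) * (100 + 3 * real m + 10 * real (length Ps) + 120 * T))
    (\<lambda>s. prepared s \<and> table (mem s)) (\<lambda>_. 0) 0"
proof -
  define nb where "nb = n div bw + 1"
  define tb where "tb = 80 + 3 * real m + 10 * real (length Ps) + 40 * T + 80 * real (n * n)"
  define J where "J = (\<lambda>k (s :: mstate). prepared s \<and> reg s vC = k \<and> reg s vTag = nb - k \<and> reg s vVL = (nb - k) * bw
    \<and> (\<forall>e<h. mem s (2 * h + 2 * e + 1) \<le> nb - k) \<and> (\<forall>x<4 * n. mem s x = 0)
    \<and> (\<forall>e<n * n. mem s (4 * n + e) = top (W e \<inter> {..<(nb - k) * bw})))"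
  have nbw: "n div bw * bw \<le> n" by simp
  have nb: "n < nb * bw" unfolding nb_def using dividend_less_div_times[OF sizes(9), of n] by simp
  have nbh: "nb < h" "nb < 2 ^ w"
  proof -
    have "n div bw \<le> n" by simp
    then show "nb < h" "nb < 2 ^ w" using sizes(3) n word unfolding nb_def by linarith+
  qed
  have num: "1 mod 2 ^ w = (1 :: nat)" using word by simp
  let ?body = "blk [assign vTag (V vTag \<oplus> N 1), multiply m Ps, scan, assign vVL (V vVL \<oplus> V vLB), decr vC]"
  have loop: "tri w A B (While vC ?body) s' (1 + (\<Sum>k<nb. 1 + tb)) (J 0) (\<lambda>_. 0) 0" if "J nb s'" for s'
  proof (rule tri_While[where I = J and g = "\<lambda>_ _. 0" and t = "\<lambda>_. tb"])
    fix k s assume k: "J (Suc k) s" "k < nb"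
    define v where "v = nb - Suc k"
    define L where "L = v * bw"
    have v: "nb - k = Suc v" "v < nb" using k(2) by (auto simp: v_def)
    have pr: "prepared s" and r: "reg s vC = Suc k" "reg s vTag = v" "reg s vVL = L"
      and tg: "\<And>e. e < h \<Longrightarrow> mem s (2 * h + 2 * e + 1) \<le> v" and z: "\<And>x. x < 4 * n \<Longrightarrow> mem s x = 0"
      and tp: "\<And>e. e < n * n \<Longrightarrow> mem s (4 * n + e) = top (W e \<inter> {..<L})"
      using k(1) by (auto simp: J_def v_def L_def)
    have "v \<le> n div bw" using v(2) by (simp add: nb_def)
    then have "L \<le> n div bw * bw" unfolding L_def by (intro mult_right_mono) auto
    then have Ln: "L \<le> n" using nbw by linarith
    have Lb: "L + bw < h" "L + 1 < h" using Ln sizes(3,8) n by linarith+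
    have vs: "valid w (reg s)" using pr by (simp add: prepared_def)
    define s1 where "s1 = s\<lparr>reg := (reg s)(vTag := Suc v)\<rparr>"
    have vw: "Suc v < 2 ^ w" "Suc v < 4 * h" using v(2) nbh word by linarith+
    have pr1: "prepared s1" using pr vw by (auto simp: prepared_def s1_def clean_def)
    have e1: "ev w A B s (V vTag \<oplus> N 1) = Suc v" using num r vw by simp
    obtain s2 where s2: "runs_within w A B (multiply m Ps) (20 + 3 * real m + 10 * (1 + real (length Ps)) + 40 * T) s1 (return_pmf s2)"
      "valid w (reg s2)" "amp s2 = amp s1" "\<And>r. r < 64 \<Longrightarrow> r \<noteq> vT \<Longrightarrow> reg s2 r = reg s1 r" "\<And>x. x < 2 * h \<Longrightarrow> mem s2 x = mem s1 x"
      "\<And>e. e < h \<Longrightarrow> mem s2 (2 * h + 2 * e + 1) \<le> Suc v \<and> cell h (Suc v) (mem s2) e < h"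
      "\<And>e. e < n * n \<Longrightarrow> cell h (Suc v) (mem s2) e \<noteq> 0 \<longleftrightarrow> W e \<inter> {L..<L + bw} \<noteq> {}"
      by (rule multiply_correct[OF pr1, of "Suc v" L]) (use r tg Lb in \<open>auto simp: s1_def less_Suc_eq_le\<close>)
    have regs2: "reg s2 vHB = 2 * h" "reg s2 vTag = Suc v" "reg s2 vN = n" "reg s2 vVL = L" "reg s2 vS = 2 ^ q" "reg s2 vC = Suc k" "reg s2 vLB = bw"
      using s2(4) pr r by (auto simp: s1_def prepared_def)
    have sc: "tri w A B scan s2 (10 + 80 * real (n * n)) (\<lambda>s'. valid w (reg s') \<and> amp s' = amp s2
      \<and> (\<forall>r. r \<notin> {vR, vFlag} \<longrightarrow> reg s' r = reg s2 r)
      \<and> mem s' = (\<lambda>x. if 4 * n \<le> x \<and> x < 4 * n + n * n \<and> cell h (Suc v) (mem s2) (x - 4 * n) \<noteq> 0 then L div 2 ^ q + 1 else mem s2 x)) (\<lambda>_. 0) 0"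
    proof (rule scan_correct[OF s2(2) word(1-3) regs2(1-5) _ sizes(1) Lb(2) vw(2)])
      fix e assume "e < n * n"
      then have "e < h" using sizes(1) by linarith
      then show "mem s2 (2 * h + 2 * e + 1) \<le> Suc v \<and> cell h (Suc v) (mem s2) e < h" by (rule s2(6))
    qed simp
    have fin: "J k (s3\<lparr>reg := (reg s3)(vVL := L + bw, vC := k)\<rparr>)" if s3: "valid w (reg s3)" "amp s3 = amp s2"
      "\<forall>r. r \<notin> {vR, vFlag} \<longrightarrow> reg s3 r = reg s2 r"
      "mem s3 = (\<lambda>x. if 4 * n \<le> x \<and> x < 4 * n + n * n \<and> cell h (Suc v) (mem s2) (x - 4 * n) \<noteq> 0 then L div 2 ^ q + 1 else mem s2 x)" for s3
    proof -
      define s4 where "s4 = s3\<lparr>reg := (reg s3)(vVL := L + bw, vC := k)\<rparr>"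
      have "L + bw < 2 ^ w" "k < 2 ^ w" using Lb(1) k(2) nbh word by linarith+
      then have v4: "valid w (reg s4)" using s3(1) by (simp add: s4_def)
      have rr: "reg s4 r = reg s1 r" if "r < 64" "r \<notin> {vR, vFlag, vT, vVL, vC}" for r
        using that s3(3) s2(4)[of r] by (simp add: s4_def)
      have pr4: "prepared s4"
        using pr1 v4 s3(2) s2(3) unfolding prepared_def clean_def by (simp add: rr s4_def[symmetric]) (simp add: s4_def)
      have m4: "mem s4 = mem s3" by (simp add: s4_def)
      have zero: "mem s4 x = 0" if "x < 4 * n" for x
      proof -
        have "mem s2 x = mem s1 x" using that sizes(1) by (intro s2(5)) linarith
        then show ?thesis using that z[OF that] unfolding m4 s3(4) by (simp add: s1_def)
      qed
      have tags: "mem s4 (2 * h + 2 * e + 1) \<le> Suc v" if "e < h" for e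
        using s2(6)[OF that] sizes(1) unfolding m4 s3(4) by auto
      have tab: "mem s4 (4 * n + e) = top (W e \<inter> {..<L + bw})" if e: "e < n * n" for e
      proof -
        have "mem s2 (4 * n + e) = mem s1 (4 * n + e)" using e sizes(1) by (intro s2(5)) linarith
        then have "mem s2 (4 * n + e) = top (W e \<inter> {..<L})" using tp[OF e] by (simp add: s1_def)
        then show ?thesis using e s2(7)[OF e] unfolding m4 s3(4) top_block[OF L_def] by auto
      qed
      have "Suc v * bw = L + bw" by (simp add: L_def)
      then show ?thesis
        unfolding s4_def[symmetric] J_def v(1)
      proof (intro conjI allI impI)
        show "prepared s4" by (rule pr4)
        show "reg s4 vC = k" by (simp add: s4_def)
        show "reg s4 vTag = Suc v" using rr[of vTag] by (simp add: s1_def)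
        show "reg s4 vVL = Suc v * bw" unfolding \<open>Suc v * bw = L + bw\<close> by (simp add: s4_def)
        show "mem s4 (4 * n + e) = top (W e \<inter> {..<Suc v * bw})" if "e < n * n" for e
          unfolding \<open>Suc v * bw = L + bw\<close> by (rule tab[OF that])
      qed (rule tags zero; assumption)+
    qed
    show "tri w A B ?body s tb (J k) (\<lambda>_. 0) 0"
      apply (rule tri_assign[OF vs], simp, simp)
      apply (simp only: e1 s1_def[symmetric])
      apply (rule tri_Cons_det[OF s2(1)])
      apply (rule tri_Cons[OF sc])
      subgoal premises p for s3
      proof -
        have v3: "valid w (reg s3)" and r3: "reg s3 vVL = L" "reg s3 vLB = bw" "reg s3 vC = Suc k" using p regs2 by auto
        have Lw: "L + bw < 2 ^ w" using Lb(1) word by linarith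
        have e3: "ev w A B s3 (V vVL \<oplus> V vLB) = L + bw" using Lw by (simp add: r3)
        show ?thesis
          apply (rule tri_assign[OF v3], simp, simp)
          apply (simp only: e3)
          apply (rule tri_decr[where k = k])
              apply (use v3 Lw word r3 in simp_all)[4]
          apply (rule tri_Nil)
            apply (simp add: tb_def)
           apply (use fin p in simp)
          apply simp
          done
      qed
      done
  qed (use that in \<open>auto simp: J_def\<close>)
  have J0: "J nb (s\<lparr>reg := (reg s)(vC := nb)\<rparr>)"
    using assms nbh by (auto simp: J_def prepared_def clean_def top_def)
  have fin: "prepared s' \<and> table (mem s')" if "J 0 s'" for s'
  proof -
    have "W e \<inter> {..<nb * bw} = W e" for e using nb by (auto simp: W_def)
    then show ?thesis using that by (auto simp: J_def table_def)
  qed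
  \<comment> \<open>Scanning takes time of order n * n for each block; \<open>T\<close> absorbs it,
    as a product takes at least that long.\<close>
  have Tn: "real (n * n) \<le> T" using T(2) by (simp add: power2_eq_square)
  have "(\<Sum>k<nb. 1 + tb) \<le> real nb * (100 + 3 * real m + 10 * real (length Ps) + 120 * T)"
    using Tn unfolding tb_def by (simp only: sum_constant card_lessThan) (intro mult_left_mono, auto)
  then have time: "12 + (\<Sum>k<nb. 1 + tb) \<le> 20 + real (n div bw + 1) * (100 + 3 * real m + 10 * real (length Ps) + 120 * T)"
    unfolding nb_def by linarith
  have e0: "ev w A B s (V vN \<oslash> V vLB \<oplus> N 1) = nb"
    using assms(1) num nbh by (simp add: prepared_def nb_def)
  have vs: "valid w (reg s)" using assms(1) by (simp add: prepared_def)
  show ?thesis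
    unfolding blocks_def
    apply (rule tri_assign[OF vs], simp, simp)
    apply (simp only: e0)
    apply (rule tri_Cons[OF loop[OF J0]])
    apply (rule tri_Nil)
      apply (use time in simp)
     apply (erule fin)
    apply simp
    done
qed

end

section \<open>Queries\<close>

abbreviation entry_addr :: ex where
  "entry_addr \<equiv> N 4 \<otimes> V vN \<oplus> ((V vI \<ominus> N 1) \<otimes> V vN \<oplus> (V vJ \<ominus> N 1))"

definition answer_query :: prog where
  "answer_query = blk [assign vT (MemAt entry_addr),
     Cond vT (blk [assign vH (V vS), assign vX ((V vT \<ominus> N 1) \<otimes> V vS), find_max]) (blk [assign vX (N 0)])]"

definition strip_query :: "nat \<Rightarrow> prog" where
  "strip_query r0 = blk [assign vN (V 0), assign vL (V 1), assign vI (V 2), assign vJ (V 3),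
     log_prog vN vReps vH, assign vReps (N r0 \<otimes> (V vReps \<oplus> N 1)), log_prog vL vP vS,
     answer_query, assign 0 (V vX)]"

definition answer_all :: "nat \<Rightarrow> prog" where
  "answer_all r0 = blk [assign vReps (N r0 \<otimes> (V vBits \<oplus> N 1)), assign vC (V vN \<otimes> V vN),
     While vC (blk [decr vC, assign vI (V vC \<oslash> V vN \<oplus> N 1), assign vJ (Op Remainder (V vC) (V vN) \<oplus> N 1),
       answer_query, poke (N 4 \<otimes> V vN \<oplus> V vC) (V vX)])]"

definition lookup_query :: prog where
  "lookup_query = blk [assign 0 (MemAt (N 4 \<otimes> V 0 \<oplus> ((V 2 \<ominus> N 1) \<otimes> V 0 \<oplus> (V 3 \<ominus> N 1))))]"

text \<open>The interval of length 2 ^ (lg n + 1) from 0 contains all indices up to n; outside the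
  index range the oracles return 0.\<close>

definition direct_query :: "nat \<Rightarrow> prog" where
  "direct_query r0 = blk [assign vN (V 0), assign vI (V 1), assign vJ (V 2), log_prog vN vP vH,
     assign vP (V vP \<oplus> N 1), assign vH (V vH \<otimes> N 2), assign vReps (N r0 \<otimes> V vP), assign vX (N 0),
     find_max, assign 0 (V vX)]"

definition max_or_0 :: "nat set \<Rightarrow> nat" where
  "max_or_0 X = (if X = {} then 0 else Max X)"

lemma sol_bool: "i \<in> {1..n} \<Longrightarrow> j \<in> {1..n} \<Longrightarrow>
    sol (bool_oracle n a) (bool_oracle n b) i j = witnesses n a b i j"
  by (auto simp: sol_def witnesses_def bool_oracle_def matrix_oracle_def bit_0)

lemma max_witness_eq:
  "max_witness n a b i j = (if max_or_0 (witnesses n a b i j) = 0 then None else Some (max_or_0 (witnesses n a b i j)))"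
proof -
  have fin: "finite (witnesses n a b i j)" by (simp add: witnesses_def)
  have "bool_product n a b i j \<longleftrightarrow> witnesses n a b i j \<noteq> {}" by (auto simp: bool_product_def witnesses_def)
  moreover have "0 < Max (witnesses n a b i j)" if "witnesses n a b i j \<noteq> {}"
    using Max_in[OF fin that] by (auto simp: witnesses_def)
  ultimately show ?thesis by (auto simp: max_witness_def max_or_0_def)
qed

lemma answer_eq: "reg s 0 = max_or_0 (witnesses n a b i j) \<Longrightarrow> answer s = max_witness n a b i j"
  by (simp add: answer_def max_witness_eq)

lemma clean_init: "clean (init ps M)"
  unfolding clean_def init_def by (intro exI[of _ 1]) (simp add: init_qstate)

lemma lg_less: "1 \<le> n \<Longrightarrow> lg n + 1 \<le> n"
  using lg_bounds[of n] less_exp[of "lg n"] by linarith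

abbreviation find_time :: "nat \<Rightarrow> nat \<Rightarrow> real" where
  "find_time R p \<equiv> 1300 * (1 + real R) * (1 + real p) ^ 2 * sqrt (2 ^ p)"

text \<open>Allows the start state to be given in a convenient form and to be identified with the
  actual one afterwards.\<close>

lemma tri_Cons_at:
  assumes "tri w A B c s\<^sub>1 T\<^sub>0 R g e" "\<And>s'. R s' \<Longrightarrow> tri w A B (blk cs) s' (T - T\<^sub>0) Q f (g s')" "s = s\<^sub>1"
  shows "tri w A B (blk (c # cs)) s T Q f e"
  using tri_Cons[OF assms(1,2)] assms(3) by simp

section \<open>Correctness of the queries\<close>

context strips
begin

lemma W_eq:
  assumes "i \<in> {1..n}" "j \<in> {1..n}"
  shows "W ((i - 1) * n + (j - 1)) = witnesses n a b i j"
proof -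
  have "i - 1 + 1 = i" "j - 1 + 1 = j" using assms by auto
  then show ?thesis unfolding W_def row_major(1,2)[OF assms] witnesses_def by simp
qed

text \<open>The recorded interval contains the maximum of all witnesses, so the maximum within the
  interval is the global one.\<close>

lemma answer_query_correct:
  assumes valid: "valid w (reg s)" and clean: "clean s" and regs: "reg s vN = n" "reg s vI = i" "reg s vJ = j" "reg s vP = q" "reg s vS = 2 ^ q"
    and ij: "i \<in> {1..n}" "j \<in> {1..n}" and e: "e = (i - 1) * n + (j - 1)"
    and zero: "\<And>x. x < 4 * n \<Longrightarrow> mem s x = 0" and entry: "mem s (4 * n + e) = top (W e)"
  shows "tri w A B answer_query s (100 + find_time (reg s vReps) q) (frame w (insert vT find_regs) s)
    (\<lambda>s'. of_bool (reg s' vX \<noteq> max_or_0 (W e))) (real q * (1 / 2) ^ reg s vReps)"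
proof -
  let ?X = "insert vT find_regs"
  define t where "t = top (W e)"
  have fin: "finite (W e)" and Wn: "W e \<subseteq> {1..n}" by (auto simp: W_def)
  have en: "e < n * n" unfolding e by (rule row_major(3)[OF ij])
  have "Max (W e) \<le> n" if "W e \<noteq> {}" using Max_in[OF fin that] Wn by auto
  then have tn: "t \<le> n + 1" by (auto simp: t_def top_def intro: order_trans[OF div_le_dividend])
  then have tw: "t < 4 * h" using sizes(2,3) n by linarith
  have num: "1 mod 2 ^ w = (1 :: nat)" "4 mod 2 ^ w = (4 :: nat)" using word by simp_all
  have "i < 4 * h" "j < 4 * h" using ij sizes(2) by auto
  then have dec: "(i + (4 * h - 1)) mod (4 * h) = i - 1" "(j + (4 * h - 1)) mod (4 * h) = j - 1"
    using sub_mod_word[of 1 i w] sub_mod_word[of 1 j w] ij unfolding word(1) by auto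
  have "4 * n < 4 * h" "(i - 1) * n < 4 * h" "(i - 1) * n + (j - 1) < 4 * h" "4 * n + ((i - 1) * n + (j - 1)) < 4 * h"
    using sizes(1,2) en unfolding e by linarith+
  then have ad: "ev w A B s entry_addr = 4 * n + e"
    using num dec by (simp add: regs word(1) e)
  then have et: "ev w A B s (MemAt entry_addr) = t"
    using entry tw by (subst ev.simps(4)) (simp only: word(1) t_def mod_less)
  define s1 where "s1 = s\<lparr>reg := (reg s)(vT := t)\<rparr>"
  have f0: "frame w ?X s s" using valid clean by (simp add: frame_def)
  have f1: "frame w ?X s s1" unfolding s1_def using tw word by (intro frame_upd[OF f0]) auto
  then have v1: "valid w (reg s1)" by (simp add: frame_def)
  let ?c = "blk [assign vH (V vS), assign vX ((V vT \<ominus> N 1) \<otimes> V vS), find_max]" and ?d = "blk [assign vX (N 0)]"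
  have main: "tri w A B (if reg s1 vT \<noteq> 0 then ?c else ?d) s1 (60 + find_time (reg s vReps) q) (frame w ?X s)
    (\<lambda>s'. of_bool (reg s' vX \<noteq> max_or_0 (W e))) (real q * (1 / 2) ^ reg s vReps)"
  proof (cases "W e = {}")
    case True
    then have t0: "reg s1 vT = 0" by (simp add: s1_def t_def top_def)
    have "frame w ?X s (s1\<lparr>reg := (reg s1)(vX := 0)\<rparr>)" using f1 word by (intro frame_upd) auto
    moreover have "0 \<le> find_time (reg s vReps) q" by simp
    ultimately have "tri w A B ?d s1 (60 + find_time (reg s vReps) q) (frame w ?X s)
      (\<lambda>s'. of_bool (reg s' vX \<noteq> max_or_0 (W e))) (real q * (1 / 2) ^ reg s vReps)"
      apply (intro tri_assign[OF v1], simp, simp)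
      apply (rule tri_Nil)
        apply simp
       apply simp
      apply (use True in \<open>simp add: max_or_0_def\<close>)
      done
    then show ?thesis using t0 by simp
  next
    case False
    define M where "M = Max (W e)"
    have M: "M \<in> W e" "M \<le> n" using Max_in[OF fin False] Wn unfolding M_def by auto
    define x where "x = (M div 2 ^ q) * 2 ^ q"
    have t: "t = M div 2 ^ q + 1" "reg s1 vT = t" "t \<noteq> 0" using False by (simp_all add: t_def top_def M_def s1_def)
    have x: "x \<le> M" "M < x + 2 ^ q" unfolding x_def using dividend_less_div_times[of "2 ^ q" M] by (auto simp: add.commute)
    have xh: "x + 2 ^ q \<le> 2 * n" "x < 4 * h" "2 ^ q < 4 * h" using x M sizes(3,5) n by linarith+
    define s3 where "s3 = s1\<lparr>reg := (reg s1)(vH := 2 ^ q, vX := x)\<rparr>"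
    have f3: "frame w ?X s s3"
      using frame_upd[OF frame_upd[OF f1, of "2 ^ q" vH], of x vX] xh word by (simp add: s3_def)
    then have v3: "valid w (reg s3)" "clean s3" by (auto simp: frame_def)
    have dec': "(t + (4 * h - 1)) mod (4 * h) = t - 1"
      using sub_mod_word[of 1 t w] tw t(3) unfolding word(1) by auto
    have "ev w A B (s1\<lparr>reg := (reg s1)(vH := 2 ^ q)\<rparr>) ((V vT \<ominus> N 1) \<otimes> V vS) = ((t - 1) * 2 ^ q) mod (4 * h)"
      using num dec' by (simp add: s1_def regs word(1))
    then have ex: "ev w A B (s1\<lparr>reg := (reg s1)(vH := 2 ^ q)\<rparr>) ((V vT \<ominus> N 1) \<otimes> V vS) = x"
      using xh(2) t(1) by (simp add: x_def)
    have regs3: "reg s3 vP = q" "reg s3 vH = 2 ^ q" "reg s3 vX = x" "reg s3 vI = i" "reg s3 vJ = j" "mem s3 = mem s" "reg s3 vReps = reg s vReps"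
      by (simp_all add: s3_def s1_def regs)
    define W' where "W' = {x..<x + 2 ^ q} \<inter> sol A B (reg s3 vI) (reg s3 vJ)"
    have W': "W' = {x..<x + 2 ^ q} \<inter> W e"
      unfolding W'_def regs3 sol_bool[OF ij] e W_eq[OF ij] ..
    have "Max W' = M"
      using M(1) x W' fin unfolding M_def by (intro Max_eqI) auto
    moreover have "W' \<noteq> {}" using M(1) x W' by auto
    ultimately have mx: "(if W' = {} then 0 else Max W') = max_or_0 (W e)" using False by (simp add: max_or_0_def M_def)
    have r100: "100 * 2 ^ q \<le> (2 :: nat) ^ w"
    proof -
      have "100 * n \<le> n * n * 100" using n by simp
      then have "100 * n \<le> 2000 * n ^ 2" by (simp add: power2_eq_square)
      then show ?thesis using sizes(5) room word(1) unfolding h_def[symmetric] by linarith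
    qed
    have "(2 :: nat) ^ q < 2 ^ w" using xh(3) word by simp
    then have qw: "q < w" by (rule power_less_imp_less_exp[rotated]) simp
    have fm: "tri w A B find_max s3 (find_time (reg s3 vReps) q) (\<lambda>s'. frame w find_regs s3 s')
      (\<lambda>s'. of_bool (reg s' vX \<noteq> (if W' = {} then 0 else Max W'))) (real q * (1 / 2) ^ reg s3 vReps)"
    proof (rule find_max_correct[OF v3(1) r100 w5 qw regs3(1,2,3) _ _ v3(2) _ bool_oracle_le bool_oracle_le W'_def])
      show "2 ^ q dvd x" by (simp add: x_def)
      show "x + 2 ^ q \<le> 2 ^ w" using xh(1) sizes(3) word by linarith
      show "mem s3 y = 0" if "y < x + 2 ^ q" for y using that xh(1) by (simp add: regs3 zero)
    qed
    have "tri w A B ?c s1 (60 + find_time (reg s vReps) q) (frame w ?X s)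
      (\<lambda>s'. of_bool (reg s' vX \<noteq> max_or_0 (W e))) (real q * (1 / 2) ^ reg s vReps)"
      apply (rule tri_assign[OF v1], simp, simp)
      apply (rule tri_assign, use v1 xh word regs in \<open>simp add: s1_def\<close>, simp, simp)
      apply (rule tri_Cons_at[where s\<^sub>1 = s3 and g = "\<lambda>s'. of_bool (reg s' vX \<noteq> max_or_0 (W e))" and R = "frame w find_regs s3" and T\<^sub>0 = "find_time (reg s vReps) q"])
        apply (use fm in \<open>simp only: mx regs3\<close>)
       apply (rule tri_Nil)
         apply simp
        apply (rule frame_trans[OF f3], assumption)
        apply blast
       apply simp
      apply (use ex regs in \<open>simp add: s3_def s1_def del: ev.simps(3)\<close>)
      done
    then show ?thesis using t by simp
  qed
  show ?thesis
    unfolding answer_query_def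
    apply (rule tri_assign[OF valid], simp, simp)
    apply (simp only: et s1_def[symmetric])
    apply (rule tri_Cons[OF tri_Cond[OF main]])
    apply (rule tri_Nil)
      apply simp
     apply assumption
    apply simp
    done
qed

lemma strip_query_correct:
  assumes M: "table M" and ij: "i \<in> {1..n}" "j \<in> {1..n}" and r0: "r0 * (lg n + 1) < 2 ^ w" and r: "R = r0 * (lg n + 1)"
  shows "tri w A B (strip_query r0) (init [n, l, i, j] M) (300 + 80 * real (lg n) + find_time R q) (\<lambda>_. True)
    (\<lambda>s. of_bool (answer s \<noteq> max_witness n a b i j)) (real q * (1 / 2) ^ R)"
proof -
  define e where "e = (i - 1) * n + (j - 1)"
  have en: "e < n * n" unfolding e_def by (rule row_major(3)[OF ij])
  define s0 where "s0 = init [n, l, i, j] M"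
  have R0: "reg s0 0 = n" "reg s0 (Suc 0) = l" "reg s0 2 = i" "reg s0 3 = j" "mem s0 = M" by (simp_all add: s0_def init_def)
  have c0: "amp s0 = amp (init [] M)" by (simp add: s0_def init_def)
  have ln: "l < 2 ^ w" "n < 2 ^ w" "4 * n < 2 ^ w" "4 * l < 2 ^ w" "i < 2 ^ w" "j < 2 ^ w" using sizes l ij word by auto
  have v0: "valid w (reg s0)" using ln word by (auto simp: valid_def s0_def init_def nth_Cons')
  have lgn: "lg n < 2 ^ w" "2 ^ lg n < (2 :: nat) ^ w" "q < 2 ^ w" "2 ^ q < (2 :: nat) ^ w" "lg n + 1 < 2 ^ w"
    using lg_bounds[of n] n less_exp[of "lg n"] less_exp[of q] ln sizes(4,5) lg_less[of n] by linarith+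
  have num: "1 mod 2 ^ w = (1 :: nat)" using word by simp
  have "r0 \<le> r0 * (lg n + 1)" by simp
  then have r0w: "r0 < 2 ^ w" using r0 by linarith
  define R1 where "R1 = (reg s0)(vN := n, vL := l, vI := i, vJ := j)"
  define R2 where "R2 = R1(vReps := lg n, vH := 2 ^ lg n, vCont := 0)"
  define R3 where "R3 = R2(vReps := R)"
  define R4 where "R4 = R3(vP := q, vS := 2 ^ q, vCont := 0)"
  have v1: "valid w R1" using v0 ln by (simp add: R1_def)
  have v2: "valid w R2" using v1 lgn by (simp add: R2_def)
  have v3: "valid w R3" using v2 r0 r by (simp add: R3_def)
  have v4: "valid w R4" using v3 lgn by (simp add: R4_def)
  have r2: "runs_within w A B (log_prog vN vReps vH) (20 + 30 * real (lg n)) (s0\<lparr>reg := R1\<rparr>) (return_pmf (s0\<lparr>reg := R2\<rparr>))"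
    using log_prog_correct[of w "s0\<lparr>reg := R1\<rparr>" vN n vReps vH A B] v1 word ln n by (simp add: R2_def R1_def)
  have r4: "runs_within w A B (log_prog vL vP vS) (20 + 30 * real q) (s0\<lparr>reg := R3\<rparr>) (return_pmf (s0\<lparr>reg := R4\<rparr>))"
    using log_prog_correct[of w "s0\<lparr>reg := R3\<rparr>" vL l vP vS A B] v3 word ln l by (simp add: R4_def R3_def R2_def R1_def)
  have e3: "ev w A B (s0\<lparr>reg := R2\<rparr>) (N r0 \<otimes> (V vReps \<oplus> N 1)) = R"
    using num lgn r0 r0w r by (simp add: R2_def)
  have aq: "tri w A B answer_query (s0\<lparr>reg := R4\<rparr>) (100 + find_time R q) (frame w (insert vT find_regs) (s0\<lparr>reg := R4\<rparr>))
    (\<lambda>s'. of_bool (reg s' vX \<noteq> max_or_0 (W e))) (real q * (1 / 2) ^ R)"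
  proof -
    have "reg (s0\<lparr>reg := R4\<rparr>) vReps = R" by (simp add: R4_def R3_def)
    moreover have "tri w A B answer_query (s0\<lparr>reg := R4\<rparr>) (100 + find_time (reg (s0\<lparr>reg := R4\<rparr>) vReps) q) (frame w (insert vT find_regs) (s0\<lparr>reg := R4\<rparr>))
      (\<lambda>s'. of_bool (reg s' vX \<noteq> max_or_0 (W e))) (real q * (1 / 2) ^ reg (s0\<lparr>reg := R4\<rparr>) vReps)"
    proof (rule answer_query_correct[OF _ _ _ _ _ _ _ ij e_def])
      show "clean (s0\<lparr>reg := R4\<rparr>)" using clean_init[of "[n, l, i, j]" M] by (simp add: clean_def s0_def)
      show "mem (s0\<lparr>reg := R4\<rparr>) x = 0" if "x < 4 * n" for x using M that by (simp add: R0 table_def)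
      show "mem (s0\<lparr>reg := R4\<rparr>) (4 * n + e) = top (W e)" using M en by (simp add: R0 table_def)
    qed (use v4 in \<open>simp_all add: R4_def R3_def R2_def R1_def\<close>)
    ultimately show ?thesis by (simp only:)
  qed
  have We: "W e = witnesses n a b i j" unfolding e_def by (rule W_eq[OF ij])
  have "real q \<le> real (lg n)" using lg_mono[of l n] l by auto
  then show ?thesis
    unfolding strip_query_def s0_def[symmetric]
    apply -
    apply (rule tri_assign[OF v0], simp, simp)
    apply (rule tri_assign, use v0 ln R0 in simp, simp, simp)
    apply (rule tri_assign, use v0 ln R0 in simp, simp, simp)
    apply (rule tri_assign, use v0 ln R0 in simp, simp, simp)
    apply (rule tri_Cons_det[where s' = "s0\<lparr>reg := R2\<rparr>"])
     apply (use r2 R0 in \<open>simp add: R1_def\<close>)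
    apply (rule tri_assign, use v2 in simp, simp, simp)
    apply (rule tri_Cons_det[where s' = "s0\<lparr>reg := R4\<rparr>"])
     apply (use r4 in \<open>simp only: e3\<close>, simp add: R3_def)
    apply (rule tri_Cons[OF aq])
    subgoal premises p for s'
    proof -
      have v: "valid w (reg s')" using p(2) by (simp add: frame_def)
      show ?thesis
        apply (rule tri_assign[OF v], simp, simp)
        apply (rule tri_Nil)
          apply (use p(1) in simp)
         apply simp
        apply (use answer_eq[of "s'\<lparr>reg := (reg s')(0 := reg s' vX)\<rparr>" n a b i j] in \<open>auto simp: We\<close>)
        done
    qed
    done
qed

text \<open>Entries are treated in decreasing order, and each is overwritten by its answer only
  after it has been read. The error is followed for one fixed entry \<open>e0\<close>: the bound is
  \<delta> until \<open>e0\<close> is treated, and then the indicator of a wrong entry, which no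
  later round changes.\<close>

lemma answer_all_correct:
  assumes s: "prepared s" "table (mem s)" and e0: "e0 < n * n" and r0: "r0 * (lg n + 1) < 2 ^ w" and r: "R = r0 * (lg n + 1)"
  shows "tri w A B (answer_all r0) s (50 + real (n * n) * (200 + find_time R q)) (\<lambda>_. True)
    (\<lambda>s. of_bool (mem s (4 * n + e0) \<noteq> max_or_0 (W e0))) (real q * (1 / 2) ^ R)"
proof -
  define \<delta> where "\<delta> = real q * (1 / 2) ^ R"
  have \<delta>: "0 \<le> \<delta>" by (simp add: \<delta>_def)
  define J where "J = (\<lambda>k (s :: mstate). valid w (reg s) \<and> clean s \<and> reg s vN = n \<and> reg s vP = q \<and> reg s vS = 2 ^ q \<and> reg s vReps = R
    \<and> reg s vC = k \<and> (\<forall>x<4 * n. mem s x = 0) \<and> (\<forall>e<k. mem s (4 * n + e) = top (W e)))"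
  define g where "g = (\<lambda>k (s :: mstate). if e0 < k then \<delta> else of_bool (mem s (4 * n + e0) \<noteq> max_or_0 (W e0)))"
  have num: "1 mod 2 ^ w = (1 :: nat)" "4 mod 2 ^ w = (4 :: nat)" using word by simp_all
  have nn: "n * n < 2 ^ w" "n < 2 ^ w" using sizes(1) word by linarith+
  let ?body = "blk [decr vC, assign vI (V vC \<oslash> V vN \<oplus> N 1), assign vJ (Op Remainder (V vC) (V vN) \<oplus> N 1),
       answer_query, poke (N 4 \<otimes> V vN \<oplus> V vC) (V vX)]"
  have loop: "tri w A B (While vC ?body) s' (1 + (\<Sum>k<n * n. 1 + (150 + find_time R q))) (J 0) (g 0) (g (n * n) s')" if "J (n * n) s'" for s'
  proof (rule tri_While[where I = J and g = g and t = "\<lambda>_. 150 + find_time R q"])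
    fix e s assume e: "J (Suc e) s" "e < n * n"
    have v: "valid w (reg s)" "clean s" and rg: "reg s vN = n" "reg s vP = q" "reg s vS = 2 ^ q" "reg s vReps = R" "reg s vC = Suc e"
      and z: "\<And>x. x < 4 * n \<Longrightarrow> mem s x = 0" and tp: "\<And>e'. e' < Suc e \<Longrightarrow> mem s (4 * n + e') = top (W e')"
      using e(1) by (auto simp: J_def)
    define i where "i = e div n + 1"
    define j where "j = e mod n + 1"
    have dm: "e div n < n" "e mod n < n" using e n by (auto simp: less_mult_imp_div_less)
    have ij: "i \<in> {1..n}" "j \<in> {1..n}" unfolding i_def j_def using dm by (simp_all add: Suc_le_eq)
    have eij: "e = (i - 1) * n + (j - 1)" by (simp add: i_def j_def)
    have lt: "e < 2 ^ w" "i < 2 ^ w" "j < 2 ^ w" using e(2) nn ij by auto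
    define s1 where "s1 = s\<lparr>reg := (reg s)(vC := e, vI := i, vJ := j)\<rparr>"
    have v1: "valid w (reg s1)" "clean s1" using v lt by (simp_all add: s1_def clean_def)
    have "tri w A B answer_query s1 (100 + find_time (reg s1 vReps) q) (frame w (insert vT find_regs) s1)
      (\<lambda>s'. of_bool (reg s' vX \<noteq> max_or_0 (W e))) (real q * (1 / 2) ^ reg s1 vReps)"
      by (rule answer_query_correct[OF v1 _ _ _ _ _ ij eij]) (simp_all add: s1_def rg z tp)
    then have aq: "tri w A B answer_query s1 (100 + find_time R q) (frame w (insert vT find_regs) s1)
      (\<lambda>s'. of_bool (reg s' vX \<noteq> max_or_0 (W e))) \<delta>"
      by (simp add: s1_def rg \<delta>_def)
    define f where "f = (\<lambda>s' :: mstate. if e0 < e then \<delta> else if e0 = e then of_bool (reg s' vX \<noteq> max_or_0 (W e)) else of_bool (mem s (4 * n + e0) \<noteq> max_or_0 (W e0)))"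
    have aq': "tri w A B answer_query s1 (100 + find_time R q) (frame w (insert vT find_regs) s1) f (g (Suc e) s)"
    proof (cases "e0 = e")
      case True
      then show ?thesis by (intro tri_conseq[OF aq]) (auto simp: f_def g_def)
    next
      case False
      then show ?thesis by (intro tri_bound[OF aq]) (auto simp: f_def g_def)
    qed
    show "tri w A B ?body s (150 + find_time R q) (J e) (g e) (g (Suc e) s)"
      apply (rule tri_decr[OF v(1) word(3) rg(5)], simp)
      apply (rule tri_assign, use v lt in simp, simp, simp)
      apply (rule tri_assign, use v lt rg num in \<open>simp add: i_def\<close>, simp, simp)
      apply (rule tri_Cons_at[where s\<^sub>1 = s1])
        apply (rule aq')
      subgoal premises p for s'
      proof -
        have v': "valid w (reg s')" "clean s'" and same: "reg s' vN = n" "reg s' vP = q" "reg s' vS = 2 ^ q" "reg s' vReps = R" "reg s' vC = e" "mem s' = mem s"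
          using p by (auto simp: frame_def s1_def rg)
        have "4 * n < 2 ^ w" "4 * n + e < 2 ^ w" using e(2) sizes(1) word by linarith+
        then have ea: "ev w A B s' (N 4 \<otimes> V vN \<oplus> V vC) = 4 * n + e" using num by (simp add: same)
        have J': "J e (s'\<lparr>mem := (mem s')(4 * n + e := reg s' vX)\<rparr>)"
          using v' same z tp by (auto simp: J_def clean_def)
        have g': "g e (s'\<lparr>mem := (mem s')(4 * n + e := reg s' vX)\<rparr>) = f s'"
          by (auto simp: g_def f_def same)
        show ?thesis
          apply (rule tri_poke[OF v'(1)], simp, simp)
          apply (simp only: ea ev.simps(1))
          apply (rule tri_Nil)
            apply simp
           apply (rule J')
          apply (simp add: g')
          done
      qed
      apply (use lt rg num in \<open>simp add: s1_def i_def j_def\<close>)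
      done
  qed (use that in \<open>auto simp: J_def\<close>)
  have vs: "valid w (reg s)" and rs: "reg s vN = n" "reg s (Suc 0) = lg n" "reg s vP = q" "reg s vS = 2 ^ q" and cs: "clean s" using s(1) by (auto simp: prepared_def)
  define s1 where "s1 = s\<lparr>reg := (reg s)(vReps := R, vC := n * n)\<rparr>"
  have J0: "J (n * n) s1"
    using vs rs cs s(2) r0 r nn by (auto simp: J_def s1_def clean_def table_def)
  have "r0 \<le> r0 * (lg n + 1)" by simp
  then have r0w: "r0 < 2 ^ w" using r0 by linarith
  have lgw: "lg n + 1 < 2 ^ w" using lg_less[of n] n nn by linarith
  have er: "ev w A B s (N r0 \<otimes> (V vBits \<oplus> N 1)) = R" using num r0w lgw r0 r by (simp add: rs)
  have g0: "g (n * n) s1 = real q * (1 / 2) ^ R" using e0 by (simp add: g_def \<delta>_def)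
  have "0 \<le> find_time R q" by simp
  then have time: "30 + (\<Sum>k<n * n. 1 + (150 + find_time R q)) \<le> 50 + real (n * n) * (200 + find_time R q)"
    by (simp only: sum_constant card_lessThan) (simp add: algebra_simps)
  show ?thesis
    unfolding answer_all_def g0[symmetric]
    apply (rule tri_assign[OF vs], simp, simp)
    apply (simp only: er)
    apply (rule tri_assign, use vs r0 r in simp, simp, simp)
    apply (rule tri_Cons_at[where s\<^sub>1 = s1])
      apply (rule loop[OF J0])
     apply (rule tri_Nil)
       apply (use time in simp)
      apply simp
     apply (simp add: g_def)
    apply (use nn rs in \<open>simp add: s1_def\<close>)
    done
qed

lemma lookup_query_correct:
  assumes ij: "i \<in> {1..n}" "j \<in> {1..n}"
  shows "tri w A B lookup_query (init [n, l, i, j] M) 30 (\<lambda>_. True) (\<lambda>s. of_bool (answer s \<noteq> max_witness n a b i j))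
    (of_bool (M (4 * n + ((i - 1) * n + (j - 1))) \<noteq> max_or_0 (W ((i - 1) * n + (j - 1)))))"
proof -
  define e where "e = (i - 1) * n + (j - 1)"
  have en: "e < n * n" unfolding e_def by (rule row_major(3)[OF ij])
  define s0 where "s0 = init [n, l, i, j] M"
  have R0: "reg s0 0 = n" "reg s0 (Suc 0) = l" "reg s0 2 = i" "reg s0 3 = j" "mem s0 = M" by (simp_all add: s0_def init_def)
  have ln: "l < 2 ^ w" "n < 2 ^ w" "i < 2 ^ w" "j < 2 ^ w" using sizes l ij word by auto
  have v0: "valid w (reg s0)" using ln word by (auto simp: valid_def s0_def init_def nth_Cons')
  have num: "1 mod 2 ^ w = (1 :: nat)" "4 mod 2 ^ w = (4 :: nat)" using word by simp_all
  have dec: "(i + (4 * h - 1)) mod (4 * h) = i - 1" "(j + (4 * h - 1)) mod (4 * h) = j - 1"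
    using sub_mod_word[of 1 i w] sub_mod_word[of 1 j w] ij ln unfolding word(1) by auto
  have "4 * n < 4 * h" "(i - 1) * n < 4 * h" "(i - 1) * n + (j - 1) < 4 * h" "4 * n + ((i - 1) * n + (j - 1)) < 4 * h"
    using sizes(1,2) en unfolding e_def by linarith+
  then have ad: "ev w A B s0 (N 4 \<otimes> V 0 \<oplus> ((V 2 \<ominus> N 1) \<otimes> V 0 \<oplus> (V 3 \<ominus> N 1))) = 4 * n + e"
    using num dec by (simp add: R0 word(1) e_def)
  have "max_or_0 (W e) \<le> n"
    using Max_in[of "W e"] by (auto simp: max_or_0_def W_def)
  then have mw: "max_or_0 (W e) < 2 ^ w" using ln(2) by linarith
  have ae: "ev w A B s0 (MemAt (N 4 \<otimes> V 0 \<oplus> ((V 2 \<ominus> N 1) \<otimes> V 0 \<oplus> (V 3 \<ominus> N 1)))) = M (4 * n + e) mod 2 ^ w"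
    by (subst ev.simps(4)) (simp only: ad R0)
  show ?thesis
    unfolding lookup_query_def s0_def[symmetric] e_def[symmetric]
    apply (rule tri_assign[OF v0], simp, simp)
    apply (simp only: ae)
    apply (rule tri_Nil)
      apply simp
     apply simp
    apply (use answer_eq[of "s0\<lparr>reg := (reg s0)(0 := M (4 * n + e) mod 2 ^ w)\<rparr>" n a b i j] mw in \<open>auto simp: W_eq[OF ij, folded e_def]\<close>)
    done
qed

end

lemma direct_query_correct:
  fixes n :: nat and a b :: "nat \<Rightarrow> nat \<Rightarrow> bool"
  defines "A \<equiv> bool_oracle n a" and "B \<equiv> bool_oracle n b"
  assumes n: "2 \<le> n" and ij: "i \<in> {1..n}" "j \<in> {1..n}" and w5: "5 \<le> w" and room: "2000 * n ^ 2 \<le> 2 ^ (w - 2)"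
    and r0: "r0 * (lg n + 1) < 2 ^ w" and r: "R = r0 * (lg n + 1)"
  shows "tri w A B (direct_query r0) (init [n, i, j] blank) (100 + 30 * real (lg n) + find_time R (lg n + 1)) (\<lambda>_. True)
    (\<lambda>s. of_bool (answer s \<noteq> max_witness n a b i j)) (real (lg n + 1) * (1 / 2) ^ R)"
proof -
  define p where "p = lg n + 1"
  define s0 where "s0 = init [n, i, j] blank"
  have R0: "reg s0 0 = n" "reg s0 (Suc 0) = i" "reg s0 2 = j" "mem s0 = blank" by (simp_all add: s0_def init_def)
  have "2 ^ (w - 2) \<le> (2 :: nat) ^ w" by (intro power_increasing) auto
  moreover have "n \<le> n ^ 2" using n by (simp add: power2_eq_square)
  ultimately have nw: "2000 * n \<le> 2 ^ w" using room by linarith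
  have big: "100 \<le> (2 :: nat) ^ w" using nw n by linarith
  have p2: "2 ^ p \<le> 2 * n" "n < 2 ^ p" using lg_bounds[of n] n by (auto simp: p_def)
  have ln: "n < 2 ^ w" "4 * n < 2 ^ w" "i < 2 ^ w" "j < 2 ^ w" using nw n ij by auto
  have v0: "valid w (reg s0)" using ln big by (auto simp: valid_def s0_def init_def nth_Cons')
  have half: "2 ^ lg n * 2 = (2 :: nat) ^ p" by (simp add: p_def)
  have lgn: "lg n < 2 ^ w" "2 ^ lg n < (2 :: nat) ^ w" "p < 2 ^ w" "2 ^ p < (2 :: nat) ^ w" "100 * 2 ^ p \<le> (2 :: nat) ^ w" "2 ^ lg n * 2 < (2 :: nat) ^ w"
    using lg_bounds[of n] n less_exp[of "lg n"] less_exp[of p] p2 nw half by linarith+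
  have pw: "p < w" using lgn(4) by (rule power_less_imp_less_exp[rotated]) simp
  note num = numeral_mod_word[OF big]
  have "r0 \<le> r0 * (lg n + 1)" by simp
  then have r0w: "r0 < 2 ^ w" using r0 by linarith
  define R1 where "R1 = (reg s0)(vN := n, vI := i, vJ := j)"
  define R2 where "R2 = R1(vP := lg n, vH := 2 ^ lg n, vCont := 0)"
  define R3 where "R3 = R2(vP := p)"
  define R4 where "R4 = R3(vH := 2 ^ p)"
  define R5 where "R5 = R4(vReps := R)"
  define R6 where "R6 = R5(vX := 0)"
  have v1: "valid w R1" using v0 ln by (simp add: R1_def)
  have v2: "valid w R2" using v1 lgn by (simp add: R2_def)
  have v3: "valid w R3" using v2 lgn by (simp add: R3_def)
  have v4: "valid w R4" using v3 lgn by (simp add: R4_def)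
  have v5: "valid w R5" using v4 r0 r by (simp add: R5_def)
  have v6: "valid w R6" using v5 big by (simp add: R6_def)
  have r2: "runs_within w A B (log_prog vN vP vH) (20 + 30 * real (lg n)) (s0\<lparr>reg := R1\<rparr>) (return_pmf (s0\<lparr>reg := R2\<rparr>))"
    using log_prog_correct[of w "s0\<lparr>reg := R1\<rparr>" vN n vP vH A B] v1 big ln n by (simp add: R2_def R1_def)
  have e3: "ev w A B (s0\<lparr>reg := R2\<rparr>) (V vP \<oplus> N 1) = p" using num lgn by (simp add: R2_def p_def)
  have e4: "ev w A B (s0\<lparr>reg := R3\<rparr>) (V vH \<otimes> N 2) = 2 ^ p" using num lgn half by (simp add: R3_def R2_def)
  have e5: "ev w A B (s0\<lparr>reg := R4\<rparr>) (N r0 \<otimes> V vP) = R" using r0w r0 r by (simp add: R4_def R3_def p_def)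
  define X where "X = {0..<0 + 2 ^ p} \<inter> sol A B (reg (s0\<lparr>reg := R6\<rparr>) vI) (reg (s0\<lparr>reg := R6\<rparr>) vJ)"
  have "reg (s0\<lparr>reg := R6\<rparr>) vI = i" "reg (s0\<lparr>reg := R6\<rparr>) vJ = j" by (simp_all add: R6_def R5_def R4_def R3_def R2_def R1_def)
  then have "X = {0..<0 + 2 ^ p} \<inter> witnesses n a b i j" unfolding X_def A_def B_def using sol_bool[OF ij] by simp
  then have X: "X = witnesses n a b i j" using p2 by (auto simp: witnesses_def)
  have rp: "reg (s0\<lparr>reg := R6\<rparr>) vReps = R" by (simp add: R6_def R5_def)
  have "tri w A B find_max (s0\<lparr>reg := R6\<rparr>) (find_time (reg (s0\<lparr>reg := R6\<rparr>) vReps) p) (\<lambda>s'. frame w find_regs (s0\<lparr>reg := R6\<rparr>) s')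
      (\<lambda>s'. of_bool (reg s' vX \<noteq> (if X = {} then 0 else Max X))) (real p * (1 / 2) ^ reg (s0\<lparr>reg := R6\<rparr>) vReps)"
    by (rule find_max_correct[OF _ lgn(5) w5 pw _ _ _ _ _ _ _ _ _ X_def])
       (use v6 lgn clean_init[of "[n, i, j]" blank] in \<open>simp_all add: R6_def R5_def R4_def R3_def R0 clean_def s0_def[symmetric] A_def B_def bool_oracle_le[unfolded One_nat_def] less_imp_le\<close>)
  then have fm: "tri w A B find_max (s0\<lparr>reg := R6\<rparr>) (find_time R p) (\<lambda>s'. frame w find_regs (s0\<lparr>reg := R6\<rparr>) s')
      (\<lambda>s'. of_bool (reg s' vX \<noteq> max_or_0 (witnesses n a b i j))) (real p * (1 / 2) ^ R)"
    unfolding rp X max_or_0_def .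
  show ?thesis
    unfolding direct_query_def s0_def[symmetric] p_def[symmetric]
    apply (rule tri_assign[OF v0], simp, simp)
    apply (rule tri_assign, use v0 ln R0 in simp, simp, simp)
    apply (rule tri_assign, use v0 ln R0 in simp, simp, simp)
    apply (rule tri_Cons_det[where s' = "s0\<lparr>reg := R2\<rparr>"])
     apply (use r2 R0 in \<open>simp add: R1_def\<close>)
    apply (rule tri_assign, use v2 in simp, simp, simp)
    apply (rule tri_assign, use v3 e3 in \<open>simp del: ev.simps add: R3_def\<close>, simp, simp)
    apply (rule tri_assign, use v4 e3 e4 in \<open>simp del: ev.simps add: R4_def R3_def\<close>, simp, simp)
    apply (rule tri_assign, use v5 e3 e4 e5 in \<open>simp del: ev.simps add: R5_def R4_def R3_def\<close>, simp, simp)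
    apply (rule tri_Cons_at[where s\<^sub>1 = "s0\<lparr>reg := R6\<rparr>"])
      apply (rule fm)
    subgoal premises pr for s'
    proof -
      have v: "valid w (reg s')" using pr by (simp add: frame_def)
      show ?thesis
        apply (rule tri_assign[OF v], simp, simp)
        apply (rule tri_Nil)
          apply (simp add: p_def)
         apply simp
        apply (use answer_eq[of "s'\<lparr>reg := (reg s')(0 := reg s' vX)\<rparr>" n a b i j] in auto)
        done
    qed
    apply (use e3 e4 e5 in \<open>simp del: ev.simps(3) add: R6_def R5_def R4_def R3_def\<close>)
    done
qed

section \<open>Error probabilities and running times\<close>

text \<open>The rules leave the continuation \<open>E\<close> free outside the support of
  \<open>D\<close>, but \<open>bind_pmf\<close> does not see it there. So program and start state
  determine the final distribution.\<close>

lemma exec_unique: "exec w A B c t s D \<Longrightarrow> exec w A B c t' s D' \<Longrightarrow> D' = D"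
proof (induction arbitrary: t' D' rule: exec.induct)
  case (Skip s)
  from Skip.prems show ?case by cases auto
next
  case (Do a s)
  from Do.prems show ?case by cases auto
next
  case (Seq c t s D d T E u)
  have "\<exists>D2 E2 t2. exec w A B c t2 s D2 \<and> (\<forall>s'\<in>set_pmf D2. \<exists>u. exec w A B d u s' (E2 s')) \<and> D' = bind_pmf D2 E2"
    using Seq.prems by cases blast
  then obtain D2 E2 t2 where D2: "exec w A B c t2 s D2" "\<And>s'. s' \<in> set_pmf D2 \<Longrightarrow> \<exists>u. exec w A B d u s' (E2 s')" "D' = bind_pmf D2 E2"
    by blast
  have eq: "D2 = D" using Seq D2(1) by blast
  have E: "E2 s' = E s'" if "s' \<in> set_pmf D" for s' using Seq D2(2)[of s'] that eq by blast
  show ?case unfolding D2(3) eq by (rule bind_pmf_cong[OF refl]) (rule E)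
next
  case (Cond_True s r c t D d)
  from Cond_True.prems show ?case by cases (use Cond_True in blast)+
next
  case (Cond_False s r d t D c)
  from Cond_False.prems show ?case by cases (use Cond_False in blast)+
next
  case (While_False s r c)
  from While_False.prems show ?case by cases (use While_False in auto)
next
  case (While_True s r c t D T E u)
  have "\<exists>D2 E2 t2. exec w A B c t2 s D2 \<and> (\<forall>s'\<in>set_pmf D2. \<exists>u. exec w A B (While r c) u s' (E2 s')) \<and> D' = bind_pmf D2 E2"
    using While_True.prems by cases (use While_True in blast)+
  then obtain D2 E2 t2 where D2: "exec w A B c t2 s D2" "\<And>s'. s' \<in> set_pmf D2 \<Longrightarrow> \<exists>u. exec w A B (While r c) u s' (E2 s')" "D' = bind_pmf D2 E2"
    by blast
  have eq: "D2 = D" using While_True D2(1) by blast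
  have E: "E2 s' = E s'" if "s' \<in> set_pmf D" for s' using While_True D2(2)[of s'] that eq by blast
  show ?case unfolding D2(3) eq by (rule bind_pmf_cong[OF refl]) (rule E)
qed

lemma runs_within_unique: "runs_within w A B c T s D \<Longrightarrow> runs_within w A B c T' s D' \<Longrightarrow> D' = D"
  unfolding runs_within_def using exec_unique by blast

text \<open>The bound \<open>g\<close> may depend on the memory found, and only its mean over the
  preprocessing has to be small. This admits lookups that err with certainty on a wrong table
  entry.\<close>

lemma answers_queriesI:
  assumes tri: "\<And>i j M. i \<in> {1..n} \<Longrightarrow> j \<in> {1..n} \<Longrightarrow> M \<in> set_pmf \<M> \<Longrightarrow>
      tri w (bool_oracle n a) (bool_oracle n b) Q (init (ps @ [i, j]) M) T (\<lambda>_. True)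
        (\<lambda>s. of_bool (answer s \<noteq> max_witness n a b i j)) (g i j M)"
    and err: "\<And>i j. i \<in> {1..n} \<Longrightarrow> j \<in> {1..n} \<Longrightarrow> (\<integral>\<^sup>+M. ennreal (g i j M) \<partial>measure_pmf \<M>) \<le> ennreal (real n powr (- \<alpha>))"
  shows "answers_queries \<alpha> w n a b Q T ps \<M>"
  unfolding answers_queries_def
proof (intro ballI)
  fix i j assume ij: "i \<in> {1..n}" "j \<in> {1..n}"
  let ?ok = "{s. answer s = max_witness n a b i j}"
  have "\<exists>D. runs_within w (bool_oracle n a) (bool_oracle n b) Q T (init (ps @ [i, j]) M) D
      \<and> emeasure (measure_pmf D) (- ?ok) \<le> ennreal (g i j M)" if M: "M \<in> set_pmf \<M>" for M
  proof -
    from tri[OF ij M] obtain D where D: "runs_within w (bool_oracle n a) (bool_oracle n b) Q T (init (ps @ [i, j]) M) D"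
      "(\<integral>\<^sup>+s. ennreal (of_bool (answer s \<noteq> max_witness n a b i j)) \<partial>measure_pmf D) \<le> ennreal (g i j M)"
      unfolding tri_def by blast
    have "(\<integral>\<^sup>+s. ennreal (of_bool (answer s \<noteq> max_witness n a b i j)) \<partial>measure_pmf D)
        = (\<integral>\<^sup>+s. indicator (- ?ok) s \<partial>measure_pmf D)"
      by (intro nn_integral_cong) (auto simp: indicator_def)
    then show ?thesis using D by auto
  qed
  then obtain R where R: "\<And>M. M \<in> set_pmf \<M> \<Longrightarrow> runs_within w (bool_oracle n a) (bool_oracle n b) Q T (init (ps @ [i, j]) M) (R M)"
      "\<And>M. M \<in> set_pmf \<M> \<Longrightarrow> emeasure (measure_pmf (R M)) (- ?ok) \<le> ennreal (g i j M)"
    by metis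
  have "emeasure (measure_pmf (bind_pmf \<M> R)) (- ?ok) = (\<integral>\<^sup>+M. emeasure (measure_pmf (R M)) (- ?ok) \<partial>measure_pmf \<M>)"
    by (rule emeasure_bind_pmf)
  also have "\<dots> \<le> (\<integral>\<^sup>+M. ennreal (g i j M) \<partial>measure_pmf \<M>)"
    by (intro nn_integral_mono_AE) (simp add: AE_measure_pmf_iff R(2))
  also have "\<dots> \<le> ennreal (real n powr (- \<alpha>))" by (rule err[OF ij])
  finally have "measure_pmf.prob (bind_pmf \<M> R) (- ?ok) \<le> real n powr (- \<alpha>)"
    by (simp add: measure_pmf.emeasure_eq_measure)
  moreover have "measure_pmf.prob (bind_pmf \<M> R) (- ?ok) = 1 - measure_pmf.prob (bind_pmf \<M> R) ?ok"
    using measure_pmf.prob_compl[of ?ok "bind_pmf \<M> R"] by (simp add: Compl_eq_Diff_UNIV)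
  ultimately have "1 - real n powr (- \<alpha>) \<le> measure_pmf.prob (bind_pmf \<M> R) ?ok" by linarith
  with R(1) show "\<exists>R. (\<forall>m\<in>set_pmf \<M>. runs_within w (bool_oracle n a) (bool_oracle n b) Q T (init (ps @ [i, j]) m) (R m))
      \<and> 1 - real n powr (- \<alpha>) \<le> measure_pmf.prob (bind_pmf \<M> R) ?ok"
    by blast
qed

text \<open>Put P = lg n + 1, so that 2 powr P exceeds n. The union bound over at most P levels
  costs a factor of at most 2 powr P, which the 1 in \<open>\<alpha> + 1 \<le> real r0\<close> pays
  for; the remaining \<alpha> becomes the exponent of n.\<close>

lemma failure_bound:
  assumes "2 \<le> n" "0 < \<alpha>" "\<alpha> + 1 \<le> real r0" "p \<le> lg n + 1"
  shows "real p * (1 / 2) ^ (r0 * (lg n + 1)) \<le> real n powr (- \<alpha>)"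
proof -
  define P where "P = lg n + 1"
  have "n < 2 ^ P" using lg_bounds[of n] assms(1) by (simp add: P_def)
  then have "real n < real (2 ^ P)" by (simp only: of_nat_less_iff)
  then have nP: "real n \<le> 2 powr real P" by (simp add: powr_realpow)
  have "p \<le> 2 ^ P" using assms(4) less_exp[of P] unfolding P_def[symmetric] by linarith
  then have "real p \<le> real (2 ^ P)" by (simp only: of_nat_le_iff)
  then have pP: "real p \<le> 2 powr real P" by (simp add: powr_realpow)
  have "(1 / 2 :: real) ^ (r0 * P) = 2 powr (- real (r0 * P))"
    by (simp only: powr_minus powr_realpow[of 2, simplified]) (simp add: power_one_over inverse_eq_divide)
  then have "real p * (1 / 2) ^ (r0 * P) \<le> 2 powr real P * 2 powr (- real (r0 * P))"
    using pP by (simp add: mult_right_mono)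
  also have "\<dots> = 2 powr (real P * (1 - real r0))" by (simp add: powr_add[symmetric] algebra_simps)
  also have "\<dots> \<le> 2 powr (real P * (- \<alpha>))" using assms(3) by (intro powr_mono mult_left_mono) auto
  also have "\<dots> = (2 powr real P) powr (- \<alpha>)" by (simp only: powr_powr)
  also have "\<dots> \<le> real n powr (- \<alpha>)" using nP assms(1,2) by (intro powr_mono2') auto
  finally show ?thesis unfolding P_def .
qed

lemma log2_ge_1: "2 \<le> n \<Longrightarrow> 1 \<le> log 2 (real n)"
  by (simp add: le_log_iff)

text \<open>The 20 yields n ^ 20 \<le> 2 ^ w and thus 2 ^ 18 * n ^ 2 \<le> 2 ^ w, which is enough
  for the factors 2000 and 4. The summands \<open>K\<close> and \<open>r0\<close> provide for the
  products with \<open>lg n + 1\<close>.\<close>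

lemma word_room:
  assumes n: "2 \<le> n" and w: "real (K + r0 + 20) * log 2 (real n) \<le> real w"
  shows "5 \<le> w" "2000 * n ^ 2 \<le> 2 ^ (w - 2)" "K * (lg n + 1) < 2 ^ w" "r0 * (lg n + 1) < 2 ^ w"
    "real K * log 2 (real n) \<le> real w"
proof -
  note L = log2_ge_1[OF n]
  have pw: "n ^ (K + r0 + 20) \<le> 2 ^ w" using word_bound[OF w] n by simp
  have "real (K + r0 + 20) * 1 \<le> real (K + r0 + 20) * log 2 (real n)" using L by (intro mult_left_mono) auto
  then have "real (K + r0 + 20) \<le> real w" using w by (simp only: mult_1_right)
  then have "K + r0 + 20 \<le> w" by (simp only: of_nat_le_iff)
  then have w20: "20 \<le> w" by simp
  then show "5 \<le> w" by simp
  have "n ^ 20 \<le> n ^ (K + r0 + 20)" using n by (intro power_increasing) auto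
  then have 20: "n ^ 20 \<le> 2 ^ w" using pw by linarith
  have "(262144 :: nat) = 2 ^ 18" by simp
  also have "\<dots> \<le> n ^ 18" using n by (intro power_mono) auto
  finally have "n ^ 2 * 262144 \<le> n ^ 2 * n ^ 18" by (rule mult_left_mono) simp
  moreover have "n ^ 2 * n ^ 18 = n ^ 20" by (simp flip: power_add)
  ultimately have n2: "n ^ 2 * 262144 \<le> 2 ^ w" using 20 by linarith
  have "w = (w - 2) + 2" using w20 by simp
  then have "(2 :: nat) ^ w = 2 ^ (w - 2) * 2 ^ 2" by (metis power_add)
  then have "(2 :: nat) ^ w = 2 ^ (w - 2) * 4" by simp
  with n2 show "2000 * n ^ 2 \<le> 2 ^ (w - 2)" by linarith
  have small: "k * (lg n + 1) < 2 ^ w" if k: "k \<le> K + r0" for k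
  proof -
    have "k * (lg n + 1) \<le> k * n" using lg_less[of n] n by (intro mult_left_mono) auto
    also have "\<dots> < 2 ^ k * n" using less_exp[of k] n by (intro mult_strict_right_mono) auto
    also have "\<dots> \<le> n ^ k * n" using n by (intro mult_right_mono power_mono) auto
    also have "\<dots> = n ^ Suc k" by simp
    also have "\<dots> \<le> n ^ (K + r0 + 20)" using n k by (intro power_increasing) auto
    also note pw
    finally show ?thesis .
  qed
  show "K * (lg n + 1) < 2 ^ w" "r0 * (lg n + 1) < 2 ^ w" by (rule small; simp)+
  have "real K * log 2 (real n) \<le> real (K + r0 + 20) * log 2 (real n)" using L by (intro mult_right_mono) auto
  then show "real K * log 2 (real n) \<le> real w" using w by linarith
qed

lemma cost_nonneg: "0 \<le> cost e"
  by (induction e) auto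

definition query_factor :: "nat \<Rightarrow> real" where
  "query_factor r0 = 400 + 11700 * (1 + 2 * real r0)"

text \<open>One logarithm stems from the number of repetitions and two from the square of 1 + p. The
  constant 11700 is 1300 * 3 ^ 2, since 1 + p is at most three logarithms of n.\<close>

lemma query_time:
  assumes n: "2 \<le> n" and p: "p \<le> lg n + 1" and x: "2 ^ p \<le> x"
  shows "300 + 80 * real (lg n) + find_time (r0 * (lg n + 1)) p \<le> query_factor r0 * log 2 (real n) ^ 3 * sqrt x"
proof -
  define L where "L = log 2 (real n)"
  have L: "1 \<le> L" "real (lg n) \<le> L" using log2_ge_1[OF n] lg_log(1)[of n] n by (simp_all add: L_def)
  have "(1 :: real) \<le> 2 ^ p" by simp
  then have "1 \<le> x" using x by (rule order_trans)
  then have x1: "1 \<le> sqrt x" by simp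
  have L3: "L \<le> L ^ 3" "1 \<le> L ^ 3" using L(1) power_increasing[of 1 3 L] by simp_all
  have LX: "L ^ 3 * 1 \<le> L ^ 3 * sqrt x" using x1 L3(2) by (intro mult_left_mono) linarith+
  have "300 + 80 * real (lg n) \<le> 400 * (L ^ 3 * sqrt x)" using L L3 LX by linarith
  moreover have "find_time (r0 * (lg n + 1)) p \<le> 11700 * (1 + 2 * real r0) * (L ^ 3 * sqrt x)"
  proof -
    have "real r0 * (real (lg n) + 1) \<le> real r0 * (2 * L)" using L by (intro mult_left_mono) auto
    then have 1: "1 + real (r0 * (lg n + 1)) \<le> (1 + 2 * real r0) * L" using L(1) by (simp add: algebra_simps)
    have "1 + real p \<le> 3 * L" using p L by linarith
    then have 2: "(1 + real p) ^ 2 \<le> (3 * L) ^ 2" by (intro power_mono) auto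
    have 3: "sqrt (2 ^ p) \<le> sqrt x" using x by simp
    have "(1 + real (r0 * (lg n + 1))) * (1 + real p) ^ 2 \<le> ((1 + 2 * real r0) * L) * (3 * L) ^ 2"
      using L(1) by (intro mult_mono[OF 1 2]) auto
    then have "(1 + real (r0 * (lg n + 1))) * (1 + real p) ^ 2 * sqrt (2 ^ p) \<le> ((1 + 2 * real r0) * L) * (3 * L) ^ 2 * sqrt x"
      using L(1) by (intro mult_mono[OF _ 3]) auto
    then have "find_time (r0 * (lg n + 1)) p \<le> 1300 * (((1 + 2 * real r0) * L) * (3 * L) ^ 2 * sqrt x)"
      by (simp only: mult.assoc)
    also have "\<dots> = 11700 * (1 + 2 * real r0) * (L ^ 3 * sqrt x)" by (simp add: power2_eq_square power3_eq_cube)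
    finally show ?thesis .
  qed
  ultimately show ?thesis unfolding query_factor_def L_def[symmetric] by (simp add: algebra_simps)
qed

lemma direct_query_answers:
  assumes n: "2 \<le> n" and w: "real (0 + r0 + 20) * log 2 (real n) \<le> real w" and \<alpha>: "0 < \<alpha>" "\<alpha> + 1 \<le> real r0"
  shows "answers_queries \<alpha> w n a b (direct_query r0) (2 * query_factor r0 * log 2 (real n) ^ 3 * sqrt (real n)) [n] (return_pmf blank)"
proof (rule answers_queriesI[where g = "\<lambda>_ _ _. real (lg n + 1) * (1 / 2) ^ (r0 * (lg n + 1))"])
  note wr = word_room[OF n w]
  fix i j M assume ij: "i \<in> {1..n}" "j \<in> {1..n}" and M: "M \<in> set_pmf (return_pmf blank)"
  have "2 ^ lg n \<le> n" using lg_bounds[of n] n by simp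
  then have "real (2 ^ lg n) \<le> real n" by (simp only: of_nat_le_iff)
  \<comment> \<open>The searched interval can have length up to 2 n; the square root of this 2 is
    absorbed in the factor 2 of the time bound.\<close>
  then have "2 ^ (lg n + 1) \<le> 2 * real n" by simp
  from query_time[OF n order_refl this, of r0]
  have "300 + 80 * real (lg n) + find_time (r0 * (lg n + 1)) (lg n + 1) \<le> query_factor r0 * log 2 (real n) ^ 3 * sqrt (2 * real n)" .
  also have "\<dots> \<le> query_factor r0 * log 2 (real n) ^ 3 * (2 * sqrt (real n))"
  proof (rule mult_left_mono)
    have "sqrt 2 \<le> (2 :: real)" by (rule real_le_lsqrt) auto
    then show "sqrt (2 * real n) \<le> 2 * sqrt (real n)" by (simp add: real_sqrt_mult mult_right_mono)
  qed (use log2_ge_1[OF n] in \<open>simp add: query_factor_def\<close>)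
  finally have time: "100 + 30 * real (lg n) + find_time (r0 * (lg n + 1)) (lg n + 1) \<le> 2 * query_factor r0 * log 2 (real n) ^ 3 * sqrt (real n)"
    by simp
  show "tri w (bool_oracle n a) (bool_oracle n b) (direct_query r0) (init ([n] @ [i, j]) M) (2 * query_factor r0 * log 2 (real n) ^ 3 * sqrt (real n)) (\<lambda>_. True)
      (\<lambda>s. of_bool (answer s \<noteq> max_witness n a b i j)) (real (lg n + 1) * (1 / 2) ^ (r0 * (lg n + 1)))"
    using tri_conseq[OF direct_query_correct[OF n ij wr(1,2,4) refl, of a b] time] M by simp
next
  show "(\<integral>\<^sup>+M. ennreal (real (lg n + 1) * (1 / 2) ^ (r0 * (lg n + 1))) \<partial>measure_pmf (return_pmf blank)) \<le> ennreal (real n powr (- \<alpha>))"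
    using ennreal_leI[OF failure_bound[OF n \<alpha> order_refl]] by simp
qed

section \<open>Total cost and error of preprocessing and queries\<close>

definition preprocessing_factor :: "nat \<Rightarrow> prog list \<Rightarrow> ex \<Rightarrow> ex \<Rightarrow> real" where
  "preprocessing_factor m Ps ei ep = 500 + (cost ei + cost ep) + 2 * (100 + 3 * real m + 10 * real (length Ps) + 120)"

context strips
begin

definition preprocessing_time :: real where
  "preprocessing_time = 400 + cost ei + cost ep + 80 * real (lg n) + real (n div bw + 1) * (100 + 3 * real m + 10 * real (length Ps) + 120 * T)"

lemma preprocessing_correct:
  "tri w A B (blk [prep ei ep, blocks m Ps]) (init [n, l] blank) preprocessing_time (\<lambda>s. prepared s \<and> table (mem s)) (\<lambda>_. 0) 0"
  apply (rule tri_Cons[OF prep_correct])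
  apply (elim conjE)
  apply (rule tri_Cons[OF blocks_correct], assumption+)
  apply (rule tri_Nil)
    apply (simp add: preprocessing_time_def)
   apply simp
  apply simp
  done

lemma all_answers_correct:
  assumes "e < n * n" "r0 * (lg n + 1) < 2 ^ w"
  shows "tri w A B (blk [prep ei ep, blocks m Ps, answer_all r0]) (init [n, l] blank)
    (preprocessing_time + real (n * n) * (200 + find_time (r0 * (lg n + 1)) q)) (\<lambda>_. True)
    (\<lambda>s. of_bool (mem s (4 * n + e) \<noteq> max_or_0 (W e))) (real q * (1 / 2) ^ (r0 * (lg n + 1)))"
  apply (rule tri_Cons[where g = "\<lambda>_. real q * (1 / 2) ^ (r0 * (lg n + 1))", OF tri_bound[OF prep_correct]])
   apply simp
  apply (elim conjE)
  apply (rule tri_Cons[where g = "\<lambda>_. real q * (1 / 2) ^ (r0 * (lg n + 1))", OF tri_bound[OF blocks_correct]], assumption+)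
   apply simp
  apply (elim conjE)
  apply (rule tri_Cons[OF answer_all_correct[OF _ _ assms refl]], assumption+)
  apply (rule tri_Nil)
    apply (simp add: preprocessing_time_def)
   apply simp
  apply simp
  done

text \<open>Constants and logarithms are dominated by \<open>T\<close>, which is at least n ^ 2. As
  the width is at most n, the additional block at most doubles the bound on the number of
  blocks.\<close>

lemma preprocessing_time_le: "preprocessing_time \<le> preprocessing_factor m Ps ei ep * (real n / real bw * T)"
proof -
  define X where "X = real n / real bw * T"
  define Y where "Y = real n / real bw"
  define k where "k = cost ei + cost ep"
  define d where "d = 100 + 3 * real m + 10 * real (length Ps)"
  have Y: "1 \<le> Y" using sizes(8,9) by (simp add: Y_def)
  have "real (lg n + 1) \<le> real n" using lg_less[of n] n by (intro of_nat_mono) simp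
  moreover have "real n \<le> real n ^ 2" using n by (simp add: power2_eq_square)
  ultimately have Tl: "real (lg n) + 1 \<le> T" using T(2) by linarith
  then have T1: "1 \<le> T" by linarith
  have XT: "X = Y * T" by (simp add: X_def Y_def)
  have "1 * T \<le> Y * T" using Y T1 by (intro mult_right_mono) auto
  then have X: "1 \<le> X" "real (lg n) \<le> X" using Tl T1 XT by linarith+
  have k: "k * 1 \<le> k * X" using X by (intro mult_left_mono) (auto simp: k_def cost_nonneg)
  have d0: "0 \<le> d" by (simp add: d_def)
  have "d * 1 \<le> d * T" using T1 d0 by (intro mult_left_mono) auto
  then have dT: "d + 120 * T \<le> (d + 120) * T" by (simp add: algebra_simps)
  have "real (n div bw) \<le> Y" 
  proof -
    have "real (n div bw) * real bw \<le> real n" by (simp only: of_nat_mult[symmetric] of_nat_le_iff div_times_less_eq_dividend)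
    then show ?thesis using sizes(9) by (simp add: Y_def pos_le_divide_eq)
  qed
  then have "real (n div bw + 1) \<le> 2 * Y" using Y by simp
  then have "real (n div bw + 1) * (d + 120 * T) \<le> 2 * Y * ((d + 120) * T)"
    using dT Y d0 T1 by (intro mult_mono) auto
  also have "\<dots> = 2 * (d + 120) * X" by (simp add: XT)
  finally have "400 + k + 80 * real (lg n) + real (n div bw + 1) * (d + 120 * T) \<le> 500 * X + k * X + 2 * (d + 120) * X"
    using X k by linarith
  then show ?thesis
    unfolding preprocessing_time_def preprocessing_factor_def X_def[symmetric] k_def[symmetric] d_def[symmetric]
    by (simp add: k_def algebra_simps)
qed

lemma strip_query_answers:
  assumes \<alpha>: "0 < \<alpha>" "\<alpha> + 1 \<le> real r0" and r0: "r0 * (lg n + 1) < 2 ^ w" and M: "\<And>M. M \<in> set_pmf \<M> \<Longrightarrow> table M"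
  shows "answers_queries \<alpha> w n a b (strip_query r0) (query_factor r0 * log 2 (real n) ^ 3 * sqrt (real l)) [n, l] \<M>"
proof (rule answers_queriesI[where g = "\<lambda>_ _ _. real q * (1 / 2) ^ (r0 * (lg n + 1))"])
  have q: "q \<le> lg n + 1" using lg_mono[of l n] l by auto
  fix i j M assume ij: "i \<in> {1..n}" "j \<in> {1..n}" and M': "M \<in> set_pmf \<M>"
  have "2 ^ q \<le> l" using lg_bounds[of l] l by simp
  then have "real (2 ^ q) \<le> real l" by (simp only: of_nat_le_iff)
  then have "2 ^ q \<le> real l" by simp
  from tri_conseq[OF strip_query_correct[OF M[OF M'] ij r0 refl] query_time[OF n q this]]
  show "tri w (bool_oracle n a) (bool_oracle n b) (strip_query r0) (init ([n, l] @ [i, j]) M) (query_factor r0 * log 2 (real n) ^ 3 * sqrt (real l)) (\<lambda>_. True)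
      (\<lambda>s. of_bool (answer s \<noteq> max_witness n a b i j)) (real q * (1 / 2) ^ (r0 * (lg n + 1)))"
    by simp
next
  have q: "q \<le> lg n + 1" using lg_mono[of l n] l by auto
  show "(\<integral>\<^sup>+M. ennreal (real q * (1 / 2) ^ (r0 * (lg n + 1))) \<partial>measure_pmf \<M>) \<le> ennreal (real n powr (- \<alpha>))"
    using ennreal_leI[OF failure_bound[OF n \<alpha> q]] by (simp add: measure_pmf.emeasure_space_1)
qed

text \<open>
  The bound on the expected error of the preprocessing is specific to one entry of the table, but
  the distribution of the final state is unique, hence the same for all entries.
\<close>

lemma all_answers_run:
  assumes \<alpha>: "0 < \<alpha>" "\<alpha> + 1 \<le> real r0" and r0: "r0 * (lg n + 1) < 2 ^ w"
  shows "\<exists>D. runs_within w A B (blk [prep ei ep, blocks m Ps, answer_all r0])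
      (preprocessing_time + real (n * n) * (200 + find_time (r0 * (lg n + 1)) q)) (init [n, l] blank) D
    \<and> answers_queries \<alpha> w n a b lookup_query 30 [n, l] (map_pmf mem D)"
proof -
  let ?T = "preprocessing_time + real (n * n) * (200 + find_time (r0 * (lg n + 1)) q)"
  let ?P = "blk [prep ei ep, blocks m Ps, answer_all r0]"
  let ?\<delta> = "real q * (1 / 2) ^ (r0 * (lg n + 1))"
  have all: "\<exists>D. runs_within w A B ?P ?T (init [n, l] blank) D
      \<and> (\<integral>\<^sup>+s. ennreal (of_bool (mem s (4 * n + e) \<noteq> max_or_0 (W e))) \<partial>measure_pmf D) \<le> ennreal ?\<delta>" if "e < n * n" for e
    using all_answers_correct[OF that r0] unfolding tri_def by blast
  have "0 < n * n" using n by simp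
  from all[OF this] obtain D where D: "runs_within w A B ?P ?T (init [n, l] blank) D" by blast
  have err: "(\<integral>\<^sup>+s. ennreal (of_bool (mem s (4 * n + e) \<noteq> max_or_0 (W e))) \<partial>measure_pmf D) \<le> ennreal ?\<delta>" if "e < n * n" for e
    using all[OF that] runs_within_unique[OF D] by blast
  have q: "q \<le> lg n + 1" using lg_mono[of l n] l by auto
  have "answers_queries \<alpha> w n a b lookup_query 30 [n, l] (map_pmf mem D)"
  proof (rule answers_queriesI[where g = "\<lambda>i j M. of_bool (M (4 * n + ((i - 1) * n + (j - 1))) \<noteq> max_or_0 (W ((i - 1) * n + (j - 1))))"])
    fix i j assume ij: "i \<in> {1..n}" "j \<in> {1..n}"
    show "(\<integral>\<^sup>+M. ennreal (of_bool (M (4 * n + ((i - 1) * n + (j - 1))) \<noteq> max_or_0 (W ((i - 1) * n + (j - 1))))) \<partial>measure_pmf (map_pmf mem D))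
        \<le> ennreal (real n powr (- \<alpha>))"
      using order_trans[OF err[OF row_major(3)[OF ij]] ennreal_leI[OF failure_bound[OF n \<alpha> q]]] by (simp only: nn_integral_map_pmf)
  qed (use lookup_query_correct in simp)
  with D show ?thesis by blast
qed

end

section \<open>From multiplication exponents to preprocessing programs\<close>

lemma suits_strips:
  assumes s: "suits \<epsilon> Ps ei ep fi fp K c" and n: "2 \<le> n" and w: "real (K + r0 + 20) * log 2 (real n) \<le> real w" and l: "l \<in> {1..n}"
    and m: "4 \<le> m" "\<And>P. P \<in> set Ps \<Longrightarrow> prog_below m P"
  shows "\<exists>T. strips w n l m K a b Ps ei ep fi fp T \<and> real n / 2 ^ fp (lg n) (lg l) * T \<le> c * strips_time \<epsilon> n l"
proof -
  note wr = word_room[OF n w]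
  have q: "lg l \<le> lg n" using lg_mono[of l n] l by auto
  note s1 = s[unfolded suits_def]
  note s2 = s1[THEN conjunct2] note s3 = s2[THEN conjunct2] note s4 = s3[THEN conjunct2] note s5 = s4[THEN conjunct2]
  from s5[THEN conjunct2, rule_format, OF n wr(5) l]
  obtain T where T: "real n ^ 2 \<le> T" "real n / 2 ^ fp (lg n) (lg l) * T \<le> c * strips_time \<epsilon> n l"
      "multiplies (w - 2) n (Ps ! fi (lg n) (lg l)) T n (2 ^ fp (lg n) (lg l)) n"
    by (elim exE conjE)
  have "strips w n l m K a b Ps ei ep fi fp T"
  proof (rule strips.intro)
    show "wf_ex ei 32" by (rule s2[THEN conjunct1])
    show "wf_ex ep 32" by (rule s3[THEN conjunct1])
    show "fp (lg n) (lg l) \<le> lg l" "fi (lg n) (lg l) < length Ps"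
      using s5[THEN conjunct1, rule_format, OF q] by simp_all
    show "classical P \<and> prog_below m P" if "P \<in> set Ps" for P
      using s1[THEN conjunct1, rule_format, OF that] m(2)[OF that] by simp
    show "ev w (bool_oracle n a) (bool_oracle n b) s' ei = fi (lg n) (lg l)
        \<and> (reg s' vIdx = fi (lg n) (lg l) \<longrightarrow> ev w (bool_oracle n a) (bool_oracle n b) s' ep = fp (lg n) (lg l))"
      if "valid w (reg s')" "reg s' vBits = lg n" "reg s' vP = lg l" for s'
      by (rule s4[THEN conjunct1, THEN spec, THEN spec, THEN spec, THEN spec, THEN spec, THEN spec, THEN mp, THEN mp, THEN mp, THEN mp, THEN mp,
            OF that q wr(3)])
  qed (rule n l wr m(1) T)+
  with T(2) show ?thesis by blast
qed

lemma common_prog_below: "\<exists>m\<ge>4. \<forall>P\<in>set Ps. prog_below m P"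
proof (induction Ps)
  case (Cons P Ps)
  then obtain m where m: "4 \<le> m" "\<forall>P\<in>set Ps. prog_below m P" by blast
  obtain k where k: "prog_below k P" using ex_prog_below by blast
  have "\<forall>Q\<in>set (P # Ps). prog_below (max m k) Q" using m k prog_below_mono[of _ _ "max m k"] by auto
  with m(1) show ?case by (intro exI[of _ "max m k"]) auto
qed auto

lemma answers_queries_mono: "answers_queries \<alpha> w n a b Q T ps M \<Longrightarrow> T \<le> T' \<Longrightarrow> answers_queries \<alpha> w n a b Q T' ps M"
  unfolding answers_queries_def by (meson runs_within_mono)

lemma strips_time_nonneg: "0 \<le> strips_time \<epsilon> n l"
  by (simp add: strips_time_def)

lemma strip_preprocessing:
  assumes s: "suits \<epsilon> Ps ei ep fi fp K c\<^sub>0" and \<alpha>: "0 < \<alpha>" "\<alpha> + 1 \<le> real r0"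
  shows "\<exists>P c. 0 \<le> c \<and> (\<forall>n\<ge>2. \<forall>w. real (K + r0 + 20) * log 2 (real n) \<le> real w \<longrightarrow> (\<forall>l\<in>{1..n}. \<forall>a b. \<exists>D.
      runs_within w (bool_oracle n a) (bool_oracle n b) P (c * strips_time \<epsilon> n l) (init [n, l] blank) D
    \<and> answers_queries \<alpha> w n a b (strip_query r0) (c * log 2 (real n) ^ 3 * sqrt (real l)) [n, l] (map_pmf mem D)))"
proof -
  obtain m where m: "4 \<le> m" "\<And>P. P \<in> set Ps \<Longrightarrow> prog_below m P" using common_prog_below by blast
  define F where "F = preprocessing_factor m Ps ei ep"
  have F: "0 \<le> F" by (simp add: F_def preprocessing_factor_def cost_nonneg)
  define c where "c = max (F * c\<^sub>0) (query_factor r0)"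
  have c: "F * c\<^sub>0 \<le> c" "query_factor r0 \<le> c" by (simp_all add: c_def)
  have c0: "0 \<le> c" using c(2) by (simp add: query_factor_def)
  have "\<exists>D. runs_within w (bool_oracle n a) (bool_oracle n b) (blk [prep ei ep, blocks m Ps]) (c * strips_time \<epsilon> n l) (init [n, l] blank) D
    \<and> answers_queries \<alpha> w n a b (strip_query r0) (c * log 2 (real n) ^ 3 * sqrt (real l)) [n, l] (map_pmf mem D)"
    if n: "2 \<le> n" and w: "real (K + r0 + 20) * log 2 (real n) \<le> real w" and l: "l \<in> {1..n}" for n w l a b
  proof -
    obtain T where S: "strips w n l m K a b Ps ei ep fi fp T" "real n / 2 ^ fp (lg n) (lg l) * T \<le> c\<^sub>0 * strips_time \<epsilon> n l"
      using suits_strips[OF s n w l m] by blast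
    interpret strips w n l m K a b Ps ei ep fi fp T by (rule S(1))
    have "preprocessing_time \<le> F * (real n / 2 ^ fp (lg n) (lg l) * T)" using preprocessing_time_le[unfolded bw_def] by (simp add: F_def)
    also have "\<dots> \<le> F * (c\<^sub>0 * strips_time \<epsilon> n l)" using S(2) F by (rule mult_left_mono)
    also have "\<dots> = F * c\<^sub>0 * strips_time \<epsilon> n l" by simp
    also have "\<dots> \<le> c * strips_time \<epsilon> n l" using c(1) strips_time_nonneg by (rule mult_right_mono)
    finally have time: "preprocessing_time \<le> c * strips_time \<epsilon> n l" .
    obtain D where D: "runs_within w (bool_oracle n a) (bool_oracle n b) (blk [prep ei ep, blocks m Ps]) preprocessing_time (init [n, l] blank) D"
        "\<forall>s\<in>set_pmf D. prepared s \<and> table (mem s)"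
      using preprocessing_correct unfolding tri_def by blast
    have tab: "table M" if "M \<in> set_pmf (map_pmf mem D)" for M using that D(2) by auto
    have "query_factor r0 * log 2 (real n) ^ 3 * sqrt (real l) \<le> c * log 2 (real n) ^ 3 * sqrt (real l)"
      using c(2) log2_ge_1[OF n] by (intro mult_right_mono) auto
    from answers_queries_mono[OF strip_query_answers[OF \<alpha> word_room(4)[OF n w] tab] this]
    show ?thesis using runs_within_mono[OF D(1) time] by blast
  qed
  then show ?thesis using c0 by blast
qed

lemma lookup_preprocessing:
  assumes s: "suits \<epsilon> Ps ei ep fi fp K c\<^sub>0" and \<alpha>: "0 < \<alpha>" "\<alpha> + 1 \<le> real r0"
  shows "\<exists>P c. 0 \<le> c \<and> (\<forall>n\<ge>2. \<forall>w. real (K + r0 + 20) * log 2 (real n) \<le> real w \<longrightarrow> (\<forall>l\<in>{1..n}. \<forall>a b. \<exists>D.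
      runs_within w (bool_oracle n a) (bool_oracle n b) P (c * log 2 (real n) ^ 3 * (strips_time \<epsilon> n l + real n ^ 2 * sqrt (real l))) (init [n, l] blank) D
    \<and> answers_queries \<alpha> w n a b lookup_query c [n, l] (map_pmf mem D)))"
proof -
  obtain m where m: "4 \<le> m" "\<And>P. P \<in> set Ps \<Longrightarrow> prog_below m P" using common_prog_below by blast
  define F where "F = preprocessing_factor m Ps ei ep"
  have F: "0 \<le> F" by (simp add: F_def preprocessing_factor_def cost_nonneg)
  define c where "c = max (F * c\<^sub>0) (query_factor r0)"
  have c: "F * c\<^sub>0 \<le> c" "query_factor r0 \<le> c" by (simp_all add: c_def)
  then have c30: "0 \<le> c" "30 \<le> c" by (simp_all add: query_factor_def)
  have "\<exists>D. runs_within w (bool_oracle n a) (bool_oracle n b) (blk [prep ei ep, blocks m Ps, answer_all r0])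
        (c * log 2 (real n) ^ 3 * (strips_time \<epsilon> n l + real n ^ 2 * sqrt (real l))) (init [n, l] blank) D
    \<and> answers_queries \<alpha> w n a b lookup_query c [n, l] (map_pmf mem D)"
    if n: "2 \<le> n" and w: "real (K + r0 + 20) * log 2 (real n) \<le> real w" and l: "l \<in> {1..n}" for n w l a b
  proof -
    obtain T where S: "strips w n l m K a b Ps ei ep fi fp T" "real n / 2 ^ fp (lg n) (lg l) * T \<le> c\<^sub>0 * strips_time \<epsilon> n l"
      using suits_strips[OF s n w l m] by blast
    interpret strips w n l m K a b Ps ei ep fi fp T by (rule S(1))
    define L where "L = log 2 (real n) ^ 3"
    have L: "1 \<le> L" using log2_ge_1[OF n] by (simp add: L_def)
    have "preprocessing_time \<le> F * (real n / 2 ^ fp (lg n) (lg l) * T)" using preprocessing_time_le[unfolded bw_def] by (simp add: F_def)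
    also have "\<dots> \<le> F * (c\<^sub>0 * strips_time \<epsilon> n l)" using S(2) F by (rule mult_left_mono)
    also have "\<dots> = F * c\<^sub>0 * strips_time \<epsilon> n l" by simp
    also have "\<dots> \<le> c * strips_time \<epsilon> n l" using c(1) strips_time_nonneg by (rule mult_right_mono)
    also have "\<dots> \<le> c * L * strips_time \<epsilon> n l"
      using mult_left_mono[OF L c30(1)] strips_time_nonneg by (intro mult_right_mono) simp_all
    finally have t1: "preprocessing_time \<le> c * L * strips_time \<epsilon> n l" .
    have q: "lg l \<le> lg n + 1" using lg_mono[of l n] l by auto
    have "2 ^ lg l \<le> l" using lg_bounds[of l] l by simp
    then have "real (2 ^ lg l) \<le> real l" by (simp only: of_nat_le_iff)
    then have "2 ^ lg l \<le> real l" by simp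
    from query_time[OF n q this, of r0]
    have "200 + find_time (r0 * (lg n + 1)) (lg l) \<le> query_factor r0 * (L * sqrt (real l))" by (simp add: L_def)
    also have "\<dots> \<le> c * (L * sqrt (real l))" using c(2) L by (intro mult_right_mono) auto
    finally have "real (n * n) * (200 + find_time (r0 * (lg n + 1)) (lg l)) \<le> real (n * n) * (c * (L * sqrt (real l)))"
      by (rule mult_left_mono) simp
    also have "\<dots> = c * L * (real n ^ 2 * sqrt (real l))" by (simp add: power2_eq_square)
    finally have "preprocessing_time + real (n * n) * (200 + find_time (r0 * (lg n + 1)) (lg l))
        \<le> c * L * (strips_time \<epsilon> n l + real n ^ 2 * sqrt (real l))"
      using t1 by (simp only: distrib_left)
    note time = this[unfolded L_def]
    from all_answers_run[OF \<alpha> word_room(4)[OF n w]] obtain D where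
      D: "runs_within w (bool_oracle n a) (bool_oracle n b) (blk [prep ei ep, blocks m Ps, answer_all r0])
          (preprocessing_time + real (n * n) * (200 + find_time (r0 * (lg n + 1)) (lg l))) (init [n, l] blank) D"
        "answers_queries \<alpha> w n a b lookup_query 30 [n, l] (map_pmf mem D)"
      by blast
    from runs_within_mono[OF D(1) time] answers_queries_mono[OF D(2) c30(2)] show ?thesis by blast
  qed
  then show ?thesis using c30(1) by blast
qed

theorem theorem3:
  fixes \<alpha> \<epsilon> :: real
  assumes "\<alpha> > 0"
    and "\<epsilon> > 0 \<or> (\<epsilon> = 0 \<and> omega_attained)"
  shows "(\<exists>Q c d. answers_without_preprocessing \<alpha>
             (\<lambda>n. c * log 2 (real n) ^ d * sqrt (real n)) Q)
       \<and> (\<exists>P Q c d. answers_after_preprocessing \<alpha>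
             (\<lambda>n l. c * strips_time \<epsilon> n l)
             (\<lambda>n l. c * log 2 (real n) ^ d * (real n / real l + sqrt (real l))) P Q)
       \<and> (\<exists>P Q c d. answers_after_preprocessing \<alpha>
             (\<lambda>n l. c * (strips_time \<epsilon> n l + real n ^ 3 / real l))
             (\<lambda>n l. c * log 2 (real n) ^ d * sqrt (real l)) P Q)
       \<and> (\<exists>P Q c d. answers_after_preprocessing \<alpha>
             (\<lambda>n l. c * log 2 (real n) ^ d *
                (strips_time \<epsilon> n l + real n ^ 3 / real l + real n ^ 2 * sqrt (real l)))
             (\<lambda>n l. c) P Q)"
proof -
  \<comment> \<open>The number of repetitions per bit of n is chosen from the required error
    exponent \<alpha>.\<close>
  obtain r0 :: nat where r0: "\<alpha> + 1 \<le> real r0" using real_arch_simple by blast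
  note \<alpha> = assms(1) r0
  obtain Ps ei ep fi fp K c\<^sub>0 where s: "suits \<epsilon> Ps ei ep fi fp K c\<^sub>0"
    using assms(2) suits_grid suits_attained by blast
  have 1: "answers_without_preprocessing \<alpha> (\<lambda>n. 2 * query_factor r0 * log 2 (real n) ^ 3 * sqrt (real n)) (direct_query r0)"
    unfolding answers_without_preprocessing_def using direct_query_answers[OF _ _ \<alpha>] by blast
  obtain P c where c: "0 \<le> c" and P: "\<And>n w l a b. 2 \<le> n \<Longrightarrow> real (K + r0 + 20) * log 2 (real n) \<le> real w \<Longrightarrow> l \<in> {1..n} \<Longrightarrow> \<exists>D.
      runs_within w (bool_oracle n a) (bool_oracle n b) P (c * strips_time \<epsilon> n l) (init [n, l] blank) D
    \<and> answers_queries \<alpha> w n a b (strip_query r0) (c * log 2 (real n) ^ 3 * sqrt (real l)) [n, l] (map_pmf mem D)"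
    using strip_preprocessing[OF s \<alpha>] by blast
  \<comment> \<open>A search within the recorded interval takes time about sqrt l, which lies below
    the bound for (2) as well as that for (3).\<close>
  have q: "c * log 2 (real n) ^ 3 * sqrt (real l) \<le> c * log 2 (real n) ^ 3 * (real n / real l + sqrt (real l))" if "2 \<le> n" for n l
    using c log2_ge_1[OF that] by (intro mult_left_mono) auto
  have p: "c * strips_time \<epsilon> n l \<le> c * (strips_time \<epsilon> n l + real n ^ 3 / real l)" for n l
    using c by (intro mult_left_mono) auto
  have 2: "answers_after_preprocessing \<alpha> (\<lambda>n l. c * strips_time \<epsilon> n l)
      (\<lambda>n l. c * log 2 (real n) ^ 3 * (real n / real l + sqrt (real l))) P (strip_query r0)"
    unfolding answers_after_preprocessing_def
  proof (intro exI[of _ "real (K + r0 + 20)"] allI impI ballI)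
    fix n w l a b assume n: "2 \<le> (n :: nat)" and w: "real (K + r0 + 20) * log 2 (real n) \<le> real w" and l: "l \<in> {1..n}"
    from P[OF n w l] obtain D where
      D: "runs_within w (bool_oracle n a) (bool_oracle n b) P (c * strips_time \<epsilon> n l) (init [n, l] blank) D"
        "answers_queries \<alpha> w n a b (strip_query r0) (c * log 2 (real n) ^ 3 * sqrt (real l)) [n, l] (map_pmf mem D)"
      by blast
    from D(1) answers_queries_mono[OF D(2) q[OF n]]
    show "\<exists>D. runs_within w (bool_oracle n a) (bool_oracle n b) P (c * strips_time \<epsilon> n l) (init [n, l] blank) D
      \<and> answers_queries \<alpha> w n a b (strip_query r0) (c * log 2 (real n) ^ 3 * (real n / real l + sqrt (real l))) [n, l] (map_pmf mem D)"
      by blast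
  qed
  have 3: "answers_after_preprocessing \<alpha> (\<lambda>n l. c * (strips_time \<epsilon> n l + real n ^ 3 / real l))
      (\<lambda>n l. c * log 2 (real n) ^ 3 * sqrt (real l)) P (strip_query r0)"
    unfolding answers_after_preprocessing_def
  proof (intro exI[of _ "real (K + r0 + 20)"] allI impI ballI)
    fix n w l a b assume n: "2 \<le> (n :: nat)" and w: "real (K + r0 + 20) * log 2 (real n) \<le> real w" and l: "l \<in> {1..n}"
    from P[OF n w l] obtain D where
      D: "runs_within w (bool_oracle n a) (bool_oracle n b) P (c * strips_time \<epsilon> n l) (init [n, l] blank) D"
        "answers_queries \<alpha> w n a b (strip_query r0) (c * log 2 (real n) ^ 3 * sqrt (real l)) [n, l] (map_pmf mem D)"
      by blast
    from runs_within_mono[OF D(1) p] D(2)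
    show "\<exists>D. runs_within w (bool_oracle n a) (bool_oracle n b) P (c * (strips_time \<epsilon> n l + real n ^ 3 / real l)) (init [n, l] blank) D
      \<and> answers_queries \<alpha> w n a b (strip_query r0) (c * log 2 (real n) ^ 3 * sqrt (real l)) [n, l] (map_pmf mem D)"
      by blast
  qed
  obtain P' c' where c': "0 \<le> c'" and P': "\<And>n w l a b. 2 \<le> n \<Longrightarrow> real (K + r0 + 20) * log 2 (real n) \<le> real w \<Longrightarrow> l \<in> {1..n} \<Longrightarrow> \<exists>D.
      runs_within w (bool_oracle n a) (bool_oracle n b) P' (c' * log 2 (real n) ^ 3 * (strips_time \<epsilon> n l + real n ^ 2 * sqrt (real l))) (init [n, l] blank) D
    \<and> answers_queries \<alpha> w n a b lookup_query c' [n, l] (map_pmf mem D)"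
    using lookup_preprocessing[OF s \<alpha>] by blast
  have p': "c' * log 2 (real n) ^ 3 * (strips_time \<epsilon> n l + real n ^ 2 * sqrt (real l))
      \<le> c' * log 2 (real n) ^ 3 * (strips_time \<epsilon> n l + real n ^ 3 / real l + real n ^ 2 * sqrt (real l))" if "2 \<le> n" for n l
    using c' log2_ge_1[OF that] by (intro mult_left_mono) auto
  have 4: "answers_after_preprocessing \<alpha> (\<lambda>n l. c' * log 2 (real n) ^ 3 *
      (strips_time \<epsilon> n l + real n ^ 3 / real l + real n ^ 2 * sqrt (real l))) (\<lambda>n l. c') P' lookup_query"
    unfolding answers_after_preprocessing_def
  proof (intro exI[of _ "real (K + r0 + 20)"] allI impI ballI)
    fix n w l a b assume n: "2 \<le> (n :: nat)" and w: "real (K + r0 + 20) * log 2 (real n) \<le> real w" and l: "l \<in> {1..n}"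
    from P'[OF n w l] obtain D where
      D: "runs_within w (bool_oracle n a) (bool_oracle n b) P' (c' * log 2 (real n) ^ 3 * (strips_time \<epsilon> n l + real n ^ 2 * sqrt (real l))) (init [n, l] blank) D"
        "answers_queries \<alpha> w n a b lookup_query c' [n, l] (map_pmf mem D)"
      by blast
    from runs_within_mono[OF D(1) p'[OF n]] D(2)
    show "\<exists>D. runs_within w (bool_oracle n a) (bool_oracle n b) P' (c' * log 2 (real n) ^ 3 * (strips_time \<epsilon> n l + real n ^ 3 / real l + real n ^ 2 * sqrt (real l))) (init [n, l] blank) D
      \<and> answers_queries \<alpha> w n a b lookup_query c' [n, l] (map_pmf mem D)"
      by blast
  qed
  show ?thesis using 1 2 3 4 by blast
qed

end
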